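(* Let $(a_j)_{j\ge1}$ be a sequence of positive reals with $a_{j+1}\le a_j$ for all $j$ and $a_j\to0$. Let $\bar K\in[2,\infty)$ and let $(b_i)_{i\ge1}$ satisfy $b_i\in[2,\bar K]$ for all $i$. Let $(A_i)_{i\ge1}$ satisfy $A_i\ge0$ for all $i$, $A_1>0$, and $\sum_{i=1}^\infty A_i=K<\infty$. Let $\{x_{ij}\}_{i,j=1}^\infty$ be any countable collection of points of $\mathbb S^2$, put $r_{ij}(x)=d_{\mathbb S^2}(x,x_{ij})$, and for each $j\ge1$ set $$\eta_j(x)=\sum_{i=1}^jA_i\,f_{a_j,b_i}(r_{ij}(x)),\qquad g_j=g_{\mathbb S^2}+\eta_j^2\,g_{\mathbb S^1}\ \text{ on } \mathbb S^2\times\mathbb S^1 .$$ Write $\mathbb S^2\times_{\eta_j}\mathbb S^1=(\mathbb S^2\times\mathbb S^1,g_j)$. Then: (1) The scalar curvature of $\mathbb S^2\times_{\eta_j}\mathbb S^1$ is $\ge0$ everywhere, for all $j$. (2) With $v=16\pi^2A_1$, $V=2\pi K(8\pi-4\pi\ln4+4\pi\bar K)$ and $D=4\pi+2\pi K(8\pi-4\pi\ln4+4\pi\bar K)$, for all $j$ $$v\le\mathrm{Vol}(\mathbb S^2\times_{\eta_j}\mathbb S^1)\le V,\qquad \mathrm{Diam}(\mathbb S^2\times_{\eta_j}\mathbb S^1)\le D .$$ (3) After possibly passing to a subsequence, $g_j$ converges in $L^q$ norm, for all $q\in[1,\infty)$, to a limit metric $g_\infty$; the limit metric $g_\infty$ is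 in $W^{1,p}$ for all $p\in[1,2)$; and $(\mathbb S^2\times\mathbb S^1,g_\infty)$ has non-negative distributional scalar curvature.
   Context: $(\mathbb S^2,g_{\mathbb S^2})$ is the standard unit round sphere with distance $d_{\mathbb S^2}$; $(\mathbb S^1,g_{\mathbb S^1})$ is the standard circle of length $2\pi$; $g_0=g_{\mathbb S^2}+g_{\mathbb S^1}$ is the product metric. For $a>0$, $b\ge2$ the function $f_{a,b}:[0,\pi]\to[2,\infty)$ is $f_{a,b}(r)=\ln\left(\frac{1+a}{\sin^2r+a}\right)+b$. A (weak) warped product Riemannian metric on $\mathbb S^2\times\mathbb S^1$ is $g=g_{\mathbb S^2}+\eta^2g_{\mathbb S^1}$ with $\eta$ an almost everywhere defined positive function on $\mathbb S^2$. The limit metric $g_\infty$ is of this form. The $L^q$ and $W^{1,p}$ norms of (symmetric 2-tensor valued) metrics are taken with respect to $g_0$: norms of tensors, the volume measure, and the (weak) covariant derivative $\overline\nabla$ are those of $g_0$. Distributional scalar curvature (Lee–LeFloch): for a metric $g$ of weak regularity and the smooth background metric $g_0$ with Levi-Civita connection $\overline\nabla$ and volume measure $\mu_0$, put $\Gamma^k_{ij}=\tfrac12g^{kl}(\overline\nabla_ig_{jl}+\overline\nabla_jg_{il}-\overline\nabla_lg_{ij})$, $V^k=g^{ij}\Gamma^k_{ij}-g^{ik}\Gamma^j_{ji}$, and $F=g^{ij}\overline{\mathrm{Ric}}_{ij}-\overline\nabla_kg^{ij}\,\Gamma^k_{ij}+\overline\nabla_kg^{ik}\,\Gamma^j_{ji}+g^{ij}(\Gamma^k_{kl}\Gamma^l_{ij}-\Gamma^k_{jl}\Gamma^l_{ik})$,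 where $\overline{\mathrm{Ric}}$ is the Ricci tensor of $g_0$. The scalar curvature distribution is $$\langle\mathrm{Scal}_g,u\rangle=\int_{\mathbb S^2\times\mathbb S^1}\Big(-V\cdot\overline\nabla\big(u\tfrac{d\mu_g}{d\mu_0}\big)+Fu\tfrac{d\mu_g}{d\mu_0}\Big)d\mu_0,\qquad u\in C^\infty(\mathbb S^2\times\mathbb S^1),$$ where the integrand is regarded as one almost everywhere defined function (terms are combined before integrating). For $g=g_{\mathbb S^2}+\eta^2g_{\mathbb S^1}$ this integrand equals $2\langle\overline\nabla\eta,\overline\nabla u\rangle_{g_0}+2\eta u$. "Non-negative distributional scalar curvature" means the pairing is well defined (finite) for all such $u$ and $\langle\mathrm{Scal}_g,u\rangle\ge0$ for every $u\ge0$. *)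

theory Defs
  imports "HOL-Analysis.Analysis"
begin

text \<open>
  The product of the round two-sphere and the circle of length \<open>2 * pi\<close> is the submanifold
  \<open>S2S1\<close> of the Euclidean space \<open>real^3 \<times> complex\<close>; the product metric is the restriction of
  the Euclidean inner product. A covariant tensor field of rank two is represented by a family of
  bilinear forms on the ambient space, of which only the restrictions to the tangent spaces
  matter; similarly for rank three. Vectors and covectors are identified by means of the product
  metric.

  With \<open>proj p\<close> the orthogonal projection onto the tangent space at \<open>p\<close>, the vectors \<open>proj p e\<close>,
  for \<open>e\<close> in the ambient \<open>Basis\<close>, satisfy
  \<open>(\<Sum>e\<in>Basis. (v \<bullet> proj p e) * (w \<bullet> proj p e)) = v \<bullet> w\<close> for tangent vectors \<open>v\<close>, \<open>w\<close>.
  A contraction with respect to the product metric is therefore the same whether it is computed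
  in an orthonormal basis of the tangent space or by summing over \<open>proj p e\<close>; below, all index
  sums run over \<open>Basis\<close> with arguments projected in this way.
\<close>

type_synonym ambient = "(real^3) \<times> complex"
type_synonym vfield = "ambient \<Rightarrow> ambient"
type_synonym tensor2 = "ambient \<Rightarrow> ambient \<Rightarrow> ambient \<Rightarrow> real"
type_synonym tensor3 = "ambient \<Rightarrow> ambient \<Rightarrow> ambient \<Rightarrow> ambient \<Rightarrow> real"

definition S2 :: "(real^3) set" where
  "S2 = sphere 0 1"

definition S2S1 :: "ambient set" where
  "S2S1 = S2 \<times> sphere 0 1"

definition tangent :: "ambient \<Rightarrow> ambient set" where
  "tangent p = {v. fst v \<bullet> fst p = 0 \<and> snd v \<bullet> snd p = 0}"

definition proj :: "ambient \<Rightarrow> ambient \<Rightarrow> ambient" where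
  "proj p v = (fst v - (fst v \<bullet> fst p) *\<^sub>R fst p, snd v - (snd v \<bullet> snd p) *\<^sub>R snd p)"

definition g0 :: tensor2 where
  "g0 p v w = v \<bullet> w"

definition warped :: "(real^3 \<Rightarrow> real) \<Rightarrow> tensor2" where
  "warped \<eta> p v w = fst v \<bullet> fst w + (\<eta> (fst p))\<^sup>2 * (snd v \<bullet> snd w)"


subsection \<open>Distance and diameter\<close>

text \<open>
  Lengths are extended nonnegative reals: the library's piecewise \<open>C\<^sup>1\<close> curves may have an
  unbounded derivative near a break point, hence infinite length.
\<close>

definition curve_length ::
    "('a::euclidean_space \<Rightarrow> 'a \<Rightarrow> 'a \<Rightarrow> real) \<Rightarrow> (real \<Rightarrow> 'a) \<Rightarrow> ennreal" where
  "curve_length g \<gamma> =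
     (\<integral>\<^sup>+t\<in>{0..1}. ennreal (sqrt (g (\<gamma> t) (vector_derivative \<gamma> (at t)) (vector_derivative \<gamma> (at t))))
        \<partial>lborel)"

definition riem_dist ::
    "'a::euclidean_space set \<Rightarrow> ('a \<Rightarrow> 'a \<Rightarrow> 'a \<Rightarrow> real) \<Rightarrow> 'a \<Rightarrow> 'a \<Rightarrow> ennreal" where
  "riem_dist S g p q =
     (INF \<gamma>\<in>{\<gamma>. valid_path \<gamma> \<and> path_image \<gamma> \<subseteq> S \<and> pathstart \<gamma> = p \<and> pathfinish \<gamma> = q}.
        curve_length g \<gamma>)"

definition riem_diam ::
    "'a::euclidean_space set \<Rightarrow> ('a \<Rightarrow> 'a \<Rightarrow> 'a \<Rightarrow> real) \<Rightarrow> ennreal" where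
  "riem_diam S g = (SUP p\<in>S. SUP q\<in>S. riem_dist S g p q)"

definition dist_S2 :: "real^3 \<Rightarrow> real^3 \<Rightarrow> real" where
  "dist_S2 x y = enn2real (riem_dist S2 (\<lambda>_ v w. v \<bullet> w) x y)"


subsection \<open>Volume\<close>

text \<open>
  Spherical coordinates on the sphere together with the angle on the circle form a chart that
  covers \<open>S2S1\<close> up to a null set. In it the volume measure of a metric \<open>g\<close> is
  \<open>sqrt (det g\<^sub>i\<^sub>j)\<close> times Lebesgue measure.
\<close>

definition chart_dom :: "(real^3) set" where
  "chart_dom = {u. 0 < u$1 \<and> u$1 < pi \<and> 0 < u$2 \<and> u$2 < 2*pi \<and> 0 < u$3 \<and> u$3 < 2*pi}"

definition chart :: "real^3 \<Rightarrow> ambient" where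
  "chart u = (vector [sin (u$1) * cos (u$2), sin (u$1) * sin (u$2), cos (u$1)], cis (u$3))"

definition chart_gram :: "tensor2 \<Rightarrow> real^3 \<Rightarrow> real^3^3" where
  "chart_gram g u =
     (\<chi> i j. g (chart u) (frechet_derivative chart (at u) (axis i 1))
                         (frechet_derivative chart (at u) (axis j 1)))"

definition vol :: "tensor2 \<Rightarrow> ambient measure" where
  "vol g = distr (density (restrict_space lborel chart_dom)
                          (\<lambda>u. ennreal (sqrt (det (chart_gram g u)))))
                 (restrict_space borel S2S1) chart"

abbreviation \<mu>0 :: "ambient measure" where
  "\<mu>0 \<equiv> vol g0"

definition vol_density :: "tensor2 \<Rightarrow> ambient \<Rightarrow> real" where
  "vol_density g p = enn2real (RN_deriv \<mu>0 (vol g) p)"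


subsection \<open>Differential calculus on the submanifold\<close>

text \<open>
  A function on \<open>S2S1\<close> is differentiated after extending it to a neighbourhood by means of the
  nearest point retraction, so that only its values on \<open>S2S1\<close> are used.
\<close>

definition retr :: "ambient \<Rightarrow> ambient" where
  "retr z = (sgn (fst z), sgn (snd z))"

definition dirderiv :: "(ambient \<Rightarrow> 'b::real_normed_vector) \<Rightarrow> ambient \<Rightarrow> ambient \<Rightarrow> 'b" where
  "dirderiv F p v = frechet_derivative (\<lambda>z. F (retr z)) (at p) v"

fun Ck_on :: "nat \<Rightarrow> 'a::euclidean_space set \<Rightarrow> ('a \<Rightarrow> 'b::real_normed_vector) \<Rightarrow> bool" where
  "Ck_on 0 S f \<longleftrightarrow> continuous_on S f"
| "Ck_on (Suc k) S f \<longleftrightarrow>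
     f differentiable_on S \<and> (\<forall>v. Ck_on k S (\<lambda>x. frechet_derivative f (at x) v))"

definition smooth_on_S2S1 :: "(ambient \<Rightarrow> 'b::real_normed_vector) \<Rightarrow> bool" where
  "smooth_on_S2S1 F \<longleftrightarrow> (\<forall>k. Ck_on k {z. fst z \<noteq> 0 \<and> snd z \<noteq> 0} (\<lambda>z. F (retr z)))"

definition lie_bracket :: "vfield \<Rightarrow> vfield \<Rightarrow> vfield" where
  "lie_bracket X Y p = dirderiv Y p (X p) - dirderiv X p (Y p)"

definition koszul :: "tensor2 \<Rightarrow> vfield \<Rightarrow> vfield \<Rightarrow> vfield \<Rightarrow> ambient \<Rightarrow> real" where
  "koszul g X Y Z p =
     dirderiv (\<lambda>q. g q (Y q) (Z q)) p (X p)
   + dirderiv (\<lambda>q. g q (X q) (Z q)) p (Y p)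
   - dirderiv (\<lambda>q. g q (X q) (Y q)) p (Z p)
   + g p (lie_bracket X Y p) (Z p)
   - g p (lie_bracket X Z p) (Y p)
   - g p (lie_bracket Y Z p) (X p)"

text \<open>The Levi-Civita connection of \<open>g\<close>, applied to tangential vector fields \<open>X\<close> and \<open>Y\<close>.\<close>

definition levi_civita :: "tensor2 \<Rightarrow> vfield \<Rightarrow> vfield \<Rightarrow> vfield" where
  "levi_civita g X Y p =
     (THE u. u \<in> tangent p \<and>
        (\<forall>z\<in>tangent p. 2 * g p u z = koszul g X Y (\<lambda>q. proj q z) p))"

text \<open>Tangent vectors at a point are extended to the vector fields \<open>\<lambda>q. proj q v\<close>.\<close>

definition riemann :: "tensor2 \<Rightarrow> ambient \<Rightarrow> ambient \<Rightarrow> ambient \<Rightarrow> ambient \<Rightarrow> ambient" where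
  "riemann g p x y z =
    (let X = (\<lambda>q. proj q x); Y = (\<lambda>q. proj q y); Z = (\<lambda>q. proj q z) in
       levi_civita g X (levi_civita g Y Z) p
     - levi_civita g Y (levi_civita g X Z) p
     - levi_civita g (lie_bracket X Y) Z p)"

definition ricci :: "tensor2 \<Rightarrow> tensor2" where
  "ricci g p y z = (\<Sum>e\<in>Basis. riemann g p (proj p e) y z \<bullet> proj p e)"

text \<open>
  The inverse metric: the covector \<open>\<lambda>z. v \<bullet> z\<close> is raised with \<open>g\<close> to a tangent vector, which is
  then paired with the covector \<open>\<lambda>z. w \<bullet> z\<close>.
\<close>

definition inverse_metric :: "tensor2 \<Rightarrow> tensor2" where
  "inverse_metric g p v w = (THE u. u \<in> tangent p \<and> (\<forall>z\<in>tangent p. g p u z = v \<bullet> z)) \<bullet> w"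

definition comp2 :: "tensor2 \<Rightarrow> tensor2" where
  "comp2 T p i j = T p (proj p i) (proj p j)"

definition comp3 :: "tensor3 \<Rightarrow> tensor3" where
  "comp3 T p k i j = T p (proj p k) (proj p i) (proj p j)"

definition scal :: "tensor2 \<Rightarrow> ambient \<Rightarrow> real" where
  "scal g p = (\<Sum>i\<in>Basis. \<Sum>j\<in>Basis. comp2 (inverse_metric g) p i j * comp2 (ricci g) p i j)"

text \<open>
  The covariant derivative, in direction \<open>x\<close>, of a rank three tensor field with respect to the
  Levi-Civita connection of the product metric, and its divergence in the first argument.
\<close>

definition cov_deriv3 ::
    "tensor3 \<Rightarrow> ambient \<Rightarrow> ambient \<Rightarrow> ambient \<Rightarrow> ambient \<Rightarrow> ambient \<Rightarrow> real" where
  "cov_deriv3 \<phi> p x y1 y2 y3 =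
    (let D = (\<lambda>y. levi_civita g0 (\<lambda>q. proj q x) (\<lambda>q. proj q y) p) in
       dirderiv (\<lambda>q. comp3 \<phi> q y1 y2 y3) p x
     - \<phi> p (D y1) (proj p y2) (proj p y3)
     - \<phi> p (proj p y1) (D y2) (proj p y3)
     - \<phi> p (proj p y1) (proj p y2) (D y3))"

definition div3 :: "tensor3 \<Rightarrow> tensor2" where
  "div3 \<phi> p y z = (\<Sum>e\<in>Basis. cov_deriv3 \<phi> p (proj p e) (proj p e) y z)"

definition div_vfield :: "vfield \<Rightarrow> ambient \<Rightarrow> real" where
  "div_vfield X p = (\<Sum>e\<in>Basis. levi_civita g0 (\<lambda>q. proj q e) X p \<bullet> proj p e)"


subsection \<open>Lebesgue and Sobolev norms of tensor fields\<close>

definition inner2 :: "tensor2 \<Rightarrow> tensor2 \<Rightarrow> ambient \<Rightarrow> real" where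
  "inner2 T U p = (\<Sum>i\<in>Basis. \<Sum>j\<in>Basis. comp2 T p i j * comp2 U p i j)"

definition inner3 :: "tensor3 \<Rightarrow> tensor3 \<Rightarrow> ambient \<Rightarrow> real" where
  "inner3 T U p = (\<Sum>k\<in>Basis. \<Sum>i\<in>Basis. \<Sum>j\<in>Basis. comp3 T p k i j * comp3 U p k i j)"

definition norm2 :: "tensor2 \<Rightarrow> ambient \<Rightarrow> real" where
  "norm2 T p = sqrt (inner2 T T p)"

definition norm3 :: "tensor3 \<Rightarrow> ambient \<Rightarrow> real" where
  "norm3 T p = sqrt (inner3 T T p)"

definition trilinear :: "('a::real_vector \<Rightarrow> 'a \<Rightarrow> 'a \<Rightarrow> real) \<Rightarrow> bool" where
  "trilinear h \<longleftrightarrow>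
     (\<forall>y z. linear (\<lambda>x. h x y z)) \<and> (\<forall>x z. linear (\<lambda>y. h x y z)) \<and> (\<forall>x y. linear (\<lambda>z. h x y z))"

definition in_Lq2 :: "real \<Rightarrow> tensor2 \<Rightarrow> bool" where
  "in_Lq2 q T \<longleftrightarrow>
     (AE p in \<mu>0. bilinear (T p)) \<and>
     (\<forall>v w. (\<lambda>p. comp2 T p v w) \<in> borel_measurable \<mu>0) \<and>
     integrable \<mu>0 (\<lambda>p. norm2 T p powr q)"

definition in_Lq3 :: "real \<Rightarrow> tensor3 \<Rightarrow> bool" where
  "in_Lq3 q T \<longleftrightarrow>
     (AE p in \<mu>0. trilinear (T p)) \<and>
     (\<forall>u v w. (\<lambda>p. comp3 T p u v w) \<in> borel_measurable \<mu>0) \<and>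
     integrable \<mu>0 (\<lambda>p. norm3 T p powr q)"

definition Lq_norm2 :: "real \<Rightarrow> tensor2 \<Rightarrow> real" where
  "Lq_norm2 q T = (\<integral>p. norm2 T p powr q \<partial>\<mu>0) powr (1 / q)"

definition converges_Lq2 :: "real \<Rightarrow> (nat \<Rightarrow> tensor2) \<Rightarrow> tensor2 \<Rightarrow> bool" where
  "converges_Lq2 q T U \<longleftrightarrow>
     (\<forall>n. in_Lq2 q (T n)) \<and> in_Lq2 q U \<and>
     (\<lambda>n. Lq_norm2 q (\<lambda>p v w. T n p v w - U p v w)) \<longlonglongrightarrow> 0"

definition smooth_tensor3 :: "tensor3 \<Rightarrow> bool" where
  "smooth_tensor3 \<phi> \<longleftrightarrow>
     (\<forall>p\<in>S2S1. trilinear (\<phi> p)) \<and> (\<forall>x y z. smooth_on_S2S1 (\<lambda>q. comp3 \<phi> q x y z))"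

text \<open>
  Weak covariant derivatives with respect to the product metric; the first argument of the
  derivative is the direction of differentiation. The manifold is compact, so every smooth field
  is a test field. A weak derivative is unique almost everywhere.
\<close>

definition has_weak_cov_deriv :: "tensor2 \<Rightarrow> tensor3 \<Rightarrow> bool" where
  "has_weak_cov_deriv T DT \<longleftrightarrow>
     in_Lq2 1 T \<and> in_Lq3 1 DT \<and>
     (\<forall>\<phi>. smooth_tensor3 \<phi> \<longrightarrow>
        (\<integral>p. inner3 DT \<phi> p \<partial>\<mu>0) = - (\<integral>p. inner2 T (div3 \<phi>) p \<partial>\<mu>0))"

definition has_weak_gradient :: "(ambient \<Rightarrow> real) \<Rightarrow> vfield \<Rightarrow> bool" where
  "has_weak_gradient f W \<longleftrightarrow>
     integrable \<mu>0 f \<and> integrable \<mu>0 W \<and> (AE p in \<mu>0. W p \<in> tangent p) \<and>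
     (\<forall>X. smooth_on_S2S1 X \<and> (\<forall>p\<in>S2S1. X p \<in> tangent p) \<longrightarrow>
        (\<integral>p. W p \<bullet> X p \<partial>\<mu>0) = - (\<integral>p. f p * div_vfield X p \<partial>\<mu>0))"

definition in_W1p :: "real \<Rightarrow> tensor2 \<Rightarrow> bool" where
  "in_W1p r T \<longleftrightarrow> in_Lq2 r T \<and> (\<exists>DT. has_weak_cov_deriv T DT \<and> in_Lq3 r DT)"

text \<open>Almost everywhere defined positive functions on the sphere.\<close>

definition weak_warping_function :: "(real^3 \<Rightarrow> real) \<Rightarrow> bool" where
  "weak_warping_function \<eta> \<longleftrightarrow>
     (\<lambda>p. \<eta> (fst p)) \<in> borel_measurable \<mu>0 \<and> (AE p in \<mu>0. 0 < \<eta> (fst p))"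


subsection \<open>Distributional scalar curvature\<close>

text \<open>
  In the following, \<open>Dg\<close> and \<open>Dgi\<close> are the weak covariant derivatives of the metric \<open>g\<close> and of its
  inverse, and \<open>W\<close> is the weak gradient of the test function times the volume density.
  \<open>LL_Gamma g Dg p k i j\<close> stands for \<open>\<Gamma>\<^sup>k\<^sub>i\<^sub>j\<close>.
\<close>

definition LL_Gamma :: "tensor2 \<Rightarrow> tensor3 \<Rightarrow> tensor3" where
  "LL_Gamma g Dg p k i j =
     (1/2) * (\<Sum>l\<in>Basis. comp2 (inverse_metric g) p k l *
                (comp3 Dg p i j l + comp3 Dg p j i l - comp3 Dg p l i j))"

definition LL_V :: "tensor2 \<Rightarrow> tensor3 \<Rightarrow> ambient \<Rightarrow> ambient \<Rightarrow> real" where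
  "LL_V g Dg p k =
    (let gi = comp2 (inverse_metric g) p; \<Gamma> = LL_Gamma g Dg p in
       (\<Sum>i\<in>Basis. \<Sum>j\<in>Basis. gi i j * \<Gamma> k i j)
     - (\<Sum>i\<in>Basis. gi i k * (\<Sum>j\<in>Basis. \<Gamma> j j i)))"

definition LL_F :: "tensor2 \<Rightarrow> tensor3 \<Rightarrow> tensor3 \<Rightarrow> ambient \<Rightarrow> real" where
  "LL_F g Dg Dgi p =
    (let gi = comp2 (inverse_metric g) p; \<Gamma> = LL_Gamma g Dg p; D = comp3 Dgi p in
       (\<Sum>i\<in>Basis. \<Sum>j\<in>Basis. gi i j * comp2 (ricci g0) p i j)
     - (\<Sum>k\<in>Basis. \<Sum>i\<in>Basis. \<Sum>j\<in>Basis. D k i j * \<Gamma> k i j)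
     + (\<Sum>k\<in>Basis. \<Sum>i\<in>Basis. D k i k * (\<Sum>j\<in>Basis. \<Gamma> j j i))
     + (\<Sum>i\<in>Basis. \<Sum>j\<in>Basis. gi i j *
          (\<Sum>k\<in>Basis. \<Sum>l\<in>Basis. \<Gamma> k k l * \<Gamma> l i j - \<Gamma> k j l * \<Gamma> l i k)))"

definition LL_integrand ::
    "tensor2 \<Rightarrow> tensor3 \<Rightarrow> tensor3 \<Rightarrow> (ambient \<Rightarrow> real) \<Rightarrow> vfield \<Rightarrow> ambient \<Rightarrow> real" where
  "LL_integrand g Dg Dgi u W p =
     - (\<Sum>k\<in>Basis. LL_V g Dg p k * (W p \<bullet> proj p k)) + LL_F g Dg Dgi p * u p * vol_density g p"

definition has_scal_pairing :: "tensor2 \<Rightarrow> (ambient \<Rightarrow> real) \<Rightarrow> real \<Rightarrow> bool" where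
  "has_scal_pairing g u I \<longleftrightarrow>
     (\<exists>Dg Dgi W.
        has_weak_cov_deriv g Dg \<and>
        has_weak_cov_deriv (inverse_metric g) Dgi \<and>
        has_weak_gradient (\<lambda>p. u p * vol_density g p) W \<and>
        has_bochner_integral \<mu>0 (LL_integrand g Dg Dgi u W) I)"

definition nonneg_distributional_scal :: "tensor2 \<Rightarrow> bool" where
  "nonneg_distributional_scal g \<longleftrightarrow>
     (\<forall>u. smooth_on_S2S1 u \<longrightarrow>
        (\<exists>I. has_scal_pairing g u I \<and> ((\<forall>p\<in>S2S1. 0 \<le> u p) \<longrightarrow> 0 \<le> I)))"


subsection \<open>The warping functions\<close>

definition f_ab :: "real \<Rightarrow> real \<Rightarrow> real \<Rightarrow> real" where
  "f_ab a b r = ln ((1 + a) / ((sin r)\<^sup>2 + a)) + b"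

definition eta ::
    "(nat \<Rightarrow> real) \<Rightarrow> (nat \<Rightarrow> real) \<Rightarrow> (nat \<Rightarrow> real) \<Rightarrow> (nat \<Rightarrow> nat \<Rightarrow> real^3) \<Rightarrow> nat \<Rightarrow> real^3 \<Rightarrow> real" where
  "eta A a b x j y = (\<Sum>i=1..j. A i * f_ab (a j) (b i) (dist_S2 y (x i j)))"

end

theory Submission imports Defs "HOL-Complex_Analysis.Great_Picard"
begin

text \<open>
  In terms of \<open>t = x \<bullet> y = cos (d(x, y))\<close> the function \<open>f\<^sub>a\<^sub>,\<^sub>b\<close> is \<open>ln ((1 + a) / (1 + a - t\<^sup>2)) + b\<close>, a
  potential with spherical Laplacian at most \<open>2 \<le> b\<close>. Hence \<open>\<Delta>\<eta> \<le> \<eta>\<close> for every \<open>\<eta> = \<eta>\<^sub>j\<close>, and the scalar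
  curvature \<open>2 - 2 \<Delta>\<eta> / \<eta>\<close> is non-negative. The volume is \<open>2\<pi> \<integral>\<eta>\<close>, which the explicit integral of the
  potential for \<open>a = 0\<close> bounds; points are joined by horizontal curves and the circle over a point where
  \<open>\<eta>\<close> is small, which bounds the diameter.

  A diagonal argument makes all centres converge. The potentials are bounded by the one for \<open>a = 0\<close>, which
  lies in every \<open>L\<^sup>q\<close> while its gradient, being of the order of the inverse distance to the poles, lies in
  \<open>L\<^sup>r\<close> for \<open>r < 2\<close>; Jensen's inequality with the weights \<open>A\<^sub>i / K\<close> carries both bounds over to the sums. By
  dominated convergence the regularised sums converge and the integrations by parts pass to the limit.
  The singular terms of the Lee--LeFloch integrand cancel, which leaves
  \<open>2 \<langle>\<nabla>\<eta>, \<nabla>u\<rangle> + 2 \<eta> u\<close>; its integral is the limit of the integrals of \<open>2 u (\<eta> - \<Delta>\<eta>) \<ge> 0\<close> for the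
  regularised \<open>\<eta>\<close>.
\<close>

section \<open>Differential calculus on the product\<close>

text \<open>The volume measure is built from a chart adapted to one axis, while the potentials are
  centred at arbitrary points. Apart from the total volume, integrals of functions of
  \<open>y \<bullet> fst p\<close> are therefore not computed in the chart: the divergence theorem
  is proved once in coordinates, and the rest follows by integrating by parts against
  \<open>proj p (y, 0)\<close>, the gradient of \<open>y \<bullet> fst p\<close>, which treats all
  centres alike. The centres move with the index, so the given warping functions come with no
  evident pointwise majorant; their convergence is proved in the mean, term by term. The limit is
  then regularised a second time, with its own fixed centres. This auxiliary sequence stays below
  the limit, so derivatives and positivity pass to the limit by dominated convergence. The quantity
  |grad \<eta>|^2 / \<eta> is in general not integrable near a centre, so the two parts of the
  curvature pairing cannot be integrated separately: the pointwise cancellation has to come before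
  integration. The bound \<eta> \<ge> 2 A_1 keeps the inverse metric under control.\<close>

lemma mem_S2S1_iff: "p \<in> S2S1 \<longleftrightarrow> norm (fst p) = 1 \<and> norm (snd p) = 1"
  by (cases p) (auto simp: S2S1_def S2_def)

lemma S2S1_inner [simp]:
  assumes "p \<in> S2S1" shows "fst p \<bullet> fst p = 1" "snd p \<bullet> snd p = 1"
  using assms by (auto simp: mem_S2S1_iff norm_eq_1)

lemma S2S1_imp_fst: "p \<in> S2S1 \<Longrightarrow> fst p \<in> S2"
  by (auto simp: S2S1_def)

lemma linear_proj: "linear (proj p)"
  by (rule linearI) (auto simp: proj_def inner_simps algebra_simps prod_eq_iff)

lemma proj_tangent: "p \<in> S2S1 \<Longrightarrow> proj p v \<in> tangent p"
  by (auto simp: tangent_def proj_def inner_simps)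

lemma proj_ident: "v \<in> tangent p \<Longrightarrow> proj p v = v"
  by (cases v) (auto simp: tangent_def proj_def)

lemma proj_proj [simp]: "p \<in> S2S1 \<Longrightarrow> proj p (proj p v) = proj p v"
  by (rule proj_ident) (rule proj_tangent)

lemma proj_adjoint: "proj p v \<bullet> w = v \<bullet> proj p w"
  by (simp add: proj_def inner_prod_def inner_simps inner_commute)

lemma tangent_inner_proj: "v \<in> tangent p \<Longrightarrow> v \<bullet> proj p w = v \<bullet> w"
  using proj_adjoint[of p v w] by (simp add: proj_ident)

lemma sum_Basis_proj: "(\<Sum>e\<in>Basis. (v \<bullet> proj p e) * (w \<bullet> proj p e)) = proj p v \<bullet> proj p w"
  by (simp only: proj_adjoint[symmetric] euclidean_inner[of "proj p v", symmetric])

lemma retr_ident: "p \<in> S2S1 \<Longrightarrow> retr p = p"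
  by (cases p) (auto simp: retr_def mem_S2S1_iff sgn_div_norm)

lemma retr_mem: "fst z \<noteq> 0 \<Longrightarrow> snd z \<noteq> 0 \<Longrightarrow> retr z \<in> S2S1"
  by (auto simp: retr_def mem_S2S1_iff norm_sgn)

lemma open_punctured: "open {z::ambient. fst z \<noteq> 0 \<and> snd z \<noteq> 0}"
  by (intro open_Collect_conj open_Collect_neq continuous_intros)

lemma S2S1_punctured: "p \<in> S2S1 \<Longrightarrow> p \<in> {z. fst z \<noteq> 0 \<and> snd z \<noteq> 0}"
  by (auto simp: mem_S2S1_iff)

lemma has_derivative_sgn_unit:
  fixes y :: "'a::real_inner"
  assumes "norm y = 1"
  shows "(sgn has_derivative (\<lambda>v. v - (v \<bullet> y) *\<^sub>R y)) (at y)"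
proof -
  have y: "y \<noteq> 0" using assms by auto
  have "((\<lambda>z. inverse (norm z) *\<^sub>R z) has_derivative
     (\<lambda>v. inverse (norm y) *\<^sub>R v + (- (inverse (norm y) * (v \<bullet> sgn y) * inverse (norm y))) *\<^sub>R y)) (at y)"
    using y by (auto intro!: derivative_eq_intros has_derivative_norm simp: assms inner_commute)
  then show ?thesis
    using assms by (simp add: sgn_div_norm [abs_def])
qed

text \<open>Through this, every derivative taken after extension by \<open>retr\<close> becomes a
  tangential one.\<close>

lemma has_derivative_retr:
  assumes "p \<in> S2S1"
  shows "(retr has_derivative proj p) (at p)"
proof -
  have 1: "((\<lambda>z::ambient. sgn (fst z)) has_derivative (\<lambda>v. fst v - (fst v \<bullet> fst p) *\<^sub>R fst p)) (at p)"
    using has_derivative_compose[OF has_derivative_fst[OF has_derivative_ident] has_derivative_sgn_unit, of p]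
      assms by (simp add: mem_S2S1_iff)
  have 2: "((\<lambda>z::ambient. sgn (snd z)) has_derivative (\<lambda>v. snd v - (snd v \<bullet> snd p) *\<^sub>R snd p)) (at p)"
    using has_derivative_compose[OF has_derivative_snd[OF has_derivative_ident] has_derivative_sgn_unit, of p]
      assms by (simp add: mem_S2S1_iff)
  show ?thesis
    using has_derivative_Pair[OF 1 2] by (simp add: retr_def[abs_def] proj_def[abs_def])
qed

lemma eventually_punctured: "p \<in> S2S1 \<Longrightarrow> eventually (\<lambda>z. fst z \<noteq> 0 \<and> snd z \<noteq> 0) (nhds p)"
  using open_punctured S2S1_punctured[of p] eventually_nhds by blast

lemma has_derivative_eventually_eq:
  assumes "(f has_derivative L) (at x)" "eventually (\<lambda>z. f z = g z) (nhds x)"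
  shows "(g has_derivative L) (at x)"
proof -
  have "eventually (\<lambda>z. f z = g z) (at x)"
    using assms(2) by (auto simp: eventually_at_filter elim: eventually_mono)
  moreover have "f x = g x"
    using assms(2) by (rule eventually_nhds_x_imp_x)
  ultimately show ?thesis
    using has_derivative_transform_eventually[OF assms(1)] by auto
qed

text \<open>Any ambient formula for \<open>F\<close> may be differentiated, even one that is not
  constant along rays: composing with \<open>retr\<close> only projects the direction.\<close>

lemma has_derivative_on_S2S1:
  assumes p: "p \<in> S2S1" and F': "(F' has_derivative L) (at p)" and eq: "\<And>q. q \<in> S2S1 \<Longrightarrow> F q = F' q"
  shows "((\<lambda>z. F (retr z)) has_derivative (\<lambda>v. L (proj p v))) (at p)"
proof -
  have "((\<lambda>z. F' (retr z)) has_derivative (\<lambda>v. L (proj p v))) (at p)"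
    using has_derivative_compose[OF has_derivative_retr[OF p], of F' L] F' p
    by (simp add: retr_ident)
  moreover have "eventually (\<lambda>z. F' (retr z) = F (retr z)) (nhds p)"
    using eventually_punctured[OF p] by (rule eventually_mono) (auto simp: eq retr_mem)
  ultimately show ?thesis
    by (rule has_derivative_eventually_eq)
qed

lemma dirderiv_eqI:
  "((\<lambda>z. F (retr z)) has_derivative L) (at p) \<Longrightarrow> dirderiv F p v = L v"
  unfolding dirderiv_def using frechet_derivative_at by metis

text \<open>Since \<open>retr\<close> is idempotent, the extended function is constant along rays
  and its derivative ignores normal components.\<close>

lemma has_derivative_retr_proj:
  assumes p: "p \<in> S2S1" and F: "((\<lambda>z. F (retr z)) has_derivative L) (at p)"
  shows "L (proj p v) = L v"
proof -
  have "((\<lambda>z. F (retr (retr z))) has_derivative (\<lambda>v. L (proj p v))) (at p)"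
    using has_derivative_compose[OF has_derivative_retr[OF p], of "\<lambda>z. F (retr z)" L] F p
    by (simp add: retr_ident)
  moreover have "eventually (\<lambda>z. F (retr (retr z)) = F (retr z)) (nhds p)"
    using eventually_punctured[OF p] by (rule eventually_mono) (auto simp: retr_ident retr_mem)
  ultimately have "((\<lambda>z. F (retr z)) has_derivative (\<lambda>v. L (proj p v))) (at p)"
    by (rule has_derivative_eventually_eq)
  from has_derivative_unique[OF this F] show ?thesis by metis
qed

section \<open>The Levi-Civita connection of a warped product\<close>

lemma has_derivative_proj_field:
  assumes p: "p \<in> S2S1"
  shows "((\<lambda>z. proj (retr z) w) has_derivative
      (\<lambda>v. (- ((fst w \<bullet> fst (proj p v)) *\<^sub>R fst p + (fst w \<bullet> fst p) *\<^sub>R fst (proj p v)),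
            - ((snd w \<bullet> snd (proj p v)) *\<^sub>R snd p + (snd w \<bullet> snd p) *\<^sub>R snd (proj p v))))) (at p)"
proof -
  let ?L = "\<lambda>v. (- ((fst w \<bullet> fst v) *\<^sub>R fst p + (fst w \<bullet> fst p) *\<^sub>R fst v),
                 - ((snd w \<bullet> snd v) *\<^sub>R snd p + (snd w \<bullet> snd p) *\<^sub>R snd v))"
  have "((\<lambda>q. proj q w) has_derivative ?L) (at p)"
    unfolding proj_def
    by (rule derivative_eq_intros refl | simp add: algebra_simps)+
  from has_derivative_on_S2S1[OF p this, of "\<lambda>q. proj q w"] show ?thesis by simp
qed

text \<open>In the Koszul formula the derivatives of the fields \<open>X\<close> and
  \<open>proj q z\<close> cancel against the brackets. What remains is twice the ambient derivative
  of \<open>Y\<close> and the derivative of the coefficient of the circle metric, and the equation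
  is solved separately in each factor. Uniqueness is definiteness of the metric.\<close>

lemma levi_civita_warped:
  assumes p: "p \<in> S2S1"
    and X: "\<And>q. q \<in> S2S1 \<Longrightarrow> X q \<in> tangent q" and Y: "\<And>q. q \<in> S2S1 \<Longrightarrow> Y q \<in> tangent q"
    and DX: "((\<lambda>z. X (retr z)) has_derivative DX) (at p)"
    and DY: "((\<lambda>z. Y (retr z)) has_derivative DY) (at p)"
    and D\<eta>: "((\<lambda>z. \<eta> (fst (retr z))) has_derivative (\<lambda>v. G \<bullet> fst v)) (at p)"
    and \<eta>: "\<eta> (fst p) \<noteq> 0" and G: "G \<bullet> fst p = 0"
  shows "levi_civita (warped \<eta>) X Y p =
     (fst (proj p (DY (X p))) - (\<eta> (fst p) * (snd (X p) \<bullet> snd (Y p))) *\<^sub>R G,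
      snd (proj p (DY (X p))) + (1 / \<eta> (fst p)) *\<^sub>R
         ((G \<bullet> fst (X p)) *\<^sub>R snd (Y p) + (G \<bullet> fst (Y p)) *\<^sub>R snd (X p)))" (is "_ = ?u")
proof -
  have inner_deriv: "dirderiv (\<lambda>q. warped \<eta> q (A q) (B q)) p v =
       warped \<eta> p (DA v) (B p) + warped \<eta> p (A p) (DB v)
        + 2 * \<eta> (fst p) * (G \<bullet> fst v) * (snd (A p) \<bullet> snd (B p))"
    if A: "((\<lambda>z. A (retr z)) has_derivative DA) (at p)" and B: "((\<lambda>z. B (retr z)) has_derivative DB) (at p)"
    for A B DA DB v
    unfolding warped_def
    by (rule dirderiv_eqI)
       (rule derivative_eq_intros A B D\<eta> refl | simp add: p retr_ident algebra_simps power2_eq_square)+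
  \<comment> \<open>What the derivatives of \<open>(\<eta> (fst q))\<^sup>2\<close> contribute to
    the three differentiated terms of the Koszul formula.\<close>
  define cor where "cor z = 2 * \<eta> (fst p) * ((G \<bullet> fst (X p)) * (snd (Y p) \<bullet> snd z)
      + (G \<bullet> fst (Y p)) * (snd (X p) \<bullet> snd z) - (G \<bullet> fst z) * (snd (X p) \<bullet> snd (Y p)))" for z
  have kos: "koszul (warped \<eta>) X Y (\<lambda>q. proj q z) p = 2 * warped \<eta> p (DY (X p)) z + cor z"
    if z: "z \<in> tangent p" for z
  proof -
    define DZ where "DZ v = (- ((fst z \<bullet> fst (proj p v)) *\<^sub>R fst p + (fst z \<bullet> fst p) *\<^sub>R fst (proj p v)),
            - ((snd z \<bullet> snd (proj p v)) *\<^sub>R snd p + (snd z \<bullet> snd p) *\<^sub>R snd (proj p v)))" for v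
    have DZ: "((\<lambda>y. proj (retr y) z) has_derivative DZ) (at p)"
      using has_derivative_proj_field[OF p, of z] unfolding DZ_def by simp
    have [simp]: "proj p z = z" by (rule proj_ident[OF z])
    show ?thesis
      unfolding koszul_def lie_bracket_def cor_def
      by (simp add: inner_deriv[OF DY DZ] inner_deriv[OF DX DZ] inner_deriv[OF DX DY]
            dirderiv_eqI[OF DX] dirderiv_eqI[OF DY] dirderiv_eqI[OF DZ])
         (simp add: warped_def inner_simps algebra_simps inner_commute)
  qed
  have u: "?u \<in> tangent p"
    using proj_tangent[OF p, of "DY (X p)"] X[OF p] Y[OF p] G
    by (auto simp: tangent_def inner_simps inner_commute)
  have gu: "2 * warped \<eta> p ?u z = 2 * warped \<eta> p (DY (X p)) z + cor z" if z: "z \<in> tangent p" for z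
  proof -
    have z0: "fst p \<bullet> fst z = 0" "snd p \<bullet> snd z = 0" using z by (auto simp: tangent_def inner_commute)
    then have "fst (proj p (DY (X p))) \<bullet> fst z = fst (DY (X p)) \<bullet> fst z"
       "snd (proj p (DY (X p))) \<bullet> snd z = snd (DY (X p)) \<bullet> snd z"
      by (auto simp: proj_def inner_simps)
    with \<eta> show ?thesis
      unfolding warped_def cor_def
      by (simp add: inner_simps field_simps power2_eq_square)
  qed
  show ?thesis
    unfolding levi_civita_def
  proof (rule the_equality)
    show "?u \<in> tangent p \<and> (\<forall>z\<in>tangent p. 2 * warped \<eta> p ?u z = koszul (warped \<eta>) X Y (\<lambda>q. proj q z) p)"
      using u gu kos by simp
  next
    fix w assume w: "w \<in> tangent p \<and> (\<forall>z\<in>tangent p. 2 * warped \<eta> p w z = koszul (warped \<eta>) X Y (\<lambda>q. proj q z) p)"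
    \<comment> \<open>The difference of two solutions is tangential and hence orthogonal to
      itself.\<close>
    define d where "d = w - ?u"
    have d: "d \<in> tangent p" using w u by (auto simp: d_def tangent_def inner_simps)
    have "warped \<eta> p w d = warped \<eta> p ?u d" using w gu[OF d] kos[OF d] d by auto
    then have "warped \<eta> p d d = 0"
      by (simp add: d_def warped_def inner_simps algebra_simps inner_commute)
    then have "fst d \<bullet> fst d + (\<eta> (fst p))\<^sup>2 * (snd d \<bullet> snd d) = 0"
      by (simp add: warped_def)
    then have "fst d \<bullet> fst d = 0 \<and> (\<eta> (fst p))\<^sup>2 * (snd d \<bullet> snd d) = 0"
      by (subst (asm) add_nonneg_eq_0_iff) auto
    then have "d = 0" using \<eta> by (auto simp: prod_eq_iff)
    then show "w = ?u" by (simp add: d_def)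
  qed
qed

section \<open>Curvature of warped products\<close>

lemma sum_Basis_prod_split:
  fixes f :: "'a::euclidean_space \<times> 'b::euclidean_space \<Rightarrow> 'c::comm_monoid_add"
  shows "sum f Basis = (\<Sum>i\<in>Basis. f (i, 0)) + (\<Sum>i\<in>Basis. f (0, i))"
proof -
  have "inj_on (\<lambda>u. (u::'a, 0::'b)) Basis" "inj_on (\<lambda>u. (0::'a, u::'b)) Basis"
    by (auto intro!: inj_onI)
  then show ?thesis
    unfolding Basis_prod_def by (subst sum.union_disjoint) (auto simp: sum.reindex)
qed

lemma levi_civita_proj_warped:
  assumes q: "q \<in> S2S1"
    and D\<eta>: "((\<lambda>z. \<eta> (fst (retr z))) has_derivative (\<lambda>v. G \<bullet> fst v)) (at q)"
    and \<eta>: "\<eta> (fst q) \<noteq> 0" and G: "G \<bullet> fst q = 0"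
  shows "levi_civita (warped \<eta>) (\<lambda>q. proj q y) (\<lambda>q. proj q z) q =
     (- ((fst z \<bullet> fst q) *\<^sub>R fst (proj q y)) - (\<eta> (fst q) * (snd (proj q y) \<bullet> snd (proj q z))) *\<^sub>R G,
      - ((snd z \<bullet> snd q) *\<^sub>R snd (proj q y)) + (1 / \<eta> (fst q)) *\<^sub>R
         ((G \<bullet> fst (proj q y)) *\<^sub>R snd (proj q z) + (G \<bullet> fst (proj q z)) *\<^sub>R snd (proj q y)))"
proof -
  have *: "proj q (- (a *\<^sub>R fst q) - b *\<^sub>R fst (proj q v), - (c *\<^sub>R snd q) - d *\<^sub>R snd (proj q v))
      = (- b *\<^sub>R fst (proj q v), - d *\<^sub>R snd (proj q v))" for a b c d v
    using q by (simp add: proj_def inner_simps algebra_simps)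
  show ?thesis
    by (subst levi_civita_warped[OF q proj_tangent proj_tangent has_derivative_proj_field[OF q]
          has_derivative_proj_field[OF q] D\<eta> \<eta> G])
       (simp_all add: q *)
qed

text \<open>With \<open>H\<close> the derivative of the gradient of a function on the sphere this is
  the Laplacian of that function.\<close>

definition trace_fst :: "ambient \<Rightarrow> (ambient \<Rightarrow> real^3) \<Rightarrow> real" where
  "trace_fst p H = (\<Sum>e\<in>Basis. H (proj p (e, 0)) \<bullet> fst (proj p (e, 0)))"

lemma sum_Basis_proj_fst:
  "(\<Sum>e\<in>Basis. (v \<bullet> fst (proj p (e, 0))) * (w \<bullet> fst (proj p (e, 0)))) = fst (proj p (v, 0)) \<bullet> fst (proj p (w, 0))"
proof -
  have "v \<bullet> fst (proj p (e, 0)) = fst (proj p (v, 0)) \<bullet> e" for v e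
    by (simp add: proj_def inner_simps inner_commute)
  then show ?thesis by (simp only: euclidean_inner[of "fst (proj p (v, 0))", symmetric])
qed

lemma sum_Basis_proj_snd:
  "(\<Sum>e\<in>Basis. (v \<bullet> snd (proj p (0, e))) * (w \<bullet> snd (proj p (0, e)))) = snd (proj p (0, v)) \<bullet> snd (proj p (0, w))"
proof -
  have "v \<bullet> snd (proj p (0, e)) = snd (proj p (0, v)) \<bullet> e" for v e
    by (simp add: proj_def inner_simps inner_commute)
  then show ?thesis by (simp only: euclidean_inner[of "snd (proj p (0, v))", symmetric])
qed

lemma trace_proj_fst:
  assumes p: "p \<in> S2S1"
  shows "(\<Sum>e\<in>Basis. fst (proj p (e, 0)) \<bullet> fst (proj p (e, 0))) = 2"
proof -
  have "(\<Sum>e\<in>Basis. fst (proj p (e, 0)) \<bullet> fst (proj p (e, 0))) = (\<Sum>e\<in>Basis. e \<bullet> e - (fst p \<bullet> e) * (fst p \<bullet> e))"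
    using p by (intro sum.cong refl) (simp add: proj_def inner_simps inner_commute algebra_simps)
  also have "\<dots> = 2"
    using p by (simp add: sum_subtractf euclidean_inner[symmetric])
  finally show ?thesis .
qed

lemma trace_proj_snd:
  assumes p: "p \<in> S2S1"
  shows "(\<Sum>e\<in>Basis. snd (proj p (0, e)) \<bullet> snd (proj p (0, e))) = 1"
proof -
  have "(\<Sum>e\<in>Basis. snd (proj p (0, e)) \<bullet> snd (proj p (0, e))) = (\<Sum>e\<in>Basis. e \<bullet> e - (snd p \<bullet> e) * (snd p \<bullet> e))"
    using p by (intro sum.cong refl) (simp add: proj_def inner_simps inner_commute algebra_simps)
  also have "\<dots> = 1"
    using p by (simp add: sum_subtractf euclidean_inner[symmetric])
  finally show ?thesis .
qed

section \<open>Second covariant derivatives and Ricci curvature of a warped product\<close>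

context
  fixes \<eta> :: "real^3 \<Rightarrow> real" and G :: "real^3 \<Rightarrow> real^3" and H :: "ambient \<Rightarrow> real^3" and p :: ambient
  assumes pos: "\<And>y. y \<in> S2 \<Longrightarrow> \<eta> y > 0"
    and grad: "\<And>q. q \<in> S2S1 \<Longrightarrow> ((\<lambda>z. \<eta> (fst (retr z))) has_derivative (\<lambda>v. G (fst q) \<bullet> fst v)) (at q)"
    and tang: "\<And>y. y \<in> S2 \<Longrightarrow> G y \<bullet> y = 0"
    and hess: "((\<lambda>z. G (fst (retr z))) has_derivative H) (at p)"
    and hess_sym: "\<And>v w. v \<in> tangent p \<Longrightarrow> w \<in> tangent p \<Longrightarrow> H v \<bullet> fst w = H w \<bullet> fst v"
    and p: "p \<in> S2S1"
begin

text \<open>The terms with \<open>fst z \<bullet> fst x\<close> and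
  \<open>snd z \<bullet> snd x\<close> come from differentiating the extension
  \<open>proj q z\<close>, whose normal part varies with the point; antisymmetrised in
  \<open>x\<close> and \<open>y\<close> they give the curvature of the round factors. The other
  terms carry the gradient \<open>G\<close> and the Hessian \<open>H\<close>.\<close>

private lemma second_derivative:
  assumes x: "x \<in> tangent p" and y: "y \<in> tangent p" and z: "z \<in> tangent p"
  shows "levi_civita (warped \<eta>) (\<lambda>q. proj q x) (levi_civita (warped \<eta>) (\<lambda>q. proj q y) (\<lambda>q. proj q z)) p =
    (- ((fst z \<bullet> fst x) *\<^sub>R fst y) - ((G (fst p) \<bullet> fst x) * (snd y \<bullet> snd z)) *\<^sub>R G (fst p)
       - (\<eta> (fst p) * (snd y \<bullet> snd z)) *\<^sub>R fst (proj p (H x, 0))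
       - ((G (fst p) \<bullet> fst y) * (snd x \<bullet> snd z) + (G (fst p) \<bullet> fst z) * (snd x \<bullet> snd y)) *\<^sub>R G (fst p),
     - ((snd z \<bullet> snd x) *\<^sub>R snd y)
       + (1 / \<eta> (fst p)) *\<^sub>R ((H x \<bullet> fst y) *\<^sub>R snd z + (H x \<bullet> fst z) *\<^sub>R snd y)
       - ((G (fst p) \<bullet> G (fst p)) * (snd y \<bullet> snd z)) *\<^sub>R snd x)"
proof -
  let ?e = "\<eta> (fst p)" and ?G = "G (fst p)"
  \<comment> \<open>The inner covariant derivative is needed at all points of the product, since it
    is differentiated once more at \<open>p\<close>.\<close>
  define E where "E q =
     (- ((fst z \<bullet> fst q) *\<^sub>R fst (proj q y)) - (\<eta> (fst q) * (snd (proj q y) \<bullet> snd (proj q z))) *\<^sub>R G (fst q),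
      - ((snd z \<bullet> snd q) *\<^sub>R snd (proj q y)) + (1 / \<eta> (fst q)) *\<^sub>R
         ((G (fst q) \<bullet> fst (proj q y)) *\<^sub>R snd (proj q z) + (G (fst q) \<bullet> fst (proj q z)) *\<^sub>R snd (proj q y)))" for q
  have E: "levi_civita (warped \<eta>) (\<lambda>q. proj q y) (\<lambda>q. proj q z) q = E q" if "q \<in> S2S1" for q
    unfolding E_def using levi_civita_proj_warped[OF that grad[OF that]] pos[OF S2S1_imp_fst[OF that]]
      tang[OF S2S1_imp_fst[OF that]] by simp
  have e: "?e > 0" using pos p S2S1_imp_fst by blast
  have G0: "?G \<bullet> fst p = 0" using tang p S2S1_imp_fst by blast
  have t: "fst y \<bullet> fst p = 0" "snd y \<bullet> snd p = 0" "fst z \<bullet> fst p = 0" "snd z \<bullet> snd p = 0"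
     "fst x \<bullet> fst p = 0" "snd x \<bullet> snd p = 0"
    "fst p \<bullet> fst y = 0" "snd p \<bullet> snd y = 0" "fst p \<bullet> fst z = 0" "snd p \<bullet> snd z = 0"
     "fst p \<bullet> fst x = 0" "snd p \<bullet> snd x = 0"
    using x y z by (auto simp: tangent_def inner_commute)
  have pi: "proj p x = x" "proj p y = y" "proj p z = z"
    using x y z by (auto simp: proj_ident)
  \<comment> \<open>For \<open>w\<close> tangent at \<open>p\<close> the derivative of
    \<open>proj q w\<close> at \<open>p\<close> is purely normal.\<close>
  define DP where "DP w v = (- ((fst w \<bullet> fst (proj p v)) *\<^sub>R fst p), - ((snd w \<bullet> snd (proj p v)) *\<^sub>R snd p))"
    for w v :: ambient
  have DY: "((\<lambda>z. proj (retr z) y) has_derivative DP y) (at p)"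
    and DZ: "((\<lambda>w. proj (retr w) z) has_derivative DP z) (at p)"
    using has_derivative_proj_field[OF p, of y] has_derivative_proj_field[OF p, of z]
    by (simp_all add: DP_def[abs_def] t)
  define DE where "DE v = (- ((fst z \<bullet> fst (proj p v)) *\<^sub>R fst y)
      - ((?G \<bullet> fst v) * (snd y \<bullet> snd z)) *\<^sub>R ?G - (?e * (snd (DP y v) \<bullet> snd z + snd y \<bullet> snd (DP z v))) *\<^sub>R ?G
      - (?e * (snd y \<bullet> snd z)) *\<^sub>R H v,
     - ((snd z \<bullet> snd (proj p v)) *\<^sub>R snd y)
     - ((?G \<bullet> fst v) / ?e\<^sup>2) *\<^sub>R ((?G \<bullet> fst y) *\<^sub>R snd z + (?G \<bullet> fst z) *\<^sub>R snd y)
     + (1 / ?e) *\<^sub>R ((H v \<bullet> fst y + ?G \<bullet> fst (DP y v)) *\<^sub>R snd z + (?G \<bullet> fst y) *\<^sub>R snd (DP z v)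
         + (H v \<bullet> fst z + ?G \<bullet> fst (DP z v)) *\<^sub>R snd y + (?G \<bullet> fst z) *\<^sub>R snd (DP y v)))" for v
  have e0: "?e \<noteq> 0" using e by simp
  have e0': "\<eta> (fst (retr p)) \<noteq> 0" using e p by (simp add: retr_ident)
  have c1: "((\<lambda>w. - ((fst z \<bullet> fst (retr w)) *\<^sub>R fst (proj (retr w) y))
       - (\<eta> (fst (retr w)) * (snd (proj (retr w) y) \<bullet> snd (proj (retr w) z))) *\<^sub>R G (fst (retr w)))
      has_derivative (\<lambda>v. fst (DE v))) (at p)"
    by (rule has_derivative_eq_rhs, (rule derivative_intros has_derivative_retr[OF p] DY DZ grad[OF p] hess)+, rule ext)
       (simp add: p retr_ident t pi DE_def algebra_simps)
  have c2: "((\<lambda>w. - ((snd z \<bullet> snd (retr w)) *\<^sub>R snd (proj (retr w) y)) + (1 / \<eta> (fst (retr w))) *\<^sub>R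
         ((G (fst (retr w)) \<bullet> fst (proj (retr w) y)) *\<^sub>R snd (proj (retr w) z)
          + (G (fst (retr w)) \<bullet> fst (proj (retr w) z)) *\<^sub>R snd (proj (retr w) y)))
      has_derivative (\<lambda>v. snd (DE v))) (at p)"
    by (rule has_derivative_eq_rhs, (rule derivative_intros has_derivative_retr[OF p] DY DZ grad[OF p] hess e0')+, rule ext)
       (simp add: p retr_ident t pi DE_def algebra_simps power2_eq_square inner_commute divide_simps)
  have DE: "((\<lambda>z. E (retr z)) has_derivative DE) (at p)"
    unfolding E_def using has_derivative_Pair[OF c1 c2] by simp
  have E': "((\<lambda>w. levi_civita (warped \<eta>) (\<lambda>q. proj q y) (\<lambda>q. proj q z) (retr w)) has_derivative DE) (at p)"
    by (rule has_derivative_eventually_eq[OF DE])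
       (use eventually_punctured[OF p] in \<open>auto elim!: eventually_mono simp: E retr_mem\<close>)
  have Et: "levi_civita (warped \<eta>) (\<lambda>q. proj q y) (\<lambda>q. proj q z) q \<in> tangent q" if q: "q \<in> S2S1" for q
    using E[OF q] proj_tangent[OF q, of y] proj_tangent[OF q, of z] tang[OF S2S1_imp_fst[OF q]]
    by (auto simp: E_def tangent_def inner_simps)
  have dp: "snd (DP w x) = - ((snd w \<bullet> snd x) *\<^sub>R snd p)" "fst (DP w x) = - ((fst w \<bullet> fst x) *\<^sub>R fst p)" for w
    by (simp_all add: DP_def pi)
  have d1: "fst (proj p (DE x)) = - ((fst z \<bullet> fst x) *\<^sub>R fst y) - ((?G \<bullet> fst x) * (snd y \<bullet> snd z)) *\<^sub>R ?G
     - (?e * (snd y \<bullet> snd z)) *\<^sub>R fst (proj p (H x, 0))"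
    by (simp add: DE_def dp pi t proj_def inner_simps G0 algebra_simps)
  have d2: "snd (proj p (DE x)) = - ((snd z \<bullet> snd x) *\<^sub>R snd y)
     - ((?G \<bullet> fst x) / ?e\<^sup>2) *\<^sub>R ((?G \<bullet> fst y) *\<^sub>R snd z + (?G \<bullet> fst z) *\<^sub>R snd y)
     + (1 / ?e) *\<^sub>R ((H x \<bullet> fst y) *\<^sub>R snd z + (H x \<bullet> fst z) *\<^sub>R snd y)"
    by (simp add: DE_def dp pi t proj_def inner_simps G0 p scaleR_right_diff_distrib scaleR_right_distrib
       scaleR_left_distrib scaleR_left_diff_distrib)
  have Ep: "E p = (- (?e * (snd y \<bullet> snd z)) *\<^sub>R ?G, (1 / ?e) *\<^sub>R ((?G \<bullet> fst y) *\<^sub>R snd z + (?G \<bullet> fst z) *\<^sub>R snd y))"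
    by (simp add: E_def t pi)
  have lc: "levi_civita (warped \<eta>) (\<lambda>q. proj q x) (levi_civita (warped \<eta>) (\<lambda>q. proj q y) (\<lambda>q. proj q z)) p =
     (fst (proj p (DE x)) - (?e * (snd x \<bullet> snd (E p))) *\<^sub>R ?G,
      snd (proj p (DE x)) + (1 / ?e) *\<^sub>R ((?G \<bullet> fst x) *\<^sub>R snd (E p) + (?G \<bullet> fst (E p)) *\<^sub>R snd x))"
    using levi_civita_warped[OF p proj_tangent Et has_derivative_proj_field[OF p] E' grad[OF p] e0 G0, of x]
    by (simp add: pi E[OF p])
  have Ep2: "?e * (snd x \<bullet> snd (E p)) = (?G \<bullet> fst y) * (snd x \<bullet> snd z) + (?G \<bullet> fst z) * (snd x \<bullet> snd y)"
    using e0 by (simp add: Ep inner_simps algebra_simps)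
  have Ep3: "?G \<bullet> fst (E p) = - ?e * (?G \<bullet> ?G) * (snd y \<bullet> snd z)"
    by (simp add: Ep)
  have Ep4: "snd (E p) = (1 / ?e) *\<^sub>R ((?G \<bullet> fst y) *\<^sub>R snd z + (?G \<bullet> fst z) *\<^sub>R snd y)"
    by (simp add: Ep)
  show ?thesis
    unfolding lc d1 d2 Ep2 Ep3 unfolding Ep4 using e0
    by (simp add: scaleR_right_distrib scaleR_right_diff_distrib power2_eq_square)
qed

text \<open>The bracket of the two extensions vanishes at \<open>p\<close> itself, and the
  connection depends on its first field only through the value at the point; differentiability of
  the bracket is what makes the formula applicable.\<close>

private lemma lie_bracket_term:
  assumes x: "x \<in> tangent p" and y: "y \<in> tangent p"
  shows "levi_civita (warped \<eta>) (lie_bracket (\<lambda>q. proj q x) (\<lambda>q. proj q y)) (\<lambda>q. proj q z) p = 0"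
proof -
  let ?L = "lie_bracket (\<lambda>q. proj q x) (\<lambda>q. proj q y)"
  define E where "E q = ((fst x \<bullet> fst q) *\<^sub>R fst (proj q y) - (fst y \<bullet> fst q) *\<^sub>R fst (proj q x),
      (snd x \<bullet> snd q) *\<^sub>R snd (proj q y) - (snd y \<bullet> snd q) *\<^sub>R snd (proj q x))" for q
  have L: "?L q = E q" if q: "q \<in> S2S1" for q
    unfolding lie_bracket_def dirderiv_eqI[OF has_derivative_proj_field[OF q]] E_def
    using q by (simp add: proj_def inner_simps algebra_simps inner_commute)
  have t: "fst x \<bullet> fst p = 0" "snd x \<bullet> snd p = 0" "fst y \<bullet> fst p = 0" "snd y \<bullet> snd p = 0"
    using x y by (auto simp: tangent_def)
  have Lp: "?L p = 0" unfolding L[OF p] E_def by (simp add: t zero_prod_def)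
  have Lt: "?L q \<in> tangent q" if q: "q \<in> S2S1" for q
    unfolding L[OF q] using proj_tangent[OF q, of x] proj_tangent[OF q, of y]
    by (auto simp: E_def tangent_def inner_simps)
  have "\<exists>D. ((\<lambda>z. E (retr z)) has_derivative D) (at p)"
    unfolding E_def
    by (rule exI, (rule derivative_intros has_derivative_retr[OF p] has_derivative_proj_field[OF p] has_derivative_Pair)+)
  then obtain D where D: "((\<lambda>z. E (retr z)) has_derivative D) (at p)" by blast
  have D': "((\<lambda>z. ?L (retr z)) has_derivative D) (at p)"
    by (rule has_derivative_eventually_eq[OF D])
       (use eventually_punctured[OF p] in \<open>auto elim!: eventually_mono simp: L retr_mem\<close>)
  have e: "\<eta> (fst p) \<noteq> 0" and G0: "G (fst p) \<bullet> fst p = 0"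
    using pos[of "fst p"] tang[of "fst p"] p S2S1_imp_fst by auto
  have DZ0: "fst (proj p (0, 0)) = 0" "snd (proj p (0, 0)) = 0" by (simp_all add: proj_def)
  have p0: "proj p 0 = 0" by (simp add: proj_def zero_prod_def)
  show ?thesis
    using levi_civita_warped[where X = ?L and Y = "\<lambda>q. proj q z", OF p Lt proj_tangent D'
        has_derivative_proj_field[OF p] grad[OF p] e G0]
    by (simp add: Lp p0 DZ0 zero_prod_def)
qed

private lemma hess_snd: "v \<in> tangent p \<Longrightarrow> fst v = 0 \<Longrightarrow> w \<in> tangent p \<Longrightarrow> H v \<bullet> fst w = 0"
  using hess_sym[of v w] by simp

text \<open>The trace is split along the factors. The sphere directions give
  \<open>2 - 1 = 1\<close> times the round metric and the Laplacian term. In the circle direction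
  all terms with \<open>G \<bullet> G\<close> and the would-be curvature of the circle cancel,
  because the circle is one-dimensional, and only the Hessian term survives.\<close>

lemma ricci_warped:
  assumes y: "y \<in> tangent p" and z: "z \<in> tangent p"
  shows "ricci (warped \<eta>) p y z = fst y \<bullet> fst z - (H y \<bullet> fst z) / \<eta> (fst p) - \<eta> (fst p) * (snd y \<bullet> snd z) * trace_fst p H"
proof -
  let ?e = "\<eta> (fst p)" and ?G = "G (fst p)"
  have riem: "riemann (warped \<eta>) p x y z =
      levi_civita (warped \<eta>) (\<lambda>q. proj q x) (levi_civita (warped \<eta>) (\<lambda>q. proj q y) (\<lambda>q. proj q z)) p
      - levi_civita (warped \<eta>) (\<lambda>q. proj q y) (levi_civita (warped \<eta>) (\<lambda>q. proj q x) (\<lambda>q. proj q z)) p"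
    if "x \<in> tangent p" for x
    unfolding riemann_def Let_def lie_bracket_term[OF that y] by simp
  have t: "fst y \<bullet> fst p = 0" "snd y \<bullet> snd p = 0" "fst z \<bullet> fst p = 0" "snd z \<bullet> snd p = 0"
    using y z by (auto simp: tangent_def)
  have tt: "snd (proj p (0, snd y)) = snd y" "snd (proj p (0, snd z)) = snd z"
    by (simp_all add: proj_def t)
  have A: "riemann (warped \<eta>) p (proj p (b, 0)) y z \<bullet> proj p (b, 0) =
      (fst z \<bullet> fst y) * (fst (proj p (b, 0)) \<bullet> fst (proj p (b, 0)))
      - (fst z \<bullet> fst (proj p (b, 0))) * (fst y \<bullet> fst (proj p (b, 0)))
      - ?e * (snd y \<bullet> snd z) * (H (proj p (b, 0)) \<bullet> fst (proj p (b, 0)))" for b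
  proof -
    have m: "proj p (b, 0) \<in> tangent p" by (rule proj_tangent[OF p])
    have s: "snd (proj p (b, 0)) = 0" by (simp add: proj_def)
    have f: "fst (proj p (w, 0)) \<bullet> fst (proj p (b, 0)) = w \<bullet> fst (proj p (b, 0))"
      "fst (proj p (b, 0)) \<bullet> fst (proj p (w, 0)) = w \<bullet> fst (proj p (b, 0))" for w
      using p by (simp_all add: proj_def inner_simps inner_commute)
    show ?thesis
      unfolding riem[OF m] second_derivative[OF m y z] second_derivative[OF y m z] inner_prod_def
      by (simp add: s f inner_diff_left inner_add_left inner_commute algebra_simps)
  qed
  have B: "riemann (warped \<eta>) p (proj p (0, c)) y z \<bullet> proj p (0, c) =
      (snd z \<bullet> snd y - (H y \<bullet> fst z) / ?e - (?G \<bullet> ?G) * (snd y \<bullet> snd z)) * (snd (proj p (0, c)) \<bullet> snd (proj p (0, c)))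
      + (?G \<bullet> ?G - 1) * ((snd z \<bullet> snd (proj p (0, c))) * (snd y \<bullet> snd (proj p (0, c))))" for c
  proof -
    have m: "proj p (0, c) \<in> tangent p" by (rule proj_tangent[OF p])
    have s: "fst (proj p (0, c)) = 0" by (simp add: proj_def)
    have h: "H (proj p (0, c)) \<bullet> fst y = 0" "H (proj p (0, c)) \<bullet> fst z = 0"
      "fst y \<bullet> H (proj p (0, c)) = 0" "fst z \<bullet> H (proj p (0, c)) = 0"
      using hess_snd[OF m s] y z by (auto simp: inner_commute)
    show ?thesis
      unfolding riem[OF m] second_derivative[OF m y z] second_derivative[OF y m z] inner_prod_def
      by (simp add: s h inner_diff_left inner_add_left inner_commute algebra_simps add_divide_distrib)
  qed
  have "ricci (warped \<eta>) p y z = (\<Sum>b\<in>Basis. riemann (warped \<eta>) p (proj p (b, 0)) y z \<bullet> proj p (b, 0))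
     + (\<Sum>c\<in>Basis. riemann (warped \<eta>) p (proj p (0, c)) y z \<bullet> proj p (0, c))"
    unfolding ricci_def by (rule sum_Basis_prod_split)
  also have "(\<Sum>b\<in>Basis. riemann (warped \<eta>) p (proj p (b, 0)) y z \<bullet> proj p (b, 0)) =
      2 * (fst z \<bullet> fst y) - fst z \<bullet> fst y - ?e * (snd y \<bullet> snd z) * trace_fst p H"
    unfolding A sum_subtractf sum_distrib_left[symmetric] sum_Basis_proj_fst trace_proj_fst[OF p] trace_fst_def
    by (simp add: proj_def t)
  also have "(\<Sum>c\<in>Basis. riemann (warped \<eta>) p (proj p (0, c)) y z \<bullet> proj p (0, c)) = - (H y \<bullet> fst z) / ?e"
    unfolding B sum.distrib sum_distrib_left[symmetric] sum_Basis_proj_snd trace_proj_snd[OF p]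
    using tt by (simp add: inner_commute algebra_simps)
  finally show ?thesis by (simp add: inner_commute)
qed

end

section \<open>Inverse metric and scalar curvature of a warped product\<close>

lemma inverse_metric_warped:
  assumes p: "p \<in> S2S1" and e: "\<eta> (fst p) \<noteq> 0"
  shows "inverse_metric (warped \<eta>) p v w =
     fst (proj p v) \<bullet> fst w + (1 / (\<eta> (fst p))\<^sup>2) * (snd (proj p v) \<bullet> snd w)"
proof -
  let ?e = "\<eta> (fst p)"
  let ?u = "(fst (proj p v), (1 / ?e\<^sup>2) *\<^sub>R snd (proj p v))"
  have u: "?u \<in> tangent p" using proj_tangent[OF p, of v] by (auto simp: tangent_def)
  have gu: "warped \<eta> p ?u z = v \<bullet> z" if "z \<in> tangent p" for z
  proof -
    have "warped \<eta> p ?u z = proj p v \<bullet> z" using e by (simp add: warped_def inner_prod_def)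
    then show ?thesis using that by (simp add: proj_adjoint proj_ident)
  qed
  have "(THE u. u \<in> tangent p \<and> (\<forall>z\<in>tangent p. warped \<eta> p u z = v \<bullet> z)) = ?u"
  proof (rule the_equality)
    show "?u \<in> tangent p \<and> (\<forall>z\<in>tangent p. warped \<eta> p ?u z = v \<bullet> z)" using u gu by simp
  next
    fix w assume w: "w \<in> tangent p \<and> (\<forall>z\<in>tangent p. warped \<eta> p w z = v \<bullet> z)"
    define d where "d = w - ?u"
    have d: "d \<in> tangent p" using w u by (auto simp: d_def tangent_def inner_simps)
    have "warped \<eta> p w d = warped \<eta> p ?u d" using w gu[OF d] d by auto
    then have "warped \<eta> p d d = 0"
      by (simp add: d_def warped_def inner_simps algebra_simps inner_commute)
    then have "fst d \<bullet> fst d + (\<eta> (fst p))\<^sup>2 * (snd d \<bullet> snd d) = 0"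
      by (simp add: warped_def)
    then have "fst d \<bullet> fst d = 0 \<and> (\<eta> (fst p))\<^sup>2 * (snd d \<bullet> snd d) = 0"
      by (subst (asm) add_nonneg_eq_0_iff) auto
    then have "d = 0" using e by (auto simp: prod_eq_iff)
    then show "w = ?u" by (simp add: d_def)
  qed
  then show ?thesis by (simp add: inverse_metric_def inner_prod_def)
qed

text \<open>The sphere directions contribute \<open>2 - trace_fst p H / \<eta> (fst p)\<close>, the
  circle direction a further \<open>- trace_fst p H / \<eta> (fst p)\<close>.\<close>

lemma scal_warped:
  assumes pos: "\<And>y. y \<in> S2 \<Longrightarrow> \<eta> y > 0"
    and grad: "\<And>q. q \<in> S2S1 \<Longrightarrow> ((\<lambda>z. \<eta> (fst (retr z))) has_derivative (\<lambda>v. G (fst q) \<bullet> fst v)) (at q)"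
    and tang: "\<And>y. y \<in> S2 \<Longrightarrow> G y \<bullet> y = 0"
    and hess: "((\<lambda>z. G (fst (retr z))) has_derivative H) (at p)"
    and hess_sym: "\<And>v w. v \<in> tangent p \<Longrightarrow> w \<in> tangent p \<Longrightarrow> H v \<bullet> fst w = H w \<bullet> fst v"
    and p: "p \<in> S2S1"
  shows "scal (warped \<eta>) p = 2 - 2 * trace_fst p H / \<eta> (fst p)"
proof -
  have ric: "ricci (warped \<eta>) p y z = fst y \<bullet> fst z - (H y \<bullet> fst z) / \<eta> (fst p) - \<eta> (fst p) * (snd y \<bullet> snd z) * trace_fst p H"
    if "y \<in> tangent p" "z \<in> tangent p" for y z
    by (rule ricci_warped[where G = G]) (use assms that in auto)
  let ?e = "\<eta> (fst p)"
  have e: "?e > 0" using pos p S2S1_imp_fst by blast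
  have ff: "fst (proj p (fst (proj p (b, 0)), 0)) = fst (proj p (b, 0))" for b
    using p by (simp add: proj_def inner_simps)
  have ss: "snd (proj p (0, snd (proj p (0, b)))) = snd (proj p (0, b))" for b
    using p by (simp add: proj_def inner_simps)
  have fh: "fst (proj p (b, 0)) \<bullet> fst (proj p (w, 0)) = w \<bullet> fst (proj p (b, 0))" for b w
    using p by (simp add: proj_def inner_simps inner_commute)
  have z: "snd (proj p (b, 0)) = 0" "fst (proj p (0, c)) = 0" for b c by (simp_all add: proj_def)
  have inv: "inverse_metric (warped \<eta>) p v w = fst (proj p v) \<bullet> fst w + (1 / ?e\<^sup>2) * (snd (proj p v) \<bullet> snd w)" for v w
    using inverse_metric_warped[of p \<eta>] p e by simp
  have 1: "(\<Sum>j\<in>Basis. comp2 (inverse_metric (warped \<eta>)) p (b, 0) j * comp2 (ricci (warped \<eta>)) p (b, 0) j)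
      = fst (proj p (b, 0)) \<bullet> fst (proj p (b, 0)) - (H (proj p (b, 0)) \<bullet> fst (proj p (b, 0))) / ?e" for b
  proof -
    have "(\<Sum>j\<in>Basis. comp2 (inverse_metric (warped \<eta>)) p (b, 0) j * comp2 (ricci (warped \<eta>)) p (b, 0) j)
      = (\<Sum>c\<in>Basis. (fst (proj p (b, 0)) \<bullet> fst (proj p (c, 0))) * ((fst (proj p (b, 0)) - (1 / ?e) *\<^sub>R H (proj p (b, 0))) \<bullet> fst (proj p (c, 0))))"
      unfolding sum_Basis_prod_split comp2_def inv ric[OF proj_tangent[OF p] proj_tangent[OF p]]
      by (simp add: z p inner_diff_left)
    also have "\<dots> = fst (proj p (fst (proj p (b, 0)), 0)) \<bullet> fst (proj p (fst (proj p (b, 0)) - (1 / ?e) *\<^sub>R H (proj p (b, 0)), 0))"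
      by (rule sum_Basis_proj_fst)
    also have "\<dots> = fst (proj p (b, 0)) \<bullet> fst (proj p (b, 0)) - (H (proj p (b, 0)) \<bullet> fst (proj p (b, 0))) / ?e"
      unfolding ff fh by (simp add: inner_diff_left fh)
    finally show ?thesis .
  qed
  have 2: "(\<Sum>j\<in>Basis. comp2 (inverse_metric (warped \<eta>)) p (0, b) j * comp2 (ricci (warped \<eta>)) p (0, b) j)
      = - (trace_fst p H / ?e) * (snd (proj p (0, b)) \<bullet> snd (proj p (0, b)))" for b
  proof -
    have "(\<Sum>j\<in>Basis. comp2 (inverse_metric (warped \<eta>)) p (0, b) j * comp2 (ricci (warped \<eta>)) p (0, b) j)
      = (\<Sum>c\<in>Basis. - (trace_fst p H / ?e) * ((snd (proj p (0, b)) \<bullet> snd (proj p (0, c))) * (snd (proj p (0, b)) \<bullet> snd (proj p (0, c)))))"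
      unfolding sum_Basis_prod_split comp2_def inv ric[OF proj_tangent[OF p] proj_tangent[OF p]]
      using e by (simp add: z p power2_eq_square field_simps)
    also have "\<dots> = - (trace_fst p H / ?e) * (snd (proj p (0, snd (proj p (0, b)))) \<bullet> snd (proj p (0, snd (proj p (0, b)))))"
      unfolding sum_distrib_left[symmetric] sum_Basis_proj_snd ..
    finally show ?thesis unfolding ss .
  qed
  show ?thesis
    unfolding scal_def sum_Basis_prod_split[of "\<lambda>i. sum (F i) Basis" for F] 1 2 sum_subtractf sum_distrib_left[symmetric]
      sum_divide_distrib[symmetric] trace_proj_fst[OF p] trace_proj_snd[OF p]
      trace_fst_def[symmetric]
    by simp
qed

section \<open>The distance of the round sphere\<close>

text \<open>At a break point \<open>vector_derivative\<close> may be an unspecified vector. The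
  speed is therefore represented by a Borel function: the continuous derivative off a finite set,
  cut off to zero elsewhere.\<close>

lemma borel_measurable_speed:
  fixes \<gamma> :: "real \<Rightarrow> 'a::euclidean_space"
  assumes "valid_path \<gamma>"
  obtains D S where "finite S" "\<And>t. t \<in> {0..1} - S \<Longrightarrow> (\<gamma> has_vector_derivative D t) (at t)"
    "D \<in> borel_measurable lborel" "\<And>t. t \<in> {0..1} - S \<Longrightarrow> vector_derivative \<gamma> (at t) = D t"
proof -
  obtain S where S: "finite S" "\<gamma> C1_differentiable_on ({0..1} - S)"
    using assms by (auto simp: valid_path_def piecewise_C1_differentiable_on_def)
  then obtain D where D: "\<And>t. t \<in> {0..1} - S \<Longrightarrow> (\<gamma> has_vector_derivative D t) (at t)"
      "continuous_on ({0..1} - S) D"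
    unfolding C1_differentiable_on_def by blast
  have meas: "{0..1} - S \<in> sets borel" using S(1) by (auto intro: sets.Diff simp: finite_imp_closed)
  have "(\<lambda>t. indicat_real ({0..1} - S) t *\<^sub>R D t) \<in> borel_measurable borel"
    by (rule borel_measurable_continuous_on_indicator[OF meas D(2)])
  then have "(\<lambda>t. indicat_real ({0..1} - S) t *\<^sub>R D t) \<in> borel_measurable lborel" by simp
  moreover have "t \<in> {0..1} - S \<Longrightarrow> (\<gamma> has_vector_derivative indicat_real ({0..1} - S) t *\<^sub>R D t) (at t)" for t
    using D(1)[of t] by simp
  ultimately show ?thesis
    using that[of S "\<lambda>t. indicat_real ({0..1} - S) t *\<^sub>R D t"] S(1)
    by (meson vector_derivative_at)
qed

text \<open>Composing with \<open>\<lambda>c. arccos (l * c)\<close> for \<open>l < 1\<close> avoids the points where \<open>arccos\<close> is not differentiable.\<close>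

lemma arccos_le_curve_length_aux:
  fixes \<gamma> :: "real \<Rightarrow> real^3"
  assumes \<gamma>: "valid_path \<gamma>" and im: "path_image \<gamma> \<subseteq> S2" and l: "0 < l" "l < 1"
  shows "ennreal (arccos (l * (pathfinish \<gamma> \<bullet> pathstart \<gamma>)) - arccos l) \<le> curve_length (\<lambda>_ v w. v \<bullet> w) \<gamma>"
proof -
  obtain D S where S: "finite S" and D: "\<And>t. t \<in> {0..1} - S \<Longrightarrow> (\<gamma> has_vector_derivative D t) (at t)"
    and meas: "D \<in> borel_measurable lborel" and vd: "\<And>t. t \<in> {0..1} - S \<Longrightarrow> vector_derivative \<gamma> (at t) = D t"
    by (rule borel_measurable_speed[OF \<gamma>]) blast
  define x where "x = pathstart \<gamma>"
  have im': "t \<in> {0..1} \<Longrightarrow> norm (\<gamma> t) = 1" for t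
    using im by (auto simp: path_image_def S2_def image_subset_iff)
  have x: "norm x = 1" using im'[of 0] by (simp add: x_def pathstart_def)
  have c_le: "\<bar>\<gamma> t \<bullet> x\<bar> \<le> 1" if "t \<in> {0..1}" for t
    using Cauchy_Schwarz_ineq2[of "\<gamma> t" x] im'[OF that] x by simp
  have lc: "\<bar>l * (\<gamma> t \<bullet> x)\<bar> < 1" if "t \<in> {0..1}" for t
  proof -
    have "\<bar>l * (\<gamma> t \<bullet> x)\<bar> = l * \<bar>\<gamma> t \<bullet> x\<bar>" using l by (simp add: abs_mult)
    also have "\<dots> \<le> l * 1" using c_le[OF that] l by (intro mult_left_mono) auto
    finally show ?thesis using l by simp
  qed
  define h where "h t = arccos (l * (\<gamma> t \<bullet> x))" for t
  define h' where "h' t = - l * (D t \<bullet> x) / sqrt (1 - (l * (\<gamma> t \<bullet> x))\<^sup>2)" for t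
  have dh: "(h has_real_derivative h' t) (at t)" if t: "t \<in> {0..1} - S" for t
  proof -
    have 1: "((\<lambda>t. l * (\<gamma> t \<bullet> x)) has_real_derivative l * (D t \<bullet> x)) (at t)"
      using D[OF t] unfolding has_vector_derivative_def has_field_derivative_def
      by (auto intro!: derivative_eq_intros simp: algebra_simps)
    show ?thesis unfolding h_def h'_def
      by (rule DERIV_chain2[OF DERIV_arccos 1, THEN DERIV_cong]) (use lc[of t] t in \<open>auto simp: field_simps abs_less_iff\<close>)
  qed
  have ch: "continuous_on {0..1} h"
    unfolding h_def using lc \<gamma>
    by (intro continuous_intros continuous_on_arccos)
       (auto simp: abs_less_iff less_imp_le intro!: valid_path_imp_path[unfolded path_def])
  have ft: "(h' has_integral (h 1 - h 0)) {0..1}"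
    by (rule fundamental_theorem_of_calculus_interior_strong[OF S _ _ ch])
       (use dh in \<open>auto simp: has_real_derivative_iff_has_vector_derivative[symmetric]\<close>)
  \<comment> \<open>On the sphere the velocity is orthogonal to \<open>\<gamma> t\<close>, so
    \<open>D t \<bullet> x\<close> sees only the component of \<open>x\<close> tangent at
    \<open>\<gamma> t\<close>, of length \<open>sqrt (1 - ?c\<^sup>2)\<close>. As
    \<open>l < 1\<close>, \<open>l\<close> times this length is at most the denominator of
    \<open>h'\<close>.\<close>
  have bd: "\<bar>h' t\<bar> \<le> norm (D t)" if t: "t \<in> {0..1} - S" "t \<in> {0<..<1}" for t
  proof -
    let ?c = "\<gamma> t \<bullet> x"
    have Dt0: "D t \<bullet> \<gamma> t = 0"
    proof -
      have g: "((\<lambda>s. \<gamma> s \<bullet> \<gamma> s) has_real_derivative (2 * (D t \<bullet> \<gamma> t))) (at t)"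
        using D[OF t(1)] unfolding has_vector_derivative_def has_field_derivative_def
        by (auto intro!: derivative_eq_intros simp: algebra_simps inner_commute)
      have "((\<lambda>s. 1) has_real_derivative (2 * (D t \<bullet> \<gamma> t))) (at t)"
      proof (rule has_field_derivative_transform_within_open[OF g, of "{0<..<1}"])
        show "\<gamma> s \<bullet> \<gamma> s = 1" if "s \<in> {0<..<1}" for s
          using im'[of s] that by (simp add: norm_eq_1)
      qed (use t in auto)
      then have "2 * (D t \<bullet> \<gamma> t) = 0" by (rule DERIV_unique) (rule DERIV_const)
      then show ?thesis by simp
    qed
    have tt: "norm (\<gamma> t) = 1" "\<bar>?c\<bar> \<le> 1" "\<bar>l * ?c\<bar> < 1" using im'[of t] c_le[of t] lc[of t] t by auto
    have "D t \<bullet> x = D t \<bullet> (x - ?c *\<^sub>R \<gamma> t)" using Dt0 by (simp add: inner_simps)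
    then have 1: "\<bar>D t \<bullet> x\<bar> \<le> norm (D t) * norm (x - ?c *\<^sub>R \<gamma> t)" using Cauchy_Schwarz_ineq2 by metis
    have "(norm (x - ?c *\<^sub>R \<gamma> t))\<^sup>2 = 1 - ?c\<^sup>2"
      unfolding power2_norm_eq_inner
      using tt x by (simp add: norm_eq_1 inner_simps inner_commute power2_eq_square)
    then have n: "norm (x - ?c *\<^sub>R \<gamma> t) = sqrt (1 - ?c\<^sup>2)" by (metis norm_ge_zero real_sqrt_unique)
    have l2: "l * l \<le> 1" using l mult_le_one[of l l] by auto
    have pos: "0 < 1 - (l * ?c)\<^sup>2" using tt(3) abs_square_less_1[of "l * ?c"] by simp
    have "l * sqrt (1 - ?c\<^sup>2) = sqrt (l\<^sup>2 * (1 - ?c\<^sup>2))" using l by (simp add: real_sqrt_mult)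
    also have "\<dots> \<le> sqrt (1 - (l * ?c)\<^sup>2)" using l2 by (simp add: algebra_simps power2_eq_square)
    finally have 2: "l * sqrt (1 - ?c\<^sup>2) \<le> sqrt (1 - (l * ?c)\<^sup>2)" .
    have "\<bar>h' t\<bar> = l * \<bar>D t \<bullet> x\<bar> / sqrt (1 - (l * ?c)\<^sup>2)" using l pos by (simp add: h'_def abs_mult)
    also have "\<dots> \<le> l * (norm (D t) * sqrt (1 - ?c\<^sup>2)) / sqrt (1 - (l * ?c)\<^sup>2)"
      using 1 n l pos by (intro divide_right_mono mult_left_mono) auto
    also have "\<dots> = norm (D t) * (l * sqrt (1 - ?c\<^sup>2)) / sqrt (1 - (l * ?c)\<^sup>2)" by simp
    also have "\<dots> \<le> norm (D t) * sqrt (1 - (l * ?c)\<^sup>2) / sqrt (1 - (l * ?c)\<^sup>2)"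
      using 2 pos by (intro divide_right_mono mult_left_mono) auto
    also have "\<dots> = norm (D t)" using pos by simp
    finally show ?thesis .
  qed
  have fin: "finite (S \<union> {0,1})" using S by simp
  have neg: "negligible (S \<union> {0,1})" by (rule negligible_finite[OF fin])
  have AES: "AE t in lborel. t \<notin> S \<union> {0,1}"
    using fin by (intro AE_not_in finite_imp_null_set_lborel)
  have cl: "curve_length (\<lambda>_ v w. v \<bullet> w) \<gamma> = (\<integral>\<^sup>+t\<in>{0..1}. ennreal (norm (D t)) \<partial>lborel)"
    unfolding curve_length_def norm_eq_sqrt_inner[symmetric]
    by (rule nn_integral_cong_AE, rule AE_mp[OF AES]) (auto simp: indicator_def vd)
  show ?thesis
  proof (cases "curve_length (\<lambda>_ v w. v \<bullet> w) \<gamma> = \<infinity>")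
    case False
    let ?F = "\<lambda>t. indicator {0..1} t *\<^sub>R norm (D t)"
    have F: "(\<integral>\<^sup>+t. ennreal (?F t) \<partial>lborel) = curve_length (\<lambda>_ v w. v \<bullet> w) \<gamma>"
      unfolding cl by (intro nn_integral_cong) (auto simp: indicator_def)
    have int: "integrable lborel ?F"
      by (rule integrableI_bounded) (use meas False F in \<open>auto simp: less_top\<close>)
    then have "(?F has_integral integral\<^sup>L lborel ?F) UNIV" by (rule has_integral_integral_lborel)
    then have F1: "((\<lambda>t. norm (D t)) has_integral integral\<^sup>L lborel ?F) {0..1}"
    proof (subst has_integral_restrict_UNIV[symmetric])
      have "(\<lambda>t. if t \<in> {0..1} then norm (D t) else 0) = ?F" by (auto simp: fun_eq_iff)
      then show "(?F has_integral integral\<^sup>L lborel ?F) UNIV \<Longrightarrow>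
          ((\<lambda>t. if t \<in> {0..1} then norm (D t) else 0) has_integral integral\<^sup>L lborel ?F) UNIV" by simp
    qed
    \<comment> \<open>At the exceptional points the majorant is \<bar>h' t\<bar> itself, so that the
      comparison holds everywhere and not only almost everywhere.\<close>
    have F2: "((\<lambda>t. if t \<in> S \<union> {0,1} then \<bar>h' t\<bar> else norm (D t)) has_integral integral\<^sup>L lborel ?F) {0..1}"
      by (rule has_integral_spike[OF neg _ F1]) auto
    have "h 1 - h 0 \<le> integral\<^sup>L lborel ?F"
      by (rule has_integral_le[OF ft F2]) (use bd in \<open>force simp: abs_le_iff\<close>)
    moreover have "ennreal (integral\<^sup>L lborel ?F) = curve_length (\<lambda>_ v w. v \<bullet> w) \<gamma>"
      unfolding F[symmetric] by (rule nn_integral_eq_integral[symmetric, OF int]) auto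
    moreover have "h 1 - h 0 = arccos (l * (pathfinish \<gamma> \<bullet> pathstart \<gamma>)) - arccos l"
      using x by (simp add: h_def x_def[symmetric] pathfinish_def norm_eq_1)
         (simp add: x_def pathstart_def[symmetric] norm_eq_1)
    ultimately show ?thesis by (metis ennreal_leI)
  qed simp
qed

text \<open>Let \<open>l\<close> tend to 1 from the left in the preceding bound:
  \<open>arccos\<close> is continuous on the closed interval and
  \<open>arccos 1 = 0\<close>.\<close>

lemma arccos_le_curve_length:
  fixes \<gamma> :: "real \<Rightarrow> real^3"
  assumes \<gamma>: "valid_path \<gamma>" and im: "path_image \<gamma> \<subseteq> S2"
  shows "ennreal (arccos (pathfinish \<gamma> \<bullet> pathstart \<gamma>)) \<le> curve_length (\<lambda>_ v w. v \<bullet> w) \<gamma>"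
proof -
  let ?c = "pathfinish \<gamma> \<bullet> pathstart \<gamma>"
  have "pathfinish \<gamma> \<in> S2" "pathstart \<gamma> \<in> S2" using im by auto
  then have c: "\<bar>?c\<bar> \<le> 1" using Cauchy_Schwarz_ineq2[of "pathfinish \<gamma>" "pathstart \<gamma>"] by (simp add: S2_def)
  have cont: "continuous_on {0..1} (\<lambda>l. arccos (l * ?c) - arccos l)"
  proof (intro continuous_intros continuous_on_arccos ballI conjI)
    fix l :: real assume l: "l \<in> {0..1}"
    have "\<bar>l * ?c\<bar> \<le> 1" using l c mult_le_one[of "\<bar>l\<bar>" "\<bar>?c\<bar>"] by (simp add: abs_mult)
    then show "- 1 \<le> l * ?c" "l * ?c \<le> 1" by auto
  qed auto
  have "((\<lambda>l. arccos (l * ?c) - arccos l) \<longlongrightarrow> arccos (1 * ?c) - arccos 1) (at 1 within {0..1})"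
    using bspec[OF cont[unfolded continuous_on_def], of 1] by simp
  then have "((\<lambda>l. arccos (l * ?c) - arccos l) \<longlongrightarrow> arccos ?c) (at_left 1)"
    by (simp add: at_within_Icc_at_left)
  then have lim: "((\<lambda>l. ennreal (arccos (l * ?c) - arccos l)) \<longlongrightarrow> ennreal (arccos ?c)) (at_left 1)"
    by (rule tendsto_ennrealI)
  have ev: "eventually (\<lambda>l::real. 0 < l \<and> l < 1) (at_left 1)"
    using eventually_at_left[of 0 "1::real"] by (auto intro!: exI[of _ 0])
  show ?thesis
    by (rule tendsto_le[OF _ tendsto_const lim])
       (auto intro: eventually_mono[OF ev] arccos_le_curve_length_aux[OF assms])
qed

lemma ex_great_circle:
  fixes x y :: "real^3"
  assumes x: "norm x = 1" and y: "norm y = 1"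
  obtains w where "norm w = 1" "w \<bullet> x = 0" "y = cos (arccos (x \<bullet> y)) *\<^sub>R x + sin (arccos (x \<bullet> y)) *\<^sub>R w"
proof -
  let ?c = "x \<bullet> y"
  have c: "\<bar>?c\<bar> \<le> 1" using Cauchy_Schwarz_ineq2[of x y] assms by simp
  have cs: "cos (arccos ?c) = ?c" "sin (arccos ?c) = sqrt (1 - ?c\<^sup>2)"
    using c by (auto simp: abs_le_iff sin_arccos)
  define v where "v = y - ?c *\<^sub>R x"
  have vx: "v \<bullet> x = 0" using x by (simp add: v_def inner_simps norm_eq_1 inner_commute)
  have "v \<bullet> v = 1 - ?c\<^sup>2"
    using x y by (simp add: v_def inner_simps norm_eq_1 inner_commute power2_eq_square)
  then have nv: "norm v = sqrt (1 - ?c\<^sup>2)" by (simp add: norm_eq_sqrt_inner)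
  show ?thesis
  proof (cases "v = 0")
    \<comment> \<open>Equal or antipodal points: the sine vanishes, and any unit vector orthogonal
      to \<open>x\<close> will do.\<close>
    case True
    obtain w where w: "w \<noteq> 0" "orthogonal x w"
      using orthogonal_to_vector_exists[of x] by (auto simp: orthogonal_commute)
    have "norm (sgn w) = 1" "sgn w \<bullet> x = 0" using w by (auto simp: norm_sgn sgn_div_norm orthogonal_def inner_commute)
    then show ?thesis using that[of "sgn w"] True nv cs by (simp add: v_def)
  next
    case False
    have "norm v *\<^sub>R sgn v = v" using False by (simp add: sgn_div_norm)
    then have "y = ?c *\<^sub>R x + norm v *\<^sub>R sgn v" by (simp add: v_def)
    moreover have "norm (sgn v) = 1" "sgn v \<bullet> x = 0" using False vx by (auto simp: norm_sgn sgn_div_norm)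
    ultimately show ?thesis using that[of "sgn v"] cs nv by metis
  qed
qed

lemma great_circle_path:
  fixes x w :: "real^3" and \<alpha> :: real
  assumes x: "norm x = 1" and w: "norm w = 1" "w \<bullet> x = 0"
  defines "\<gamma> \<equiv> \<lambda>t. cos (t * \<alpha>) *\<^sub>R x + sin (t * \<alpha>) *\<^sub>R w"
  shows "valid_path \<gamma>" "path_image \<gamma> \<subseteq> S2"
    "(\<gamma> has_vector_derivative (- \<alpha> * sin (t * \<alpha>)) *\<^sub>R x + (\<alpha> * cos (t * \<alpha>)) *\<^sub>R w) (at t)"
    "norm ((- \<alpha> * sin (t * \<alpha>)) *\<^sub>R x + (\<alpha> * cos (t * \<alpha>)) *\<^sub>R w) = \<bar>\<alpha>\<bar>"
proof -
  have d: "(\<gamma> has_vector_derivative (- \<alpha> * sin (t * \<alpha>)) *\<^sub>R x + (\<alpha> * cos (t * \<alpha>)) *\<^sub>R w) (at t)" for t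
    unfolding \<gamma>_def has_vector_derivative_def
    by (auto intro!: derivative_eq_intros simp: algebra_simps)
  show "(\<gamma> has_vector_derivative (- \<alpha> * sin (t * \<alpha>)) *\<^sub>R x + (\<alpha> * cos (t * \<alpha>)) *\<^sub>R w) (at t)" by (rule d)
  have "\<gamma> C1_differentiable_on {0..1}"
    unfolding C1_differentiable_on_def
    by (rule exI[of _ "\<lambda>t. (- \<alpha> * sin (t * \<alpha>)) *\<^sub>R x + (\<alpha> * cos (t * \<alpha>)) *\<^sub>R w"])
       (intro conjI ballI d continuous_intros)
  then show "valid_path \<gamma>" by (simp add: valid_path_def C1_differentiable_imp_piecewise)
  have n: "norm (a *\<^sub>R x + b *\<^sub>R w) = sqrt (a\<^sup>2 + b\<^sup>2)" for a b
    using x w by (simp add: norm_eq_sqrt_inner inner_simps inner_commute power2_eq_square)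
  show "path_image \<gamma> \<subseteq> S2"
    by (auto simp: path_image_def S2_def \<gamma>_def n add.commute)
  have "(- \<alpha> * sin (t * \<alpha>))\<^sup>2 + (\<alpha> * cos (t * \<alpha>))\<^sup>2 = \<alpha>\<^sup>2"
    by (simp add: power_mult_distrib distrib_left[symmetric])
  then show "norm ((- \<alpha> * sin (t * \<alpha>)) *\<^sub>R x + (\<alpha> * cos (t * \<alpha>)) *\<^sub>R w) = \<bar>\<alpha>\<bar>"
    unfolding n by simp
qed

text \<open>A great circle arc attains the lower bound
  \<open>arccos_le_curve_length\<close>.\<close>

lemma dist_S2_eq_arccos:
  assumes "x \<in> S2" "y \<in> S2" shows "dist_S2 x y = arccos (x \<bullet> y)"
proof -
  have x: "norm x = 1" and y: "norm y = 1" using assms by (auto simp: S2_def)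
  have c: "\<bar>x \<bullet> y\<bar> \<le> 1" using Cauchy_Schwarz_ineq2[of x y] x y by simp
  let ?a = "arccos (x \<bullet> y)"
  have a: "0 \<le> ?a" using c by (auto intro: arccos_lbound)
  obtain w where w: "norm w = 1" "w \<bullet> x = 0" "y = cos ?a *\<^sub>R x + sin ?a *\<^sub>R w"
    using ex_great_circle[OF x y] .
  let ?\<gamma> = "\<lambda>t. cos (t * ?a) *\<^sub>R x + sin (t * ?a) *\<^sub>R w"
  note gc = great_circle_path[OF x w(1,2), of ?a]
  have "curve_length (\<lambda>_ v w. v \<bullet> w) ?\<gamma> = (\<integral>\<^sup>+t::real\<in>{0..1}. ennreal ?a \<partial>lborel)"
    unfolding curve_length_def vector_derivative_at[OF gc(3)] norm_eq_sqrt_inner[symmetric] gc(4)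
    using a by simp
  also have "\<dots> = ennreal ?a" by (simp add: nn_integral_cmult_indicator)
  finally have len: "curve_length (\<lambda>_ v w. v \<bullet> w) ?\<gamma> = ennreal ?a" .
  have ends: "pathstart ?\<gamma> = x" "pathfinish ?\<gamma> = y" using w(3) by (auto simp: pathstart_def pathfinish_def)
  have "riem_dist S2 (\<lambda>_ v w. v \<bullet> w) x y = ennreal ?a"
    unfolding riem_dist_def
  proof (rule antisym)
    show "(INF \<gamma>\<in>{\<gamma>. valid_path \<gamma> \<and> path_image \<gamma> \<subseteq> S2 \<and> pathstart \<gamma> = x \<and> pathfinish \<gamma> = y}.
        curve_length (\<lambda>_ v w. v \<bullet> w) \<gamma>) \<le> ennreal ?a"
      using gc(1,2) ends len by (intro INF_lower2[of ?\<gamma>]) auto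
  qed (auto intro!: INF_greatest simp: inner_commute dest: arccos_le_curve_length)
  then show ?thesis using a by (simp add: dist_S2_def)
qed

lemma f_ab_dist_S2:
  assumes "x \<in> S2" "y \<in> S2"
  shows "f_ab a b (dist_S2 y x) = ln ((1 + a) / (1 - (x \<bullet> y)\<^sup>2 + a)) + b"
proof -
  have "\<bar>y \<bullet> x\<bar> \<le> 1" using Cauchy_Schwarz_ineq2[of y x] assms by (auto simp: S2_def)
  moreover then have "(y \<bullet> x)\<^sup>2 \<le> 1" by (simp add: abs_square_le_1)
  ultimately show ?thesis
    by (simp add: f_ab_def dist_S2_eq_arccos assms sin_arccos abs_le_iff inner_commute)
qed

section \<open>The volume of warped products\<close>

lemma vector_3_eq_axis: "(vector [a, b, c] :: real^3) = a *\<^sub>R axis 1 1 + b *\<^sub>R axis 2 1 + c *\<^sub>R axis 3 1"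
  by (simp add: vec_eq_iff forall_3 axis_def)

lemma inner_3: "(u :: real^3) \<bullet> v = u$1 * v$1 + u$2 * v$2 + u$3 * v$3"
  by (simp add: inner_vec_def sum_3)

lemma cis_eq_scaleR: "cis t = cos t *\<^sub>R 1 + sin t *\<^sub>R \<i>"
  by (simp add: complex_eq_iff)

text \<open>The coordinate vector fields of \<open>chart\<close>; the quarter turn in the third
  comes from differentiating \<open>cis (u$3)\<close>.\<close>

definition chart_frame :: "3 \<Rightarrow> real^3 \<Rightarrow> ambient" where
  "chart_frame i u = (if i = 1 then (vector [cos (u$1) * cos (u$2), cos (u$1) * sin (u$2), - sin (u$1)], 0)
     else if i = 2 then (vector [- sin (u$1) * sin (u$2), sin (u$1) * cos (u$2), 0], 0)
     else (0, cis (u$3 + pi/2)))"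

lemma chart_frame_simps [simp]:
  "chart_frame 1 u = (vector [cos (u$1) * cos (u$2), cos (u$1) * sin (u$2), - sin (u$1)], 0)"
  "chart_frame 2 u = (vector [- sin (u$1) * sin (u$2), sin (u$1) * cos (u$2), 0], 0)"
  "chart_frame 3 u = (0, - sin (u$3) *\<^sub>R 1 + cos (u$3) *\<^sub>R \<i>)"
  by (simp_all add: chart_frame_def complex_eq_iff cos_add sin_add)

lemma has_derivative_vec_nth [derivative_intros]:
  "(f has_derivative f') F \<Longrightarrow> ((\<lambda>x. f x $ i) has_derivative (\<lambda>h. f' h $ i)) F"
  by (rule bounded_linear.has_derivative[OF bounded_linear_vec_nth])

lemma has_derivative_chart:
  "(chart has_derivative (\<lambda>v. v$1 *\<^sub>R chart_frame 1 u + v$2 *\<^sub>R chart_frame 2 u + v$3 *\<^sub>R chart_frame 3 u)) (at u)"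
proof -
  have 1: "((\<lambda>u::real^3. vector [sin (u$1) * cos (u$2), sin (u$1) * sin (u$2), cos (u$1)] :: real^3) has_derivative
     (\<lambda>v. v$1 *\<^sub>R fst (chart_frame 1 u) + v$2 *\<^sub>R fst (chart_frame 2 u))) (at u)"
    unfolding vector_3_eq_axis chart_frame_simps
    by (rule has_derivative_eq_rhs, (rule derivative_intros)+, rule ext) (simp add: algebra_simps)
  have 2: "((\<lambda>u::real^3. cis (u$3)) has_derivative (\<lambda>v. v$3 *\<^sub>R snd (chart_frame 3 u))) (at u)"
    unfolding cis_eq_scaleR chart_frame_simps
    by (rule has_derivative_eq_rhs, (rule derivative_intros)+, rule ext) (simp add: algebra_simps)
  show ?thesis
    unfolding chart_def[abs_def] using has_derivative_Pair[OF 1 2]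
    by (rule has_derivative_eq_rhs) (auto simp: fun_eq_iff)
qed

lemma frechet_derivative_chart:
  "frechet_derivative chart (at u) (axis i 1) = chart_frame i u"
proof -
  have "frechet_derivative chart (at u) = (\<lambda>v. v$1 *\<^sub>R chart_frame 1 u + v$2 *\<^sub>R chart_frame 2 u + v$3 *\<^sub>R chart_frame 3 u)"
    using frechet_derivative_at[OF has_derivative_chart] by metis
  then show ?thesis
    using exhaust_3[of i] by (auto simp: axis_def)
qed

lemma chart_mem: "chart u \<in> S2S1"
proof -
  have "fst (chart u) \<bullet> fst (chart u) = (sin (u$1))\<^sup>2 * ((cos (u$2))\<^sup>2 + (sin (u$2))\<^sup>2) + (cos (u$1))\<^sup>2"
    by (simp add: chart_def inner_3 power2_eq_square algebra_simps del: sin_cos_squared_add3)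
  then have "norm (fst (chart u)) = 1" by (simp add: norm_eq_1)
  moreover have "norm (snd (chart u)) = 1" by (simp add: chart_def)
  ultimately show ?thesis by (simp only: mem_S2S1_iff)
qed

lemma continuous_chart: "continuous_on S chart"
  using has_derivative_chart has_derivative_continuous continuous_at_imp_continuous_on by blast

text \<open>The coordinate frame is orthogonal for every warped metric, so the Gram matrix is
  diagonal with entries \<open>1\<close>, \<open>(sin (u$1))\<^sup>2\<close> and the square of the
  warping function.\<close>

lemma det_chart_gram: "det (chart_gram (warped \<eta>) u) = (sin (u$1) * \<eta> (fst (chart u)))\<^sup>2"
proof -
  let ?e = "\<eta> (fst (chart u))"
  have t: "(sin t)\<^sup>2 + (cos t)\<^sup>2 = 1" "(cos t)\<^sup>2 + (sin t)\<^sup>2 = 1" for t :: real by auto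
  have 11: "warped \<eta> (chart u) (chart_frame 1 u) (chart_frame 1 u) = 1"
  proof -
    have "warped \<eta> (chart u) (chart_frame 1 u) (chart_frame 1 u) =
       (cos (u$1))\<^sup>2 * ((cos (u$2))\<^sup>2 + (sin (u$2))\<^sup>2) + (sin (u$1))\<^sup>2"
      by (simp add: warped_def inner_3 power2_eq_square algebra_simps del: sin_cos_squared_add3)
    then show ?thesis by simp
  qed
  have 22: "warped \<eta> (chart u) (chart_frame 2 u) (chart_frame 2 u) = (sin (u$1))\<^sup>2"
  proof -
    have "warped \<eta> (chart u) (chart_frame 2 u) (chart_frame 2 u) = (sin (u$1))\<^sup>2 * ((cos (u$2))\<^sup>2 + (sin (u$2))\<^sup>2)"
      by (simp add: warped_def inner_3 power2_eq_square algebra_simps del: sin_cos_squared_add3)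
    then show ?thesis by simp
  qed
  have 33: "warped \<eta> (chart u) (chart_frame 3 u) (chart_frame 3 u) = ?e\<^sup>2"
    using t by (simp add: warped_def inner_complex_def power2_eq_square)
  have o: "warped \<eta> (chart u) (chart_frame i u) (chart_frame j u) = 0" if "i \<noteq> j" for i j
    using that exhaust_3[of i] exhaust_3[of j]
    by (auto simp: warped_def inner_3 algebra_simps)
  show ?thesis
    unfolding det_3 chart_gram_def frechet_derivative_chart
    by (simp add: 11 22 33 o power_mult_distrib del: chart_frame_simps)
qed

text \<open>Makes every computation for warped products available for the background metric.\<close>

lemma g0_eq_warped: "g0 = warped (\<lambda>_. 1)"
  by (auto simp: fun_eq_iff g0_def warped_def inner_prod_def)

lemma chart_dom_borel [measurable]: "chart_dom \<in> sets borel"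
proof -
  have "open chart_dom" unfolding chart_dom_def
    by (intro open_Collect_conj open_Collect_less continuous_intros)
  then show ?thesis by simp
qed

lemma measurable_chart [measurable]:
  "chart \<in> measurable (restrict_space lborel chart_dom) (restrict_space borel S2S1)"
proof (rule measurable_restrict_space2)
  show "chart \<in> restrict_space lborel chart_dom \<rightarrow>\<^sub>M borel"
    using borel_measurable_continuous_onI[OF continuous_chart]
    by (intro measurable_restrict_space1) (simp add: measurable_lborel1)
qed (auto simp: chart_mem)

lemma space_vol [simp]: "space (vol g) = S2S1"
  by (simp add: vol_def space_restrict_space)

lemma sets_vol [measurable_cong]: "sets (vol g) = sets (restrict_space borel S2S1)"
  by (simp add: vol_def)

lemma chart_dom_sin_pos: "AE u in restrict_space lborel chart_dom. 0 < sin (u$1)"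
  by (rule AE_I2) (auto simp: space_restrict_space chart_dom_def sin_gt_zero)

lemma borel_measurable_sin_nth [measurable]:
  "(\<lambda>u::real^3. sin (u$i)) \<in> borel_measurable (restrict_space lborel chart_dom)"
  by (intro measurable_restrict_space1) (auto intro!: borel_measurable_continuous_onI continuous_intros)

lemma mu0_eq: "\<mu>0 = distr (density (restrict_space lborel chart_dom) (\<lambda>u. ennreal (sin (u$1)))) (restrict_space borel S2S1) chart"
  unfolding vol_def g0_eq_warped det_chart_gram
  by (intro distr_cong density_cong refl) (use chart_dom_sin_pos in auto)

text \<open>The absolute value is the square root of the square in the Gram determinant; the sine is
  positive on the chart domain.\<close>

lemma vol_warped:
  assumes [measurable]: "(\<lambda>p. \<eta> (fst p)) \<in> borel_measurable (restrict_space borel S2S1)"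
  shows "vol (warped \<eta>) = density \<mu>0 (\<lambda>p. ennreal \<bar>\<eta> (fst p)\<bar>)"
proof -
  let ?R = "restrict_space lborel chart_dom"
  have [measurable]: "(\<lambda>u. \<eta> (fst (chart u))) \<in> borel_measurable ?R"
    using measurable_compose[OF measurable_chart assms] .
  have "density ?R (\<lambda>u. ennreal (sqrt (det (chart_gram (warped \<eta>) u)))) =
      density ?R (\<lambda>u. ennreal (sin (u$1)) * ennreal \<bar>\<eta> (fst (chart u))\<bar>)"
    unfolding det_chart_gram
    by (intro density_cong) (use chart_dom_sin_pos in \<open>auto simp: abs_mult ennreal_mult[symmetric]\<close>)
  also have "\<dots> = density (density ?R (\<lambda>u. ennreal (sin (u$1)))) (\<lambda>u. ennreal \<bar>\<eta> (fst (chart u))\<bar>)"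
    by (subst density_density_eq) auto
  finally have *: "density ?R (\<lambda>u. ennreal (sqrt (det (chart_gram (warped \<eta>) u)))) = \<dots>" .
  show ?thesis
    unfolding mu0_eq by (subst density_distr) (auto simp: vol_def *)
qed

section \<open>Integration in the chart\<close>

lemma nn_integral_mu0:
  assumes [measurable]: "f \<in> borel_measurable (restrict_space borel S2S1)"
  shows "(\<integral>\<^sup>+p. f p \<partial>\<mu>0) = (\<integral>\<^sup>+u. ennreal (sin (u$1)) * f (chart u) * indicator chart_dom u \<partial>lborel)"
proof -
  show ?thesis
    unfolding mu0_eq
    by (subst nn_integral_distr, simp, simp, subst nn_integral_density)
       (auto simp: nn_integral_restrict_space intro!: measurable_compose[OF measurable_chart])
qed

lemma integral_mu0:
  fixes f :: "ambient \<Rightarrow> real"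
  assumes [measurable]: "f \<in> borel_measurable (restrict_space borel S2S1)"
  shows "(\<integral>p. f p \<partial>\<mu>0) = (\<integral>u. indicator chart_dom u * (sin (u$1) * f (chart u)) \<partial>lborel)"
proof -
  have sin_nonneg: "AE u in restrict_space lborel chart_dom. 0 \<le> sin (u$1)"
    using chart_dom_sin_pos by eventually_elim simp
  show ?thesis
    unfolding mu0_eq
    using sin_nonneg
    by (subst integral_distr, simp, simp, subst integral_density)
       (auto simp: integral_restrict_space intro!: measurable_compose[OF measurable_chart])
qed

text \<open>Lebesgue measure is determined by its values on boxes, and the preimage of a box is a
  product of three intervals.\<close>

lemma lborel_vec3:
  "(lborel :: (real^3) measure) = distr (lborel \<Otimes>\<^sub>M (lborel \<Otimes>\<^sub>M lborel)) borel (\<lambda>w. vector [fst w, fst (snd w), snd (snd w)])"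
proof (rule lborel_eqI)
  have B: "(Basis :: (real^3) set) = {axis 1 1, axis 2 1, axis 3 1}"
    by (auto simp: Basis_vec_def UNIV_3)
  have m: "(\<lambda>w. vector [fst w, fst (snd w), snd (snd w)] :: real^3)
     \<in> measurable ((lborel::real measure) \<Otimes>\<^sub>M ((lborel::real measure) \<Otimes>\<^sub>M (lborel::real measure))) borel"
    unfolding lborel_prod vector_3_eq_axis measurable_lborel1 measurable_lborel2
    by (intro borel_measurable_continuous_onI continuous_intros)
  fix l u :: "real^3" assume le: "\<And>b. b \<in> Basis \<Longrightarrow> l \<bullet> b \<le> u \<bullet> b"
  then have le3: "l$1 \<le> u$1" "l$2 \<le> u$2" "l$3 \<le> u$3"
    using le[of "axis 1 1"] le[of "axis 2 1"] le[of "axis 3 1"] by (auto simp: B inner_axis)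
  have em: "emeasure (lborel :: (real \<times> real \<times> real) measure) (A \<times> (B \<times> C)) =
      emeasure lborel A * (emeasure lborel B * emeasure lborel C)"
    if [simp]: "A \<in> sets borel" "B \<in> sets borel" "C \<in> sets borel" for A B C :: "real set"
  proof -
    have "emeasure (lborel :: (real \<times> real) measure) (B \<times> C) = emeasure lborel B * emeasure lborel C"
      using lborel.emeasure_pair_measure_Times[of B lborel C] by (simp add: lborel_prod)
    moreover have "emeasure (lborel :: (real \<times> real \<times> real) measure) (A \<times> (B \<times> C)) = emeasure lborel A * emeasure lborel (B \<times> C)"
      using lborel.emeasure_pair_measure_Times[of A lborel "B \<times> C"] borel_Times[of B C] by (simp add: lborel_prod)
    ultimately show ?thesis by simp
  qed
  then have "emeasure (lborel :: (real \<times> real \<times> real) measure) ({l$1<..<u$1} \<times> ({l$2<..<u$2} \<times> {l$3<..<u$3})) =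
      ennreal ((u$1 - l$1) * ((u$2 - l$2) * (u$3 - l$3)))"
    using le3 by (simp add: ennreal_mult)
  moreover have "(\<lambda>w. vector [fst w, fst (snd w), snd (snd w)] :: real^3) -` box l u \<inter> space (lborel \<Otimes>\<^sub>M (lborel \<Otimes>\<^sub>M lborel))
     = {l$1<..<u$1} \<times> ({l$2<..<u$2} \<times> {l$3<..<u$3})"
    by (auto simp: box_def B inner_axis space_pair_measure)
  ultimately show "emeasure (distr (lborel \<Otimes>\<^sub>M (lborel \<Otimes>\<^sub>M lborel)) borel (\<lambda>w. vector [fst w, fst (snd w), snd (snd w)])) (box l u)
     = ennreal (\<Prod>b\<in>Basis. (u - l) \<bullet> b)"
    by (subst emeasure_distr[OF m]) (simp_all add: lborel_prod B axis_eq_axis inner_axis)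
qed simp

lemma measurable_vector_3:
  "(\<lambda>w. vector [fst w, fst (snd w), snd (snd w)] :: real^3)
     \<in> measurable ((lborel::real measure) \<Otimes>\<^sub>M ((lborel::real measure) \<Otimes>\<^sub>M (lborel::real measure))) borel"
  unfolding lborel_prod vector_3_eq_axis measurable_lborel1 measurable_lborel2
  by (intro borel_measurable_continuous_onI continuous_intros)

lemma nn_integral_vec3:
  assumes f: "f \<in> borel_measurable (borel :: (real^3) measure)"
  shows "(\<integral>\<^sup>+u. f u \<partial>lborel) = (\<integral>\<^sup>+x. \<integral>\<^sup>+y. \<integral>\<^sup>+z. f (vector [x, y, z]) \<partial>lborel \<partial>lborel \<partial>lborel)"
proof -
  note m = measurable_compose[OF measurable_vector_3 f]
  have m1: "(\<lambda>w. f (vector [fst w, fst (snd w), snd (snd w)])) \<in> borel_measurable (lborel \<Otimes>\<^sub>M lborel)"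
    using m by (simp add: lborel_prod)
  have m2: "(\<lambda>w. f (vector [x, fst w, snd w])) \<in> borel_measurable (lborel \<Otimes>\<^sub>M lborel)" for x
    using measurable_compose[OF measurable_Pair1'[of x lborel] m1] by (simp add: lborel_prod)
  have "(\<integral>\<^sup>+u. f u \<partial>lborel) = (\<integral>\<^sup>+w. f (vector [fst w, fst (snd w), snd (snd w)]) \<partial>(lborel \<Otimes>\<^sub>M lborel))"
    by (subst lborel_vec3, subst nn_integral_distr[OF measurable_vector_3]) (simp_all add: f lborel_prod)
  also have "\<dots> = (\<integral>\<^sup>+x. \<integral>\<^sup>+w. f (vector [x, fst w, snd w]) \<partial>lborel \<partial>lborel)"
    using lborel.nn_integral_fst[OF m1] by simp
  also have "\<dots> = (\<integral>\<^sup>+x. \<integral>\<^sup>+y. \<integral>\<^sup>+z. f (vector [x, y, z]) \<partial>lborel \<partial>lborel \<partial>lborel)"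
    using lborel.nn_integral_fst[OF m2] by (simp add: lborel_prod)
  finally show ?thesis .
qed

text \<open>By Fubini one integrates first along the coordinate whose partial integrals vanish. In
  the non-integrable cases, for the whole function or for a slice, the Bochner integral is 0 by
  convention.\<close>

lemma integral_vec3_zero:
  fixes f :: "real^3 \<Rightarrow> real"
  assumes f: "f \<in> borel_measurable borel"
    and zero: "(\<forall>y z. (\<integral>x. f (vector [x, y, z]) \<partial>lborel) = 0) \<or> (\<forall>x z. (\<integral>y. f (vector [x, y, z]) \<partial>lborel) = 0)
       \<or> (\<forall>x y. (\<integral>z. f (vector [x, y, z]) \<partial>lborel) = 0)"
  shows "(\<integral>u. f u \<partial>lborel) = 0"
proof -
  define h where "h = (\<lambda>x w. f (vector [x, fst w, snd w]))"
  have eq: "(\<integral>u. f u \<partial>lborel) = integral\<^sup>L (lborel \<Otimes>\<^sub>M lborel) (\<lambda>(x, w). h x w)"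
    unfolding h_def
    by (subst lborel_vec3, subst integral_distr[OF measurable_vector_3]) (simp_all add: f lborel_prod case_prod_beta')
  show ?thesis
  proof (cases "integrable (lborel \<Otimes>\<^sub>M lborel) (\<lambda>(x, w). h x w)")
    case True
    have inner: "(\<integral>w. h x w \<partial>lborel) = 0"
      if "(\<forall>z. (\<integral>y. f (vector [x, y, z]) \<partial>lborel) = 0) \<or> (\<forall>y. (\<integral>z. f (vector [x, y, z]) \<partial>lborel) = 0)" for x
    proof (cases "integrable (lborel \<Otimes>\<^sub>M lborel) (\<lambda>(y, z). f (vector [x, y, z]))")
      case True
      have "(\<integral>w. h x w \<partial>lborel) = integral\<^sup>L (lborel \<Otimes>\<^sub>M lborel) (\<lambda>(y, z). f (vector [x, y, z]))"
        by (simp add: h_def lborel_prod case_prod_beta')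
      then show ?thesis
        using that lborel_pair.integral_fst'[OF True] lborel_pair.integral_snd[OF True] by auto
    next
      case False
      then show ?thesis
        by (simp add: h_def lborel_prod case_prod_beta' not_integrable_integral_eq)
    qed
    show ?thesis
      using zero
    proof (elim disjE)
      assume "\<forall>y z. (\<integral>x. f (vector [x, y, z]) \<partial>lborel) = 0"
      then show ?thesis unfolding eq lborel_pair.integral_snd[OF True, symmetric] by (simp add: h_def)
    qed (unfold eq lborel_pair.integral_fst'[OF True, symmetric], simp_all add: inner)
  qed (simp add: eq not_integrable_integral_eq)
qed

lemma compact_S2S1: "compact S2S1"
  unfolding S2S1_def S2_def by (intro compact_Times compact_sphere)

lemma indicator_chart_dom:
  "indicat_real chart_dom (vector [x, y, z]) = indicator {0<..<pi} x * indicator {0<..<2*pi} y * indicator {0<..<2*pi} z"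
  by (auto simp: chart_dom_def indicator_def)

text \<open>The area \<open>4 * pi\<close> of the sphere times the length \<open>2 * pi\<close> of
  the circle.\<close>

lemma emeasure_mu0: "emeasure \<mu>0 S2S1 = ennreal (8 * pi\<^sup>2)"
proof -
  have m: "(\<lambda>u::real^3. ennreal (sin (u$1)) * indicator chart_dom u) \<in> borel_measurable borel"
    by (intro borel_measurable_times_ennreal measurable_compose[OF _ measurable_ennreal] borel_measurable_continuous_onI
        borel_measurable_indicator chart_dom_borel continuous_intros)
  have ind: "indicator chart_dom (vector [x, y, z] :: real^3) =
      (indicator {0<..<pi} x * indicator {0<..<2*pi} y * indicator {0<..<2*pi} z :: ennreal)" for x y z
    by (auto simp: chart_dom_def indicator_def)
  have s: "(\<integral>\<^sup>+x. ennreal (sin x) * indicator {0<..<pi} x \<partial>lborel) = 2"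
  proof -
    have "(\<integral>\<^sup>+x. ennreal (sin x) * indicator {0<..<pi} x \<partial>lborel) = (\<integral>\<^sup>+x. ennreal (sin x) * indicator {0..pi} x \<partial>lborel)"
      using AE_lborel_singleton[of 0] AE_lborel_singleton[of pi]
      by (intro nn_integral_cong_AE) (eventually_elim, auto simp: indicator_def)
    also have "\<dots> = ennreal ((- cos pi) - (- cos 0))"
      by (rule nn_integral_FTC_Icc) (auto intro!: derivative_eq_intros sin_ge_zero)
    finally show ?thesis by simp
  qed
  have "emeasure \<mu>0 S2S1 = (\<integral>\<^sup>+p. 1 \<partial>\<mu>0)"
    by (simp add: nn_integral_const)
  also have "\<dots> = (\<integral>\<^sup>+u. ennreal (sin (u$1)) * indicator chart_dom u \<partial>lborel)"
    by (subst nn_integral_mu0) auto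
  also have "\<dots> = (\<integral>\<^sup>+x. \<integral>\<^sup>+y. \<integral>\<^sup>+z. (ennreal (sin x) * indicator {0<..<pi} x) * indicator {0<..<2*pi} y * indicator {0<..<2*pi} z \<partial>lborel \<partial>lborel \<partial>lborel)"
    by (subst nn_integral_vec3[OF m]) (simp add: ind ac_simps)
  also have "\<dots> = (\<integral>\<^sup>+x. \<integral>\<^sup>+y. (ennreal (sin x) * indicator {0<..<pi} x) * indicator {0<..<2*pi} y * ennreal (2 * pi) \<partial>lborel \<partial>lborel)"
    by (intro nn_integral_cong) (subst nn_integral_cmult, auto)
  also have "\<dots> = (\<integral>\<^sup>+x. (ennreal (sin x) * indicator {0<..<pi} x) * ennreal (2 * pi) * ennreal (2 * pi) \<partial>lborel)"
    by (intro nn_integral_cong) (subst nn_integral_multc, simp, subst nn_integral_cmult, auto)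
  also have "\<dots> = 2 * ennreal (2 * pi) * ennreal (2 * pi)"
    by (subst nn_integral_multc, simp, subst nn_integral_multc, simp) (simp add: s)
  also have "\<dots> = ennreal (8 * pi\<^sup>2)"
    by (simp add: ennreal_mult[symmetric] ennreal_numeral[symmetric] power2_eq_square del: ennreal_numeral)
  finally show ?thesis .
qed

interpretation mu0: finite_measure \<mu>0
  by (rule finite_measureI) (simp add: emeasure_mu0)

lemma measure_mu0: "measure \<mu>0 S2S1 = 8 * pi\<^sup>2"
  by (simp add: measure_def emeasure_mu0)

lemma borel_measurable_mu0_continuous:
  fixes f :: "ambient \<Rightarrow> 'b::real_normed_vector"
  assumes "continuous_on S2S1 f" shows "f \<in> borel_measurable \<mu>0"
  using borel_measurable_continuous_on_restrict[OF assms] measurable_cong_sets[OF sets_vol refl] by blast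

lemma integrable_mu0_continuous:
  fixes f :: "ambient \<Rightarrow> 'b::euclidean_space"
  assumes f: "continuous_on S2S1 f" shows "integrable \<mu>0 f"
proof -
  have "bounded (f ` S2S1)" using compact_continuous_image[OF f compact_S2S1] compact_imp_bounded by blast
  then obtain B where "\<And>p. p \<in> S2S1 \<Longrightarrow> norm (f p) \<le> B" by (auto simp: bounded_iff)
  then show ?thesis
    by (intro mu0.integrable_const_bound[where B = B] AE_I2 borel_measurable_mu0_continuous f) auto
qed

lemma integral_indicator_ioo_FTC:
  fixes F f :: "real \<Rightarrow> real"
  assumes "a \<le> b" "\<And>x. (F has_real_derivative f x) (at x)" "continuous_on UNIV f"
  shows "(\<integral>x. indicator {a<..<b} x * f x \<partial>lborel) = F b - F a"
proof -
  have mf: "f \<in> borel_measurable borel" by (rule borel_measurable_continuous_onI[OF assms(3)])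
  have "(\<integral>x. indicator {a<..<b} x * f x \<partial>lborel) = (\<integral>x. f x * indicator {a..b} x \<partial>lborel)"
  proof (rule integral_cong_AE)
    show "AE x in lborel. indicator {a<..<b} x * f x = f x * indicator {a..b} x"
      using AE_lborel_singleton[of a] AE_lborel_singleton[of b] by eventually_elim (auto simp: indicator_def)
  qed (use mf in auto)
  also have "\<dots> = F b - F a"
    using assms by (intro integral_FTC_Icc_real) (auto simp: continuous_on_eq_continuous_at)
  finally show ?thesis .
qed

lemma continuous_vector_3 [continuous_intros]:
  fixes f g h :: "'a::topological_space \<Rightarrow> real"
  shows "continuous_on S f \<Longrightarrow> continuous_on S g \<Longrightarrow> continuous_on S h \<Longrightarrow>
    continuous_on S (\<lambda>t. vector [f t, g t, h t] :: real^3)"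
  unfolding vector_3_eq_axis by (intro continuous_intros)

text \<open>One summand of a divergence in coordinates: integrating a partial derivative along its
  own coordinate leaves boundary values. They agree for the two poles in the first coordinate, and
  by periodicity in the two angles.\<close>

lemma chart_dom_partial_zero:
  fixes F D :: "real^3 \<Rightarrow> real"
  assumes D: "continuous_on UNIV D"
    and disj: "((\<forall>x y z. ((\<lambda>t. F (vector [t, y, z])) has_real_derivative D (vector [x, y, z])) (at x))
        \<and> (\<forall>y z. F (vector [pi, y, z]) = F (vector [0, y, z])))
      \<or> ((\<forall>x y z. ((\<lambda>t. F (vector [x, t, z])) has_real_derivative D (vector [x, y, z])) (at y))
        \<and> (\<forall>x z. F (vector [x, 2 * pi, z]) = F (vector [x, 0, z])))
      \<or> ((\<forall>x y z. ((\<lambda>t. F (vector [x, y, t])) has_real_derivative D (vector [x, y, z])) (at z))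
        \<and> (\<forall>x y. F (vector [x, y, 2 * pi]) = F (vector [x, y, 0])))"
  shows "(\<integral>u. indicator chart_dom u * D u \<partial>lborel) = 0"
proof (rule integral_vec3_zero)
  show "(\<lambda>u. indicator chart_dom u * D u) \<in> borel_measurable borel"
    using borel_measurable_continuous_onI[OF D] by (intro borel_measurable_times borel_measurable_indicator) auto
  have c: "continuous_on UNIV (\<lambda>t. D (vector [f t, g t, h t]))"
    if "continuous_on UNIV f" "continuous_on UNIV g" "continuous_on UNIV h" for f g h :: "real \<Rightarrow> real"
    using continuous_on_compose2[OF D continuous_vector_3[OF that]] by simp
  let ?i = "\<lambda>x y z. indicator chart_dom (vector [x, y, z] :: real^3) * D (vector [x, y, z])"
  have 1: "?i x y z = (indicator {0<..<2*pi} y * indicator {0<..<2*pi} z) * (indicator {0<..<pi} x * D (vector [x, y, z]))"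
    and 2: "?i x y z = (indicator {0<..<pi} x * indicator {0<..<2*pi} z) * (indicator {0<..<2*pi} y * D (vector [x, y, z]))"
    and 3: "?i x y z = (indicator {0<..<pi} x * indicator {0<..<2*pi} y) * (indicator {0<..<2*pi} z * D (vector [x, y, z]))"
    for x y z by (simp_all add: indicator_chart_dom)
  show "(\<forall>y z. (\<integral>x. ?i x y z \<partial>lborel) = 0) \<or> (\<forall>x z. (\<integral>y. ?i x y z \<partial>lborel) = 0) \<or> (\<forall>x y. (\<integral>z. ?i x y z \<partial>lborel) = 0)"
    using disj
  proof (elim disjE conjE)
    assume d: "\<forall>x y z. ((\<lambda>t. F (vector [t, y, z])) has_real_derivative D (vector [x, y, z])) (at x)"
      and e: "\<forall>y z. F (vector [pi, y, z]) = F (vector [0, y, z])"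
    have "(\<integral>x. indicator {0<..<pi} x * D (vector [x, y, z]) \<partial>lborel) = 0" for y z
      by (subst integral_indicator_ioo_FTC[where F = "\<lambda>t. F (vector [t, y, z])"])
         (use d e in \<open>auto intro!: c continuous_intros\<close>)
    then show ?thesis unfolding 1 by simp
  next
    assume d: "\<forall>x y z. ((\<lambda>t. F (vector [x, t, z])) has_real_derivative D (vector [x, y, z])) (at y)"
      and e: "\<forall>x z. F (vector [x, 2 * pi, z]) = F (vector [x, 0, z])"
    have "(\<integral>y. indicator {0<..<2*pi} y * D (vector [x, y, z]) \<partial>lborel) = 0" for x z
      by (subst integral_indicator_ioo_FTC[where F = "\<lambda>t. F (vector [x, t, z])"])
         (use d e in \<open>auto intro!: c continuous_intros\<close>)
    then show ?thesis unfolding 2 by simp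
  next
    assume d: "\<forall>x y z. ((\<lambda>t. F (vector [x, y, t])) has_real_derivative D (vector [x, y, z])) (at z)"
      and e: "\<forall>x y. F (vector [x, y, 2 * pi]) = F (vector [x, y, 0])"
    have "(\<integral>z. indicator {0<..<2*pi} z * D (vector [x, y, z]) \<partial>lborel) = 0" for x y
      by (subst integral_indicator_ioo_FTC[where F = "\<lambda>t. F (vector [x, y, t])"])
         (use d e in \<open>auto intro!: c continuous_intros\<close>)
    then show ?thesis unfolding 3 by simp
  qed
qed

lemma integrable_chart_dom:
  fixes D :: "real^3 \<Rightarrow> real"
  assumes D: "continuous_on UNIV D"
  shows "integrable lborel (\<lambda>u. indicator chart_dom u * D u)"
proof -
  let ?C = "cbox (vector [0, 0, 0]) (vector [pi, 2*pi, 2*pi]) :: (real^3) set"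
  have "set_integrable lborel ?C D"
    unfolding set_integrable_def
    by (intro borel_integrable_compact continuous_on_subset[OF D]) auto
  then have "set_integrable lborel chart_dom D"
    by (rule set_integrable_subset) (auto simp: chart_dom_def mem_box_cart forall_3)
  then show ?thesis by (simp add: set_integrable_def)
qed

text \<open>Tangential fields of class \<open>C\<^sup>1\<close>, with the derivative of their degree zero homogeneous extension.\<close>

definition C1_field :: "vfield \<Rightarrow> (ambient \<Rightarrow> ambient \<Rightarrow> ambient) \<Rightarrow> bool" where
  "C1_field X X' \<longleftrightarrow>
     (\<forall>p\<in>S2S1. X p \<in> tangent p \<and> ((\<lambda>z. X (retr z)) has_derivative X' p) (at p)) \<and>
     (\<forall>v. continuous_on S2S1 (\<lambda>p. X' p v))"

text \<open>For a tangential field this ambient trace is the divergence: the extension is constant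
  along rays, so normal directions contribute nothing.\<close>

definition field_trace :: "(ambient \<Rightarrow> ambient \<Rightarrow> ambient) \<Rightarrow> ambient \<Rightarrow> real" where
  "field_trace X' p = (\<Sum>e\<in>Basis. X' p e \<bullet> e)"

lemma continuous_on_retr_derivative:
  assumes "\<And>p. p \<in> S2S1 \<Longrightarrow> ((\<lambda>z. F (retr z)) has_derivative F' p) (at p)"
  shows "continuous_on S2S1 F"
proof -
  have "continuous_on S2S1 (\<lambda>z. F (retr z))"
    using assms has_derivative_continuous continuous_at_imp_continuous_on by blast
  then show ?thesis by (rule continuous_on_eq) (simp add: retr_ident)
qed

text \<open>Continuity in the point for each fixed direction becomes joint continuity by expanding
  the direction in \<open>Basis\<close>.\<close>

lemma continuous_derivative_apply:
  fixes F' :: "ambient \<Rightarrow> ambient \<Rightarrow> 'b::real_normed_vector"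
  assumes lin: "\<And>t. t \<in> T \<Longrightarrow> linear (F' (f t))" and c: "\<And>v. continuous_on S (\<lambda>p. F' p v)"
    and f: "continuous_on T f" "f ` T \<subseteq> S" and w: "continuous_on T w"
  shows "continuous_on T (\<lambda>t. F' (f t) (w t))"
proof -
  have "continuous_on T (\<lambda>t. \<Sum>e\<in>Basis. (w t \<bullet> e) *\<^sub>R F' (f t) e)"
    by (intro continuous_intros w continuous_on_compose2[OF c f(1)]) (use f in auto)
  then show ?thesis
  proof (rule continuous_on_eq)
    fix t assume "t \<in> T"
    from lin[OF this] have "F' (f t) (\<Sum>e\<in>Basis. (w t \<bullet> e) *\<^sub>R e) = (\<Sum>e\<in>Basis. (w t \<bullet> e) *\<^sub>R F' (f t) e)"
      by (simp add: linear_sum linear_cmul)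
    then show "(\<Sum>e\<in>Basis. (w t \<bullet> e) *\<^sub>R F' (f t) e) = F' (f t) (w t)" by (simp add: euclidean_representation)
  qed
qed

text \<open>The second coordinate vector divided by its length \<open>sin (u$1)\<close>; in this
  form it is still defined at the poles.\<close>

definition unit_frame2 :: "real^3 \<Rightarrow> ambient" where
  "unit_frame2 u = (vector [- sin (u$2), cos (u$2), 0], 0)"

lemma chart_frame_2: "chart_frame 2 u = sin (u$1) *\<^sub>R unit_frame2 u"
  by (simp add: unit_frame2_def vec_eq_iff forall_3)

text \<open>The two unit normals and the three normalised coordinate vectors form an orthonormal
  basis of the ambient space. In components this is a polynomial identity modulo the relations
  between sine and cosine.\<close>

lemma frame_expand:
  "v = (v \<bullet> (fst (chart u), 0)) *\<^sub>R (fst (chart u), 0) + (v \<bullet> chart_frame 1 u) *\<^sub>R chart_frame 1 u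
    + (v \<bullet> unit_frame2 u) *\<^sub>R unit_frame2 u + (v \<bullet> chart_frame 3 u) *\<^sub>R chart_frame 3 u
    + (v \<bullet> (0, snd (chart u))) *\<^sub>R (0, snd (chart u))"
proof (rule prod_eqI)
  have 1: "(sin (u$1))\<^sup>2 + (cos (u$1))\<^sup>2 = 1" "(sin (u$2))\<^sup>2 + (cos (u$2))\<^sup>2 = 1" "(sin (u$3))\<^sup>2 + (cos (u$3))\<^sup>2 = 1"
    by simp_all
  have 3: "r = (r * (s * d) + q * (s * c) + w * b) * (s * d) + (r * (b * d) + q * (b * c) - w * s) * (b * d) - (- r * c + q * d) * c"
     "q = (r * (s * d) + q * (s * c) + w * b) * (s * c) + (r * (b * d) + q * (b * c) - w * s) * (b * c) + (- r * c + q * d) * d"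
     "w = (r * (s * d) + q * (s * c) + w * b) * b - (r * (b * d) + q * (b * c) - w * s) * s"
    if "s\<^sup>2 + b\<^sup>2 = 1" "c\<^sup>2 + d\<^sup>2 = 1" for r q w s b c d :: real
    using that by algebra+
  have 4: "r = (r * d + q * c) * d - (- r * c + q * d) * c" "q = (r * d + q * c) * c + (- r * c + q * d) * d"
     if "c\<^sup>2 + d\<^sup>2 = 1" for r q c d :: real using that by algebra+
  show "fst v = fst ((v \<bullet> (fst (chart u), 0)) *\<^sub>R (fst (chart u), 0) + (v \<bullet> chart_frame 1 u) *\<^sub>R chart_frame 1 u
    + (v \<bullet> unit_frame2 u) *\<^sub>R unit_frame2 u + (v \<bullet> chart_frame 3 u) *\<^sub>R chart_frame 3 u
    + (v \<bullet> (0, snd (chart u))) *\<^sub>R (0, snd (chart u)))"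
    using 3[OF 1(1,2), where r = "fst v $ 1" and q = "fst v $ 2" and w = "fst v $ 3"]
    by (simp add: vec_eq_iff forall_3 chart_def unit_frame2_def inner_prod_def inner_3)
  show "snd v = snd ((v \<bullet> (fst (chart u), 0)) *\<^sub>R (fst (chart u), 0) + (v \<bullet> chart_frame 1 u) *\<^sub>R chart_frame 1 u
    + (v \<bullet> unit_frame2 u) *\<^sub>R unit_frame2 u + (v \<bullet> chart_frame 3 u) *\<^sub>R chart_frame 3 u
    + (v \<bullet> (0, snd (chart u))) *\<^sub>R (0, snd (chart u)))"
    using 4[OF 1(3), where r = "Re (snd v)" and q = "Im (snd v)"]
    by (simp add: complex_eq_iff chart_def unit_frame2_def inner_prod_def inner_complex_def algebra_simps)
qed

lemma trace_frame:
  assumes "linear L"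
  shows "(\<Sum>e\<in>Basis. L e \<bullet> e) = L (fst (chart u), 0) \<bullet> (fst (chart u), 0) + L (chart_frame 1 u) \<bullet> chart_frame 1 u
    + L (unit_frame2 u) \<bullet> unit_frame2 u + L (chart_frame 3 u) \<bullet> chart_frame 3 u
    + L (0, snd (chart u)) \<bullet> (0, snd (chart u))"
proof -
  have le: "L e = (e \<bullet> (fst (chart u), 0)) *\<^sub>R L (fst (chart u), 0) + (e \<bullet> chart_frame 1 u) *\<^sub>R L (chart_frame 1 u)
    + (e \<bullet> unit_frame2 u) *\<^sub>R L (unit_frame2 u) + (e \<bullet> chart_frame 3 u) *\<^sub>R L (chart_frame 3 u)
    + (e \<bullet> (0, snd (chart u))) *\<^sub>R L (0, snd (chart u))" for e
    by (subst frame_expand[of e u]) (simp only: linear_add[OF assms] linear_cmul[OF assms])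
  have eu: "(\<Sum>e\<in>Basis. (e \<bullet> a) * (b \<bullet> e)) = b \<bullet> a" for a b :: ambient
    by (subst euclidean_inner[of b a]) (simp add: inner_commute mult.commute)
  have "(\<Sum>e\<in>Basis. L e \<bullet> e) = (\<Sum>e\<in>Basis. (e \<bullet> (fst (chart u), 0)) * (L (fst (chart u), 0) \<bullet> e) + (e \<bullet> chart_frame 1 u) * (L (chart_frame 1 u) \<bullet> e)
    + (e \<bullet> unit_frame2 u) * (L (unit_frame2 u) \<bullet> e) + (e \<bullet> chart_frame 3 u) * (L (chart_frame 3 u) \<bullet> e)
    + (e \<bullet> (0, snd (chart u))) * (L (0, snd (chart u)) \<bullet> e))"
    by (intro sum.cong refl, subst le) (simp only: inner_add_left inner_scaleR_left)
  also have "\<dots> = L (fst (chart u), 0) \<bullet> (fst (chart u), 0) + L (chart_frame 1 u) \<bullet> chart_frame 1 u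
    + L (unit_frame2 u) \<bullet> unit_frame2 u + L (chart_frame 3 u) \<bullet> chart_frame 3 u
    + L (0, snd (chart u)) \<bullet> (0, snd (chart u))"
    by (simp only: sum.distrib eu)
  finally show ?thesis .
qed

section \<open>The divergence theorem\<close>

text \<open>The divergence in spherical coordinates, multiplied by the density
  \<open>sin (u$1)\<close>, is a sum of three partial derivatives. The cosine terms from
  differentiating the density and from the rotation of the frame cancel between \<open>D1\<close>
  and \<open>D2\<close>; normal parts of the differentiated frame drop out because the field is
  tangential.\<close>

theorem divergence_S2S1:
  assumes X: "C1_field X X'"
  shows "(\<integral>p. field_trace X' p \<partial>\<mu>0) = 0"
proof -
  have tan: "X (chart u) \<in> tangent (chart u)"
    and D: "((\<lambda>z. X (retr z)) has_derivative X' (chart u)) (at (chart u))" for u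
    using X chart_mem[of u] by (auto simp: C1_field_def)
  have lin: "linear (X' p)" if "p \<in> S2S1" for p
    using X that by (auto simp: C1_field_def intro: has_derivative_linear)
  note linc = lin[OF chart_mem]
  have cX': "continuous_on S2S1 (\<lambda>p. X' p v)" for v using X unfolding C1_field_def by blast
  define h where "h u = X (chart u)" for u
  have h_orth: "fst (h u) \<bullet> fst (chart u) = 0" "snd (h u) \<bullet> snd (chart u) = 0" for u
    using tan[of u] by (auto simp: h_def tangent_def)
  have dh: "(h has_derivative (\<lambda>v. X' (chart u) (v$1 *\<^sub>R chart_frame 1 u + v$2 *\<^sub>R chart_frame 2 u + v$3 *\<^sub>R chart_frame 3 u))) (at u)" for u
    using has_derivative_compose[OF has_derivative_chart D] by (simp add: h_def[abs_def] retr_ident chart_mem)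
  have ch: "continuous_on UNIV h"
    using dh has_derivative_continuous continuous_at_imp_continuous_on by blast
  have cf: "continuous_on UNIV (chart_frame i)" for i
    unfolding chart_frame_def using exhaust_3[of i]
    by (auto intro!: continuous_intros simp: cis_eq_scaleR)
  have ce: "continuous_on UNIV unit_frame2"
    unfolding unit_frame2_def by (intro continuous_intros)
  have cx: "continuous_on UNIV (\<lambda>u. X' (chart u) (w u))" if "continuous_on UNIV w" for w
    by (rule continuous_derivative_apply[where S = S2S1, OF linc cX' continuous_chart _ that]) (auto simp: chart_mem)
  \<comment> \<open>The coordinate components of the field times the density
    \<open>sin (u$1)\<close>; in \<open>F2\<close> the density cancels against the length of the
    second coordinate vector.\<close>
  define F1 where "F1 u = sin (u$1) * (h u \<bullet> chart_frame 1 u)" for u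
  define D1 where "D1 u = cos (u$1) * (h u \<bullet> chart_frame 1 u) + sin (u$1) * (X' (chart u) (chart_frame 1 u) \<bullet> chart_frame 1 u)" for u
  define F2 where "F2 u = h u \<bullet> unit_frame2 u" for u
  define D2 where "D2 u = X' (chart u) (chart_frame 2 u) \<bullet> unit_frame2 u - cos (u$1) * (h u \<bullet> chart_frame 1 u)" for u
  define F3 where "F3 u = sin (u$1) * (h u \<bullet> chart_frame 3 u)" for u
  define D3 where "D3 u = sin (u$1) * (X' (chart u) (chart_frame 3 u) \<bullet> chart_frame 3 u)" for u
  have c1: "continuous_on UNIV D1" and c2: "continuous_on UNIV D2" and c3: "continuous_on UNIV D3"
    unfolding D1_def D2_def D3_def by (intro continuous_intros ch cf ce cx)+
  have v1: "((\<lambda>t. vector [t, y, z] :: real^3) has_derivative (\<lambda>t. t *\<^sub>R axis 1 1)) (at x)"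
    and v2: "((\<lambda>t. vector [x, t, z] :: real^3) has_derivative (\<lambda>t. t *\<^sub>R axis 2 1)) (at y)"
    and v3: "((\<lambda>t. vector [x, y, t] :: real^3) has_derivative (\<lambda>t. t *\<^sub>R axis 3 1)) (at z)" for x y z :: real
    unfolding vector_3_eq_axis
    by ((rule has_derivative_eq_rhs, (rule derivative_intros)+, rule ext, simp)+)
  have ax: "axis i (1::real) $ j = (if i = j then 1 else 0)" for i j :: 3 by (simp add: axis_def)
  have h1: "((\<lambda>t. h (vector [t, y, z])) has_derivative (\<lambda>t. t *\<^sub>R X' (chart (vector [x, y, z])) (chart_frame 1 (vector [x, y, z])))) (at x)"
    and h2: "((\<lambda>t. h (vector [x, t, z])) has_derivative (\<lambda>t. t *\<^sub>R X' (chart (vector [x, y, z])) (chart_frame 2 (vector [x, y, z])))) (at y)"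
    and h3: "((\<lambda>t. h (vector [x, y, t])) has_derivative (\<lambda>t. t *\<^sub>R X' (chart (vector [x, y, z])) (chart_frame 3 (vector [x, y, z])))) (at z)"
    for x y z
    using has_derivative_compose[OF v1 dh, of y z x] has_derivative_compose[OF v2 dh, of x z y] has_derivative_compose[OF v3 dh, of x y z]
    by (simp_all add: ax linear_cmul[OF linc] del: chart_frame_simps)
  have f1: "((\<lambda>t. chart_frame 1 (vector [t, y, z])) has_derivative (\<lambda>t. t *\<^sub>R - (fst (chart (vector [x, y, z])), 0))) (at x)"
    and f2: "((\<lambda>t. unit_frame2 (vector [x, t, z])) has_derivative (\<lambda>t. t *\<^sub>R - (sin x *\<^sub>R (fst (chart (vector [x, y, z])), 0) + cos x *\<^sub>R chart_frame 1 (vector [x, y, z])))) (at y)"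
    and f3: "((\<lambda>t. chart_frame 3 (vector [x, y, t])) has_derivative (\<lambda>t. t *\<^sub>R - (0, snd (chart (vector [x, y, z]))))) (at z)"
    for x y z
  proof -
    have e: "sin x * (sin x * c) + cos x * (cos x * c) = c" for c :: real
    proof -
      have "sin x * (sin x * c) + cos x * (cos x * c) = ((sin x)\<^sup>2 + (cos x)\<^sup>2) * c"
        by (simp only: power2_eq_square distrib_right mult.assoc)
      then show ?thesis by simp
    qed
    have N: "sin x *\<^sub>R (fst (chart (vector [x, y, z])), 0) + cos x *\<^sub>R chart_frame 1 (vector [x, y, z]) = (vector [cos y, sin y, 0], 0)"
      by (simp add: vec_eq_iff forall_3 chart_def e)
    show "((\<lambda>t. chart_frame 1 (vector [t, y, z])) has_derivative (\<lambda>t. t *\<^sub>R - (fst (chart (vector [x, y, z])), 0))) (at x)"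
      unfolding chart_frame_simps vector_3_eq_axis chart_def
      by (rule has_derivative_eq_rhs, (rule derivative_intros has_derivative_Pair)+, rule ext) (auto simp: vec_eq_iff forall_3 ax)
    show "((\<lambda>t. unit_frame2 (vector [x, t, z])) has_derivative (\<lambda>t. t *\<^sub>R - (sin x *\<^sub>R (fst (chart (vector [x, y, z])), 0) + cos x *\<^sub>R chart_frame 1 (vector [x, y, z])))) (at y)"
      unfolding N unfolding unit_frame2_def vector_3_eq_axis
      by (rule has_derivative_eq_rhs, (rule derivative_intros has_derivative_Pair)+, rule ext) (auto simp: vec_eq_iff forall_3 ax)
    show "((\<lambda>t. chart_frame 3 (vector [x, y, t])) has_derivative (\<lambda>t. t *\<^sub>R - (0, snd (chart (vector [x, y, z]))))) (at z)"
      unfolding chart_frame_simps vector_3_eq_axis chart_def cis_eq_scaleR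
      by (rule has_derivative_eq_rhs, (rule derivative_intros has_derivative_Pair)+, rule ext) (auto simp: vec_eq_iff forall_3 ax algebra_simps)
  qed
  have z1: "(\<integral>u. indicator chart_dom u * D1 u \<partial>lborel) = 0"
  proof (rule chart_dom_partial_zero[where F = F1, OF c1], rule disjI1, intro conjI allI)
    fix x y z
    show "((\<lambda>t. F1 (vector [t, y, z])) has_real_derivative D1 (vector [x, y, z])) (at x)"
      unfolding F1_def D1_def has_field_derivative_def vector_3
      by (rule has_derivative_eq_rhs, (rule derivative_intros h1 f1)+, rule ext)
         (use h_orth(1)[of "vector [x, y, z]"] in \<open>simp add: inner_Pair_0 algebra_simps del: chart_frame_simps\<close>)
  qed (simp_all add: F1_def)
  have z2: "(\<integral>u. indicator chart_dom u * D2 u \<partial>lborel) = 0"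
  proof (rule chart_dom_partial_zero[where F = F2, OF c2], rule disjI2, rule disjI1, intro conjI allI)
    fix x y z
    show "((\<lambda>t. F2 (vector [x, t, z])) has_real_derivative D2 (vector [x, y, z])) (at y)"
      unfolding F2_def D2_def has_field_derivative_def vector_3
      by (rule has_derivative_eq_rhs, (rule derivative_intros h2 f2)+, rule ext)
         (use h_orth(1)[of "vector [x, y, z]"] in \<open>simp add: inner_Pair_0 inner_diff_right inner_add_right algebra_simps del: chart_frame_simps\<close>)
    have "chart (vector [x, 2 * pi, z]) = chart (vector [x, 0, z])" by (simp add: chart_def)
    then show "F2 (vector [x, 2 * pi, z]) = F2 (vector [x, 0, z])" by (simp add: F2_def h_def unit_frame2_def)
  qed
  have z3: "(\<integral>u. indicator chart_dom u * D3 u \<partial>lborel) = 0"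
  proof (rule chart_dom_partial_zero[where F = F3, OF c3], rule disjI2, rule disjI2, intro conjI allI)
    fix x y z
    show "((\<lambda>t. F3 (vector [x, y, t])) has_real_derivative D3 (vector [x, y, z])) (at z)"
      unfolding F3_def D3_def has_field_derivative_def vector_3
      by (rule has_derivative_eq_rhs, (rule derivative_intros h3 f3)+, rule ext)
         (use h_orth(2)[of "vector [x, y, z]"] in \<open>simp add: inner_Pair_0 algebra_simps del: chart_frame_simps\<close>)
    have "chart (vector [x, y, 2 * pi]) = chart (vector [x, y, 0])" by (simp add: chart_def)
    then show "F3 (vector [x, y, 2 * pi]) = F3 (vector [x, y, 0])" by (simp add: F3_def h_def)
  qed
  \<comment> \<open>The extension is constant along the rays of either factor.\<close>
  have normal: "X' (chart u) (fst (chart u), 0) = 0" "X' (chart u) (0, snd (chart u)) = 0" for u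
  proof -
    have "proj (chart u) (fst (chart u), 0) = 0" "proj (chart u) (0, snd (chart u)) = 0"
      using chart_mem[of u] by (simp_all add: proj_def zero_prod_def)
    then show "X' (chart u) (fst (chart u), 0) = 0" "X' (chart u) (0, snd (chart u)) = 0"
      using has_derivative_retr_proj[OF chart_mem D, of u] linear_0[OF linc] by metis+
  qed
  have tr: "sin (u$1) * field_trace X' (chart u) = D1 u + D2 u + D3 u" for u
    unfolding field_trace_def trace_frame[OF linc, where u = u] normal D1_def D2_def D3_def chart_frame_2 linear_cmul[OF linc]
    by (simp add: algebra_simps del: chart_frame_simps)
  have "continuous_on S2S1 (field_trace X')"
    unfolding field_trace_def by (intro continuous_intros cX')
  then have "field_trace X' \<in> borel_measurable (restrict_space borel S2S1)"
    by (rule borel_measurable_continuous_on_restrict)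
  then have "(\<integral>p. field_trace X' p \<partial>\<mu>0) = (\<integral>u. indicator chart_dom u * (D1 u + D2 u + D3 u) \<partial>lborel)"
    by (simp add: integral_mu0 tr)
  also have "\<dots> = 0"
    using integrable_chart_dom[OF c1] integrable_chart_dom[OF c2] integrable_chart_dom[OF c3] z1 z2 z3
    by (simp add: distrib_left)
  finally show ?thesis .
qed

text \<open>The derivative is that of the degree zero homogeneous extension, so the gradient \<open>W\<close> is tangential.\<close>

definition has_grad :: "(ambient \<Rightarrow> real) \<Rightarrow> vfield \<Rightarrow> bool" where
  "has_grad f W \<longleftrightarrow>
     (\<forall>p\<in>S2S1. W p \<in> tangent p \<and> ((\<lambda>z. f (retr z)) has_derivative (\<lambda>v. W p \<bullet> v)) (at p)) \<and> continuous_on S2S1 W"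

text \<open>The divergence theorem for the product \<open>f p *\<^sub>R X p\<close>.\<close>

lemma integration_by_parts:
  assumes f: "has_grad f W" and X: "C1_field X X'"
  shows "(\<integral>p. W p \<bullet> X p \<partial>\<mu>0) = - (\<integral>p. f p * field_trace X' p \<partial>\<mu>0)"
proof -
  have D: "((\<lambda>z. X (retr z)) has_derivative X' p) (at p)" and Df: "((\<lambda>z. f (retr z)) has_derivative (\<lambda>v. W p \<bullet> v)) (at p)"
    if "p \<in> S2S1" for p using assms that by (auto simp: C1_field_def has_grad_def)
  have cX: "continuous_on S2S1 X" and cf: "continuous_on S2S1 f"
    using continuous_on_retr_derivative[OF D] continuous_on_retr_derivative[OF Df] by auto
  have cW: "continuous_on S2S1 W" and cX': "continuous_on S2S1 (\<lambda>p. X' p v)" for v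
    using assms unfolding C1_field_def has_grad_def by blast+
  have "C1_field (\<lambda>p. f p *\<^sub>R X p) (\<lambda>p v. f p *\<^sub>R X' p v + (W p \<bullet> v) *\<^sub>R X p)"
    unfolding C1_field_def
  proof (intro conjI ballI allI)
    fix p assume p: "p \<in> S2S1"
    show "f p *\<^sub>R X p \<in> tangent p" using X p by (auto simp: C1_field_def tangent_def)
    show "((\<lambda>z. f (retr z) *\<^sub>R X (retr z)) has_derivative (\<lambda>v. f p *\<^sub>R X' p v + (W p \<bullet> v) *\<^sub>R X p)) (at p)"
      by (rule has_derivative_eq_rhs[OF has_derivative_scaleR[OF Df[OF p] D[OF p]]]) (simp add: retr_ident[OF p])
  qed (intro continuous_intros cf cX cW cX')
  from divergence_S2S1[OF this] have "(\<integral>p. field_trace (\<lambda>p v. f p *\<^sub>R X' p v + (W p \<bullet> v) *\<^sub>R X p) p \<partial>\<mu>0) = 0" .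
  moreover have "field_trace (\<lambda>p v. f p *\<^sub>R X' p v + (W p \<bullet> v) *\<^sub>R X p) p = f p * field_trace X' p + W p \<bullet> X p" for p
    unfolding field_trace_def
    by (simp add: inner_add_left sum.distrib sum_distrib_left euclidean_inner[of "W p" "X p"])
  moreover have "integrable \<mu>0 (\<lambda>p. f p * field_trace X' p)" "integrable \<mu>0 (\<lambda>p. W p \<bullet> X p)"
    unfolding field_trace_def by (intro integrable_mu0_continuous continuous_intros cf cX' cW cX)+
  ultimately show ?thesis by simp
qed

section \<open>Green's identity\<close>

lemma has_gradD: "has_grad f W \<Longrightarrow> p \<in> S2S1 \<Longrightarrow> ((\<lambda>z. f (retr z)) has_derivative (\<lambda>v. W p \<bullet> v)) (at p)"
  and has_grad_tangent: "has_grad f W \<Longrightarrow> p \<in> S2S1 \<Longrightarrow> W p \<in> tangent p"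
  and has_grad_continuous: "has_grad f W \<Longrightarrow> continuous_on S2S1 W"
  by (auto simp: has_grad_def)

lemma has_grad_continuous_on: "has_grad f W \<Longrightarrow> continuous_on S2S1 f"
  by (rule continuous_on_retr_derivative) (erule has_gradD)

lemma has_grad_const: "has_grad (\<lambda>_. c) (\<lambda>_. 0)"
  by (auto simp: has_grad_def tangent_def)

lemma has_grad_add:
  assumes "has_grad f W" "has_grad f2 W2"
  shows "has_grad (\<lambda>p. f p + f2 p) (\<lambda>p. W p + W2 p)"
  unfolding has_grad_def
proof (intro conjI ballI)
  fix p assume p: "p \<in> S2S1"
  show "W p + W2 p \<in> tangent p"
    using assms[THEN has_grad_tangent, OF p] by (auto simp: tangent_def inner_add_left)
  show "((\<lambda>z. f (retr z) + f2 (retr z)) has_derivative (\<lambda>v. (W p + W2 p) \<bullet> v)) (at p)"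
    using has_derivative_add[OF assms[THEN has_gradD, OF p]] by (simp add: inner_add_left)
qed (intro continuous_intros assms[THEN has_grad_continuous])

lemma has_grad_mult:
  assumes "has_grad f W" "has_grad f2 W2"
  shows "has_grad (\<lambda>p. f p * f2 p) (\<lambda>p. f p *\<^sub>R W2 p + f2 p *\<^sub>R W p)"
  unfolding has_grad_def
proof (intro conjI ballI)
  fix p assume p: "p \<in> S2S1"
  show "f p *\<^sub>R W2 p + f2 p *\<^sub>R W p \<in> tangent p"
    using assms[THEN has_grad_tangent, OF p] by (auto simp: tangent_def inner_add_left)
  show "((\<lambda>z. f (retr z) * f2 (retr z)) has_derivative (\<lambda>v. (f p *\<^sub>R W2 p + f2 p *\<^sub>R W p) \<bullet> v)) (at p)"
    using has_derivative_mult[OF assms[THEN has_gradD, OF p]] p by (simp add: inner_add_left retr_ident algebra_simps)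
qed (intro continuous_intros assms[THEN has_grad_continuous] assms[THEN has_grad_continuous_on])

lemma has_grad_cmult: "has_grad f W \<Longrightarrow> has_grad (\<lambda>p. c * f p) (\<lambda>p. c *\<^sub>R W p)"
  using has_grad_mult[OF has_grad_const[of c]] by fastforce

lemma has_grad_sum:
  assumes "\<And>i. i \<in> I \<Longrightarrow> has_grad (f i) (W i)"
  shows "has_grad (\<lambda>p. \<Sum>i\<in>I. f i p) (\<lambda>p. \<Sum>i\<in>I. W i p)"
  using assms
proof (induction I rule: infinite_finite_induct)
  case (insert i I)
  then show ?case using has_grad_add[of "f i" "W i" "\<lambda>p. \<Sum>i\<in>I. f i p" "\<lambda>p. \<Sum>i\<in>I. W i p"] by simp
qed (auto intro: has_grad_const)

lemma has_grad_compose: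
  assumes f: "has_grad f W" and d: "\<And>p. p \<in> S2S1 \<Longrightarrow> (\<phi> has_real_derivative \<phi>' (f p)) (at (f p))"
    and c: "continuous_on (f ` S2S1) \<phi>'"
  shows "has_grad (\<lambda>p. \<phi> (f p)) (\<lambda>p. \<phi>' (f p) *\<^sub>R W p)"
  unfolding has_grad_def
proof (intro conjI ballI)
  fix p assume p: "p \<in> S2S1"
  show "\<phi>' (f p) *\<^sub>R W p \<in> tangent p"
    using has_grad_tangent[OF f p] by (auto simp: tangent_def)
  have "(\<phi> has_derivative (*) (\<phi>' (f p))) (at (f (retr p)))"
    using d[OF p] by (simp add: retr_ident[OF p] has_field_derivative_def)
  from has_derivative_compose[OF has_gradD[OF f p] this]
  show "((\<lambda>z. \<phi> (f (retr z))) has_derivative (\<lambda>v. (\<phi>' (f p) *\<^sub>R W p) \<bullet> v)) (at p)" by simp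
qed (intro continuous_intros continuous_on_compose2[OF c] has_grad_continuous[OF f] has_grad_continuous_on[OF f] subset_refl)

lemma has_grad_inner: "has_grad (\<lambda>p. y \<bullet> fst p) (\<lambda>p. proj p (y, 0))"
  unfolding has_grad_def
proof (intro conjI ballI)
  fix p assume p: "p \<in> S2S1"
  have "((\<lambda>q. y \<bullet> fst q) has_derivative (\<lambda>v. y \<bullet> fst v)) (at p)" by (auto intro!: derivative_eq_intros)
  from has_derivative_on_S2S1[OF p this, of "\<lambda>q. y \<bullet> fst q"]
  have "((\<lambda>z. y \<bullet> fst (retr z)) has_derivative (\<lambda>v. y \<bullet> fst (proj p v))) (at p)" by simp
  moreover have "y \<bullet> fst (proj p v) = proj p (y, 0) \<bullet> v" for v
    unfolding proj_adjoint by (simp add: inner_prod_def)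
  ultimately show "((\<lambda>z. y \<bullet> fst (retr z)) has_derivative (\<lambda>v. proj p (y, 0) \<bullet> v)) (at p)" by simp
  show "proj p (y, 0) \<in> tangent p" by (rule proj_tangent[OF p])
qed (auto simp: proj_def intro!: continuous_intros)

lemma proj_inner_self:
  "p \<in> S2S1 \<Longrightarrow> y \<in> S2 \<Longrightarrow> proj p (y, 0) \<bullet> proj p (y, 0) = 1 - (y \<bullet> fst p)\<^sup>2"
  by (simp add: proj_def inner_simps S2_def norm_eq_1 inner_commute power2_eq_square)

definition proj_deriv :: "ambient \<Rightarrow> ambient \<Rightarrow> ambient \<Rightarrow> ambient" where
  "proj_deriv w p v = (- ((fst w \<bullet> fst (proj p v)) *\<^sub>R fst p + (fst w \<bullet> fst p) *\<^sub>R fst (proj p v)),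
     - ((snd w \<bullet> snd (proj p v)) *\<^sub>R snd p + (snd w \<bullet> snd p) *\<^sub>R snd (proj p v)))"

lemma C1_field_proj: "C1_field (\<lambda>p. proj p w) (proj_deriv w)"
  unfolding C1_field_def
proof (intro conjI ballI allI)
  fix p assume p: "p \<in> S2S1"
  show "proj p w \<in> tangent p" by (rule proj_tangent[OF p])
  show "((\<lambda>z. proj (retr z) w) has_derivative proj_deriv w p) (at p)"
    using has_derivative_proj_field[OF p, of w] by (simp add: proj_deriv_def[abs_def])
qed (auto simp: proj_deriv_def proj_def intro!: continuous_intros)

text \<open>The field \<open>proj p w\<close> is the gradient of \<open>w \<bullet> p\<close>, and
  linear functions are eigenfunctions of the Laplacian: with eigenvalue -2 on the sphere and -1 on
  the circle.\<close>

lemma field_trace_proj: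
  assumes p: "p \<in> S2S1"
  shows "field_trace (proj_deriv w) p = - 2 * (fst w \<bullet> fst p) - (snd w \<bullet> snd p)"
proof -
  have a: "(\<Sum>b\<in>Basis. (fst w \<bullet> fst (proj p (b, 0))) * (fst p \<bullet> b)) = 0"
  proof -
    have "(\<Sum>b\<in>Basis. (fst w \<bullet> fst (proj p (b, 0))) * (fst p \<bullet> b)) = (\<Sum>b\<in>Basis. (fst (proj p (fst w, 0)) \<bullet> b) * (fst p \<bullet> b))"
      by (intro sum.cong refl) (simp add: proj_def inner_simps inner_commute)
    also have "\<dots> = fst (proj p (fst w, 0)) \<bullet> fst p" by (rule euclidean_inner[symmetric])
    finally show ?thesis using p by (simp add: proj_def inner_simps)
  qed
  have b: "(\<Sum>b\<in>Basis. (snd w \<bullet> snd (proj p (0, b))) * (snd p \<bullet> b)) = 0"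
  proof -
    have "(\<Sum>b\<in>Basis. (snd w \<bullet> snd (proj p (0, b))) * (snd p \<bullet> b)) = (\<Sum>b\<in>Basis. (snd (proj p (0, snd w)) \<bullet> b) * (snd p \<bullet> b))"
      by (intro sum.cong refl) (simp add: proj_def inner_simps inner_commute)
    also have "\<dots> = snd (proj p (0, snd w)) \<bullet> snd p" by (rule euclidean_inner[symmetric])
    finally show ?thesis using p by (simp add: proj_def inner_simps)
  qed
  have c: "fst (proj p (b, 0)) \<bullet> b = fst (proj p (b, 0)) \<bullet> fst (proj p (b, 0))"
    and d: "snd (proj p (0, c)) \<bullet> c = snd (proj p (0, c)) \<bullet> snd (proj p (0, c))" for b c
    using p by (simp_all add: proj_def inner_simps inner_commute)
  have "field_trace (proj_deriv w) p =
      - ((\<Sum>b\<in>Basis. (fst w \<bullet> fst (proj p (b, 0))) * (fst p \<bullet> b)) + (fst w \<bullet> fst p) * (\<Sum>b\<in>Basis. fst (proj p (b, 0)) \<bullet> fst (proj p (b, 0))))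
      - ((\<Sum>b\<in>Basis. (snd w \<bullet> snd (proj p (0, b))) * (snd p \<bullet> b)) + (snd w \<bullet> snd p) * (\<Sum>b\<in>Basis. snd (proj p (0, b)) \<bullet> snd (proj p (0, b))))"
    unfolding field_trace_def sum_Basis_prod_split proj_deriv_def
    by (simp add: inner_Pair_0 inner_diff_left c d sum_negf sum_subtractf sum_distrib_left)
  then show ?thesis by (simp add: a b trace_proj_fst[OF p] trace_proj_snd[OF p])
qed

lemma abs_inner_S2_le: "p \<in> S2S1 \<Longrightarrow> y \<in> S2 \<Longrightarrow> \<bar>y \<bullet> fst p\<bar> \<le> 1"
  using Cauchy_Schwarz_ineq2[of y "fst p"] by (simp add: S2_def mem_S2S1_iff)

lemma inner_S2_sq_le: "p \<in> S2S1 \<Longrightarrow> y \<in> S2 \<Longrightarrow> (y \<bullet> fst p)\<^sup>2 \<le> 1"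
  using abs_inner_S2_le by (simp add: abs_square_le_1)

lemma inner_S2_image: "y \<in> S2 \<Longrightarrow> (\<lambda>p. y \<bullet> fst p) ` S2S1 \<subseteq> {-1..1}"
  using abs_inner_S2_le by (fastforce simp: abs_le_iff)

text \<open>If \<open>\<phi>1\<close> is the derivative of a function \<phi> and
  \<open>t = y \<bullet> fst p\<close>, the factor after \<open>u p\<close> is the Laplacian of
  \<phi>(t), because |grad t|^2 = 1 - t^2 and the Laplacian of t is -2 t. The identity is
  integration by parts of \<open>u\<close> times \<open>\<phi>1 t\<close> against the gradient of
  \<open>t\<close>.\<close>

lemma green_weighted:
  assumes u: "has_grad u U" and y: "y \<in> S2"
    and d: "\<And>t. \<bar>t\<bar> \<le> 1 \<Longrightarrow> (\<phi>1 has_real_derivative \<phi>2 t) (at t)" and c: "continuous_on {-1..1} \<phi>2"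
  shows "(\<integral>p. \<phi>1 (y \<bullet> fst p) * (U p \<bullet> proj p (y, 0))
      + u p * ((1 - (y \<bullet> fst p)\<^sup>2) * \<phi>2 (y \<bullet> fst p) - 2 * (y \<bullet> fst p) * \<phi>1 (y \<bullet> fst p)) \<partial>\<mu>0) = 0"
proof -
  have g: "has_grad (\<lambda>p. \<phi>1 (y \<bullet> fst p)) (\<lambda>p. \<phi>2 (y \<bullet> fst p) *\<^sub>R proj p (y, 0))"
    by (rule has_grad_compose[OF has_grad_inner]) (use d abs_inner_S2_le[OF _ y] in auto, rule continuous_on_subset[OF c inner_S2_image[OF y]])
  note gu = has_grad_mult[OF u g]
  let ?W = "\<lambda>p. u p *\<^sub>R \<phi>2 (y \<bullet> fst p) *\<^sub>R proj p (y, 0) + \<phi>1 (y \<bullet> fst p) *\<^sub>R U p"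
  let ?T = "\<lambda>p. u p * \<phi>1 (y \<bullet> fst p) * field_trace (proj_deriv (y, 0)) p"
  have ibp: "(\<integral>p. ?W p \<bullet> proj p (y, 0) \<partial>\<mu>0) = - (\<integral>p. ?T p \<partial>\<mu>0)"
    by (rule integration_by_parts[OF gu C1_field_proj])
  have i: "integrable \<mu>0 (\<lambda>p. ?W p \<bullet> proj p (y, 0))" "integrable \<mu>0 ?T"
    unfolding field_trace_def
    by (intro integrable_mu0_continuous continuous_intros has_grad_continuous[OF gu] has_grad_continuous_on[OF gu]
        has_grad_continuous[OF has_grad_inner] C1_field_proj[unfolded C1_field_def, THEN conjunct2, rule_format])+
  have "(\<integral>p. \<phi>1 (y \<bullet> fst p) * (U p \<bullet> proj p (y, 0))
      + u p * ((1 - (y \<bullet> fst p)\<^sup>2) * \<phi>2 (y \<bullet> fst p) - 2 * (y \<bullet> fst p) * \<phi>1 (y \<bullet> fst p)) \<partial>\<mu>0)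
     = (\<integral>p. ?W p \<bullet> proj p (y, 0) + ?T p \<partial>\<mu>0)"
    using y by (intro Bochner_Integration.integral_cong refl)
      (simp add: field_trace_proj inner_add_left proj_inner_self algebra_simps)
  also have "\<dots> = 0" using i ibp by simp
  finally show ?thesis .
qed

section \<open>Integrals of functions of the height \<open>y \<bullet> fst p\<close>\<close>

lemma green_radial:
  assumes "y \<in> S2" "\<And>t. \<bar>t\<bar> \<le> 1 \<Longrightarrow> (\<phi>1 has_real_derivative \<phi>2 t) (at t)" "continuous_on {-1..1} \<phi>2"
  shows "(\<integral>p. (1 - (y \<bullet> fst p)\<^sup>2) * \<phi>2 (y \<bullet> fst p) - 2 * (y \<bullet> fst p) * \<phi>1 (y \<bullet> fst p) \<partial>\<mu>0) = 0"
  using green_weighted[OF has_grad_const[of 1] assms] by simp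

text \<open>Green's identity for \<open>\<phi>1 t = t ^ (2 * k + 1)\<close> is the recursion (2k +
  1) m_k = (2k + 3) m_(k+1) between successive moments.\<close>

lemma integral_even_moment:
  assumes y: "y \<in> S2"
  shows "(\<integral>p. (y \<bullet> fst p) ^ (2 * k) \<partial>\<mu>0) = 8 * pi\<^sup>2 / (2 * real k + 1)"
proof (induction k)
  case 0
  show ?case by (simp add: measure_mu0)
next
  case (Suc k)
  let ?t = "\<lambda>p::ambient. y \<bullet> fst p"
  have "(\<integral>p. (1 - (?t p)\<^sup>2) * ((2 * real k + 1) * (?t p) ^ (2 * k)) - 2 * ?t p * (?t p) ^ (2 * k + 1) \<partial>\<mu>0) = 0"
    by (rule green_radial[OF y], rule DERIV_cong[OF DERIV_pow]) (auto intro!: continuous_intros)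
  moreover have "(1 - (?t p)\<^sup>2) * ((2 * real k + 1) * (?t p) ^ (2 * k)) - 2 * ?t p * (?t p) ^ (2 * k + 1)
      = (2 * real k + 1) * (?t p) ^ (2 * k) - (2 * real k + 3) * (?t p) ^ (2 * Suc k)" for p
    by (simp add: algebra_simps power2_eq_square)
  moreover have "(\<integral>p. c * (?t p) ^ m - d * (?t p) ^ n \<partial>\<mu>0) = c * (\<integral>p. (?t p) ^ m \<partial>\<mu>0) - d * (\<integral>p. (?t p) ^ n \<partial>\<mu>0)" for c d m n
    by (subst Bochner_Integration.integral_diff) (auto intro!: integrable_mu0_continuous continuous_intros)
  ultimately have "(2 * real k + 1) * (\<integral>p. (?t p) ^ (2 * k) \<partial>\<mu>0) = (2 * real k + 3) * (\<integral>p. (?t p) ^ (2 * Suc k) \<partial>\<mu>0)"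
    by (simp only: diff_eq_eq add_0)
  then have "8 * pi\<^sup>2 = (2 * real k + 3) * (\<integral>p. (?t p) ^ (2 * Suc k) \<partial>\<mu>0)"
    unfolding Suc.IH by (simp add: add_nonneg_eq_0_iff)
  then have "(\<integral>p. (?t p) ^ (2 * Suc k) \<partial>\<mu>0) = 8 * pi\<^sup>2 / (2 * real k + 3)"
    by (simp only: nonzero_eq_divide_eq) (simp add: mult.commute add_nonneg_eq_0_iff)
  then show ?case by (simp add: algebra_simps)
qed

lemma nn_integral_even_moment:
  assumes y: "y \<in> S2"
  shows "(\<integral>\<^sup>+p. ennreal ((y \<bullet> fst p) ^ (2 * k)) \<partial>\<mu>0) = ennreal (8 * pi\<^sup>2 / (2 * real k + 1))"
  unfolding integral_even_moment[OF y, symmetric]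
  by (rule nn_integral_eq_integral) (auto intro!: integrable_mu0_continuous continuous_intros)

lemma borel_measurable_inner_mu0 [measurable]: "(\<lambda>p. y \<bullet> fst p) \<in> borel_measurable \<mu>0"
  by (intro borel_measurable_mu0_continuous continuous_intros)

lemma tendsto_divide_odd: "(\<lambda>k. c / (2 * real k + 1)) \<longlonglongrightarrow> 0"
  by (rule real_tendsto_divide_at_top[OF tendsto_const], rule filterlim_at_top_mono[OF filterlim_real_sequentially]) simp

text \<open>The indicator of the two poles lies below every even power of the height, and the even
  moments tend to zero.\<close>

lemma AE_inner_sq_less_1:
  assumes y: "y \<in> S2" shows "AE p in \<mu>0. (y \<bullet> fst p)\<^sup>2 < 1"
proof -
  let ?N = "{p \<in> space \<mu>0. (y \<bullet> fst p)\<^sup>2 = 1}"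
  have N: "?N \<in> sets \<mu>0" by measurable
  have le: "emeasure \<mu>0 ?N \<le> ennreal (8 * pi\<^sup>2 / (2 * real k + 1))" for k
  proof -
    have "emeasure \<mu>0 ?N = (\<integral>\<^sup>+p. indicator ?N p \<partial>\<mu>0)" using N by simp
    also have "\<dots> \<le> (\<integral>\<^sup>+p. ennreal ((y \<bullet> fst p) ^ (2 * k)) \<partial>\<mu>0)"
      by (intro nn_integral_mono) (auto simp: indicator_def power_mult)
    finally show ?thesis unfolding nn_integral_even_moment[OF y] .
  qed
  have "(\<lambda>k. 8 * pi\<^sup>2 / (2 * real k + 1)) \<longlonglongrightarrow> 0" by (rule tendsto_divide_odd)
  then have "(\<lambda>k. ennreal (8 * pi\<^sup>2 / (2 * real k + 1))) \<longlonglongrightarrow> ennreal 0" by (rule tendsto_ennrealI)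
  then have "emeasure \<mu>0 ?N \<le> ennreal 0"
    by (rule tendsto_lowerbound[OF _ always_eventually[OF allI[OF le]]]) simp
  then have "emeasure \<mu>0 ?N = 0" by simp
  then have "AE p in \<mu>0. (y \<bullet> fst p)\<^sup>2 \<noteq> 1" using N by (intro AE_I[of _ _ ?N]) auto
  then show ?thesis
  proof (rule AE_mp, intro AE_I2 impI)
    fix p assume "p \<in> space \<mu>0" "(y \<bullet> fst p)\<^sup>2 \<noteq> 1"
    then show "(y \<bullet> fst p)\<^sup>2 < 1" using inner_S2_sq_le[of p y] y by simp
  qed
qed

text \<open>Partial fractions give 2 (1/(2k+2) - 1/(2k+3)). Adding and subtracting 1/(2k+1) splits
  this into a telescoping series with sum 1 and the alternating harmonic series with sum
  \<open>ln 2\<close>.\<close>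

lemma log_moment_sums: "(\<lambda>k. 1 / ((real k + 1) * (2 * real k + 3))) sums (2 - 2 * ln 2)"
proof -
  have t: "(\<lambda>k. 1 / (2 * real k + 1) - 1 / (2 * real (Suc k) + 1)) sums (1 / (2 * real 0 + 1) - 0)"
    by (rule telescope_sums'[OF tendsto_divide_odd])
  have "(\<lambda>k. 2 * ((1 / (2 * real k + 1) - 1 / (2 * real (Suc k) + 1)) - (inverse (real (2 * k + 1)) - inverse (real (2 * k + 2)))))
     sums (2 * ((1 / (2 * real 0 + 1) - 0) - ln 2))"
    by (intro sums_mult sums_diff t alternating_harmonic_series_sums')
  moreover have "2 * ((1 / (2 * real k + 1) - 1 / (2 * real (Suc k) + 1)) - (inverse (real (2 * k + 1)) - inverse (real (2 * k + 2))))
     = 1 / ((real k + 1) * (2 * real k + 3))" for k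
    by (simp add: divide_simps) (simp add: algebra_simps)
  ultimately show ?thesis by simp
qed

lemma neg_ln_one_minus_sums:
  fixes s :: real assumes "0 \<le> s" "s < 1"
  shows "(\<lambda>k. s ^ Suc k / (real k + 1)) sums (- ln (1 - s))"
proof -
  have "summable (\<lambda>k. s ^ Suc k / (real k + 1))"
  proof (rule summable_comparison_test'[where N = 0])
    show "summable (\<lambda>k. s ^ Suc k)" using assms by simp
    show "norm (s ^ Suc k / (real k + 1)) \<le> s ^ Suc k" for k
      using assms by (simp add: divide_le_eq mult_left_le[of _ "s * s ^ k"] algebra_simps)
  qed
  moreover have "(-1) ^ n * (1 / real (n + 1)) * (1 - s - 1) ^ Suc n = - (s ^ Suc n / (real n + 1))" for n
  proof -
    have "(-1::real) ^ n * (- s) ^ Suc n = - (s ^ Suc n)"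
      by (cases "even n") auto
    then show ?thesis by (simp add: field_simps)
  qed
  ultimately show ?thesis
    using ln_series[of "1 - s"] assms by (simp add: suminf_minus sums_iff)
qed

text \<open>The logarithm is expanded in even powers of the height and integrated termwise; all
  terms are non-negative. The resulting series of moments is \<open>log_moment_sums\<close>.\<close>

lemma nn_integral_neg_ln:
  assumes y: "y \<in> S2"
  shows "(\<integral>\<^sup>+p. ennreal (- ln (1 - (y \<bullet> fst p)\<^sup>2)) \<partial>\<mu>0) = ennreal (8 * pi\<^sup>2 * (2 - 2 * ln 2))"
proof -
  have "(\<integral>\<^sup>+p. ennreal (- ln (1 - (y \<bullet> fst p)\<^sup>2)) \<partial>\<mu>0) = (\<integral>\<^sup>+p. (\<Sum>k. ennreal (1 / (real k + 1) * (y \<bullet> fst p) ^ (2 * Suc k))) \<partial>\<mu>0)"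
  proof (rule nn_integral_cong_AE, rule AE_mp[OF AE_inner_sq_less_1[OF y]], intro AE_I2 impI)
    fix p assume "(y \<bullet> fst p)\<^sup>2 < 1"
    from neg_ln_one_minus_sums[OF _ this]
    have "(\<lambda>k. 1 / (real k + 1) * (y \<bullet> fst p) ^ (2 * Suc k)) sums (- ln (1 - (y \<bullet> fst p)\<^sup>2))"
      unfolding power_mult by simp
    moreover have "0 \<le> 1 / (real k + 1) * (y \<bullet> fst p) ^ (2 * Suc k)" for k unfolding power_mult by simp
    ultimately show "ennreal (- ln (1 - (y \<bullet> fst p)\<^sup>2)) = (\<Sum>k. ennreal (1 / (real k + 1) * (y \<bullet> fst p) ^ (2 * Suc k)))"
      by (intro suminf_ennreal_eq[symmetric])
  qed
  also have "\<dots> = (\<Sum>k. \<integral>\<^sup>+p. ennreal (1 / (real k + 1) * (y \<bullet> fst p) ^ (2 * Suc k)) \<partial>\<mu>0)"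
    by (rule nn_integral_suminf) measurable
  also have "\<dots> = (\<Sum>k. ennreal (8 * pi\<^sup>2 * (1 / ((real k + 1) * (2 * real k + 3)))))"
  proof (rule suminf_cong)
    fix k
    have "(\<integral>\<^sup>+p. ennreal (1 / (real k + 1) * (y \<bullet> fst p) ^ (2 * Suc k)) \<partial>\<mu>0)
       = ennreal (1 / (real k + 1)) * (\<integral>\<^sup>+p. ennreal ((y \<bullet> fst p) ^ (2 * Suc k)) \<partial>\<mu>0)"
      by (subst nn_integral_cmult[symmetric]) (auto simp: ennreal_mult'[symmetric])
    also have "\<dots> = ennreal (1 / (real k + 1) * (8 * pi\<^sup>2 / (2 * real (Suc k) + 1)))"
      unfolding nn_integral_even_moment[OF y] by (subst ennreal_mult[symmetric]) auto
    also have "1 / (real k + 1) * (8 * pi\<^sup>2 / (2 * real (Suc k) + 1)) = 8 * pi\<^sup>2 * (1 / ((real k + 1) * (2 * real k + 3)))"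
      by (simp add: algebra_simps)
    finally show "(\<integral>\<^sup>+p. ennreal (1 / (real k + 1) * (y \<bullet> fst p) ^ (2 * Suc k)) \<partial>\<mu>0) = ennreal (8 * pi\<^sup>2 * (1 / ((real k + 1) * (2 * real k + 3))))" .
  qed
  also have "\<dots> = ennreal (8 * pi\<^sup>2 * (2 - 2 * ln 2))"
    by (rule suminf_ennreal_eq[OF _ sums_mult[OF log_moment_sums]]) simp
  finally show ?thesis .
qed

text \<open>Green's identity for \<open>\<phi>1 t = t * (1 + a - t\<^sup>2) powr -s\<close>; the bound is uniform in \<open>a\<close>.\<close>

lemma nn_integral_regularized_powr_le:
  assumes y: "y \<in> S2" and s: "0 < s" "s < 1" and a: "0 < a" "a \<le> 1"
  shows "(\<integral>\<^sup>+p. ennreal ((1 + a - (y \<bullet> fst p)\<^sup>2) powr - s) \<partial>\<mu>0) \<le> ennreal (8 * pi\<^sup>2 * (1 / (1 - s) + 2))"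
proof -
  let ?t = "\<lambda>p::ambient. y \<bullet> fst p"
  let ?D = "\<lambda>t::real. 1 + a - t\<^sup>2"
  have D: "?D t > 0" if "\<bar>t\<bar> \<le> 1" for t
    using that a abs_square_le_1[of t] by simp
  define \<phi>2 where "\<phi>2 t = ?D t powr - s + 2 * s * t\<^sup>2 * ?D t powr (- s - 1)" for t
  have c\<phi>2: "continuous_on {-1..1} \<phi>2"
    unfolding \<phi>2_def by (intro continuous_intros) (use D in \<open>force simp: abs_le_iff\<close>)+
  have cD: "continuous_on S2S1 (\<lambda>p. ?D (?t p) powr e)" for e
    by (intro continuous_intros) (use D[OF abs_inner_S2_le[OF _ y]] in force)
  have cp: "continuous_on S2S1 (\<lambda>p. \<phi>2 (?t p))"
    by (rule continuous_on_compose2[OF c\<phi>2 _ inner_S2_image[OF y]]) (intro continuous_intros)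
  note cont_rules = continuous_on_diff continuous_on_add continuous_on_mult continuous_on_const continuous_on_power
    continuous_on_inner continuous_on_fst continuous_on_id
  have "(\<integral>p. (1 - (?t p)\<^sup>2) * \<phi>2 (?t p) - 2 * ?t p * (?t p * ?D (?t p) powr - s) \<partial>\<mu>0) = 0"
  proof (rule green_radial[OF y _ c\<phi>2])
    fix t :: real assume "\<bar>t\<bar> \<le> 1"
    from D[OF this] show "((\<lambda>t. t * ?D t powr - s) has_real_derivative \<phi>2 t) (at t)"
      unfolding \<phi>2_def
      by (auto intro!: derivative_eq_intros simp: power2_eq_square algebra_simps)
  qed
  \<comment> \<open>A majorant of the Green integrand turns the identity into a bound for the
    integral of \<open>(?t p)\<^sup>2 * ?D (?t p) powr - s\<close>; the coefficient
    \<open>1 - s\<close> has to be positive for this.\<close>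
  moreover have "(\<integral>p. (1 - (?t p)\<^sup>2) * \<phi>2 (?t p) - 2 * ?t p * (?t p * ?D (?t p) powr - s) \<partial>\<mu>0)
     \<le> (\<integral>p. 2 - 2 * (1 - s) * ((?t p)\<^sup>2 * ?D (?t p) powr - s) \<partial>\<mu>0)"
  proof (rule integral_mono)
    show "integrable \<mu>0 (\<lambda>p. (1 - (?t p)\<^sup>2) * \<phi>2 (?t p) - 2 * ?t p * (?t p * ?D (?t p) powr - s))"
      by (intro integrable_mu0_continuous cont_rules cp cD)
    show "integrable \<mu>0 (\<lambda>p. 2 - 2 * (1 - s) * ((?t p)\<^sup>2 * ?D (?t p) powr - s))"
      by (intro integrable_mu0_continuous cont_rules cD)
    fix p assume "p \<in> space \<mu>0"
    then have p: "\<bar>?t p\<bar> \<le> 1" "(?t p)\<^sup>2 \<le> 1" using abs_inner_S2_le[of p y] inner_S2_sq_le[of p y] y by auto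
    let ?d = "?D (?t p)"
    have d: "?d > 0" "1 - (?t p)\<^sup>2 \<le> ?d" "?d \<le> 2" using D[OF p(1)] a zero_le_power2[of "?t p"] by linarith+
    have e: "?d powr (- s - 1) = ?d powr - s / ?d" using d by (simp add: powr_diff)
    have 1: "(1 - (?t p)\<^sup>2) * ?d powr - s \<le> 2"
    proof -
      have "(1 - (?t p)\<^sup>2) * ?d powr - s \<le> ?d * ?d powr - s" using d by (intro mult_right_mono) auto
      also have "\<dots> = ?d powr (1 - s)" using d by (simp add: powr_diff powr_minus field_simps)
      also have "\<dots> \<le> 2 powr (1 - s)" using d s by (intro powr_mono2) auto
      also have "\<dots> \<le> 2 powr 1" using s by (intro powr_mono) auto
      finally show ?thesis by simp
    qed
    have 2: "(1 - (?t p)\<^sup>2) * (2 * s * (?t p)\<^sup>2 * ?d powr (- s - 1)) \<le> 2 * s * (?t p)\<^sup>2 * ?d powr - s"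
    proof -
      have "(1 - (?t p)\<^sup>2) * (2 * s * (?t p)\<^sup>2 * ?d powr (- s - 1)) = ((1 - (?t p)\<^sup>2) / ?d) * (2 * s * (?t p)\<^sup>2 * ?d powr - s)"
        unfolding e by simp
      also have "\<dots> \<le> 1 * (2 * s * (?t p)\<^sup>2 * ?d powr - s)" using d s by (intro mult_right_mono) auto
      finally show ?thesis by simp
    qed
    show "(1 - (?t p)\<^sup>2) * \<phi>2 (?t p) - 2 * ?t p * (?t p * ?d powr - s) \<le> 2 - 2 * (1 - s) * ((?t p)\<^sup>2 * ?d powr - s)"
      using 1 2 unfolding \<phi>2_def by (simp add: algebra_simps power2_eq_square)
  qed
  moreover have "integrable \<mu>0 (\<lambda>p. (?t p)\<^sup>2 * ?D (?t p) powr - s)"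
    by (intro integrable_mu0_continuous cont_rules cD)
  ultimately have "2 * (1 - s) * (\<integral>p. (?t p)\<^sup>2 * ?D (?t p) powr - s \<partial>\<mu>0) \<le> 2 * (8 * pi\<^sup>2)"
    by (simp add: measure_mu0)
  then have I1: "(\<integral>p. (?t p)\<^sup>2 * ?D (?t p) powr - s \<partial>\<mu>0) \<le> 8 * pi\<^sup>2 / (1 - s)"
    using s by (simp add: field_simps)
  \<comment> \<open>The factor \<open>(?t p)\<^sup>2\<close> is removed at the cost of
    \<open>(1 - (?t p)\<^sup>2) * ?D (?t p) powr - s\<close>, which is at most 2.\<close>
  have "(\<integral>p. ?D (?t p) powr - s \<partial>\<mu>0) \<le> (\<integral>p. (?t p)\<^sup>2 * ?D (?t p) powr - s + 2 \<partial>\<mu>0)"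
  proof (rule integral_mono)
    show "integrable \<mu>0 (\<lambda>p. ?D (?t p) powr - s)" "integrable \<mu>0 (\<lambda>p. (?t p)\<^sup>2 * ?D (?t p) powr - s + 2)"
      by (intro integrable_mu0_continuous cont_rules cD)+
    fix p assume "p \<in> space \<mu>0"
    then have p: "\<bar>?t p\<bar> \<le> 1" "(?t p)\<^sup>2 \<le> 1" using abs_inner_S2_le[of p y] inner_S2_sq_le[of p y] y by auto
    let ?d = "?D (?t p)"
    have d: "?d > 0" "1 - (?t p)\<^sup>2 \<le> ?d" "?d \<le> 2" using D[OF p(1)] a zero_le_power2[of "?t p"] by linarith+
    have "(1 - (?t p)\<^sup>2) * ?d powr - s \<le> ?d * ?d powr - s" using d by (intro mult_right_mono) auto
    also have "\<dots> = ?d powr (1 - s)" using d by (simp add: powr_diff powr_minus field_simps)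
    also have "\<dots> \<le> 2 powr (1 - s)" using d s by (intro powr_mono2) auto
    also have "\<dots> \<le> 2 powr 1" using s by (intro powr_mono) auto
    finally show "?d powr - s \<le> (?t p)\<^sup>2 * ?d powr - s + 2" by (simp add: algebra_simps)
  qed
  also have "\<dots> = (\<integral>p. (?t p)\<^sup>2 * ?D (?t p) powr - s \<partial>\<mu>0) + 2 * (8 * pi\<^sup>2)"
    by (subst Bochner_Integration.integral_add) (auto intro!: integrable_mu0_continuous cont_rules cD simp: measure_mu0)
  also have "\<dots> \<le> 8 * pi\<^sup>2 / (1 - s) + 2 * (8 * pi\<^sup>2)" using I1 by simp
  also have "\<dots> = 8 * pi\<^sup>2 * (1 / (1 - s) + 2)" by (simp add: algebra_simps)
  finally have "(\<integral>p. ?D (?t p) powr - s \<partial>\<mu>0) \<le> 8 * pi\<^sup>2 * (1 / (1 - s) + 2)" .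
  moreover have "(\<integral>\<^sup>+p. ennreal (?D (?t p) powr - s) \<partial>\<mu>0) = ennreal (\<integral>p. ?D (?t p) powr - s \<partial>\<mu>0)"
    by (rule nn_integral_eq_integral) (auto intro!: integrable_mu0_continuous cD)
  ultimately show ?thesis by (simp add: ennreal_leI)
qed

text \<open>Fatou's lemma along \<open>a = 1 / real (Suc n)\<close>, the bound of the regularised
  integrals being independent of \<open>a\<close>.\<close>

lemma nn_integral_powr_le:
  assumes y: "y \<in> S2" and s: "0 < s" "s < 1"
  shows "(\<integral>\<^sup>+p. ennreal ((1 - (y \<bullet> fst p)\<^sup>2) powr - s) \<partial>\<mu>0) \<le> ennreal (8 * pi\<^sup>2 * (1 / (1 - s) + 2))"
proof -
  let ?f = "\<lambda>n p. ennreal ((1 + 1 / real (Suc n) - (y \<bullet> fst (p::ambient))\<^sup>2) powr - s)"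
  have "(\<integral>\<^sup>+p. ennreal ((1 - (y \<bullet> fst p)\<^sup>2) powr - s) \<partial>\<mu>0) = (\<integral>\<^sup>+p. liminf (\<lambda>n. ?f n p) \<partial>\<mu>0)"
  proof (rule nn_integral_cong_AE, rule AE_mp[OF AE_inner_sq_less_1[OF y]], intro AE_I2 impI)
    fix p :: ambient assume p: "(y \<bullet> fst p)\<^sup>2 < 1"
    have "(\<lambda>n. 1 + 1 / real (Suc n) - (y \<bullet> fst p)\<^sup>2) \<longlonglongrightarrow> 1 + 0 - (y \<bullet> fst p)\<^sup>2"
      by (intro tendsto_intros LIMSEQ_Suc[OF lim_1_over_n])
    then have "(\<lambda>n. ?f n p) \<longlonglongrightarrow> ennreal ((1 - (y \<bullet> fst p)\<^sup>2) powr - s)"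
      using p by (intro tendsto_ennrealI tendsto_powr tendsto_const) auto
    then show "ennreal ((1 - (y \<bullet> fst p)\<^sup>2) powr - s) = liminf (\<lambda>n. ?f n p)"
      by (metis lim_imp_Liminf trivial_limit_sequentially)
  qed
  also have "\<dots> \<le> liminf (\<lambda>n. \<integral>\<^sup>+p. ?f n p \<partial>\<mu>0)"
    by (rule nn_integral_liminf) measurable
  also have "\<dots> \<le> liminf (\<lambda>n::nat. ennreal (8 * pi\<^sup>2 * (1 / (1 - s) + 2)))"
    by (intro Liminf_mono always_eventually allI nn_integral_regularized_powr_le y s) auto
  also have "\<dots> = ennreal (8 * pi\<^sup>2 * (1 / (1 - s) + 2))" by (simp add: Liminf_const)
  finally show ?thesis .
qed

section \<open>Finite sums of potentials\<close>

definition potential :: "real \<Rightarrow> real \<Rightarrow> real" where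
  "potential a t = ln ((1 + a) / (1 + a - t\<^sup>2))"

definition potential' :: "real \<Rightarrow> real \<Rightarrow> real" where
  "potential' a t = 2 * t / (1 + a - t\<^sup>2)"

definition potential'' :: "real \<Rightarrow> real \<Rightarrow> real" where
  "potential'' a t = 2 / (1 + a - t\<^sup>2) + 4 * t\<^sup>2 / (1 + a - t\<^sup>2)\<^sup>2"

lemma potential_denom_pos: "0 < a \<Longrightarrow> \<bar>t\<bar> \<le> 1 \<Longrightarrow> 0 < 1 + a - (t::real)\<^sup>2"
  using abs_square_le_1[of t] by simp

lemma DERIV_potential:
  assumes "0 < a" "\<bar>t\<bar> \<le> 1"
  shows "(potential a has_real_derivative potential' a t) (at t)"
proof -
  let ?D = "1 + a - t\<^sup>2"
  have D: "?D > 0" by (rule potential_denom_pos[OF assms])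
  have d: "((\<lambda>t. 1 + a - t\<^sup>2) has_real_derivative - 2 * t) (at t)"
    by (auto intro!: derivative_eq_intros)
  have "((\<lambda>t. (1 + a) / (1 + a - t\<^sup>2)) has_real_derivative (0 * ?D - (1 + a) * (- 2 * t)) / (?D * ?D)) (at t)"
    using D by (intro DERIV_divide DERIV_const d) simp
  moreover have "(ln has_real_derivative inverse ((1 + a) / ?D)) (at ((1 + a) / ?D))"
    using D assms by (intro DERIV_ln) simp
  ultimately have "(potential a has_real_derivative inverse ((1 + a) / ?D) * ((0 * ?D - (1 + a) * (- 2 * t)) / (?D * ?D))) (at t)"
    unfolding potential_def[abs_def] by (intro DERIV_chain2)
  moreover have "inverse (c / d) * ((0 * d - c * (- 2 * t)) / (d * d)) = 2 * t / d" if "c > 0" "d > 0" for c d :: real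
    using that by (simp add: field_simps)
  ultimately show ?thesis
    using D assms by (simp only: potential'_def)
qed

lemma DERIV_potential':
  assumes "0 < a" "\<bar>t\<bar> \<le> 1"
  shows "(potential' a has_real_derivative potential'' a t) (at t)"
proof -
  let ?D = "1 + a - t\<^sup>2"
  have D: "?D > 0" by (rule potential_denom_pos[OF assms])
  have d: "((\<lambda>t. 1 + a - t\<^sup>2) has_real_derivative - 2 * t) (at t)"
    by (auto intro!: derivative_eq_intros)
  have n: "((\<lambda>t. 2 * t) has_real_derivative 2) (at t)"
    by (auto intro!: derivative_eq_intros)
  have "(potential' a has_real_derivative (2 * ?D - (2 * t) * (- 2 * t)) / (?D * ?D)) (at t)"
    unfolding potential'_def[abs_def] using D by (intro DERIV_divide n d) simp
  moreover have "(2 * d - (2 * t) * (- 2 * t)) / (d * d) = 2 / d + 4 * t\<^sup>2 / d\<^sup>2" if "d > 0" for d :: real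
    using that by (simp add: field_simps power2_eq_square)
  ultimately show ?thesis
    using D by (simp only: potential''_def)
qed

lemma continuous_potential'': "0 < a \<Longrightarrow> continuous_on {-1..1} (potential'' a)"
  unfolding potential''_def
  by (intro continuous_intros) (use potential_denom_pos in \<open>fastforce simp: abs_le_iff\<close>)+

lemma continuous_potential': "0 < a \<Longrightarrow> continuous_on {-1..1} (potential' a)"
  unfolding potential'_def
  by (intro continuous_intros) (use potential_denom_pos in \<open>fastforce simp: abs_le_iff\<close>)+

lemma potential_nonneg: "0 < a \<Longrightarrow> \<bar>t\<bar> \<le> 1 \<Longrightarrow> 0 \<le> potential a t"
  using potential_denom_pos[of a t] unfolding potential_def by (intro ln_ge_zero) (simp add: field_simps)

lemma potential_0: "t\<^sup>2 < 1 \<Longrightarrow> potential 0 t = - ln (1 - t\<^sup>2)"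
  by (simp add: potential_def ln_div)

lemma potential_0_nonneg: "t\<^sup>2 < 1 \<Longrightarrow> 0 \<le> potential 0 t"
  by (simp add: potential_0)

lemma potential_le_0:
  assumes "0 \<le> a" "t\<^sup>2 < 1" shows "potential a t \<le> potential 0 t"
proof -
  have "(1 + a) / (1 + a - t\<^sup>2) \<le> 1 / (1 - t\<^sup>2)"
    using assms by (simp add: divide_simps) (simp add: algebra_simps)
  then show ?thesis unfolding potential_def using assms by (intro ln_mono) auto
qed

text \<open>The left side is the spherical Laplacian of the potential. With
  \<open>D = 1 + a - t\<^sup>2\<close> it equals
  \<open>2 - 2 * a / D - 4 * a * t\<^sup>2 / D\<^sup>2\<close>, and both corrections have the
  favourable sign.\<close>

lemma potential_laplacian_le:
  assumes a: "0 < a" and t: "\<bar>t\<bar> \<le> 1"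
  shows "(1 - t\<^sup>2) * potential'' a t - 2 * t * potential' a t \<le> 2"
proof -
  let ?D = "1 + a - t\<^sup>2"
  have D: "?D > 0" by (rule potential_denom_pos[OF a t])
  have "(1 - t\<^sup>2) * potential'' a t - 2 * t * potential' a t = (?D - a) * (2 / ?D + 4 * t\<^sup>2 / ?D\<^sup>2) - 4 * t\<^sup>2 / ?D"
    by (simp add: potential''_def potential'_def power2_eq_square)
  also have "\<dots> = 2 - 2 * a / ?D - 4 * a * t\<^sup>2 / ?D\<^sup>2"
  proof -
    have "(d - a) * (2 / d + 4 * s / d\<^sup>2) - 4 * s / d = 2 - 2 * a / d - 4 * a * s / d\<^sup>2" if "d > 0" for d s :: real
      using that by (simp add: field_simps power2_eq_square)
    from this[OF D] show ?thesis .
  qed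
  also have "\<dots> \<le> 2"
  proof -
    have "0 \<le> 2 * a / ?D" "0 \<le> 4 * a * t\<^sup>2 / ?D\<^sup>2" using D a by auto
    then show ?thesis by linarith
  qed
  finally show ?thesis .
qed

lemma f_ab_dist_S2_potential:
  "x \<in> S2 \<Longrightarrow> y \<in> S2 \<Longrightarrow> f_ab a b (dist_S2 y x) = potential a (x \<bullet> y) + b"
  by (simp add: f_ab_dist_S2 potential_def algebra_simps)

lemma nn_integral_potential_0:
  assumes y: "y \<in> S2"
  shows "(\<integral>\<^sup>+p. ennreal (potential 0 (y \<bullet> fst p)) \<partial>\<mu>0) = ennreal (8 * pi\<^sup>2 * (2 - 2 * ln 2))"
  unfolding nn_integral_neg_ln[OF y, symmetric]
  by (rule nn_integral_cong_AE, rule AE_mp[OF AE_inner_sq_less_1[OF y]]) (simp add: potential_0)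

text \<open>With \<open>c\<close> and \<open>d\<close> the second and the first derivative of a
  function of the height, the map under the trace is the derivative of its gradient, so this is its
  Laplacian; the factor 2 is the dimension of the sphere.\<close>

lemma trace_fst_proj:
  assumes p: "p \<in> S2S1"
  shows "trace_fst p (\<lambda>v. c *\<^sub>R (w \<bullet> fst v) *\<^sub>R fst (proj p (w, 0)) + d *\<^sub>R fst (proj_deriv (w, 0) p v))
     = c * (fst (proj p (w, 0)) \<bullet> fst (proj p (w, 0))) - 2 * d * (w \<bullet> fst p)"
proof -
  have 1: "fst (proj p (w, 0)) \<bullet> fst (proj p (e, 0)) = w \<bullet> fst (proj p (e, 0))"
    and 2: "fst p \<bullet> fst (proj p (e, 0)) = 0" for e w
    using p by (auto simp: proj_def inner_simps inner_commute)
  have "trace_fst p (\<lambda>v. c *\<^sub>R (w \<bullet> fst v) *\<^sub>R fst (proj p (w, 0)) + d *\<^sub>R fst (proj_deriv (w, 0) p v))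
    = (\<Sum>e\<in>Basis. c * ((w \<bullet> fst (proj p (e, 0))) * (w \<bullet> fst (proj p (e, 0)))) - d * (w \<bullet> fst p) * (fst (proj p (e, 0)) \<bullet> fst (proj p (e, 0))))"
    unfolding trace_fst_def proj_deriv_def
    using p by (intro sum.cong refl) (simp add: inner_add_left inner_diff_left 1 2 algebra_simps)
  also have "\<dots> = c * (fst (proj p (w, 0)) \<bullet> fst (proj p (w, 0))) - 2 * d * (w \<bullet> fst p)"
    unfolding sum_subtractf sum_distrib_left[symmetric] sum_Basis_proj_fst trace_proj_fst[OF p] by simp
  finally show ?thesis .
qed

lemma has_grad_cong:
  assumes f: "has_grad f W" and eq: "\<And>p. p \<in> S2S1 \<Longrightarrow> g p = f p"
  shows "has_grad g W"
  unfolding has_grad_def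
proof (intro conjI ballI)
  fix p assume p: "p \<in> S2S1"
  show "W p \<in> tangent p" by (rule has_grad_tangent[OF f p])
  have "eventually (\<lambda>z. f (retr z) = g (retr z)) (nhds p)"
    using eventually_punctured[OF p] by (rule eventually_mono) (simp add: eq retr_mem)
  then show "((\<lambda>z. g (retr z)) has_derivative (\<lambda>v. W p \<bullet> v)) (at p)"
    by (rule has_derivative_eventually_eq[OF has_gradD[OF f p]])
qed (rule has_grad_continuous[OF f])

text \<open>The formula for \<open>\<eta>\<close> is required on the sphere only, where distance and
  inner product determine each other. Both the given sums \<open>eta\<close> and the auxiliary
  regularisations of the limit are instances.\<close>

locale finite_warping =
  fixes I :: "nat set" and A b :: "nat \<Rightarrow> real" and x :: "nat \<Rightarrow> real^3" and a :: real and \<eta> :: "real^3 \<Rightarrow> real"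
  assumes finite_I: "finite I" and a_pos: "0 < a"
    and A_nonneg: "\<And>i. i \<in> I \<Longrightarrow> 0 \<le> A i" and b_ge: "\<And>i. i \<in> I \<Longrightarrow> 2 \<le> b i" and x_S2: "\<And>i. i \<in> I \<Longrightarrow> x i \<in> S2"
    and A_pos: "\<exists>i\<in>I. 0 < A i"
    and \<eta>_eq: "\<And>y. y \<in> S2 \<Longrightarrow> \<eta> y = (\<Sum>i\<in>I. A i * (potential a (x i \<bullet> y) + b i))"
begin

definition grad :: vfield where
  "grad p = (\<Sum>i\<in>I. (A i * potential' a (x i \<bullet> fst p)) *\<^sub>R proj p (x i, 0))"

lemma \<eta>_eq_S2S1: "p \<in> S2S1 \<Longrightarrow> \<eta> (fst p) = (\<Sum>i\<in>I. A i * (potential a (x i \<bullet> fst p) + b i))"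
  by (rule \<eta>_eq[OF S2S1_imp_fst])

lemma has_grad_potential:
  assumes "i \<in> I"
  shows "has_grad (\<lambda>p. potential a (x i \<bullet> fst p)) (\<lambda>p. potential' a (x i \<bullet> fst p) *\<^sub>R proj p (x i, 0))"
  by (rule has_grad_compose[OF has_grad_inner DERIV_potential[OF a_pos abs_inner_S2_le[OF _ x_S2[OF assms]]]
        continuous_on_subset[OF continuous_potential'[OF a_pos] inner_S2_image[OF x_S2[OF assms]]]])

lemma has_grad_\<eta>: "has_grad (\<lambda>p. \<eta> (fst p)) grad"
proof (rule has_grad_cong)
  have "has_grad (\<lambda>p. \<Sum>i\<in>I. A i * (potential a (x i \<bullet> fst p) + b i))
      (\<lambda>p. \<Sum>i\<in>I. A i *\<^sub>R (potential' a (x i \<bullet> fst p) *\<^sub>R proj p (x i, 0) + 0))"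
    by (rule has_grad_sum, rule has_grad_cmult, rule has_grad_add[OF has_grad_potential has_grad_const])
  then show "has_grad (\<lambda>p. \<Sum>i\<in>I. A i * (potential a (x i \<bullet> fst p) + b i)) grad"
    by (simp add: grad_def[abs_def])
qed (rule \<eta>_eq_S2S1)

lemma continuous_\<eta>: "continuous_on S2S1 (\<lambda>p. \<eta> (fst p))"
  by (rule has_grad_continuous_on[OF has_grad_\<eta>])

text \<open>Two choices of \<open>J\<close> matter: a single index gives the lower volume bound, and
  the whole of \<open>I\<close> compares \<open>\<eta>\<close> with its Laplacian.\<close>

lemma \<eta>_ge: "p \<in> S2S1 \<Longrightarrow> J \<subseteq> I \<Longrightarrow> 2 * (\<Sum>i\<in>J. A i) \<le> \<eta> (fst p)"
proof -
  assume p: "p \<in> S2S1" and J: "J \<subseteq> I"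
  have t: "A i * 2 \<le> A i * (potential a (x i \<bullet> fst p) + b i)" if "i \<in> I" for i
  proof (rule mult_left_mono[OF _ A_nonneg[OF that]])
    show "2 \<le> potential a (x i \<bullet> fst p) + b i"
      using potential_nonneg[OF a_pos abs_inner_S2_le[OF p x_S2[OF that]]] b_ge[OF that] by linarith
  qed
  have "2 * (\<Sum>i\<in>J. A i) \<le> 2 * (\<Sum>i\<in>I. A i)"
    using J finite_I A_nonneg by (intro mult_left_mono sum_mono2) auto
  also have "\<dots> = (\<Sum>i\<in>I. A i * 2)" by (simp only: mult.commute[of 2] sum_distrib_right)
  also have "\<dots> \<le> \<eta> (fst p)" unfolding \<eta>_eq_S2S1[OF p] by (intro sum_mono t)
  finally show ?thesis .
qed

lemma \<eta>_pos: "p \<in> S2S1 \<Longrightarrow> 0 < \<eta> (fst p)"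
proof -
  assume p: "p \<in> S2S1"
  obtain i where "i \<in> I" "0 < A i" using A_pos by blast
  then show ?thesis using \<eta>_ge[OF p, of "{i}"] by simp
qed

lemma \<eta>_pos_S2: "y \<in> S2 \<Longrightarrow> 0 < \<eta> y"
  using \<eta>_pos[of "(y, 1)"] by (simp add: S2S1_def)

lemma scal_nonneg:
  assumes p: "p \<in> S2S1" shows "0 \<le> scal (warped \<eta>) p"
proof -
  \<comment> \<open>The sphere component of \<open>grad\<close> as a function of the sphere variable
    alone, and below it the derivative of its extension; the circle component vanishes.\<close>
  define G where "G y = (\<Sum>i\<in>I. (A i * potential' a (x i \<bullet> y)) *\<^sub>R (x i - (x i \<bullet> y) *\<^sub>R y))" for y
  define H where "H v = (\<Sum>i\<in>I. (A i * potential'' a (x i \<bullet> fst p)) *\<^sub>R (x i \<bullet> fst (proj p v)) *\<^sub>R fst (proj p (x i, 0))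
     + (A i * potential' a (x i \<bullet> fst p)) *\<^sub>R fst (proj_deriv (x i, 0) p v))" for v
  have fproj: "fst (proj q (x i, 0)) = x i - (x i \<bullet> fst q) *\<^sub>R fst q" "snd (proj q (x i, 0)) = 0" for q i
    by (simp_all add: proj_def)
  have Gg: "fst (grad q) = G (fst q)" "snd (grad q) = 0" for q
    by (simp_all add: grad_def G_def fst_sum snd_sum fproj)
  have "scal (warped \<eta>) p = 2 - 2 * trace_fst p H / \<eta> (fst p)"
  proof (rule scal_warped[where G = G])
    show "\<eta> y > 0" if "y \<in> S2" for y by (rule \<eta>_pos_S2[OF that])
    show "((\<lambda>z. \<eta> (fst (retr z))) has_derivative (\<lambda>v. G (fst q) \<bullet> fst v)) (at q)" if "q \<in> S2S1" for q
      using has_gradD[OF has_grad_\<eta> that] by (simp add: inner_prod_def Gg)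
    show "G y \<bullet> y = 0" if "y \<in> S2" for y
      using has_grad_tangent[OF has_grad_\<eta>, of "(y, 1)"] that by (simp add: S2S1_def tangent_def Gg)
    show "((\<lambda>z. G (fst (retr z))) has_derivative H) (at p)"
    proof -
      have d: "((\<lambda>z. potential' a (x i \<bullet> fst (retr z))) has_derivative (\<lambda>v. potential'' a (x i \<bullet> fst p) * (x i \<bullet> fst (proj p v)))) (at p)"
        if i: "i \<in> I" for i
      proof -
        have "has_grad (\<lambda>p. potential' a (x i \<bullet> fst p)) (\<lambda>p. potential'' a (x i \<bullet> fst p) *\<^sub>R proj p (x i, 0))"
          by (rule has_grad_compose[OF has_grad_inner DERIV_potential'[OF a_pos abs_inner_S2_le[OF _ x_S2[OF i]]]
                continuous_on_subset[OF continuous_potential''[OF a_pos] inner_S2_image[OF x_S2[OF i]]]])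
        from has_gradD[OF this p] show ?thesis by (simp add: proj_adjoint inner_Pair_0 inner_commute[of "(x i, 0)"] inner_commute[of "x i"])
      qed
      have e: "((\<lambda>z. proj (retr z) (x i, 0)) has_derivative proj_deriv (x i, 0) p) (at p)" for i
        using C1_field_proj[of "(x i, 0)"] p by (auto simp: C1_field_def)
      have "((\<lambda>z. \<Sum>i\<in>I. (A i * potential' a (x i \<bullet> fst (retr z))) *\<^sub>R fst (proj (retr z) (x i, 0))) has_derivative H) (at p)"
        unfolding H_def
        by (rule has_derivative_sum, rule has_derivative_eq_rhs, (rule derivative_intros d e | assumption)+)
           (simp add: retr_ident[OF p] fun_eq_iff algebra_simps)
      then show ?thesis by (simp add: G_def fproj)
    qed
    show "H v \<bullet> fst w = H w \<bullet> fst v" if v: "v \<in> tangent p" and w: "w \<in> tangent p" for v w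
    proof -
      have "fst p \<bullet> fst v = 0" "fst p \<bullet> fst w = 0" using v w by (auto simp: tangent_def inner_commute)
      then show ?thesis
        unfolding H_def inner_sum_left
        by (intro sum.cong refl) (simp add: proj_ident[OF v] proj_ident[OF w] proj_deriv_def inner_simps fproj inner_commute algebra_simps)
    qed
  qed (rule p)
  \<comment> \<open>Each potential has Laplacian at most 2, so the Laplacian of
    \<open>\<eta>\<close> is at most twice the sum of the weights; the constants
    \<open>b i \<ge> 2\<close> make \<open>\<eta>\<close> at least that.\<close>
  moreover have "trace_fst p H \<le> \<eta> (fst p)"
  proof -
    have "trace_fst p H = (\<Sum>i\<in>I. trace_fst p (\<lambda>v. (A i * potential'' a (x i \<bullet> fst p)) *\<^sub>R (x i \<bullet> fst v) *\<^sub>R fst (proj p (x i, 0))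
       + (A i * potential' a (x i \<bullet> fst p)) *\<^sub>R fst (proj_deriv (x i, 0) p v)))"
      unfolding trace_fst_def H_def inner_sum_left by (subst sum.swap) (simp add: p)
    also have "\<dots> = (\<Sum>i\<in>I. A i * ((1 - (x i \<bullet> fst p)\<^sup>2) * potential'' a (x i \<bullet> fst p) - 2 * (x i \<bullet> fst p) * potential' a (x i \<bullet> fst p)))"
    proof (intro sum.cong refl)
      fix i assume i: "i \<in> I"
      have eq: "fst (proj p (x i, 0)) \<bullet> fst (proj p (x i, 0)) = 1 - (x i \<bullet> fst p)\<^sup>2"
        using proj_inner_self[OF p x_S2[OF i]] by (simp add: inner_prod_def fproj)
      show "trace_fst p (\<lambda>v. (A i * potential'' a (x i \<bullet> fst p)) *\<^sub>R (x i \<bullet> fst v) *\<^sub>R fst (proj p (x i, 0))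
       + (A i * potential' a (x i \<bullet> fst p)) *\<^sub>R fst (proj_deriv (x i, 0) p v))
       = A i * ((1 - (x i \<bullet> fst p)\<^sup>2) * potential'' a (x i \<bullet> fst p) - 2 * (x i \<bullet> fst p) * potential' a (x i \<bullet> fst p))"
        unfolding trace_fst_proj[OF p] eq by (simp add: algebra_simps)
    qed
    also have "\<dots> \<le> (\<Sum>i\<in>I. A i * 2)"
      by (intro sum_mono mult_left_mono potential_laplacian_le a_pos abs_inner_S2_le p x_S2 A_nonneg)
    also have "\<dots> \<le> \<eta> (fst p)" using \<eta>_ge[OF p subset_refl] by (simp add: sum_distrib_right mult.commute)
    finally show ?thesis .
  qed
  ultimately show ?thesis using \<eta>_pos[OF p] by (simp add: divide_le_eq)
qed

lemma measurable_\<eta> [measurable]: "(\<lambda>p. \<eta> (fst p)) \<in> borel_measurable (restrict_space borel S2S1)"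
  by (rule borel_measurable_continuous_on_restrict[OF continuous_\<eta>])

lemma emeasure_vol: "emeasure (vol (warped \<eta>)) S2S1 = (\<integral>\<^sup>+p. ennreal (\<eta> (fst p)) \<partial>\<mu>0)"
proof -
  have "S2S1 \<in> sets \<mu>0" using sets.top[of \<mu>0] unfolding space_vol .
  moreover have "(\<lambda>p. \<eta> (fst p)) \<in> borel_measurable \<mu>0" by measurable
  ultimately have "emeasure (vol (warped \<eta>)) S2S1 = (\<integral>\<^sup>+p. ennreal \<bar>\<eta> (fst p)\<bar> * indicator S2S1 p \<partial>\<mu>0)"
    by (simp add: vol_warped emeasure_density)
  also have "\<dots> = (\<integral>\<^sup>+p. ennreal (\<eta> (fst p)) \<partial>\<mu>0)"
    by (intro nn_integral_cong) (use \<eta>_pos in \<open>auto simp: less_imp_le\<close>)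
  finally show ?thesis .
qed

lemma emeasure_vol_ge: "J \<subseteq> I \<Longrightarrow> ennreal (16 * pi\<^sup>2 * (\<Sum>i\<in>J. A i)) \<le> emeasure (vol (warped \<eta>)) S2S1"
proof -
  assume J: "J \<subseteq> I"
  have "0 \<le> (\<Sum>i\<in>J. A i)" by (rule sum_nonneg) (use J A_nonneg in blast)
  then have "ennreal (16 * pi\<^sup>2 * (\<Sum>i\<in>J. A i)) = (\<integral>\<^sup>+p. ennreal (2 * (\<Sum>i\<in>J. A i)) \<partial>\<mu>0)"
    by (simp add: emeasure_mu0 ennreal_mult[symmetric] algebra_simps)
  also have "\<dots> \<le> (\<integral>\<^sup>+p. ennreal (\<eta> (fst p)) \<partial>\<mu>0)"
    by (intro nn_integral_mono ennreal_leI \<eta>_ge J) simp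
  finally show ?thesis unfolding emeasure_vol .
qed

lemma emeasure_vol_le:
  assumes "\<And>i. i \<in> I \<Longrightarrow> b i \<le> B"
  shows "emeasure (vol (warped \<eta>)) S2S1 \<le> ennreal (2 * pi * (\<Sum>i\<in>I. A i) * (8 * pi - 4 * pi * ln 4 + 4 * pi * B))"
proof -
  \<comment> \<open>Rewrites the termwise bound into the constant of the theorem, by
    \<open>ln 4 = 2 * ln 2\<close>.\<close>
  have c: "8 * pi\<^sup>2 * (2 - 2 * ln 2) + B * (8 * pi\<^sup>2) = 2 * pi * (8 * pi - 4 * pi * ln 4 + 4 * pi * B)"
    using ln_realpow[of 2 2] by (simp add: power2_eq_square algebra_simps)
  have ln2: "ln (2::real) \<le> 1" using ln_le_minus_one[of "2::real"] by simp
  have each: "(\<integral>\<^sup>+p. ennreal (A i * (potential a (x i \<bullet> fst p) + b i)) \<partial>\<mu>0)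
      \<le> ennreal (A i * (2 * pi * (8 * pi - 4 * pi * ln 4 + 4 * pi * B)))" if i: "i \<in> I" for i
  proof -
    have B: "0 \<le> B" using b_ge[OF i] assms[OF i] by simp
    have "(\<integral>\<^sup>+p. ennreal (A i * (potential a (x i \<bullet> fst p) + b i)) \<partial>\<mu>0)
       \<le> (\<integral>\<^sup>+p. ennreal (A i) * (ennreal (potential 0 (x i \<bullet> fst p)) + ennreal B) \<partial>\<mu>0)"
    proof (rule nn_integral_mono_AE, rule AE_mp[OF AE_inner_sq_less_1[OF x_S2[OF i]]], intro AE_I2 impI)
      fix p assume "p \<in> space \<mu>0" and t: "(x i \<bullet> fst p)\<^sup>2 < 1"
      have "A i * (potential a (x i \<bullet> fst p) + b i) \<le> A i * (potential 0 (x i \<bullet> fst p) + B)"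
        using potential_le_0[OF less_imp_le[OF a_pos] t] assms[OF i] A_nonneg[OF i] by (intro mult_left_mono) auto
      then show "ennreal (A i * (potential a (x i \<bullet> fst p) + b i)) \<le> ennreal (A i) * (ennreal (potential 0 (x i \<bullet> fst p)) + ennreal B)"
        using potential_0_nonneg[OF t] B A_nonneg[OF i] by (simp add: ennreal_plus[symmetric] ennreal_mult[symmetric] ennreal_leI del: ennreal_plus)
    qed
    also have "\<dots> = ennreal (A i) * (ennreal (8 * pi\<^sup>2 * (2 - 2 * ln 2)) + ennreal B * ennreal (8 * pi\<^sup>2))"
    proof -
      have [measurable]: "(\<lambda>p. potential 0 (x i \<bullet> fst p)) \<in> borel_measurable \<mu>0" unfolding potential_def by measurable
      show ?thesis
        by (subst nn_integral_cmult, simp, subst nn_integral_add) (auto simp: nn_integral_potential_0[OF x_S2[OF i]] emeasure_mu0)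
    qed
    also have "\<dots> = ennreal (A i * (8 * pi\<^sup>2 * (2 - 2 * ln 2) + B * (8 * pi\<^sup>2)))"
      using B A_nonneg[OF i] ln2 by (simp add: ennreal_plus[symmetric] ennreal_mult[symmetric] del: ennreal_plus)
    finally show ?thesis unfolding c .
  qed
  have p0: "0 \<le> A i * (potential a (x i \<bullet> fst p) + b i)" if "i \<in> I" "p \<in> S2S1" for i p
    using that potential_nonneg[OF a_pos abs_inner_S2_le[OF that(2) x_S2[OF that(1)]]] b_ge[OF that(1)] A_nonneg[OF that(1)]
    by (intro mult_nonneg_nonneg) auto
  \<comment> \<open>The constant has to be non-negative before the real sums can be moved into
    \<open>ennreal\<close>.\<close>
  obtain i0 where "i0 \<in> I" using A_pos by blast
  then have "0 \<le> 4 * pi * B" using b_ge assms by fastforce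
  moreover have "4 * pi * ln 4 \<le> 8 * pi" using ln2 ln_realpow[of 2 2] by simp
  ultimately have pos: "0 \<le> 2 * pi * (8 * pi - 4 * pi * ln 4 + 4 * pi * B)" by (intro mult_nonneg_nonneg) auto
  have "emeasure (vol (warped \<eta>)) S2S1 = (\<integral>\<^sup>+p. (\<Sum>i\<in>I. ennreal (A i * (potential a (x i \<bullet> fst p) + b i))) \<partial>\<mu>0)"
    unfolding emeasure_vol by (intro nn_integral_cong) (simp add: \<eta>_eq_S2S1 sum_ennreal p0)
  also have "\<dots> = (\<Sum>i\<in>I. \<integral>\<^sup>+p. ennreal (A i * (potential a (x i \<bullet> fst p) + b i)) \<partial>\<mu>0)"
    unfolding potential_def by (rule nn_integral_sum) measurable
  also have "\<dots> \<le> (\<Sum>i\<in>I. ennreal (A i * (2 * pi * (8 * pi - 4 * pi * ln 4 + 4 * pi * B))))"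
    by (intro sum_mono each)
  also have "\<dots> = ennreal (\<Sum>i\<in>I. A i * (2 * pi * (8 * pi - 4 * pi * ln 4 + 4 * pi * B)))"
    by (rule sum_ennreal) (use A_nonneg pos in auto)
  also have "(\<Sum>i\<in>I. A i * (2 * pi * (8 * pi - 4 * pi * ln 4 + 4 * pi * B))) = 2 * pi * (\<Sum>i\<in>I. A i) * (8 * pi - 4 * pi * ln 4 + 4 * pi * B)"
    unfolding sum_distrib_right[symmetric] by (simp only: ac_simps)
  finally show ?thesis .
qed

end

section \<open>The diameter\<close>

text \<open>The joined path runs through the arcs with speed factors 2, 4, 4 during times 1/2, 1/4,
  1/4, so the bounds simply add. The arcs are given on the whole line to avoid one-sided
  derivatives.\<close>

lemma riem_dist_le_three_arcs:
  fixes \<gamma>1 \<gamma>2 \<gamma>3 :: "real \<Rightarrow> 'a::euclidean_space"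
  assumes d1: "\<And>t. (\<gamma>1 has_vector_derivative D1 t) (at t)" "continuous_on UNIV D1"
    and d2: "\<And>t. (\<gamma>2 has_vector_derivative D2 t) (at t)" "continuous_on UNIV D2"
    and d3: "\<And>t. (\<gamma>3 has_vector_derivative D3 t) (at t)" "continuous_on UNIV D3"
    and S: "\<And>t. \<gamma>1 t \<in> S" "\<And>t. \<gamma>2 t \<in> S" "\<And>t. \<gamma>3 t \<in> S"
    and c1: "\<And>t. sqrt (g (\<gamma>1 t) (D1 t) (D1 t)) \<le> c1" and c2: "\<And>t. sqrt (g (\<gamma>2 t) (D2 t) (D2 t)) \<le> c2"
    and c3: "\<And>t. sqrt (g (\<gamma>3 t) (D3 t) (D3 t)) \<le> c3"
    and c: "0 \<le> c1" "0 \<le> c2" "0 \<le> c3"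
    and hom: "\<And>p v r. g p (r *\<^sub>R v) (r *\<^sub>R v) = r\<^sup>2 * g p v v"
    and e12: "\<gamma>1 1 = \<gamma>2 0" and e23: "\<gamma>2 1 = \<gamma>3 0"
  shows "riem_dist S g (\<gamma>1 0) (\<gamma>3 1) \<le> ennreal (c1 + c2 + c3)"
proof -
  have vp: "valid_path \<gamma>" if "\<And>t. (\<gamma> has_vector_derivative D t) (at t)" "continuous_on UNIV D" for \<gamma> D :: "real \<Rightarrow> 'a"
    unfolding valid_path_def using that
    by (intro C1_differentiable_imp_piecewise) (auto simp: C1_differentiable_on_def intro: continuous_on_subset)
  let ?\<gamma> = "\<gamma>1 +++ (\<gamma>2 +++ \<gamma>3)"
  have v: "valid_path ?\<gamma>"
    using vp[OF d1] vp[OF d2] vp[OF d3] e12 e23 by (intro valid_path_join) (auto simp: pathstart_def pathfinish_def joinpaths_def)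
  have im: "path_image ?\<gamma> \<subseteq> S"
    using S by (auto simp: path_image_def joinpaths_def)
  have se: "pathstart ?\<gamma> = \<gamma>1 0" "pathfinish ?\<gamma> = \<gamma>3 1"
    by (simp_all add: pathstart_def pathfinish_def joinpaths_def)
  have aff: "((\<lambda>t. \<gamma> (m * t + n)) has_vector_derivative m *\<^sub>R D (m * t + n)) (at t)"
    if "\<And>t. (\<gamma> has_vector_derivative D t) (at t)" for \<gamma> D :: "real \<Rightarrow> 'a" and m n t
  proof -
    have "((\<lambda>t. m * t + n) has_vector_derivative m) (at t)"
      by (auto intro!: derivative_eq_intros simp: has_real_derivative_iff_has_vector_derivative[symmetric])
    from vector_diff_chain_at[OF this that] show ?thesis by (simp add: o_def)
  qed
  define speed where "speed t = sqrt (g (?\<gamma> t) (vector_derivative ?\<gamma> (at t)) (vector_derivative ?\<gamma> (at t)))" for t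
  have sp: "speed t \<le> m * b"
    if op: "open U" "t \<in> U" "\<And>s. s \<in> U \<Longrightarrow> ?\<gamma> s = \<gamma> (m * s + n)"
      and D: "\<And>t. (\<gamma> has_vector_derivative D t) (at t)" and b: "\<And>t. sqrt (g (\<gamma> t) (D t) (D t)) \<le> b" and m: "0 \<le> m"
    for U t \<gamma> m n D b
  proof -
    have "(?\<gamma> has_vector_derivative m *\<^sub>R D (m * t + n)) (at t)"
      by (rule has_vector_derivative_transform_within_open[OF aff[OF D] op(1,2)]) (simp add: op(3))
    then have "vector_derivative ?\<gamma> (at t) = m *\<^sub>R D (m * t + n)" by (rule vector_derivative_at)
    moreover have "?\<gamma> t = \<gamma> (m * t + n)" using op by simp
    ultimately have "speed t = m * sqrt (g (\<gamma> (m * t + n)) (D (m * t + n)) (D (m * t + n)))"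
      using m by (simp only: speed_def hom real_sqrt_mult real_sqrt_abs abs_of_nonneg)
    then show ?thesis using b m by (simp add: mult_left_mono)
  qed
  \<comment> \<open>On the three open intervals the joined path is \<open>\<gamma>1 (2 * t)\<close>,
    \<open>\<gamma>2 (4 * t - 2)\<close> and \<open>\<gamma>3 (4 * t - 3)\<close>.\<close>
  have b1: "speed t \<le> 2 * c1" if "t \<in> {0<..<1/2}" for t
    by (rule sp[where U = "{0<..<1/2}" and n = 0 and D = D1 and \<gamma> = \<gamma>1]) (use that d1 c1 in \<open>auto simp: joinpaths_def\<close>)
  have b2: "speed t \<le> 4 * c2" if "t \<in> {1/2<..<3/4}" for t
    by (rule sp[where U = "{1/2<..<3/4}" and n = "-2" and D = D2 and \<gamma> = \<gamma>2]) (use that d2 c2 in \<open>auto simp: joinpaths_def algebra_simps\<close>)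
  have b3: "speed t \<le> 4 * c3" if "t \<in> {3/4<..<1}" for t
    by (rule sp[where U = "{3/4<..<1}" and n = "-3" and D = D3 and \<gamma> = \<gamma>3]) (use that d3 c3 in \<open>auto simp: joinpaths_def algebra_simps\<close>)
  have null: "AE t :: real in lborel. t \<notin> {0, 1/2, 3/4, 1}"
    by (rule AE_not_in[OF finite_imp_null_set_lborel]) (intro finite.intros)
  have cl: "curve_length g ?\<gamma> = (\<integral>\<^sup>+t\<in>{0..1}. ennreal (speed t) \<partial>lborel)"
    unfolding curve_length_def speed_def ..
  let ?i1 = "indicator {0<..<1/2} :: real \<Rightarrow> ennreal"
  let ?i2 = "indicator {1/2<..<3/4} :: real \<Rightarrow> ennreal"
  let ?i3 = "indicator {3/4<..<1} :: real \<Rightarrow> ennreal"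
  define B :: "real \<Rightarrow> ennreal" where "B = (\<lambda>t. ennreal (2 * c1) * ?i1 t + (ennreal (4 * c2) * ?i2 t + ennreal (4 * c3) * ?i3 t))"
  have "curve_length g ?\<gamma> \<le> integral\<^sup>N lborel B"
    unfolding cl
  proof (rule nn_integral_mono_AE)
    show "AE t in lborel. ennreal (speed t) * indicator {0..1} t \<le> B t"
    proof (rule eventually_mono[OF null])
      fix t :: real assume "t \<notin> {0, 1/2, 3/4, 1}"
      then have ne: "t \<noteq> 0" "t \<noteq> 1/2" "t \<noteq> 3/4" "t \<noteq> 1" by simp_all
      consider "t \<in> {0<..<1/2}" | "t \<in> {1/2<..<3/4}" | "t \<in> {3/4<..<1}" | "t \<notin> {0..1}"
      proof (cases "t < 1/2")
        case True with ne(1) that(1,4) show ?thesis by (cases "0 < t") simp_all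
      next
        case False
        show ?thesis
        proof (cases "t < 3/4")
          case True with False ne(2) that(2) show ?thesis by simp
        next
          case False with ne(3,4) that(3,4) show ?thesis by (cases "t < 1") simp_all
        qed
      qed
      then show "ennreal (speed t) * indicator {0..1} t \<le> B t"
      proof cases
        case 1 with ennreal_leI[OF b1[OF 1]] show ?thesis by (simp add: B_def)
      next
        case 2 with ennreal_leI[OF b2[OF 2]] show ?thesis by (simp add: B_def)
      next
        case 3 with ennreal_leI[OF b3[OF 3]] show ?thesis by (simp add: B_def)
      qed simp
    qed
  qed
  also have "integral\<^sup>N lborel B = ennreal (2 * c1) * ennreal (1/2) + (ennreal (4 * c2) * ennreal (1/4) + ennreal (4 * c3) * ennreal (1/4))"
    unfolding B_def by (simp add: nn_integral_add nn_integral_cmult_indicator)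
  also have "\<dots> = ennreal (2 * c1 * (1/2)) + (ennreal (4 * c2 * (1/4)) + ennreal (4 * c3 * (1/4)))"
    using c by (simp only: ennreal_mult'[symmetric])
  also have "\<dots> = ennreal (c1 + c2 + c3)"
    using c by (simp add: add.assoc)
  finally have "curve_length g ?\<gamma> \<le> ennreal (c1 + c2 + c3)" .
  then show ?thesis
    unfolding riem_dist_def using v im se by (intro INF_lower2[of ?\<gamma>]) auto
qed

context finite_warping
begin

text \<open>Where \<open>\<eta> y0 \<le> M\<close> the circle has length at most
  \<open>2 * pi * M\<close>. Horizontal curves have the same length as on the round sphere, so any
  two points are joined by a great circle arc to \<open>y0\<close>, a rotation there, and an arc
  away from it.\<close>

lemma riem_diam_le:
  assumes M: "0 < M" and vol: "emeasure (vol (warped \<eta>)) S2S1 \<le> ennreal (2 * pi * M)"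
  shows "riem_diam S2S1 (warped \<eta>) \<le> ennreal (4 * pi + 2 * pi * M)"
proof -
  \<comment> \<open>Otherwise the volume would be at least \<open>8 * pi\<^sup>2 * M\<close>, which
    exceeds \<open>2 * pi * M\<close>.\<close>
  have "\<exists>y0\<in>S2. \<eta> y0 \<le> M"
  proof (rule ccontr)
    assume "\<not> ?thesis"
    then have "M \<le> \<eta> (fst p)" if "p \<in> S2S1" for p using S2S1_imp_fst[OF that] by fastforce
    then have "(\<integral>\<^sup>+p. ennreal M \<partial>\<mu>0) \<le> emeasure (vol (warped \<eta>)) S2S1"
      unfolding emeasure_vol by (intro nn_integral_mono ennreal_leI) simp
    also note vol
    finally have "M * (8 * pi\<^sup>2) \<le> 2 * pi * M"
      using M by (simp add: emeasure_mu0 ennreal_mult[symmetric])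
    then have "8 * pi * (pi * M) \<le> 2 * (pi * M)" by (simp add: power2_eq_square algebra_simps)
    then have "8 * pi \<le> 2" using M by (simp add: mult_le_cancel_right)
    then show False using pi_gt3 by simp
  qed
  then obtain y0 where y0: "y0 \<in> S2" "\<eta> y0 \<le> M" by blast
  have "riem_dist S2S1 (warped \<eta>) p q \<le> ennreal (4 * pi + 2 * pi * M)" if p: "p \<in> S2S1" and q: "q \<in> S2S1" for p q
  proof -
    have n: "norm (fst p) = 1" "norm (snd p) = 1" "norm (fst q) = 1" "norm (snd q) = 1" "norm y0 = 1"
      using p q y0 by (auto simp: mem_S2S1_iff S2_def)
    obtain w1 where w1: "norm w1 = 1" "w1 \<bullet> fst p = 0" "y0 = cos (arccos (fst p \<bullet> y0)) *\<^sub>R fst p + sin (arccos (fst p \<bullet> y0)) *\<^sub>R w1"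
      using ex_great_circle[OF n(1,5)] .
    obtain w2 where w2: "norm w2 = 1" "w2 \<bullet> y0 = 0" "fst q = cos (arccos (y0 \<bullet> fst q)) *\<^sub>R y0 + sin (arccos (y0 \<bullet> fst q)) *\<^sub>R w2"
      using ex_great_circle[OF n(5,3)] .
    define \<alpha>1 where "\<alpha>1 = arccos (fst p \<bullet> y0)"
    define \<alpha>2 where "\<alpha>2 = arccos (y0 \<bullet> fst q)"
    have "\<bar>fst p \<bullet> y0\<bar> \<le> 1" "\<bar>y0 \<bullet> fst q\<bar> \<le> 1"
      using Cauchy_Schwarz_ineq2[of "fst p" y0] Cauchy_Schwarz_ineq2[of y0 "fst q"] n by auto
    then have \<alpha>: "0 \<le> \<alpha>1" "\<alpha>1 \<le> pi" "0 \<le> \<alpha>2" "\<alpha>2 \<le> pi"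
      by (auto simp: \<alpha>1_def \<alpha>2_def abs_le_iff intro: arccos_lbound arccos_ubound)
    define a1 where "a1 = Arg (snd p)"
    \<comment> \<open>The difference of principal arguments may exceed half a turn; that it is at
      most a full turn is enough.\<close>
    define \<beta> where "\<beta> = Arg (snd q) - Arg (snd p)"
    have "- pi < Arg (snd p)" "Arg (snd p) \<le> pi" "- pi < Arg (snd q)" "Arg (snd q) \<le> pi" using Arg_bounded by auto
    then have \<beta>: "\<bar>\<beta>\<bar> \<le> 2 * pi" by (simp add: \<beta>_def)
    have cp: "cis a1 = snd p" "cis (a1 + \<beta>) = snd q"
      using n cis_Arg_unique by (auto simp: a1_def \<beta>_def) (metis cis_Arg n(2,4) norm_zero sgn_div_norm inverse_1 scaleR_one zero_neq_one)+
    let ?\<gamma>1 = "\<lambda>t. (cos (t * \<alpha>1) *\<^sub>R fst p + sin (t * \<alpha>1) *\<^sub>R w1, snd p)"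
    let ?D1 = "\<lambda>t. ((- \<alpha>1 * sin (t * \<alpha>1)) *\<^sub>R fst p + (\<alpha>1 * cos (t * \<alpha>1)) *\<^sub>R w1, 0::complex)"
    let ?\<gamma>2 = "\<lambda>t. (y0, cos (a1 + t * \<beta>) *\<^sub>R 1 + sin (a1 + t * \<beta>) *\<^sub>R \<i>)"
    let ?D2 = "\<lambda>t. (0::real^3, (- \<beta> * sin (a1 + t * \<beta>)) *\<^sub>R 1 + (\<beta> * cos (a1 + t * \<beta>)) *\<^sub>R \<i>)"
    let ?\<gamma>3 = "\<lambda>t. (cos (t * \<alpha>2) *\<^sub>R y0 + sin (t * \<alpha>2) *\<^sub>R w2, snd q)"
    let ?D3 = "\<lambda>t. ((- \<alpha>2 * sin (t * \<alpha>2)) *\<^sub>R y0 + (\<alpha>2 * cos (t * \<alpha>2)) *\<^sub>R w2, 0::complex)"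
    note g1 = great_circle_path[OF n(1) w1(1,2), of \<alpha>1] and g3 = great_circle_path[OF n(5) w2(1,2), of \<alpha>2]
    have mem: "cos s *\<^sub>R u + sin s *\<^sub>R w \<in> S2" if "norm u = 1" "norm w = 1" "w \<bullet> u = 0" for s and u w :: "real^3"
      using that by (simp add: S2_def norm_eq_1 inner_simps inner_commute power2_eq_square[symmetric])
    have pm: "fst p \<in> S2" "snd p \<in> sphere 0 1" "snd q \<in> sphere 0 1" using p q by (auto simp: S2S1_def)
    have "riem_dist S2S1 (warped \<eta>) (?\<gamma>1 0) (?\<gamma>3 1) \<le> ennreal (\<alpha>1 + 2 * pi * M + \<alpha>2)"
    proof (rule riem_dist_le_three_arcs[where ?\<gamma>1.0 = ?\<gamma>1 and ?\<gamma>2.0 = ?\<gamma>2 and ?\<gamma>3.0 = ?\<gamma>3 and S = S2S1 and g = "warped \<eta>"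
        and ?c1.0 = \<alpha>1 and ?c2.0 = "2 * pi * M" and ?c3.0 = \<alpha>2 and ?D1.0 = ?D1 and ?D2.0 = ?D2 and ?D3.0 = ?D3])
      show "(?\<gamma>1 has_vector_derivative ?D1 t) (at t)" for t
        by (intro has_vector_derivative_Pair g1(3) has_vector_derivative_const)
      show "(?\<gamma>3 has_vector_derivative ?D3 t) (at t)" for t
        by (intro has_vector_derivative_Pair g3(3) has_vector_derivative_const)
      show "(?\<gamma>2 has_vector_derivative ?D2 t) (at t)" for t
        unfolding has_vector_derivative_def by (auto intro!: derivative_eq_intros simp: algebra_simps)
      show "continuous_on UNIV ?D1" "continuous_on UNIV ?D2" "continuous_on UNIV ?D3"
        by (intro continuous_intros)+
      show "?\<gamma>1 t \<in> S2S1" "?\<gamma>3 t \<in> S2S1" for t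
        using mem[OF n(1) w1(1,2), of "t * \<alpha>1"] mem[OF n(5) w2(1,2), of "t * \<alpha>2"] pm by (auto simp: S2S1_def)
      show "?\<gamma>2 t \<in> S2S1" for t
        using y0 by (simp add: S2S1_def cis_eq_scaleR[symmetric])
      show "sqrt (warped \<eta> (?\<gamma>1 t) (?D1 t) (?D1 t)) \<le> \<alpha>1" for t
        using g1(4)[of t] \<alpha> by (simp add: warped_def norm_eq_sqrt_inner)
      show "sqrt (warped \<eta> (?\<gamma>3 t) (?D3 t) (?D3 t)) \<le> \<alpha>2" for t
        using g3(4)[of t] \<alpha> by (simp add: warped_def norm_eq_sqrt_inner)
      show "sqrt (warped \<eta> (?\<gamma>2 t) (?D2 t) (?D2 t)) \<le> 2 * pi * M" for t
      proof -
        have "(- \<beta> * sin s) * (- \<beta> * sin s) + (\<beta> * cos s) * (\<beta> * cos s) = \<beta>\<^sup>2" for s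
        proof -
          have "(- \<beta> * sin s) * (- \<beta> * sin s) + (\<beta> * cos s) * (\<beta> * cos s) = \<beta>\<^sup>2 * ((sin s)\<^sup>2 + (cos s)\<^sup>2)"
            by (simp only: power2_eq_square) (simp add: algebra_simps del: sin_cos_squared_add3)
          then show ?thesis by simp
        qed
        then have "warped \<eta> (?\<gamma>2 t) (?D2 t) (?D2 t) = (\<eta> y0 * \<beta>)\<^sup>2"
          by (simp add: warped_def inner_complex_def power_mult_distrib)
        then have "sqrt (warped \<eta> (?\<gamma>2 t) (?D2 t) (?D2 t)) = \<eta> y0 * \<bar>\<beta>\<bar>"
          using \<eta>_pos_S2[OF y0(1)] by (simp add: abs_mult)
        also have "\<dots> \<le> M * (2 * pi)"
          using y0 \<beta> \<eta>_pos_S2[OF y0(1)] M by (intro mult_mono) auto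
        finally show ?thesis by (simp add: mult.commute)
      qed
      show "?\<gamma>1 1 = ?\<gamma>2 0" "?\<gamma>2 1 = ?\<gamma>3 0"
        using w1(3) cp by (simp_all add: \<alpha>1_def cis_eq_scaleR)
    qed (use \<alpha> M in \<open>auto simp: warped_def power2_eq_square algebra_simps\<close>)
    also have "?\<gamma>1 0 = p" by simp
    also have "?\<gamma>3 1 = q" using w2(3) by (simp add: \<alpha>2_def prod_eq_iff)
    \<comment> \<open>The two horizontal arcs together contribute at most
      \<open>2 * pi\<close>.\<close>
    also have "ennreal (\<alpha>1 + 2 * pi * M + \<alpha>2) \<le> ennreal (4 * pi + 2 * pi * M)"
      using \<alpha> by (intro ennreal_leI) auto
    finally show ?thesis .
  qed
  then show ?thesis unfolding riem_diam_def by (intro SUP_least)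
qed

end

section \<open>Estimates in Lebesgue spaces\<close>

text \<open>The supporting line of the convex power function at \<open>s\<close>. It is Young's
  inequality for \<open>h powr q\<close> and \<open>s powr q\<close> with the weights
  \<open>1 / q\<close> and \<open>1 - 1 / q\<close>.\<close>

lemma powr_tangent_le:
  fixes h s q :: real
  assumes q: "1 \<le> q" and h: "0 \<le> h" and s: "0 < s"
  shows "s powr q + q * s powr (q - 1) * (h - s) \<le> h powr q"
proof (cases "h = 0")
  case True
  have "s powr (q - 1) * s = s powr q" using s by (simp add: powr_diff)
  then have "s powr q + q * s powr (q - 1) * (h - s) = (1 - q) * s powr q" using True by (simp add: algebra_simps)
  then show ?thesis using True q s by (simp add: mult_nonpos_nonneg)
next
  case False
  then have h: "0 < h" using h by simp
  define \<theta> where "\<theta> = 1 / q"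
  have \<theta>: "0 \<le> \<theta>" "0 \<le> 1 - \<theta>" "\<theta> + (1 - \<theta>) = 1" using q by (auto simp: \<theta>_def)
  have "(h powr q) powr \<theta> * (s powr q) powr (1 - \<theta>) \<le> \<theta> * h powr q + (1 - \<theta>) * s powr q"
    by (rule Youngs_inequality_0) (use \<theta> h s in auto)
  moreover have "(h powr q) powr \<theta> = h" using q h by (simp add: \<theta>_def powr_powr)
  moreover have "(s powr q) powr (1 - \<theta>) = s powr (q - 1)" 
  proof -
    have "q * (1 - \<theta>) = q - 1" using q by (simp add: \<theta>_def right_diff_distrib)
    then show ?thesis by (simp add: powr_powr)
  qed
  ultimately have "h * s powr (q - 1) \<le> (1 / q) * h powr q + (1 - 1 / q) * s powr q" by (simp add: \<theta>_def)
  then have "q * (h * s powr (q - 1)) \<le> q * ((1 / q) * h powr q + (1 - 1 / q) * s powr q)"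
    using q by (intro mult_left_mono) auto
  also have "\<dots> = h powr q + (q - 1) * s powr q" using q by (simp add: field_simps)
  finally have "q * h * s powr (q - 1) \<le> h powr q + (q - 1) * s powr q" by simp
  moreover have e: "s powr (q - 1) * s = s powr q" using s by (simp add: powr_diff)
  moreover have "q * P * (h - s) = q * h * P - q * (P * s)" for P :: real by algebra
  ultimately have "q * s powr (q - 1) * (h - s) \<le> h powr q + (q - 1) * s powr q - q * s powr q" by simp
  then show ?thesis by (simp add: left_diff_distrib)
qed

text \<open>Jensen's inequality for the weights \<open>A i / K\<close>.\<close>

lemma suminf_powr_le:
  fixes A h :: "nat \<Rightarrow> real"
  assumes A: "\<And>i. 0 \<le> A i" "A sums K" and K: "0 < K" and h: "\<And>i. 0 \<le> h i" and S: "summable (\<lambda>i. A i * h i)" and q: "1 \<le> q"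
  shows "ennreal ((\<Sum>i. A i * h i) powr q) \<le> ennreal (K powr (q - 1)) * (\<Sum>i. ennreal (A i * h i powr q))"
proof (cases "(\<Sum>i. A i * h i) = 0 \<or> (\<Sum>i. ennreal (A i * h i powr q)) = top")
  case True
  then show ?thesis using K by (auto simp: ennreal_mult_top)
next
  case False
  define T where "T = (\<Sum>i. A i * h i)"
  have "0 \<le> T" unfolding T_def using A h by (intro suminf_nonneg S mult_nonneg_nonneg)
  then have T: "0 < T" using False by (simp add: T_def)
  have Q: "summable (\<lambda>i. A i * h i powr q)"
    using False A by (intro summable_suminf_not_top) auto
  let ?s = "T / K"
  have s: "0 < ?s" using T K by simp
  \<comment> \<open>The supporting line at the weighted mean \<open>T / K\<close>: summed against
    the weights, its linear part cancels.\<close>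
  have "A i * (?s powr q - q * ?s powr (q - 1) * ?s) + (q * ?s powr (q - 1)) * (A i * h i) \<le> A i * h i powr q" for i
    using mult_left_mono[OF powr_tangent_le[OF q h s] A(1), of i i] by (simp add: algebra_simps)
  then have "K * (?s powr q - q * ?s powr (q - 1) * ?s) + (q * ?s powr (q - 1)) * T \<le> (\<Sum>i. A i * h i powr q)"
    by (rule sums_le[OF _ sums_add[OF sums_mult2[OF A(2)] sums_mult[OF summable_sums[OF S, folded T_def]]] summable_sums[OF Q]])
  moreover have "K * (?s powr q - q * ?s powr (q - 1) * ?s) + (q * ?s powr (q - 1)) * T = K * ?s powr q"
    using K by (simp add: field_simps)
  ultimately have "K powr (q - 1) * (K * ?s powr q) \<le> K powr (q - 1) * (\<Sum>i. A i * h i powr q)"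
    by (intro mult_left_mono) auto
  moreover have "K powr (q - 1) * (K * ?s powr q) = T powr q"
    using K T by (simp add: powr_divide powr_diff)
  ultimately have "ennreal (T powr q) \<le> ennreal (K powr (q - 1) * (\<Sum>i. A i * h i powr q))"
    by (intro ennreal_leI) simp
  also have "\<dots> = ennreal (K powr (q - 1)) * ennreal (\<Sum>i. A i * h i powr q)"
    using A by (intro ennreal_mult suminf_nonneg Q) auto
  also have "ennreal (\<Sum>i. A i * h i powr q) = (\<Sum>i. ennreal (A i * h i powr q))"
    using A by (intro suminf_ennreal2[symmetric] Q) auto
  finally show ?thesis by (simp add: T_def)
qed

text \<open>By Tonelli the series has finite integral, so it is finite almost everywhere.\<close>

lemma AE_summable_weighted:
  assumes A: "\<And>i. 0 \<le> A i" "A sums (K::real)" and m [measurable]: "\<And>i. h i \<in> borel_measurable M"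
    and h: "\<And>i x. 0 \<le> h i x"
    and C: "\<And>i. (\<integral>\<^sup>+x. ennreal (h i x) \<partial>M) \<le> ennreal C" "0 \<le> C"
  shows "AE x in M. summable (\<lambda>i. A i * h i x)"
proof -
  have "(\<integral>\<^sup>+x. (\<Sum>i. ennreal (A i * h i x)) \<partial>M) = (\<Sum>i. \<integral>\<^sup>+x. ennreal (A i * h i x) \<partial>M)"
    by (rule nn_integral_suminf) measurable
  also have "\<dots> \<le> (\<Sum>i. ennreal (A i * C))"
  proof (rule suminf_le)
    fix i
    have "(\<integral>\<^sup>+x. ennreal (A i * h i x) \<partial>M) = ennreal (A i) * (\<integral>\<^sup>+x. ennreal (h i x) \<partial>M)"
      using A h by (subst nn_integral_cmult[symmetric]) (auto simp: ennreal_mult)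
    also have "\<dots> \<le> ennreal (A i) * ennreal C" by (intro mult_left_mono C) auto
    finally show "(\<integral>\<^sup>+x. ennreal (A i * h i x) \<partial>M) \<le> ennreal (A i * C)" using A C by (simp add: ennreal_mult)
  qed auto
  also have "\<dots> = ennreal (K * C)"
    using A C by (intro suminf_ennreal_eq sums_mult2) auto
  finally have fin: "(\<integral>\<^sup>+x. (\<Sum>i. ennreal (A i * h i x)) \<partial>M) \<noteq> \<infinity>" by (auto simp: top_unique)
  have "AE x in M. (\<Sum>i. ennreal (A i * h i x)) \<noteq> \<infinity>"
    by (rule nn_integral_PInf_AE[OF _ fin]) measurable
  then show ?thesis
    by (rule eventually_mono) (use A h in \<open>auto intro!: summable_suminf_not_top\<close>)
qed

text \<open>The bounds \<open>C i\<close> may vary with the index: in the convergence proof the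
  terms below and beyond the cut-off are estimated differently.\<close>

lemma nn_integral_suminf_powr_le:
  assumes A: "\<And>i. 0 \<le> A i" "A sums (K::real)" and K: "0 < K" and m [measurable]: "\<And>i. h i \<in> borel_measurable M"
    and h: "\<And>i x. 0 \<le> h i x" and S: "AE x in M. summable (\<lambda>i. A i * h i x)" and q: "1 \<le> q"
    and C: "\<And>i. (\<integral>\<^sup>+x. ennreal (h i x powr q) \<partial>M) \<le> ennreal (C i)" "\<And>i. 0 \<le> C i" "summable (\<lambda>i. A i * C i)"
  shows "(\<integral>\<^sup>+x. ennreal ((\<Sum>i. A i * h i x) powr q) \<partial>M) \<le> ennreal (K powr (q - 1) * (\<Sum>i. A i * C i))"
proof -
  have "(\<integral>\<^sup>+x. ennreal ((\<Sum>i. A i * h i x) powr q) \<partial>M) \<le> (\<integral>\<^sup>+x. ennreal (K powr (q - 1)) * (\<Sum>i. ennreal (A i * h i x powr q)) \<partial>M)"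
    by (rule nn_integral_mono_AE, rule eventually_mono[OF S], rule suminf_powr_le[OF A K h _ q])
  also have "\<dots> = ennreal (K powr (q - 1)) * (\<Sum>i. \<integral>\<^sup>+x. ennreal (A i * h i x powr q) \<partial>M)"
    by (subst nn_integral_cmult, measurable, subst nn_integral_suminf) measurable
  also have "\<dots> \<le> ennreal (K powr (q - 1)) * (\<Sum>i. ennreal (A i * C i))"
  proof (intro mult_left_mono suminf_le)
    fix i
    have "(\<integral>\<^sup>+x. ennreal (A i * h i x powr q) \<partial>M) = ennreal (A i) * (\<integral>\<^sup>+x. ennreal (h i x powr q) \<partial>M)"
      using A by (subst nn_integral_cmult[symmetric]) (auto simp: ennreal_mult)
    also have "\<dots> \<le> ennreal (A i) * ennreal (C i)" by (intro mult_left_mono C) auto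
    finally show "(\<integral>\<^sup>+x. ennreal (A i * h i x powr q) \<partial>M) \<le> ennreal (A i * C i)" using A C by (simp add: ennreal_mult)
  qed auto
  also have "(\<Sum>i. ennreal (A i * C i)) = ennreal (\<Sum>i. A i * C i)"
    using A C by (intro suminf_ennreal2) auto
  also have "ennreal (K powr (q - 1)) * ennreal (\<Sum>i. A i * C i) = ennreal (K powr (q - 1) * (\<Sum>i. A i * C i))"
    using A C by (intro ennreal_mult[symmetric] suminf_nonneg) auto
  finally show ?thesis .
qed

lemma integrable_of_nn_integral_le:
  fixes f :: "'a \<Rightarrow> real"
  assumes "f \<in> borel_measurable M" "\<And>x. 0 \<le> f x" "(\<integral>\<^sup>+x. ennreal (f x) \<partial>M) \<le> ennreal C"
  shows "integrable M f"
  using assms by (intro integrableI_nonneg) (auto simp: less_top top_unique le_less_trans[OF _ ennreal_less_top])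

lemma ln_le_powr:
  fixes z e :: real assumes "0 < z" "0 < e" shows "ln z \<le> z powr e / e"
proof -
  have "e * ln z = ln (z powr e)" using assms by (simp add: ln_powr)
  also have "\<dots> \<le> z powr e" using ln_le_minus_one[of "z powr e"] assms by simp
  finally show ?thesis using assms by (simp add: field_simps)
qed

text \<open>A logarithm grows more slowly than any power. The exponent \<open>1 / (2 * q)\<close> is
  chosen so that the \<open>q\<close>-th power becomes \<open>(1 - t\<^sup>2) powr - (1/2)\<close>,
  which is integrable.\<close>

lemma potential_0_powr_le:
  assumes t: "t\<^sup>2 < 1" and q: "1 \<le> q" and c: "0 \<le> c"
  shows "(potential 0 t + c) powr q \<le> (2 * q + c) powr q * (1 - t\<^sup>2) powr - (1/2)"
proof -
  define z where "z = (1 - t\<^sup>2) powr - (1 / (2 * q))"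
  have z: "1 \<le> z" using t q by (simp add: z_def powr_minus_divide powr_le1 le_divide_eq)
  have "potential 0 t = ln (1 / (1 - t\<^sup>2))" by (simp add: potential_def)
  also have "\<dots> \<le> (1 / (1 - t\<^sup>2)) powr (1 / (2 * q)) / (1 / (2 * q))"
    by (rule ln_le_powr) (use t q in auto)
  also have "\<dots> = 2 * q * z" using t by (simp add: z_def powr_divide powr_minus_divide)
  finally have "potential 0 t + c \<le> (2 * q + c) * z"
    using z c mult_left_mono[OF z c] by (simp add: algebra_simps)
  then have "(potential 0 t + c) powr q \<le> ((2 * q + c) * z) powr q"
    using potential_0_nonneg[OF t] c q by (intro powr_mono2) auto
  also have "\<dots> = (2 * q + c) powr q * z powr q" using z q c by (simp add: powr_mult)
  also have "z powr q = (1 - t\<^sup>2) powr - (1/2)" using q t by (simp add: z_def powr_powr)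
  finally show ?thesis .
qed

lemma borel_measurable_potential [measurable]: "potential a \<in> borel_measurable borel" "potential' a \<in> borel_measurable borel"
  unfolding potential_def[abs_def] potential'_def[abs_def] by measurable

text \<open>The number \<open>32 * pi\<^sup>2\<close> is the bound of
  \<open>nn_integral_powr_le\<close> for \<open>s = 1/2\<close>.\<close>

lemma nn_integral_potential_0_powr_le:
  assumes y: "y \<in> S2" and q: "1 \<le> q" and c: "0 \<le> c"
  shows "(\<integral>\<^sup>+p. ennreal (\<bar>potential 0 (y \<bullet> fst p) + c\<bar> powr q) \<partial>\<mu>0) \<le> ennreal ((2 * q + c) powr q * (32 * pi\<^sup>2))"
proof -
  have "(\<integral>\<^sup>+p. ennreal (\<bar>potential 0 (y \<bullet> fst p) + c\<bar> powr q) \<partial>\<mu>0)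
    \<le> (\<integral>\<^sup>+p. ennreal ((2 * q + c) powr q) * ennreal ((1 - (y \<bullet> fst p)\<^sup>2) powr - (1/2)) \<partial>\<mu>0)"
    by (rule nn_integral_mono_AE, rule eventually_mono[OF AE_inner_sq_less_1[OF y]])
       (use potential_0_powr_le[OF _ q c] potential_0_nonneg c in \<open>auto simp: ennreal_mult[symmetric] intro!: ennreal_leI\<close>)
  also have "\<dots> = ennreal ((2 * q + c) powr q) * (\<integral>\<^sup>+p. ennreal ((1 - (y \<bullet> fst p)\<^sup>2) powr - (1/2)) \<partial>\<mu>0)"
    by (rule nn_integral_cmult) measurable
  also have "\<dots> \<le> ennreal ((2 * q + c) powr q) * ennreal (8 * pi\<^sup>2 * (1 / (1 - 1/2) + 2))"
    by (intro mult_left_mono nn_integral_powr_le y) auto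
  also have "\<dots> = ennreal ((2 * q + c) powr q * (32 * pi\<^sup>2))" by (simp add: ennreal_mult)
  finally show ?thesis .
qed

text \<open>Norm of the gradient of \<open>\<lambda>p. potential 0 (y \<bullet> fst p)\<close>.\<close>

definition grad_norm :: "real^3 \<Rightarrow> ambient \<Rightarrow> real" where
  "grad_norm y p = \<bar>potential' 0 (y \<bullet> fst p)\<bar> * sqrt \<bar>1 - (y \<bullet> fst p)\<^sup>2\<bar>"

lemma grad_norm_nonneg: "0 \<le> grad_norm y p"
  by (simp add: grad_norm_def)

lemma borel_measurable_grad_norm [measurable]: "grad_norm y \<in> borel_measurable \<mu>0"
  unfolding grad_norm_def[abs_def] by measurable

lemma grad_norm_powr_le:
  assumes t: "(y \<bullet> fst p)\<^sup>2 < 1" and r: "1 \<le> r"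
  shows "grad_norm y p powr r \<le> 2 powr r * (1 - (y \<bullet> fst p)\<^sup>2) powr - (r / 2)"
proof -
  let ?t = "y \<bullet> fst p" let ?s = "1 - ?t\<^sup>2"
  have s: "0 < ?s" using t by simp
  have a: "\<bar>?t\<bar> \<le> 1" using t abs_square_less_1[of ?t] by simp
  have "grad_norm y p = 2 * \<bar>?t\<bar> * (sqrt ?s / ?s)"
    using s by (simp add: grad_norm_def potential'_def abs_mult)
  also have "sqrt ?s / ?s = ?s powr - (1/2)" 
  proof -
    have "sqrt ?s / ?s = ?s powr (1/2) / ?s powr 1" using s by (simp add: powr_half_sqrt)
    also have "\<dots> = ?s powr (1/2 - 1)" by (rule powr_diff[symmetric])
    finally show ?thesis by simp
  qed
  finally have "grad_norm y p \<le> 2 * ?s powr - (1/2)"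
    using mult_right_mono[OF a, of "2 * ?s powr - (1/2)"] by (simp add: algebra_simps)
  then have "grad_norm y p powr r \<le> (2 * ?s powr - (1/2)) powr r"
    using r grad_norm_nonneg by (intro powr_mono2) auto
  also have "\<dots> = 2 powr r * ?s powr - (r / 2)" by (simp add: powr_mult powr_powr)
  finally show ?thesis .
qed

text \<open>The gradient norm is at most twice the power -1/2 of 1 - t^2, so its \<open>r\<close>-th
  power has exponent \<open>r / 2\<close>, which is below the threshold 1 exactly when
  \<open>r < 2\<close>.\<close>

lemma nn_integral_grad_norm_powr_le:
  assumes y: "y \<in> S2" and r: "1 \<le> r" "r < 2"
  shows "(\<integral>\<^sup>+p. ennreal (grad_norm y p powr r) \<partial>\<mu>0) \<le> ennreal (2 powr r * (8 * pi\<^sup>2 * (1 / (1 - r / 2) + 2)))"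
proof -
  have "(\<integral>\<^sup>+p. ennreal (grad_norm y p powr r) \<partial>\<mu>0)
    \<le> (\<integral>\<^sup>+p. ennreal (2 powr r) * ennreal ((1 - (y \<bullet> fst p)\<^sup>2) powr - (r / 2)) \<partial>\<mu>0)"
    by (rule nn_integral_mono_AE, rule eventually_mono[OF AE_inner_sq_less_1[OF y]])
       (use grad_norm_powr_le r in \<open>auto simp: ennreal_mult[symmetric] intro!: ennreal_leI\<close>)
  also have "\<dots> = ennreal (2 powr r) * (\<integral>\<^sup>+p. ennreal ((1 - (y \<bullet> fst p)\<^sup>2) powr - (r / 2)) \<partial>\<mu>0)"
    by (rule nn_integral_cmult) measurable
  also have "\<dots> \<le> ennreal (2 powr r) * ennreal (8 * pi\<^sup>2 * (1 / (1 - r / 2) + 2))"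
    by (intro mult_left_mono nn_integral_powr_le y) (use r in auto)
  also have "\<dots> = ennreal (2 powr r * (8 * pi\<^sup>2 * (1 / (1 - r / 2) + 2)))"
    using r by (intro ennreal_mult[symmetric]) (auto intro!: mult_nonneg_nonneg add_nonneg_nonneg)
  finally show ?thesis .
qed

section \<open>The limit warping function\<close>

lemma norm_proj_unit:
  assumes "p \<in> S2S1" "y \<in> S2"
  shows "norm (proj p (y, 0)) = sqrt \<bar>1 - (y \<bullet> fst p)\<^sup>2\<bar>"
  using proj_inner_self[OF assms] inner_S2_sq_le[OF assms] by (simp add: norm_eq_sqrt_inner)

lemma abs_potential'_le:
  assumes a: "0 \<le> a" and t: "t\<^sup>2 < 1"
  shows "\<bar>potential' a t\<bar> \<le> \<bar>potential' 0 t\<bar>"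
proof -
  have "\<bar>2 * t\<bar> / (1 + a - t\<^sup>2) \<le> \<bar>2 * t\<bar> / (1 - t\<^sup>2)" using a t by (intro divide_left_mono) auto
  moreover have "0 < 1 + a - t\<^sup>2" using a t by simp
  ultimately show ?thesis using t by (simp add: potential'_def)
qed

lemma tendsto_potential:
  assumes a: "(a \<longlongrightarrow> 0) F" and t: "t\<^sup>2 < 1"
  shows "((\<lambda>n. potential (a n) t) \<longlongrightarrow> potential 0 t) F" "((\<lambda>n. potential' (a n) t) \<longlongrightarrow> potential' 0 t) F"
  unfolding potential_def potential'_def using t by (auto intro!: tendsto_eq_intros a)

text \<open>Indices start at 0 here, so \<open>A 0\<close> plays the role of the positive first
  weight \<open>A 1\<close> of the theorem. The centres \<open>x\<close> are the limits of the
  moving ones.\<close>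

locale limit_warping =
  fixes A b :: "nat \<Rightarrow> real" and x :: "nat \<Rightarrow> real^3" and K B :: real
  assumes A_nonneg: "\<And>i. 0 \<le> A i" and A0_pos: "0 < A 0" and A_sums: "A sums K"
    and b_ge: "\<And>i. 2 \<le> b i" and b_le: "\<And>i. b i \<le> B" and x_S2: "\<And>i. x i \<in> S2"
begin

text \<open>The absolute values make all terms non-negative at every point, so that the estimates
  for weighted series apply as they stand; at \<open>good\<close> points they change
  nothing.\<close>

definition eta_sum :: "real^3 \<Rightarrow> real" where
  "eta_sum y = (\<Sum>i. A i * \<bar>potential 0 (x i \<bullet> y) + b i\<bar>)"

text \<open>The maximum matters only on the null set where the series diverges.\<close>

definition eta_lim :: "real^3 \<Rightarrow> real" where
  "eta_lim y = max (2 * A 0) (eta_sum y)"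

definition grad_bound :: "ambient \<Rightarrow> real" where
  "grad_bound p = (\<Sum>i. A i * grad_norm (x i) p)"

definition grad_lim :: vfield where
  "grad_lim p = (\<Sum>i. (A i * potential' 0 (x i \<bullet> fst p)) *\<^sub>R proj p (x i, 0))"

text \<open>A set of full measure that avoids the poles of all potentials and on which the series of
  values and of gradients converge absolutely; the pointwise statements below are made
  there.\<close>

definition good :: "ambient \<Rightarrow> bool" where
  "good p \<longleftrightarrow> p \<in> S2S1 \<and> (\<forall>i. (x i \<bullet> fst p)\<^sup>2 < 1) \<and>
     summable (\<lambda>i. A i * \<bar>potential 0 (x i \<bullet> fst p) + b i\<bar>) \<and> summable (\<lambda>i. A i * grad_norm (x i) p)"

definition reg :: "nat \<Rightarrow> real" where
  "reg n = 1 / real (Suc n)"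

text \<open>A regularisation of the limit with the limit's own centres, independent of the given
  sequence of metrics. Integration by parts and positivity are carried over to the limit along
  it.\<close>

definition eta_approx :: "nat \<Rightarrow> real^3 \<Rightarrow> real" where
  "eta_approx n y = (\<Sum>i\<le>n. A i * (potential (reg n) (x i \<bullet> y) + b i))"

definition grad_approx :: "nat \<Rightarrow> vfield" where
  "grad_approx n p = (\<Sum>i\<le>n. (A i * potential' (reg n) (x i \<bullet> fst p)) *\<^sub>R proj p (x i, 0))"

lemma K_pos: "0 < K"
  using sums_unique[OF A_sums] suminf_pos2[OF sums_summable[OF A_sums] A_nonneg A0_pos] by simp

lemma reg_pos: "0 < reg n"
  by (simp add: reg_def)

lemma reg_tendsto: "reg \<longlonglongrightarrow> 0"
  unfolding reg_def[abs_def] by (rule LIMSEQ_Suc[OF lim_1_over_n])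

lemma finite_warping_approx: "finite_warping {..n} A b x (reg n) (eta_approx n)"
  by unfold_locales (use A_nonneg b_ge x_S2 A0_pos reg_pos in \<open>auto simp: eta_approx_def\<close>)

lemma has_grad_approx: "has_grad (\<lambda>p. eta_approx n (fst p)) (grad_approx n)"
proof -
  interpret f: finite_warping "{..n}" A b x "reg n" "eta_approx n" by (rule finite_warping_approx)
  show ?thesis using f.has_grad_\<eta> by (simp add: f.grad_def[abs_def] grad_approx_def[abs_def])
qed

lemma eta_approx_ge: "p \<in> S2S1 \<Longrightarrow> 2 * A 0 \<le> eta_approx n (fst p)"
proof -
  interpret f: finite_warping "{..n}" A b x "reg n" "eta_approx n" by (rule finite_warping_approx)
  show "p \<in> S2S1 \<Longrightarrow> 2 * A 0 \<le> eta_approx n (fst p)" using f.\<eta>_ge[of p "{0}"] by simp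
qed

lemma AE_summable_eta: "AE p in \<mu>0. summable (\<lambda>i. A i * \<bar>potential 0 (x i \<bullet> fst p) + b i\<bar>)"
proof (rule AE_summable_weighted[OF A_nonneg A_sums])
  show "(\<integral>\<^sup>+p. ennreal \<bar>potential 0 (x i \<bullet> fst p) + b i\<bar> \<partial>\<mu>0) \<le> ennreal ((2 + B) powr 1 * (32 * pi\<^sup>2))" for i
  proof -
    have "(\<integral>\<^sup>+p. ennreal \<bar>potential 0 (x i \<bullet> fst p) + b i\<bar> \<partial>\<mu>0) \<le> ennreal ((2 * 1 + b i) powr 1 * (32 * pi\<^sup>2))"
      using nn_integral_potential_0_powr_le[OF x_S2, of 1 "b i" i] b_ge[of i] by simp
    also have "\<dots> \<le> ennreal ((2 + B) powr 1 * (32 * pi\<^sup>2))"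
      using b_le[of i] b_ge[of i] by (intro ennreal_leI mult_right_mono) auto
    finally show ?thesis .
  qed
qed auto

lemma AE_summable_grad: "AE p in \<mu>0. summable (\<lambda>i. A i * grad_norm (x i) p)"
proof (rule AE_summable_weighted[OF A_nonneg A_sums])
  show "(\<integral>\<^sup>+p. ennreal (grad_norm (x i) p) \<partial>\<mu>0) \<le> ennreal (2 powr 1 * (8 * pi\<^sup>2 * (1 / (1 - 1 / 2) + 2)))" for i
    using nn_integral_grad_norm_powr_le[OF x_S2, of 1 i] by (simp add: grad_norm_nonneg)
qed (auto simp: grad_norm_nonneg)

lemma AE_good: "AE p in \<mu>0. good p"
proof -
  have "AE p in \<mu>0. \<forall>i. (x i \<bullet> fst p)\<^sup>2 < 1"
    unfolding AE_all_countable by (intro allI AE_inner_sq_less_1 x_S2)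
  with AE_summable_eta AE_summable_grad AE_space[of \<mu>0] show ?thesis
    by eventually_elim (simp add: good_def)
qed

context
  fixes p assumes good: "good p"
begin

lemma good_S2S1: "p \<in> S2S1" and good_less: "(x i \<bullet> fst p)\<^sup>2 < 1" and good_le: "\<bar>x i \<bullet> fst p\<bar> \<le> 1"
  and good_summable: "summable (\<lambda>i. A i * (potential 0 (x i \<bullet> fst p) + b i))" "summable (\<lambda>i. A i * grad_norm (x i) p)"
  and good_term: "\<bar>potential 0 (x i \<bullet> fst p) + b i\<bar> = potential 0 (x i \<bullet> fst p) + b i"
proof -
  show S: "p \<in> S2S1" using good by (simp add: good_def)
  have less: "(x i \<bullet> fst p)\<^sup>2 < 1" for i using good by (simp add: good_def)
  show "(x i \<bullet> fst p)\<^sup>2 < 1" by (rule less)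
  show "\<bar>x i \<bullet> fst p\<bar> \<le> 1" by (rule abs_inner_S2_le[OF S x_S2])
  have t: "\<bar>potential 0 (x i \<bullet> fst p) + b i\<bar> = potential 0 (x i \<bullet> fst p) + b i" for i
    using potential_0_nonneg[OF less[of i]] b_ge[of i] by simp
  show "\<bar>potential 0 (x i \<bullet> fst p) + b i\<bar> = potential 0 (x i \<bullet> fst p) + b i" by (rule t)
  show "summable (\<lambda>i. A i * (potential 0 (x i \<bullet> fst p) + b i))" "summable (\<lambda>i. A i * grad_norm (x i) p)"
    using good unfolding good_def t by auto
qed

lemma eta_sum_good: "eta_sum (fst p) = (\<Sum>i. A i * (potential 0 (x i \<bullet> fst p) + b i))"
  by (simp add: eta_sum_def good_term)

lemma potential_approx_bounds:
  "0 \<le> A i * (potential (reg n) (x i \<bullet> fst p) + b i)"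
  "A i * (potential (reg n) (x i \<bullet> fst p) + b i) \<le> A i * (potential 0 (x i \<bullet> fst p) + b i)"
  using potential_nonneg[OF reg_pos good_le, of n i] potential_le_0[OF less_imp_le[OF reg_pos] good_less, of n i]
    A_nonneg[of i] b_ge[of i] by (auto intro!: mult_nonneg_nonneg mult_left_mono)

lemma eta_approx_le_sum: "eta_approx n (fst p) \<le> eta_sum (fst p)"
proof -
  have "eta_approx n (fst p) \<le> (\<Sum>i\<le>n. A i * (potential 0 (x i \<bullet> fst p) + b i))"
    unfolding eta_approx_def by (intro sum_mono potential_approx_bounds)
  also have "\<dots> \<le> eta_sum (fst p)"
    unfolding eta_sum_good by (rule sum_le_suminf[OF good_summable(1)]) (use potential_approx_bounds order_trans in blast)+
  finally show ?thesis .
qed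

lemma eta_lim_good: "eta_lim (fst p) = eta_sum (fst p)"
  using eta_approx_ge[OF good_S2S1, of 0] eta_approx_le_sum[of 0] by (simp add: eta_lim_def)

lemma eta_approx_le: "eta_approx n (fst p) \<le> eta_lim (fst p)"
  using eta_approx_le_sum eta_lim_good by simp

text \<open>Number of terms and regularisation change together, so this is Tannery's theorem, with
  the terms beyond \<open>n\<close> set to zero and those of the limit as majorants.\<close>

lemma eta_approx_tendsto: "(\<lambda>n. eta_approx n (fst p)) \<longlonglongrightarrow> eta_lim (fst p)"
proof -
  let ?a = "\<lambda>k n. if k \<le> n then A k * (potential (reg n) (x k \<bullet> fst p) + b k) else 0"
  have "((\<lambda>n. suminf (\<lambda>k. ?a k n)) \<longlongrightarrow> (\<Sum>k. A k * (potential 0 (x k \<bullet> fst p) + b k))) sequentially"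
  proof (rule tannerys_theorem[THEN conjunct2, THEN conjunct2])
    fix k
    have ev: "eventually (\<lambda>n. A k * (potential (reg n) (x k \<bullet> fst p) + b k) = ?a k n) sequentially"
      using eventually_ge_at_top[of k] by eventually_elim simp
    show "(\<lambda>n. ?a k n) \<longlonglongrightarrow> A k * (potential 0 (x k \<bullet> fst p) + b k)"
      by (rule Lim_transform_eventually[OF _ ev]) (intro tendsto_intros tendsto_potential reg_tendsto good_less)
  next
    show "eventually (\<lambda>(k, n). norm (?a k n) \<le> A k * (potential 0 (x k \<bullet> fst p) + b k)) (at_top \<times>\<^sub>F sequentially)"
      using potential_approx_bounds order_trans[OF potential_approx_bounds] by (intro always_eventually) auto
  qed (use good_summable in auto)
  moreover have "suminf (\<lambda>k. ?a k n) = eta_approx n (fst p)" for n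
    unfolding eta_approx_def by (subst suminf_finite[of "{..n}"]) auto
  ultimately show ?thesis by (simp add: eta_lim_good eta_sum_good)
qed

lemma grad_term_le: "norm ((A i * potential' (reg n) (x i \<bullet> fst p)) *\<^sub>R proj p (x i, 0)) \<le> A i * grad_norm (x i) p"
  using abs_potential'_le[OF less_imp_le[OF reg_pos] good_less, of n i] A_nonneg[of i]
  by (auto simp: grad_norm_def norm_proj_unit[OF good_S2S1 x_S2] abs_mult mult.assoc intro!: mult_left_mono mult_right_mono)

lemma norm_grad_approx_le: "norm (grad_approx n p) \<le> grad_bound p"
proof -
  have "norm (grad_approx n p) \<le> (\<Sum>i\<le>n. A i * grad_norm (x i) p)"
    unfolding grad_approx_def by (intro sum_norm_le grad_term_le)
  also have "\<dots> \<le> grad_bound p"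
    unfolding grad_bound_def by (rule sum_le_suminf[OF good_summable(2)]) (auto simp: A_nonneg grad_norm_nonneg)
  finally show ?thesis .
qed

text \<open>Tannery's theorem for each coordinate, with the weighted gradient norms as
  majorants.\<close>

lemma grad_approx_tendsto: "(\<lambda>n. grad_approx n p) \<longlonglongrightarrow> grad_lim p"
proof -
  have lim: "(\<lambda>n. grad_approx n p \<bullet> e) \<longlonglongrightarrow> (\<Sum>k. ((A k * potential' 0 (x k \<bullet> fst p)) *\<^sub>R proj p (x k, 0)) \<bullet> e)"
    if e: "e \<in> Basis" for e
  proof -
    let ?t = "\<lambda>n k. ((A k * potential' (reg n) (x k \<bullet> fst p)) *\<^sub>R proj p (x k, 0)) \<bullet> e"
    let ?a = "\<lambda>k n. if k \<le> n then ?t n k else 0"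
    have "((\<lambda>n. suminf (\<lambda>k. ?a k n)) \<longlongrightarrow> (\<Sum>k. ((A k * potential' 0 (x k \<bullet> fst p)) *\<^sub>R proj p (x k, 0)) \<bullet> e)) sequentially"
    proof (rule tannerys_theorem[THEN conjunct2, THEN conjunct2])
      fix k
      have ev: "eventually (\<lambda>n. ?t n k = ?a k n) sequentially"
        using eventually_ge_at_top[of k] by eventually_elim simp
      show "(\<lambda>n. ?a k n) \<longlonglongrightarrow> ((A k * potential' 0 (x k \<bullet> fst p)) *\<^sub>R proj p (x k, 0)) \<bullet> e"
        by (rule Lim_transform_eventually[OF _ ev]) (intro tendsto_intros tendsto_potential reg_tendsto good_less)
    next
      have "norm (?t n k) \<le> A k * grad_norm (x k) p" for n k
        using Basis_le_norm[OF e] grad_term_le order_trans unfolding real_norm_def by blast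
      then show "eventually (\<lambda>(k, n). norm (?a k n) \<le> A k * grad_norm (x k) p) (at_top \<times>\<^sub>F sequentially)"
        using A_nonneg grad_norm_nonneg by (intro always_eventually) auto
    qed (use good_summable in auto)
    moreover have "suminf (\<lambda>k. ?a k n) = grad_approx n p \<bullet> e" for n
      unfolding grad_approx_def inner_sum_left by (subst suminf_finite[of "{..n}"]) auto
    ultimately show ?thesis by simp
  qed
  have "summable (\<lambda>k. (A k * potential' 0 (x k \<bullet> fst p)) *\<^sub>R proj p (x k, 0))"
  proof (rule summable_comparison_test'[OF good_summable(2), of 0])
    fix k
    show "norm ((A k * potential' 0 (x k \<bullet> fst p)) *\<^sub>R proj p (x k, 0)) \<le> A k * grad_norm (x k) p"
      by (simp add: grad_norm_def norm_proj_unit[OF good_S2S1 x_S2] abs_mult A_nonneg)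
  qed
  then have "grad_lim p \<bullet> e = (\<Sum>k. ((A k * potential' 0 (x k \<bullet> fst p)) *\<^sub>R proj p (x k, 0)) \<bullet> e)" for e
    unfolding grad_lim_def by (rule bounded_linear.suminf[OF bounded_linear_inner_left])
  with lim have l: "(\<lambda>n. grad_approx n p \<bullet> e) \<longlonglongrightarrow> grad_lim p \<bullet> e" if "e \<in> Basis" for e
    using that by metis
  have "(\<lambda>n. \<Sum>e\<in>Basis. (grad_approx n p \<bullet> e) *\<^sub>R e) \<longlonglongrightarrow> (\<Sum>e\<in>Basis. (grad_lim p \<bullet> e) *\<^sub>R e)"
    by (intro tendsto_sum tendsto_scaleR l tendsto_const)
  then show ?thesis by (simp add: euclidean_representation)
qed

lemma norm_grad_lim_le: "norm (grad_lim p) \<le> grad_bound p"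
  by (rule tendsto_upperbound[OF tendsto_norm[OF grad_approx_tendsto]]) (auto intro: always_eventually norm_grad_approx_le)

lemma grad_lim_tangent: "grad_lim p \<in> tangent p"
proof -
  have t: "grad_approx n p \<in> tangent p" for n by (rule has_grad_tangent[OF has_grad_approx good_S2S1])
  have 1: "(\<lambda>n. fst (grad_approx n p) \<bullet> fst p) \<longlonglongrightarrow> fst (grad_lim p) \<bullet> fst p"
    and 2: "(\<lambda>n. snd (grad_approx n p) \<bullet> snd p) \<longlonglongrightarrow> snd (grad_lim p) \<bullet> snd p"
    by (intro tendsto_intros grad_approx_tendsto)+
  have "fst (grad_lim p) \<bullet> fst p = 0" "snd (grad_lim p) \<bullet> snd p = 0"
    using LIMSEQ_unique[OF 1, of 0] LIMSEQ_unique[OF 2, of 0] t by (auto simp: tangent_def)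
  then show ?thesis by (simp add: tangent_def)
qed

lemma snd_grad_lim: "snd (grad_lim p) = 0"
proof -
  have 1: "(\<lambda>n. snd (grad_approx n p)) \<longlonglongrightarrow> snd (grad_lim p)"
    by (intro tendsto_intros grad_approx_tendsto)
  have "snd (grad_approx n p) = 0" for n by (simp add: grad_approx_def snd_sum proj_def)
  then show ?thesis using LIMSEQ_unique[OF 1, of 0] by simp
qed

end

lemma eta_lim_ge: "2 * A 0 \<le> eta_lim y"
  by (simp add: eta_lim_def)

lemma eta_lim_pos: "0 < eta_lim y"
  using eta_lim_ge[of y] A0_pos by simp

lemma borel_measurable_lim:
  "(\<lambda>p. eta_lim (fst p)) \<in> borel_measurable \<mu>0" "grad_bound \<in> borel_measurable \<mu>0" "grad_lim \<in> borel_measurable \<mu>0"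
proof -
  have [measurable]: "(\<lambda>p. proj p w) \<in> borel_measurable \<mu>0" for w
    unfolding proj_def by (intro borel_measurable_mu0_continuous continuous_intros)
  show "(\<lambda>p. eta_lim (fst p)) \<in> borel_measurable \<mu>0" unfolding eta_lim_def eta_sum_def by measurable
  show "grad_bound \<in> borel_measurable \<mu>0" unfolding grad_bound_def[abs_def] by measurable
  show "grad_lim \<in> borel_measurable \<mu>0" unfolding grad_lim_def[abs_def] by measurable
qed

lemmas [measurable] = borel_measurable_lim

text \<open>Holds almost everywhere because the value of \<open>suminf\<close> at a divergent series
  is unspecified.\<close>

lemma grad_bound_nonneg: "AE p in \<mu>0. 0 \<le> grad_bound p"
  by (rule eventually_mono[OF AE_good]) (meson norm_grad_lim_le norm_ge_zero order_trans)

text \<open>Jensen's inequality for the weighted series, with a bound for the potentials that is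
  uniform in the centre and in \<open>b i\<close>.\<close>

lemma nn_integral_eta_lim_powr:
  assumes q: "1 \<le> q"
  shows "\<exists>C. (\<integral>\<^sup>+p. ennreal (eta_lim (fst p) powr q) \<partial>\<mu>0) \<le> ennreal C"
proof -
  let ?C = "(2 * q + B) powr q * (32 * pi\<^sup>2)"
  have "(\<integral>\<^sup>+p. ennreal (eta_lim (fst p) powr q) \<partial>\<mu>0) = (\<integral>\<^sup>+p. ennreal ((\<Sum>i. A i * \<bar>potential 0 (x i \<bullet> fst p) + b i\<bar>) powr q) \<partial>\<mu>0)"
    by (rule nn_integral_cong_AE, rule eventually_mono[OF AE_good]) (simp add: eta_lim_good eta_sum_def)
  also have "\<dots> \<le> ennreal (K powr (q - 1) * (\<Sum>i. A i * ?C))"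
  proof (rule nn_integral_suminf_powr_le[OF A_nonneg A_sums K_pos _ _ AE_summable_eta q])
    fix i
    have "(\<integral>\<^sup>+p. ennreal (\<bar>potential 0 (x i \<bullet> fst p) + b i\<bar> powr q) \<partial>\<mu>0) \<le> ennreal ((2 * q + b i) powr q * (32 * pi\<^sup>2))"
      using b_ge[of i] by (intro nn_integral_potential_0_powr_le x_S2 q) auto
    also have "\<dots> \<le> ennreal ?C"
      using b_le[of i] b_ge[of i] q by (intro ennreal_leI mult_right_mono powr_mono2) auto
    finally show "(\<integral>\<^sup>+p. ennreal (\<bar>potential 0 (x i \<bullet> fst p) + b i\<bar> powr q) \<partial>\<mu>0) \<le> ennreal ?C" .
  qed (auto intro: summable_mult2 sums_summable[OF A_sums])
  finally show ?thesis by blast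
qed

lemma integrable_eta_lim_powr: "1 \<le> q \<Longrightarrow> integrable \<mu>0 (\<lambda>p. eta_lim (fst p) powr q)"
  using nn_integral_eta_lim_powr[of q] by (auto intro!: integrable_of_nn_integral_le)

lemma integrable_grad_bound_powr:
  assumes r: "1 \<le> r" "r < 2"
  shows "integrable \<mu>0 (\<lambda>p. grad_bound p powr r)"
proof -
  let ?C = "2 powr r * (8 * pi\<^sup>2 * (1 / (1 - r / 2) + 2))"
  have C: "0 \<le> ?C" using r by (intro mult_nonneg_nonneg add_nonneg_nonneg) auto
  have "(\<integral>\<^sup>+p. ennreal (grad_bound p powr r) \<partial>\<mu>0) \<le> ennreal (K powr (r - 1) * (\<Sum>i. A i * ?C))"
    unfolding grad_bound_def
    by (rule nn_integral_suminf_powr_le[OF A_nonneg A_sums K_pos _ _ AE_summable_grad r(1) nn_integral_grad_norm_powr_le[OF x_S2 r] C])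
       (auto simp: grad_norm_nonneg intro: summable_mult2 sums_summable[OF A_sums])
  then show ?thesis by (intro integrable_of_nn_integral_le) auto
qed

lemma integrable_eta_lim: "integrable \<mu>0 (\<lambda>p. eta_lim (fst p))"
  using integrable_eta_lim_powr[of 1] eta_lim_pos by (simp add: less_imp_le)

lemma integrable_eta_lim_sq: "integrable \<mu>0 (\<lambda>p. (eta_lim (fst p))\<^sup>2)"
proof -
  have "(eta_lim y)\<^sup>2 = eta_lim y powr 2" for y using eta_lim_pos[of y] by simp
  then show ?thesis using integrable_eta_lim_powr[of 2] by simp
qed

lemma integrable_grad_bound: "integrable \<mu>0 grad_bound"
proof (rule integrable_cong_AE_imp[OF integrable_grad_bound_powr[of 1]])
  show "AE p in \<mu>0. grad_bound p powr 1 = grad_bound p"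
    using grad_bound_nonneg by eventually_elim simp
qed auto

lemma integrable_eta_grad_powr:
  assumes r: "1 \<le> r" "r < 2"
  shows "integrable \<mu>0 (\<lambda>p. (eta_lim (fst p) * grad_bound p) powr r)"
proof (rule Bochner_Integration.integrable_bound)
  \<comment> \<open>The midpoint between \<open>r\<close> and 2: \<open>grad_bound\<close> still
    lies in the Lebesgue space of exponent \<open>s\<close>. Young's inequality with exponent
    \<open>s / r\<close> leaves to \<open>eta_lim\<close> a conjugate exponent, which may be as
    large as it likes.\<close>
  define s where "s = (r + 2) / 2"
  define c where "c = s / r"
  define d where "d = c / (c - 1)"
  have s: "1 \<le> s" "s < 2" using r by (auto simp: s_def)
  have c: "1 < c" using r by (simp add: c_def s_def)
  have d: "1 < d" using c by (simp add: d_def)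
  have cd: "1 / c + 1 / d = 1" using c by (simp add: d_def field_simps)
  have rd: "1 \<le> r * d" using mult_mono[of 1 r 1 d] r d by simp
  show "integrable \<mu>0 (\<lambda>p. grad_bound p powr s / c + eta_lim (fst p) powr (r * d) / d)"
    by (intro Bochner_Integration.integrable_add integrable_divide integrable_grad_bound_powr s integrable_eta_lim_powr rd)
  show "AE p in \<mu>0. norm ((eta_lim (fst p) * grad_bound p) powr r) \<le> norm (grad_bound p powr s / c + eta_lim (fst p) powr (r * d) / d)"
    using grad_bound_nonneg
  proof eventually_elim
    case (elim p)
    have "(eta_lim (fst p) * grad_bound p) powr r = grad_bound p powr r * eta_lim (fst p) powr r"
      using elim eta_lim_pos[of "fst p"] by (simp add: powr_mult)
    also have "\<dots> \<le> (grad_bound p powr r) powr c / c + (eta_lim (fst p) powr r) powr d / d"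
      by (rule Youngs_inequality[OF c d cd]) auto
    also have "\<dots> = grad_bound p powr s / c + eta_lim (fst p) powr (r * d) / d"
      using r by (simp add: powr_powr c_def)
    finally show ?case by simp
  qed
qed measurable

lemma integrable_eta_grad: "integrable \<mu>0 (\<lambda>p. eta_lim (fst p) * grad_bound p)"
proof (rule integrable_cong_AE_imp[OF integrable_eta_grad_powr[of 1]])
  show "AE p in \<mu>0. (eta_lim (fst p) * grad_bound p) powr 1 = eta_lim (fst p) * grad_bound p"
    using grad_bound_nonneg by eventually_elim (simp add: eta_lim_pos less_imp_le)
qed auto

end

section \<open>Dependence of the potential on the regularisation and on the centre\<close>

lemma ln_one_plus_le_powr:
  fixes s e :: real assumes s: "0 \<le> s" and e: "0 < e" "e \<le> 1"
  shows "ln (1 + s) \<le> (1 + 1 / e) * s powr e"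
proof (cases "s \<le> 1")
  case True
  have "ln (1 + s) \<le> s" using s by (rule ln_add_one_self_le_self)
  also have "s \<le> s powr e"
  proof (cases "s = 0")
    case False
    then show ?thesis using powr_mono'[of e 1 s] s True e by simp
  qed simp
  also have "s powr e \<le> (1 + 1 / e) * s powr e"
    using mult_right_mono[of 1 "1 + 1 / e" "s powr e"] e by simp
  finally show ?thesis .
next
  case False
  have "ln (1 + s) \<le> ln (2 * s)" using False by (intro ln_mono) auto
  also have "\<dots> = ln 2 + ln s" using False by (simp add: ln_mult)
  also have "\<dots> \<le> 1 + s powr e / e"
    using ln_le_minus_one[of "2::real"] ln_le_powr[of s e] False e by (intro add_mono) auto
  also have "\<dots> \<le> s powr e + s powr e / e" using False e by (simp add: ge_one_powr_ge_zero)
  also have "\<dots> = (1 + 1 / e) * s powr e" by (simp add: distrib_right)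
  finally show ?thesis .
qed

text \<open>A Hoelder estimate for the logarithm, paid for with negative powers of the arguments:
  the quotient of the larger by the smaller argument is put into
  \<open>ln_one_plus_le_powr\<close>.\<close>

lemma abs_ln_diff_le:
  fixes u v e :: real assumes u: "0 < u" and v: "0 < v" and e: "0 < e" "e \<le> 1"
  shows "\<bar>ln u - ln v\<bar> \<le> (1 + 1 / e) * \<bar>u - v\<bar> powr e * (u powr - e + v powr - e)"
proof -
  have *: "\<bar>ln u - ln v\<bar> \<le> (1 + 1 / e) * \<bar>u - v\<bar> powr e * (u powr - e + v powr - e)"
    if u: "0 < u" and uv: "u \<le> v" for u v :: real
  proof -
    have "ln v - ln u = ln (v / u)" using u uv by (simp add: ln_div)
    also have "v / u = 1 + (v - u) / u" using u by (simp add: field_simps)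
    also have "ln \<dots> \<le> (1 + 1 / e) * ((v - u) / u) powr e"
      using u uv e by (intro ln_one_plus_le_powr) auto
    also have "((v - u) / u) powr e = \<bar>u - v\<bar> powr e * u powr - e"
      using u uv by (simp add: powr_divide powr_minus_divide)
    also have "(1 + 1 / e) * (\<bar>u - v\<bar> powr e * u powr - e) \<le> (1 + 1 / e) * \<bar>u - v\<bar> powr e * (u powr - e + v powr - e)"
      unfolding mult.assoc[symmetric] using e by (intro mult_left_mono) auto
    finally show ?thesis using u uv by simp
  qed
  show ?thesis
    using *[of u v] *[of v u] u v by (cases "u \<le> v") (auto simp: abs_minus_commute add.commute)
qed

lemma add_powr_le:
  fixes u v q :: real assumes "0 \<le> u" "0 \<le> v" "0 \<le> q"
  shows "(u + v) powr q \<le> 2 powr q * (u powr q + v powr q)"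
proof -
  have "(u + v) powr q \<le> (2 * max u v) powr q" using assms by (intro powr_mono2) auto
  also have "\<dots> = 2 powr q * max u v powr q" using assms by (simp add: powr_mult)
  also have "\<dots> \<le> 2 powr q * (u powr q + v powr q)" by (intro mult_left_mono) (auto simp: max_def)
  finally show ?thesis .
qed

text \<open>The Hoelder exponent \<open>1 / (2 * q)\<close> turns the singular weights, after taking
  the \<open>q\<close>-th power, into the integrable power \<open>-1/2\<close>. The arguments of the
  two logarithms differ by at most \<open>a + 2 * \<delta>\<close>, as
  \<open>\<bar>s + t\<bar> \<le> 2\<close>.\<close>

lemma potential_diff_powr_le:
  fixes a q s t \<delta> :: real
  assumes a: "0 < a" and s: "s\<^sup>2 < 1" and t: "t\<^sup>2 < 1" and \<delta>: "\<bar>s - t\<bar> \<le> \<delta>" and q: "1 \<le> q"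
  shows "\<bar>potential a s - potential 0 t\<bar> powr q
     \<le> ((a + (1 + 2 * q) * (a + 2 * \<delta>) powr (1 / (2 * q))) powr q * 2 powr q) * ((1 - s\<^sup>2) powr - (1/2) + (1 - t\<^sup>2) powr - (1/2))"
proof -
  define e where "e = 1 / (2 * q)"
  have e: "0 < e" "e \<le> 1" "1 / e = 2 * q" using q by (auto simp: e_def)
  let ?u = "1 + a - s\<^sup>2" and ?v = "1 - t\<^sup>2"
  define U where "U = (1 - s\<^sup>2) powr - e"
  define V where "V = (1 - t\<^sup>2) powr - e"
  have u: "0 < ?u" "0 < ?v" using a s t by auto
  have UV: "0 \<le> U" "1 \<le> V"
    using t e by (auto simp: U_def V_def powr_minus_divide powr_le1 le_divide_eq)
  have st: "\<bar>s\<bar> \<le> 1" "\<bar>t\<bar> \<le> 1" using s t by (auto simp: abs_square_less_1 less_imp_le)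
  have "\<bar>?u - ?v\<bar> \<le> a + \<bar>(s - t) * (s + t)\<bar>"
    using a by (simp add: power2_eq_square algebra_simps)
  also have "\<bar>(s - t) * (s + t)\<bar> \<le> \<delta> * 2"
    unfolding abs_mult using \<delta> st by (intro mult_mono) auto
  finally have d: "\<bar>?u - ?v\<bar> \<le> a + 2 * \<delta>" by simp
  have "potential a s - potential 0 t = ln (1 + a) + (ln ?v - ln ?u)"
    using a s t u by (simp add: potential_def ln_div)
  then have "\<bar>potential a s - potential 0 t\<bar> \<le> \<bar>ln (1 + a)\<bar> + \<bar>ln ?v - ln ?u\<bar>" by simp
  also have "\<bar>ln (1 + a)\<bar> \<le> a" using a ln_add_one_self_le_self[of a] by simp
  also have "\<bar>ln ?v - ln ?u\<bar> \<le> (1 + 2 * q) * \<bar>?u - ?v\<bar> powr e * (?u powr - e + ?v powr - e)"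
    using abs_ln_diff_le[OF u e(1,2)] e(3) by (simp add: abs_minus_commute)
  also have "\<dots> \<le> (1 + 2 * q) * (a + 2 * \<delta>) powr e * (U + V)"
  proof (intro mult_mono add_mono powr_mono2)
    show "?u powr - e \<le> U" unfolding U_def using a s e by (intro powr_mono2') auto
  qed (use d e q in \<open>auto simp: V_def\<close>)
  finally have le1: "\<bar>potential a s - potential 0 t\<bar> \<le> a + (1 + 2 * q) * (a + 2 * \<delta>) powr e * (U + V)" by simp
  \<comment> \<open>Because \<open>V \<ge> 1\<close>, the additive term from
    \<open>ln (1 + a)\<close> is absorbed into the factor \<open>U + V\<close>.\<close>
  have "a \<le> a * (U + V)" using a UV mult_left_mono[of 1 "U + V" a] by simp
  with le1 have "\<bar>potential a s - potential 0 t\<bar> \<le> (a + (1 + 2 * q) * (a + 2 * \<delta>) powr e) * (U + V)"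
    by (subst distrib_right) simp
  then have "\<bar>potential a s - potential 0 t\<bar> powr q \<le> ((a + (1 + 2 * q) * (a + 2 * \<delta>) powr e) * (U + V)) powr q"
    using q by (intro powr_mono2) auto
  also have "\<dots> = (a + (1 + 2 * q) * (a + 2 * \<delta>) powr e) powr q * (U + V) powr q"
    by (rule powr_mult)
  also have "\<dots> \<le> (a + (1 + 2 * q) * (a + 2 * \<delta>) powr e) powr q * (2 powr q * (U powr q + V powr q))"
    using UV q by (intro mult_left_mono add_powr_le) auto
  also have "U powr q = (1 - s\<^sup>2) powr - (1/2)" using q by (simp add: U_def e_def powr_powr)
  also have "V powr q = (1 - t\<^sup>2) powr - (1/2)" using q by (simp add: V_def e_def powr_powr)
  finally show ?thesis by (simp add: e_def mult.assoc)
qed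

text \<open>The coefficient of \<open>potential_diff_powr_le\<close> times
  \<open>64 * pi\<^sup>2\<close>, which is \<open>32 * pi\<^sup>2\<close> for each of the two
  singular weights.\<close>

definition diff_const :: "real \<Rightarrow> real \<Rightarrow> real \<Rightarrow> real" where
  "diff_const q a \<delta> = (a + (1 + 2 * q) * (a + 2 * \<delta>) powr (1 / (2 * q))) powr q * 2 powr q * (64 * pi\<^sup>2)"

lemma diff_const_nonneg: "0 \<le> diff_const q a \<delta>"
  by (simp add: diff_const_def)

lemma diff_const_mono:
  "0 \<le> a \<Longrightarrow> a \<le> a' \<Longrightarrow> 0 \<le> \<delta> \<Longrightarrow> \<delta> \<le> \<delta>' \<Longrightarrow> 1 \<le> q \<Longrightarrow> diff_const q a \<delta> \<le> diff_const q a' \<delta>'"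
  unfolding diff_const_def
  by (intro mult_right_mono powr_mono2 add_mono mult_left_mono) (auto intro!: add_nonneg_nonneg)

lemma diff_const_tendsto:
  assumes a: "(a \<longlongrightarrow> 0) F" and d: "(d \<longlongrightarrow> 0) F" and nn: "\<And>n. 0 < a n" "\<And>n. 0 \<le> d n" and q: "1 \<le> q"
  shows "((\<lambda>n. diff_const q (a n) (d n)) \<longlongrightarrow> 0) F"
proof -
  have z: "((\<lambda>n. f n powr e) \<longlongrightarrow> 0) F" if "(f \<longlongrightarrow> 0) F" "\<And>n. 0 \<le> f n" "0 < e" for f :: "'a \<Rightarrow> real" and e
    using tendsto_powr2[OF that(1) tendsto_const, of e] that by simp
  have nn': "0 \<le> a n + 2 * d n" for n using nn(1)[of n] nn(2)[of n] by simp
  have nn'': "0 \<le> a n + (1 + 2 * q) * (a n + 2 * d n) powr (1 / (2 * q))" for n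
    using less_imp_le[OF nn(1)[of n]] q by (intro add_nonneg_nonneg mult_nonneg_nonneg) auto
  have 1: "((\<lambda>n. (a n + 2 * d n) powr (1 / (2 * q))) \<longlongrightarrow> 0) F"
    using tendsto_add[OF a tendsto_mult_right_zero[OF d, of 2]] nn' q by (intro z) auto
  have 2: "((\<lambda>n. (a n + (1 + 2 * q) * (a n + 2 * d n) powr (1 / (2 * q))) powr q) \<longlongrightarrow> 0) F"
    using tendsto_add[OF a tendsto_mult_right_zero[OF 1, of "1 + 2 * q"]] nn'' q by (intro z) auto
  show ?thesis
    unfolding diff_const_def by (intro tendsto_mult_left_zero 2)
qed

lemma nn_integral_potential_diff_le:
  assumes y: "y \<in> S2" and z: "z \<in> S2" and a: "0 < a" and q: "1 \<le> q"
  shows "(\<integral>\<^sup>+p. ennreal (\<bar>potential a (z \<bullet> fst p) - potential 0 (y \<bullet> fst p)\<bar> powr q) \<partial>\<mu>0) \<le> ennreal (diff_const q a (norm (z - y)))"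
proof -
  define M where "M = (a + (1 + 2 * q) * (a + 2 * norm (z - y)) powr (1 / (2 * q))) powr q * 2 powr q"
  have M: "0 \<le> M" by (simp add: M_def)
  have "(\<integral>\<^sup>+p. ennreal (\<bar>potential a (z \<bullet> fst p) - potential 0 (y \<bullet> fst p)\<bar> powr q) \<partial>\<mu>0)
    \<le> (\<integral>\<^sup>+p. ennreal M * (ennreal ((1 - (z \<bullet> fst p)\<^sup>2) powr - (1/2)) + ennreal ((1 - (y \<bullet> fst p)\<^sup>2) powr - (1/2))) \<partial>\<mu>0)"
  proof (rule nn_integral_mono_AE)
    show "AE p in \<mu>0. ennreal (\<bar>potential a (z \<bullet> fst p) - potential 0 (y \<bullet> fst p)\<bar> powr q)
       \<le> ennreal M * (ennreal ((1 - (z \<bullet> fst p)\<^sup>2) powr - (1/2)) + ennreal ((1 - (y \<bullet> fst p)\<^sup>2) powr - (1/2)))"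
      using AE_inner_sq_less_1[OF y] AE_inner_sq_less_1[OF z] AE_space
    proof eventually_elim
      case (elim p)
      have "norm (fst p) = 1" using elim(3) by (simp add: mem_S2S1_iff)
      then have "\<bar>z \<bullet> fst p - y \<bullet> fst p\<bar> \<le> norm (z - y)"
        using Cauchy_Schwarz_ineq2[of "z - y" "fst p"] by (simp add: inner_diff_left)
      from potential_diff_powr_le[OF a elim(2,1) this q]
      have "ennreal (\<bar>potential a (z \<bullet> fst p) - potential 0 (y \<bullet> fst p)\<bar> powr q)
        \<le> ennreal (M * ((1 - (z \<bullet> fst p)\<^sup>2) powr - (1/2) + (1 - (y \<bullet> fst p)\<^sup>2) powr - (1/2)))"
        unfolding M_def by (rule ennreal_leI)
      then show ?case using M by (simp add: ennreal_mult)
    qed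
  qed
  also have "\<dots> = ennreal M * ((\<integral>\<^sup>+p. ennreal ((1 - (z \<bullet> fst p)\<^sup>2) powr - (1/2)) \<partial>\<mu>0) + (\<integral>\<^sup>+p. ennreal ((1 - (y \<bullet> fst p)\<^sup>2) powr - (1/2)) \<partial>\<mu>0))"
    by (subst nn_integral_cmult, measurable, subst nn_integral_add) measurable
  also have "\<dots> \<le> ennreal M * (ennreal (8 * pi\<^sup>2 * (1 / (1 - 1/2) + 2)) + ennreal (8 * pi\<^sup>2 * (1 / (1 - 1/2) + 2)))"
    by (intro mult_left_mono add_mono nn_integral_powr_le y z) auto
  also have "\<dots> = ennreal (M * (64 * pi\<^sup>2))"
    using M by (simp add: ennreal_plus[symmetric] ennreal_mult[symmetric] del: ennreal_plus)
  finally show ?thesis by (simp add: M_def diff_const_def)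
qed

section \<open>Convergence of warping functions with moving centres\<close>

context limit_warping
begin

context
  fixes N :: "nat \<Rightarrow> nat" and \<alpha> :: "nat \<Rightarrow> real" and \<alpha>m :: real and \<xi> :: "nat \<Rightarrow> nat \<Rightarrow> real^3" and H :: "nat \<Rightarrow> real^3 \<Rightarrow> real"
  assumes N: "filterlim N at_top sequentially" and \<alpha>: "\<And>n. 0 < \<alpha> n" "\<And>n. \<alpha> n \<le> \<alpha>m" "\<alpha> \<longlonglongrightarrow> 0"
    and \<xi>: "\<And>n i. \<xi> n i \<in> S2" "\<And>i. (\<lambda>n. \<xi> n i) \<longlonglongrightarrow> x i"
    and H: "\<And>n p. p \<in> S2S1 \<Longrightarrow> H n (fst p) = (\<Sum>i<N n. A i * (potential (\<alpha> n) (\<xi> n i \<bullet> fst p) + b i))"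
begin

lemma borel_measurable_H: "(\<lambda>p. H n (fst p)) \<in> borel_measurable \<mu>0"
proof -
  have "(\<lambda>p. \<Sum>i<N n. A i * (potential (\<alpha> n) (\<xi> n i \<bullet> fst p) + b i)) \<in> borel_measurable \<mu>0" by measurable
  then show ?thesis by (subst measurable_cong[where g = "\<lambda>p. \<Sum>i<N n. A i * (potential (\<alpha> n) (\<xi> n i \<bullet> fst p) + b i)"]) (simp_all add: H)
qed

text \<open>The difference is a weighted series: below \<open>N n\<close> the constants
  \<open>b i\<close> cancel and two potentials are compared, beyond \<open>N n\<close> the tail of
  the limit remains. Jensen's inequality bounds the integral by the series of
  \<open>A i * C n i\<close>. It tends to zero by Tannery's theorem, since a fixed index eventually
  lies below the cut-off.\<close>

lemma nn_integral_H_diff_le: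
  assumes q: "1 \<le> q"
  shows "\<exists>c. c \<longlonglongrightarrow> 0 \<and> (\<forall>n. (\<integral>\<^sup>+p. ennreal (\<bar>H n (fst p) - eta_lim (fst p)\<bar> powr q) \<partial>\<mu>0) \<le> ennreal (c n))"
proof -
  define h where "h n i p = (if i < N n then \<bar>potential (\<alpha> n) (\<xi> n i \<bullet> fst p) - potential 0 (x i \<bullet> fst p)\<bar>
      else \<bar>potential 0 (x i \<bullet> fst p) + b i\<bar>)" for n i and p :: ambient
  define C where "C n i = (if i < N n then diff_const q (\<alpha> n) (norm (\<xi> n i - x i)) else (2 * q + B) powr q * (32 * pi\<^sup>2))" for n i
  \<comment> \<open>A majorant uniform in \<open>n\<close> and \<open>i\<close>: two unit vectors
    are at distance at most 2, and \<open>diff_const\<close> is monotone.\<close>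
  define Cm where "Cm = diff_const q \<alpha>m 2 + (2 * q + B) powr q * (32 * pi\<^sup>2)"
  have C0: "0 \<le> C n i" for n i by (simp add: C_def diff_const_nonneg)
  have CCm: "C n i \<le> Cm" for n i
  proof -
    have "norm (\<xi> n i - x i) \<le> 2"
      using norm_triangle_ineq4[of "\<xi> n i" "x i"] \<xi>(1)[of n i] x_S2[of i] by (simp add: S2_def)
    then have "diff_const q (\<alpha> n) (norm (\<xi> n i - x i)) \<le> diff_const q \<alpha>m 2"
      by (rule diff_const_mono[OF less_imp_le[OF \<alpha>(1)] \<alpha>(2) norm_ge_zero _ q])
    moreover have "0 \<le> diff_const q \<alpha>m 2" "0 \<le> (2 * q + B) powr q * (32 * pi\<^sup>2)"
      by (simp_all add: diff_const_nonneg)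
    moreover have "(if P then u else v) \<le> d + v" if "u \<le> d" "0 \<le> d" "0 \<le> v" for P and u v d :: real
      using that by simp
    ultimately show ?thesis unfolding C_def Cm_def by blast
  qed
  have Clim: "(\<lambda>n. C n i) \<longlonglongrightarrow> 0" for i
  proof -
    have "(\<lambda>n. norm (\<xi> n i - x i)) \<longlonglongrightarrow> 0" using \<xi>(2) by (simp add: tendsto_norm_zero_iff LIM_zero)
    from diff_const_tendsto[OF \<alpha>(3) this \<alpha>(1) _ q]
    have l: "(\<lambda>n. diff_const q (\<alpha> n) (norm (\<xi> n i - x i))) \<longlonglongrightarrow> 0" by simp
    have "eventually (\<lambda>n. Suc i \<le> N n) sequentially" using N by (simp add: filterlim_at_top)
    then have "eventually (\<lambda>n. diff_const q (\<alpha> n) (norm (\<xi> n i - x i)) = C n i) sequentially"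
      by eventually_elim (simp add: C_def)
    from Lim_transform_eventually[OF l this] show ?thesis .
  qed
  have sC: "summable (\<lambda>i. A i * C n i)" for n
    by (rule summable_comparison_test'[where N = 0 and g = "\<lambda>i. A i * Cm"])
       (use A_nonneg CCm C0 in \<open>auto intro: summable_mult2 sums_summable[OF A_sums] mult_left_mono\<close>)
  have bound: "(\<integral>\<^sup>+p. ennreal (\<bar>H n (fst p) - eta_lim (fst p)\<bar> powr q) \<partial>\<mu>0) \<le> ennreal (K powr (q - 1) * (\<Sum>i. A i * C n i))" for n
  proof -
    have sm: "AE p in \<mu>0. summable (\<lambda>i. A i * h n i p)"
    proof (rule eventually_mono[OF AE_summable_eta])
      fix p :: ambient assume *: "summable (\<lambda>i. A i * \<bar>potential 0 (x i \<bullet> fst p) + b i\<bar>)"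
      have ev: "eventually (\<lambda>i. A i * h n i p = A i * \<bar>potential 0 (x i \<bullet> fst p) + b i\<bar>) sequentially"
        using eventually_ge_at_top[of "N n"] by eventually_elim (simp add: h_def)
      show "summable (\<lambda>i. A i * h n i p)" using summable_cong[OF ev] * by simp
    qed
    have "(\<integral>\<^sup>+p. ennreal (\<bar>H n (fst p) - eta_lim (fst p)\<bar> powr q) \<partial>\<mu>0) \<le> (\<integral>\<^sup>+p. ennreal ((\<Sum>i. A i * h n i p) powr q) \<partial>\<mu>0)"
    proof (rule nn_integral_mono_AE)
      show "AE p in \<mu>0. ennreal (\<bar>H n (fst p) - eta_lim (fst p)\<bar> powr q) \<le> ennreal ((\<Sum>i. A i * h n i p) powr q)"
        using AE_good sm
      proof eventually_elim
        case (elim p)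
        let ?t = "\<lambda>i. if i < N n then A i * (potential (\<alpha> n) (\<xi> n i \<bullet> fst p) + b i) else 0"
        let ?l = "\<lambda>i. A i * (potential 0 (x i \<bullet> fst p) + b i)"
        have t: "?t sums H n (fst p)"
          unfolding H[OF good_S2S1[OF elim(1)]] by (rule sums_If_finite_set[OF finite_lessThan, unfolded lessThan_iff])
        have l: "?l sums eta_lim (fst p)"
          unfolding eta_lim_good[OF elim(1)] eta_sum_good[OF elim(1)] by (rule summable_sums[OF good_summable(1)[OF elim(1)]])
        have ab: "\<bar>?t i - ?l i\<bar> = A i * h n i p" for i
          using A_nonneg[of i] good_term[OF elim(1), of i]
          by (auto simp: h_def abs_mult right_diff_distrib[symmetric])
        have "\<bar>H n (fst p) - eta_lim (fst p)\<bar> = \<bar>\<Sum>i. ?t i - ?l i\<bar>"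
          using sums_unique[OF sums_diff[OF t l]] by simp
        also have "\<dots> \<le> (\<Sum>i. \<bar>?t i - ?l i\<bar>)"
          by (rule summable_rabs) (use elim(2) in \<open>simp only: ab\<close>)
        finally have "\<bar>H n (fst p) - eta_lim (fst p)\<bar> \<le> (\<Sum>i. A i * h n i p)" unfolding ab .
        then show ?case using q by (intro ennreal_leI powr_mono2) auto
      qed
    qed
    also have "\<dots> \<le> ennreal (K powr (q - 1) * (\<Sum>i. A i * C n i))"
    proof (rule nn_integral_suminf_powr_le[OF A_nonneg A_sums K_pos _ _ sm q _ C0 sC])
      show "(\<integral>\<^sup>+p. ennreal (h n i p powr q) \<partial>\<mu>0) \<le> ennreal (C n i)" for i
      proof (cases "i < N n")
        case True
        then show ?thesis using nn_integral_potential_diff_le[OF x_S2 \<xi>(1) \<alpha>(1) q] by (simp add: h_def C_def)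
      next
        case False
        have "(\<integral>\<^sup>+p. ennreal (\<bar>potential 0 (x i \<bullet> fst p) + b i\<bar> powr q) \<partial>\<mu>0) \<le> ennreal ((2 * q + b i) powr q * (32 * pi\<^sup>2))"
          using b_ge[of i] by (intro nn_integral_potential_0_powr_le x_S2 q) auto
        also have "\<dots> \<le> ennreal ((2 * q + B) powr q * (32 * pi\<^sup>2))"
          using b_le[of i] b_ge[of i] q by (intro ennreal_leI mult_right_mono powr_mono2) auto
        finally show ?thesis using False by (simp add: h_def C_def)
      qed
      show "h n i \<in> borel_measurable \<mu>0" for i unfolding h_def by (cases "i < N n") simp_all
    qed (auto simp: h_def)
    finally show ?thesis .
  qed
  have lim0: "(\<lambda>n. A k * C n k) \<longlonglongrightarrow> 0" for k by (rule tendsto_mult_right_zero[OF Clim])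
  have sCm: "summable (\<lambda>i. A i * Cm)" by (rule summable_mult2[OF sums_summable[OF A_sums]])
  have nb: "norm (A k * C n k) \<le> A k * Cm" for k n :: nat
    unfolding real_norm_def abs_of_nonneg[OF mult_nonneg_nonneg[OF A_nonneg C0]] by (rule mult_left_mono[OF CCm A_nonneg])
  have ev: "eventually (\<lambda>(k, n). norm (A k * C n k) \<le> A k * Cm) (at_top \<times>\<^sub>F sequentially)"
    by (rule always_eventually, rule allI) (unfold split_beta, rule nb)
  note tannerys_theorem[OF lim0 ev sCm sequentially_bot]
  then have "(\<lambda>n. \<Sum>i. A i * C n i) \<longlonglongrightarrow> (\<Sum>i. 0)" by (elim conjE)
  then have "(\<lambda>n. \<Sum>i. A i * C n i) \<longlonglongrightarrow> 0" unfolding suminf_zero .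
  then have "(\<lambda>n. K powr (q - 1) * (\<Sum>i. A i * C n i)) \<longlonglongrightarrow> 0"
    by (rule tendsto_mult_right_zero)
  with bound show ?thesis by blast
qed

lemma integrable_H_diff:
  assumes q: "1 \<le> q"
  shows "integrable \<mu>0 (\<lambda>p. \<bar>H n (fst p) - eta_lim (fst p)\<bar> powr q)"
    "(\<lambda>n. \<integral>p. \<bar>H n (fst p) - eta_lim (fst p)\<bar> powr q \<partial>\<mu>0) \<longlonglongrightarrow> 0"
proof -
  obtain c where c: "c \<longlonglongrightarrow> 0" "\<And>n. (\<integral>\<^sup>+p. ennreal (\<bar>H n (fst p) - eta_lim (fst p)\<bar> powr q) \<partial>\<mu>0) \<le> ennreal (c n)"
    using nn_integral_H_diff_le[OF q] by blast
  have m: "(\<lambda>p. \<bar>H n (fst p) - eta_lim (fst p)\<bar> powr q) \<in> borel_measurable \<mu>0" for n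
    using borel_measurable_H[of n] by measurable
  show I: "integrable \<mu>0 (\<lambda>p. \<bar>H n (fst p) - eta_lim (fst p)\<bar> powr q)" for n
    by (rule integrable_of_nn_integral_le[OF m _ c(2)]) simp
  have le: "(\<integral>p. \<bar>H n (fst p) - eta_lim (fst p)\<bar> powr q \<partial>\<mu>0) \<le> max 0 (c n)" for n
  proof -
    have "ennreal (\<integral>p. \<bar>H n (fst p) - eta_lim (fst p)\<bar> powr q \<partial>\<mu>0) \<le> ennreal (max 0 (c n))"
      using nn_integral_eq_integral[OF I, of n] order_trans[OF c(2)[of n] ennreal_leI[of "c n" "max 0 (c n)"]] by simp
    then show ?thesis by (simp add: ennreal_le_iff)
  qed
  show "(\<lambda>n. \<integral>p. \<bar>H n (fst p) - eta_lim (fst p)\<bar> powr q \<partial>\<mu>0) \<longlonglongrightarrow> 0"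
  proof (rule tendsto_sandwich[OF _ _ tendsto_const])
    show "(\<lambda>n. max 0 (c n)) \<longlonglongrightarrow> 0" using tendsto_max[OF tendsto_const c(1), of 0] by simp
  qed (auto intro!: always_eventually le)
qed

text \<open>The mixed product of the powers of \<bar>u - v\<bar> and \<open>v\<close> is split by
  the inequality of arithmetic and geometric means with a free weight \<open>l\<close>, to be
  adapted later to the size of the difference.\<close>

lemma square_diff_powr_le:
  fixes u v q l :: real
  assumes "0 \<le> v" "1 \<le> q" "0 < l"
  shows "\<bar>u\<^sup>2 - v\<^sup>2\<bar> powr q \<le> 2 powr q * ((2 powr q / l + 1) * \<bar>u - v\<bar> powr (2 * q) + 2 powr q * l * v powr (2 * q))"
proof -
  let ?d = "\<bar>u - v\<bar>"
  have "\<bar>u\<^sup>2 - v\<^sup>2\<bar> = ?d * \<bar>u + v\<bar>" by (simp add: power2_eq_square abs_mult[symmetric] algebra_simps)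
  also have "\<dots> \<le> ?d * (2 * v + ?d)" using assms by (intro mult_left_mono) auto
  finally have "\<bar>u\<^sup>2 - v\<^sup>2\<bar> powr q \<le> (?d * (2 * v + ?d)) powr q" using assms by (intro powr_mono2) auto
  also have "\<dots> = ?d powr q * (2 * v + ?d) powr q" by (rule powr_mult)
  also have "\<dots> \<le> ?d powr q * (2 powr q * ((2 * v) powr q + ?d powr q))"
    using assms by (intro mult_left_mono add_powr_le) auto
  also have "\<dots> = 2 powr q * (2 powr q * (?d powr q * v powr q) + ?d powr q * ?d powr q)"
    using assms by (simp add: powr_mult algebra_simps)
  also have "?d powr q * ?d powr q = ?d powr (2 * q)" by (simp add: powr_add[symmetric])
  also have "?d powr q * v powr q \<le> ?d powr (2 * q) / l + l * v powr (2 * q)"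
  proof -
    have am: "s * t \<le> s\<^sup>2 / l + l * t\<^sup>2" for s t :: real
    proof -
      have "0 \<le> (s / sqrt l - sqrt l * t)\<^sup>2 + s\<^sup>2 / l + l * t\<^sup>2" using assms by simp
      also have "(s / sqrt l - sqrt l * t)\<^sup>2 = s\<^sup>2 / l + l * t\<^sup>2 - 2 * (s * t)"
        using assms by (simp add: power2_diff power_mult_distrib power_divide)
      finally show ?thesis by simp
    qed
    have "(z powr q)\<^sup>2 = z powr (2 * q)" for z :: real by (simp add: power2_eq_square powr_add[symmetric])
    with am[of "?d powr q" "v powr q"] show ?thesis by simp
  qed
  finally show ?thesis using assms by (simp add: algebra_simps)
qed

lemma integrable_H_sq_diff:
  assumes q: "1 \<le> q"
  shows "integrable \<mu>0 (\<lambda>p. \<bar>(H n (fst p))\<^sup>2 - (eta_lim (fst p))\<^sup>2\<bar> powr q)" (is ?int)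
    and "(\<lambda>n. \<integral>p. \<bar>(H n (fst p))\<^sup>2 - (eta_lim (fst p))\<^sup>2\<bar> powr q \<partial>\<mu>0) \<longlonglongrightarrow> 0" (is ?lim)
proof -
  let ?D = "\<lambda>n p. \<bar>H n (fst p) - eta_lim (fst p)\<bar> powr (2 * q)"
  let ?S = "\<lambda>n p. \<bar>(H n (fst p))\<^sup>2 - (eta_lim (fst p))\<^sup>2\<bar> powr q"
  let ?E = "\<lambda>p. eta_lim (fst p) powr (2 * q)"
  let ?d = "\<lambda>n. \<integral>p. ?D n p \<partial>\<mu>0"
  have q2: "1 \<le> 2 * q" using q by simp
  note iD = integrable_H_diff[OF q2] and iE = integrable_eta_lim_powr[OF q2]
  have m: "?S n \<in> borel_measurable \<mu>0" for n using borel_measurable_H[of n] by measurable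
  have le: "?S n p \<le> 2 powr q * ((2 powr q / l + 1) * ?D n p + 2 powr q * l * ?E p)" if "0 < l" for n l p
    using square_diff_powr_le[OF less_imp_le[OF eta_lim_pos] q that] .
  have iR: "integrable \<mu>0 (\<lambda>p. 2 powr q * ((2 powr q / l + 1) * ?D n p + 2 powr q * l * ?E p))" for n l
    by (intro integrable_mult_right Bochner_Integration.integrable_add iD(1) iE)
  have iS: "integrable \<mu>0 (?S n)" for n
    by (rule Bochner_Integration.integrable_bound[OF iR[of 1 n] m]) (use le[of 1 n] in \<open>auto intro!: AE_I2 order_trans[OF _ abs_ge_self]\<close>)
  then show ?int .
  \<comment> \<open>The weight balances \<open>?d n / l n\<close> against \<open>l n\<close>: both
    are then small with \<open>?d n\<close>. Adding \<open>reg n\<close> keeps it positive when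
    \<open>?d n\<close> vanishes.\<close>
  define l where "l n = sqrt (?d n) + reg n" for n
  have d0: "0 \<le> ?d n" for n by (rule integral_nonneg_AE) simp
  have l: "0 < l n" for n using d0[of n] reg_pos[of n] by (simp add: l_def add_nonneg_pos)
  have bd: "(\<integral>p. ?S n p \<partial>\<mu>0) \<le> 2 powr q * (2 powr q * sqrt (?d n) + ?d n + 2 powr q * l n * (\<integral>p. ?E p \<partial>\<mu>0))" for n
  proof -
    have "(\<integral>p. ?S n p \<partial>\<mu>0) \<le> (\<integral>p. 2 powr q * ((2 powr q / l n + 1) * ?D n p + 2 powr q * l n * ?E p) \<partial>\<mu>0)"
      by (rule integral_mono[OF iS iR le[OF l]])
    also have "\<dots> = 2 powr q * ((2 powr q / l n + 1) * ?d n + 2 powr q * l n * (\<integral>p. ?E p \<partial>\<mu>0))"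
      using iD(1) iE by simp
    also have "(2 powr q / l n + 1) * ?d n \<le> 2 powr q * sqrt (?d n) + ?d n"
    proof -
      have "?d n = sqrt (?d n) * sqrt (?d n)" using d0 by simp
      also have "\<dots> \<le> sqrt (?d n) * l n" using d0[of n] reg_pos[of n] by (intro mult_left_mono) (auto simp: l_def)
      finally have "?d n / l n \<le> sqrt (?d n)" using l[of n] by (simp add: divide_le_eq)
      from mult_left_mono[OF this, of "2 powr q"] show ?thesis by (simp add: distrib_right)
    qed
    finally show ?thesis by simp
  qed
  have dl: "?d \<longlonglongrightarrow> 0" by (rule iD(2))
  have ll: "l \<longlonglongrightarrow> 0" unfolding l_def[abs_def]
    using tendsto_add[OF tendsto_real_sqrt[OF dl] reg_tendsto] by simp
  have "(\<lambda>n. 2 powr q * (2 powr q * sqrt (?d n) + ?d n + 2 powr q * l n * (\<integral>p. ?E p \<partial>\<mu>0))) \<longlonglongrightarrow>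
      2 powr q * (2 powr q * sqrt 0 + 0 + 2 powr q * 0 * (\<integral>p. ?E p \<partial>\<mu>0))"
    by (intro tendsto_intros dl ll)
  then have ub: "(\<lambda>n. 2 powr q * (2 powr q * sqrt (?d n) + ?d n + 2 powr q * l n * (\<integral>p. ?E p \<partial>\<mu>0))) \<longlonglongrightarrow> 0"
    by (simp only: real_sqrt_zero mult_zero_right mult_zero_left add_0_right)
  show ?lim
  proof (rule tendsto_sandwich[OF _ _ tendsto_const ub])
    show "eventually (\<lambda>n. 0 \<le> (\<integral>p. ?S n p \<partial>\<mu>0)) sequentially"
      by (rule always_eventually, rule allI, rule integral_nonneg_AE, rule AE_I2, rule powr_ge_zero)
    show "eventually (\<lambda>n. (\<integral>p. ?S n p \<partial>\<mu>0) \<le> 2 powr q * (2 powr q * sqrt (?d n) + ?d n + 2 powr q * l n * (\<integral>p. ?E p \<partial>\<mu>0))) sequentially"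
      by (rule always_eventually, rule allI, rule bd)
  qed
qed

end

end

section \<open>Weak derivatives\<close>

text \<open>Testing against fields of class \<open>C\<^sup>1\<close> instead of smooth fields makes products available.\<close>

definition weak_grad :: "(ambient \<Rightarrow> real) \<Rightarrow> vfield \<Rightarrow> bool" where
  "weak_grad f W \<longleftrightarrow> integrable \<mu>0 f \<and> integrable \<mu>0 W \<and> (AE p in \<mu>0. W p \<in> tangent p) \<and>
     (\<forall>X X'. C1_field X X' \<longrightarrow> (\<integral>p. W p \<bullet> X p \<partial>\<mu>0) = - (\<integral>p. f p * field_trace X' p \<partial>\<mu>0))"

lemma C1_field_continuous:
  assumes "C1_field X X'"
  shows "continuous_on S2S1 X" "continuous_on S2S1 (field_trace X')"
proof -
  show "continuous_on S2S1 X"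
    by (rule continuous_on_retr_derivative[where F' = X']) (use assms in \<open>simp add: C1_field_def\<close>)
  have "continuous_on S2S1 (\<lambda>p. X' p v)" for v using assms unfolding C1_field_def by blast
  then show "continuous_on S2S1 (field_trace X')"
    unfolding field_trace_def by (intro continuous_intros)
qed

lemma continuous_S2S1_bound:
  fixes f :: "ambient \<Rightarrow> 'b::real_normed_vector"
  assumes "continuous_on S2S1 f"
  obtains C where "0 \<le> C" "\<And>p. p \<in> S2S1 \<Longrightarrow> norm (f p) \<le> C"
proof -
  have "bounded (f ` S2S1)" using compact_continuous_image[OF assms compact_S2S1] compact_imp_bounded by blast
  then obtain B where "\<And>p. p \<in> S2S1 \<Longrightarrow> norm (f p) \<le> B" by (auto simp: bounded_iff)
  then show ?thesis using that[of "\<bar>B\<bar>"] by (meson abs_ge_self abs_ge_zero order_trans)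
qed

lemma weak_grad_limit:
  fixes f :: "nat \<Rightarrow> ambient \<Rightarrow> real" and W :: "nat \<Rightarrow> vfield"
  assumes g: "\<And>n. has_grad (f n) (W n)"
    and m: "f0 \<in> borel_measurable \<mu>0" "W0 \<in> borel_measurable \<mu>0"
    and lim: "AE p in \<mu>0. (\<lambda>n. f n p) \<longlonglongrightarrow> f0 p" "AE p in \<mu>0. (\<lambda>n. W n p) \<longlonglongrightarrow> W0 p"
    and bd: "AE p in \<mu>0. \<forall>n. \<bar>f n p\<bar> \<le> F p" "AE p in \<mu>0. \<forall>n. norm (W n p) \<le> G p"
    and int: "integrable \<mu>0 F" "integrable \<mu>0 G"
  shows "weak_grad f0 W0"
  unfolding weak_grad_def
proof (intro conjI allI impI)
  have mf: "f n \<in> borel_measurable \<mu>0" and mW: "W n \<in> borel_measurable \<mu>0" for n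
    by (rule borel_measurable_mu0_continuous[OF has_grad_continuous_on[OF g]])
       (rule borel_measurable_mu0_continuous[OF has_grad_continuous[OF g]])
  have bf: "AE p in \<mu>0. norm (f n p) \<le> F p" for n using bd(1) by eventually_elim simp
  have bW: "AE p in \<mu>0. norm (W n p) \<le> G p" for n using bd(2) by eventually_elim simp
  show "integrable \<mu>0 f0" by (rule integrable_dominated_convergence[OF m(1) mf int(1) lim(1) bf])
  show "integrable \<mu>0 W0" by (rule integrable_dominated_convergence[OF m(2) mW int(2) lim(2) bW])
  show "AE p in \<mu>0. W0 p \<in> tangent p"
    using lim(2) AE_space
  proof eventually_elim
    case (elim p)
    then have p: "p \<in> S2S1" by simp
    have 1: "(\<lambda>n. fst (W n p) \<bullet> fst p) \<longlonglongrightarrow> fst (W0 p) \<bullet> fst p"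
      and 2: "(\<lambda>n. snd (W n p) \<bullet> snd p) \<longlonglongrightarrow> snd (W0 p) \<bullet> snd p"
      by (intro tendsto_intros elim)+
    then show ?case
      using LIMSEQ_unique[OF 1, of 0] LIMSEQ_unique[OF 2, of 0] has_grad_tangent[OF g p]
      by (auto simp: tangent_def)
  qed
  fix X X' assume X: "C1_field X X'"
  note cX = C1_field_continuous[OF X]
  obtain B1 where B1: "0 \<le> B1" "\<And>p. p \<in> S2S1 \<Longrightarrow> norm (X p) \<le> B1" using continuous_S2S1_bound[OF cX(1)] by blast
  obtain B2 where B2: "0 \<le> B2" "\<And>p. p \<in> S2S1 \<Longrightarrow> norm (field_trace X' p) \<le> B2" using continuous_S2S1_bound[OF cX(2)] by blast
  have mX: "X \<in> borel_measurable \<mu>0" "field_trace X' \<in> borel_measurable \<mu>0"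
    by (intro borel_measurable_mu0_continuous cX)+
  have L1: "(\<lambda>n. \<integral>p. W n p \<bullet> X p \<partial>\<mu>0) \<longlonglongrightarrow> (\<integral>p. W0 p \<bullet> X p \<partial>\<mu>0)"
  proof (rule integral_dominated_convergence[where w = "\<lambda>p. B1 * G p"])
    show "AE p in \<mu>0. (\<lambda>n. W n p \<bullet> X p) \<longlonglongrightarrow> W0 p \<bullet> X p" using lim(2) by eventually_elim (intro tendsto_intros)
    show "AE p in \<mu>0. norm (W n p \<bullet> X p) \<le> B1 * G p" for n
      using bW[of n] AE_space
    proof eventually_elim
      case (elim p)
      have "norm (W n p \<bullet> X p) \<le> norm (W n p) * norm (X p)" by (simp add: Cauchy_Schwarz_ineq2)
      also have "\<dots> \<le> G p * B1" using elim B1 by (intro mult_mono) (auto intro: order_trans[OF norm_ge_zero])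
      finally show ?case by (simp only: mult.commute)
    qed
  qed (use m mW mX int in auto)
  have L2: "(\<lambda>n. \<integral>p. f n p * field_trace X' p \<partial>\<mu>0) \<longlonglongrightarrow> (\<integral>p. f0 p * field_trace X' p \<partial>\<mu>0)"
  proof (rule integral_dominated_convergence[where w = "\<lambda>p. B2 * F p"])
    show "AE p in \<mu>0. (\<lambda>n. f n p * field_trace X' p) \<longlonglongrightarrow> f0 p * field_trace X' p" using lim(1) by eventually_elim (intro tendsto_intros)
    show "AE p in \<mu>0. norm (f n p * field_trace X' p) \<le> B2 * F p" for n
      using bf[of n] AE_space
    proof eventually_elim
      case (elim p)
      have "norm (f n p * field_trace X' p) = norm (f n p) * norm (field_trace X' p)" by (rule norm_mult)
      also have "\<dots> \<le> F p * B2" using elim B2 by (intro mult_mono) (auto intro: order_trans[OF abs_ge_zero])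
      finally show ?case by (simp only: mult.commute)
    qed
  qed (use m mf mX int in auto)
  have "(\<lambda>n. \<integral>p. W n p \<bullet> X p \<partial>\<mu>0) \<longlonglongrightarrow> - (\<integral>p. f0 p * field_trace X' p \<partial>\<mu>0)"
    unfolding integration_by_parts[OF g X] by (rule tendsto_minus[OF L2])
  then show "(\<integral>p. W0 p \<bullet> X p \<partial>\<mu>0) = - (\<integral>p. f0 p * field_trace X' p \<partial>\<mu>0)"
    by (rule LIMSEQ_unique[OF L1])
qed

section \<open>Smooth test fields and the divergence of the product connection\<close>

lemma smooth_on_S2S1_derivative:
  assumes F: "smooth_on_S2S1 F"
  shows "p \<in> S2S1 \<Longrightarrow> ((\<lambda>z. F (retr z)) has_derivative dirderiv F p) (at p)"
    and "continuous_on S2S1 (\<lambda>p. dirderiv F p v)"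
proof -
  let ?U = "{z::ambient. fst z \<noteq> 0 \<and> snd z \<noteq> 0}"
  have "Ck_on (Suc 0) ?U (\<lambda>z. F (retr z))" using F unfolding smooth_on_S2S1_def by blast
  then have d: "(\<lambda>z. F (retr z)) differentiable_on ?U"
    and c: "continuous_on ?U (\<lambda>p. frechet_derivative (\<lambda>z. F (retr z)) (at p) v)" for v unfolding Ck_on.simps by blast+
  show "((\<lambda>z. F (retr z)) has_derivative dirderiv F p) (at p)" if "p \<in> S2S1"
  proof -
    have "(\<lambda>z. F (retr z)) differentiable (at p)"
      using d S2S1_punctured[OF that] open_punctured differentiable_on_eq_differentiable_at by blast
    then show ?thesis unfolding dirderiv_def[abs_def] by (simp add: frechet_derivative_works)
  qed
  show "continuous_on S2S1 (\<lambda>p. dirderiv F p v)"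
    unfolding dirderiv_def by (rule continuous_on_subset[OF c]) (use S2S1_punctured in blast)
qed

definition smooth_grad :: "(ambient \<Rightarrow> real) \<Rightarrow> vfield" where
  "smooth_grad u p = (\<Sum>e\<in>Basis. dirderiv u p e *\<^sub>R e)"

lemma smooth_grad_inner:
  assumes "smooth_on_S2S1 u" "p \<in> S2S1"
  shows "smooth_grad u p \<bullet> v = dirderiv u p v"
proof -
  have lin: "linear (dirderiv u p)"
    using smooth_on_S2S1_derivative(1)[OF assms] by (rule has_derivative_linear)
  have "smooth_grad u p \<bullet> v = (\<Sum>e\<in>Basis. (v \<bullet> e) *\<^sub>R dirderiv u p e)"
    by (simp add: smooth_grad_def inner_sum_left inner_commute[of v] mult.commute)
  also have "\<dots> = dirderiv u p (\<Sum>e\<in>Basis. (v \<bullet> e) *\<^sub>R e)"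
    by (simp only: linear_sum[OF lin] linear_cmul[OF lin])
  finally show ?thesis by (simp add: euclidean_representation)
qed

lemma has_grad_smooth:
  assumes u: "smooth_on_S2S1 u" shows "has_grad u (smooth_grad u)"
  unfolding has_grad_def
proof (intro conjI ballI)
  fix p assume p: "p \<in> S2S1"
  note D = smooth_on_S2S1_derivative(1)[OF u p]
  have n: "dirderiv u p (fst p, 0) = 0" "dirderiv u p (0, snd p) = 0"
  proof -
    have "proj p (fst p, 0) = 0" "proj p (0, snd p) = 0" using p by (simp_all add: proj_def zero_prod_def)
    then show "dirderiv u p (fst p, 0) = 0" "dirderiv u p (0, snd p) = 0"
      using has_derivative_retr_proj[OF p D] linear_0[OF has_derivative_linear[OF D]] by metis+
  qed
  show "smooth_grad u p \<in> tangent p"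
    using smooth_grad_inner[OF u p, of "(fst p, 0)"] smooth_grad_inner[OF u p, of "(0, snd p)"]
    by (simp add: tangent_def n inner_Pair_0)
  show "((\<lambda>z. u (retr z)) has_derivative (\<lambda>v. smooth_grad u p \<bullet> v)) (at p)"
    using D by (simp add: smooth_grad_inner[OF u p])
qed (unfold smooth_grad_def, intro continuous_intros smooth_on_S2S1_derivative(2)[OF u])

lemma C1_field_smooth:
  assumes "smooth_on_S2S1 X" "\<And>p. p \<in> S2S1 \<Longrightarrow> X p \<in> tangent p"
  shows "C1_field X (dirderiv X)"
  unfolding C1_field_def using assms smooth_on_S2S1_derivative[OF assms(1)] by blast

lemma linear_expand:
  fixes f :: "ambient \<Rightarrow> 'b::real_vector"
  assumes "linear f" shows "(\<Sum>e\<in>Basis. (w \<bullet> e) *\<^sub>R f e) = f w"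
proof -
  have "(\<Sum>e\<in>Basis. (w \<bullet> e) *\<^sub>R f e) = f (\<Sum>e\<in>Basis. (w \<bullet> e) *\<^sub>R e)"
    by (simp only: linear_sum[OF assms] linear_cmul[OF assms])
  then show ?thesis by (simp add: euclidean_representation)
qed

text \<open>The symmetric map \<open>proj p\<close> may be moved from one slot of a trace to the
  other.\<close>

lemma sum_proj_cyclic:
  fixes f :: "ambient \<Rightarrow> ambient \<Rightarrow> real"
  assumes l1: "\<And>v. linear (\<lambda>w. f w v)" and l2: "\<And>w. linear (f w)"
  shows "(\<Sum>e\<in>Basis. f (proj p e) e) = (\<Sum>e\<in>Basis. f e (proj p e))"
proof -
  have "(\<Sum>e\<in>Basis. f (proj p e) e) = (\<Sum>e\<in>Basis. \<Sum>k\<in>Basis. (proj p e \<bullet> k) *\<^sub>R f k e)"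
    by (intro sum.cong refl linear_expand[OF l1, symmetric])
  also have "\<dots> = (\<Sum>k\<in>Basis. \<Sum>e\<in>Basis. (proj p k \<bullet> e) *\<^sub>R f k e)"
    by (subst sum.swap, intro sum.cong refl) (metis proj_adjoint inner_commute)
  also have "\<dots> = (\<Sum>k\<in>Basis. f k (proj p k))"
    by (intro sum.cong refl linear_expand[OF l2])
  finally show ?thesis .
qed

lemma levi_civita_g0:
  assumes p: "p \<in> S2S1"
    and X: "\<And>q. q \<in> S2S1 \<Longrightarrow> X q \<in> tangent q" and Y: "\<And>q. q \<in> S2S1 \<Longrightarrow> Y q \<in> tangent q"
    and DX: "((\<lambda>z. X (retr z)) has_derivative DX) (at p)"
    and DY: "((\<lambda>z. Y (retr z)) has_derivative DY) (at p)"
  shows "levi_civita g0 X Y p = proj p (DY (X p))"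
proof -
  have "((\<lambda>z::ambient. 1::real) has_derivative (\<lambda>v. 0 \<bullet> fst v)) (at p)" by simp
  from levi_civita_warped[where \<eta> = "\<lambda>_. 1", OF p X Y DX DY this]
  show ?thesis by (simp add: g0_eq_warped)
qed

text \<open>The product connection is the projected ambient derivative. All projections in
  \<open>div_vfield\<close> can be moved onto the direction of differentiation, where
  \<open>X' p\<close> ignores them.\<close>

lemma div_vfield_eq_trace:
  assumes X: "C1_field X X'" and p: "p \<in> S2S1"
  shows "div_vfield X p = field_trace X' p"
proof -
  have D: "((\<lambda>z. X (retr z)) has_derivative X' p) (at p)" and t: "\<And>q. q \<in> S2S1 \<Longrightarrow> X q \<in> tangent q"
    using X p by (auto simp: C1_field_def)
  have lin: "linear (X' p)" by (rule has_derivative_linear[OF D])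
  have "div_vfield X p = (\<Sum>e\<in>Basis. proj p (X' p (proj p e)) \<bullet> proj p e)"
    unfolding div_vfield_def
    by (intro sum.cong refl, subst levi_civita_g0[OF p proj_tangent t has_derivative_proj_field[OF p] D]) simp_all
  also have "\<dots> = (\<Sum>e\<in>Basis. X' p e \<bullet> proj p e)"
    using p by (simp add: proj_adjoint has_derivative_retr_proj[OF p D])
  also have "\<dots> = (\<Sum>e\<in>Basis. X' p (proj p e) \<bullet> e)"
    by (rule sum_proj_cyclic[symmetric, where f = "\<lambda>w v. X' p w \<bullet> v"])
       (rule linearI; simp add: linear_add[OF lin] linear_cmul[OF lin] inner_add_left inner_add_right)+
  also have "\<dots> = field_trace X' p"
    by (simp add: field_trace_def has_derivative_retr_proj[OF p D])
  finally show ?thesis .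
qed

lemma weak_grad_imp_has_weak_gradient:
  assumes "weak_grad f W" shows "has_weak_gradient f W"
  unfolding has_weak_gradient_def
proof (intro conjI allI impI)
  show "integrable \<mu>0 f" "integrable \<mu>0 W" "AE p in \<mu>0. W p \<in> tangent p"
    using assms by (auto simp: weak_grad_def)
  fix X assume "smooth_on_S2S1 X \<and> (\<forall>p\<in>S2S1. X p \<in> tangent p)"
  then have X: "C1_field X (dirderiv X)" by (intro C1_field_smooth) auto
  have "(\<integral>p. f p * field_trace (dirderiv X) p \<partial>\<mu>0) = (\<integral>p. f p * div_vfield X p \<partial>\<mu>0)"
    by (intro Bochner_Integration.integral_cong refl) (simp add: div_vfield_eq_trace[OF X])
  then show "(\<integral>p. W p \<bullet> X p \<partial>\<mu>0) = - (\<integral>p. f p * div_vfield X p \<partial>\<mu>0)"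
    using assms X by (simp add: weak_grad_def)
qed

lemma C1_field_scaleR:
  assumes f: "has_grad f W" and X: "C1_field X X'"
  shows "C1_field (\<lambda>p. f p *\<^sub>R X p) (\<lambda>p v. f p *\<^sub>R X' p v + (W p \<bullet> v) *\<^sub>R X p)"
  unfolding C1_field_def
proof (intro conjI ballI allI)
  have cX': "continuous_on S2S1 (\<lambda>p. X' p v)" for v using X unfolding C1_field_def by blast
  show "continuous_on S2S1 (\<lambda>p. f p *\<^sub>R X' p v + (W p \<bullet> v) *\<^sub>R X p)" for v
    by (intro continuous_intros cX' has_grad_continuous_on[OF f] has_grad_continuous[OF f] C1_field_continuous[OF X])
  fix p assume p: "p \<in> S2S1"
  have D: "((\<lambda>z. X (retr z)) has_derivative X' p) (at p)" using X p by (auto simp: C1_field_def)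
  show "f p *\<^sub>R X p \<in> tangent p" using X p by (auto simp: C1_field_def tangent_def)
  show "((\<lambda>z. f (retr z) *\<^sub>R X (retr z)) has_derivative (\<lambda>v. f p *\<^sub>R X' p v + (W p \<bullet> v) *\<^sub>R X p)) (at p)"
    by (rule has_derivative_eq_rhs[OF has_derivative_scaleR[OF has_gradD[OF f p] D]]) (simp add: retr_ident[OF p])
qed

lemma field_trace_scaleR:
  "field_trace (\<lambda>p v. f p *\<^sub>R X' p v + (W p \<bullet> v) *\<^sub>R X p) p = f p * field_trace X' p + W p \<bullet> X p"
  unfolding field_trace_def
  by (simp add: inner_add_left sum.distrib sum_distrib_left euclidean_inner[of "W p" "X p"])

lemma C1_field_sum:
  assumes "\<And>k. k \<in> S \<Longrightarrow> C1_field (X k) (X' k)"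
  shows "C1_field (\<lambda>p. \<Sum>k\<in>S. X k p) (\<lambda>p v. \<Sum>k\<in>S. X' k p v)"
  unfolding C1_field_def
proof (intro conjI ballI allI)
  have c: "continuous_on S2S1 (\<lambda>p. X' k p v)" if "k \<in> S" for k v using assms[OF that] unfolding C1_field_def by blast
  show "continuous_on S2S1 (\<lambda>p. \<Sum>k\<in>S. X' k p v)" for v by (intro continuous_intros c)
  fix p assume p: "p \<in> S2S1"
  have t: "X k p \<in> tangent p" and D: "((\<lambda>z. X k (retr z)) has_derivative X' k p) (at p)" if "k \<in> S" for k
    using assms[OF that] p by (auto simp: C1_field_def)
  show "(\<Sum>k\<in>S. X k p) \<in> tangent p" using t by (simp add: tangent_def fst_sum snd_sum inner_sum_left)
  show "((\<lambda>z. \<Sum>k\<in>S. X k (retr z)) has_derivative (\<lambda>v. \<Sum>k\<in>S. X' k p v)) (at p)"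
    by (rule has_derivative_sum) (rule D)
qed

lemma field_trace_sum: "field_trace (\<lambda>p v. \<Sum>k\<in>S. X' k p v) p = (\<Sum>k\<in>S. field_trace (X' k) p)"
  unfolding field_trace_def inner_sum_left by (rule sum.swap)

text \<open>\<open>factor s\<close> is the projection to the first factor of the product if \<open>s\<close> holds, else to the
  second; \<open>factor_form s p\<close> is the metric of that factor.\<close>

definition factor :: "bool \<Rightarrow> ambient \<Rightarrow> ambient" where
  "factor s v = (if s then (fst v, 0) else (0, snd v))"

definition factor_form :: "bool \<Rightarrow> tensor2" where
  "factor_form s p i j = proj p (factor s i) \<bullet> j"

lemma factor_adjoint: "factor s v \<bullet> w = v \<bullet> factor s w"
  by (simp add: factor_def inner_prod_def)

lemma factor_proj: "factor s (proj p v) = proj p (factor s v)"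
  by (simp add: factor_def proj_def)

lemma proj_factor_self: "p \<in> S2S1 \<Longrightarrow> proj p (factor s p) = 0"
  by (simp add: factor_def proj_def zero_prod_def)

lemma factor_form_right: "factor_form s p i j = i \<bullet> proj p (factor s j)"
  unfolding factor_form_def by (simp only: proj_adjoint factor_adjoint factor_proj[symmetric])

lemma factor_form_eq:
  assumes "p \<in> S2S1"
  shows "factor_form True p i j = fst (proj p i) \<bullet> fst (proj p j)"
    "factor_form False p i j = snd (proj p i) \<bullet> snd (proj p j)"
  using assms by (simp_all add: factor_form_def factor_def proj_def inner_prod_def inner_simps inner_commute)

lemma linear_sum_inner:
  fixes f :: "ambient \<Rightarrow> real"
  assumes "linear f" shows "(\<Sum>e\<in>Basis. (e \<bullet> w) * f e) = f w"
  using linear_expand[OF assms, of w] by (simp add: inner_commute)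

lemma sum_factor_form_proj:
  fixes F :: "ambient \<Rightarrow> ambient \<Rightarrow> real"
  assumes p: "p \<in> S2S1" and l1: "\<And>w. linear (\<lambda>v. F v w)" and l2: "\<And>v. linear (F v)"
  shows "(\<Sum>i\<in>Basis. \<Sum>j\<in>Basis. factor_form s p i j * F (proj p i) (proj p j)) = (\<Sum>i\<in>Basis. \<Sum>j\<in>Basis. factor_form s p i j * F i j)"
proof -
  have 1: "(\<Sum>i\<in>Basis. factor_form s p i j * F (proj p i) w) = (\<Sum>i\<in>Basis. factor_form s p i j * F i w)" for j w
  proof -
    have "linear (\<lambda>v. F (proj p v) w)" using linear_compose[OF linear_proj l1] by (simp add: o_def)
    from linear_sum_inner[OF this] linear_sum_inner[OF l1] show ?thesis
      by (simp only: factor_form_right proj_proj[OF p])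
  qed
  have 2: "(\<Sum>j\<in>Basis. factor_form s p i j * F v (proj p j)) = (\<Sum>j\<in>Basis. factor_form s p i j * F v j)" for i v
  proof -
    have "linear (\<lambda>w. F v (proj p w))" using linear_compose[OF linear_proj l2] by (simp add: o_def)
    from linear_sum_inner[OF this] linear_sum_inner[OF l2] show ?thesis
      by (simp only: factor_form_def inner_commute[of "proj p (factor s i)"] proj_proj[OF p])
  qed
  show ?thesis unfolding 2 by (subst (1 2) sum.swap) (simp only: 1)
qed

text \<open>The metrics of the two factors are orthogonal as tensors, and the squared norm of each
  is the dimension of its factor.\<close>

lemma sum_factor_form_mult:
  assumes p: "p \<in> S2S1"
  shows "(\<Sum>i\<in>Basis. \<Sum>j\<in>Basis. factor_form s p i j * factor_form t p i j) = (if s = t then if s then 2 else 1 else 0)"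
proof -
  have "(\<Sum>i\<in>Basis. \<Sum>j\<in>Basis. factor_form s p i j * factor_form t p i j) = (\<Sum>i\<in>Basis. proj p (factor s i) \<bullet> proj p (factor t i))"
    unfolding factor_form_def by (intro sum.cong refl euclidean_inner[symmetric])
  also have "\<dots> = (if s = t then if s then 2 else 1 else 0)"
    using trace_proj_fst[OF p] trace_proj_snd[OF p]
    by (cases s; cases t) (simp_all add: sum_Basis_prod_split factor_def inner_prod_def proj_def)
  finally show ?thesis .
qed

lemma has_grad_linear: "has_grad (\<lambda>p. w \<bullet> p) (\<lambda>p. proj p w)"
  unfolding has_grad_def
proof (intro conjI ballI)
  fix p assume p: "p \<in> S2S1"
  show "proj p w \<in> tangent p" by (rule proj_tangent[OF p])
  have "((\<lambda>q. w \<bullet> q) has_derivative (\<lambda>v. w \<bullet> v)) (at p)" by (auto intro!: derivative_eq_intros)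
  from has_derivative_on_S2S1[OF p this, of "\<lambda>q. w \<bullet> q"]
  show "((\<lambda>z. w \<bullet> retr z) has_derivative (\<lambda>v. proj p w \<bullet> v)) (at p)" by (simp add: proj_adjoint)
qed (auto simp: proj_def intro!: continuous_intros)

definition factor_form_grad :: "bool \<Rightarrow> ambient \<Rightarrow> ambient \<Rightarrow> vfield" where
  "factor_form_grad s i j p = - ((factor s i \<bullet> p) *\<^sub>R proj p (factor s j) + (factor s j \<bullet> p) *\<^sub>R proj p (factor s i))"

lemma has_grad_factor_form: "has_grad (\<lambda>p. factor_form s p i j) (factor_form_grad s i j)"
proof -
  have g: "has_grad (\<lambda>p. factor s i \<bullet> j + - 1 * ((factor s i \<bullet> p) * (factor s j \<bullet> p)))
     (\<lambda>p. 0 + - 1 *\<^sub>R ((factor s i \<bullet> p) *\<^sub>R proj p (factor s j) + (factor s j \<bullet> p) *\<^sub>R proj p (factor s i)))"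
    by (rule has_grad_add[OF has_grad_const has_grad_cmult[OF has_grad_mult[OF has_grad_linear has_grad_linear]]])
  have e: "factor s i \<bullet> j + - 1 * ((factor s i \<bullet> p) * (factor s j \<bullet> p)) = factor_form s p i j" for p
    by (cases s) (simp_all add: factor_form_def factor_def proj_def inner_prod_def inner_simps inner_commute)
  show ?thesis using g unfolding e by (simp add: factor_form_grad_def[abs_def])
qed

lemma dirderiv_linear_param:
  assumes F: "\<And>w. smooth_on_S2S1 (F w)" and lin: "\<And>q. q \<in> S2S1 \<Longrightarrow> linear (\<lambda>w. F w q :: real)" and p: "p \<in> S2S1"
  shows "linear (\<lambda>w. dirderiv (F w) p v)"
proof (rule linearI)
  note D = smooth_on_S2S1_derivative(1)[OF F p]
  fix w w' :: 'a and r :: real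
  have "eventually (\<lambda>z. F w (retr z) + F w' (retr z) = F (w + w') (retr z)) (nhds p)"
    using eventually_punctured[OF p] by (rule eventually_mono) (simp add: linear_add[OF lin] retr_mem)
  from has_derivative_eventually_eq[OF has_derivative_add[OF D D] this]
  show "dirderiv (F (w + w')) p v = dirderiv (F w) p v + dirderiv (F w') p v" by (rule dirderiv_eqI)
  have "eventually (\<lambda>z. r *\<^sub>R F w (retr z) = F (r *\<^sub>R w) (retr z)) (nhds p)"
    using eventually_punctured[OF p] by (rule eventually_mono) (simp add: linear_cmul[OF lin] retr_mem)
  from has_derivative_eventually_eq[OF has_derivative_scaleR_right[OF D] this]
  show "dirderiv (F (r *\<^sub>R w)) p v = r *\<^sub>R dirderiv (F w) p v" by (rule dirderiv_eqI)
qed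

section \<open>Contraction of a test field with the metric of a factor\<close>

context
  fixes \<phi> :: tensor3
  assumes \<phi>: "smooth_tensor3 \<phi>"
begin

private definition C where "C k i j = (\<lambda>q. comp3 \<phi> q k i j)"

private lemma smooth_C: "smooth_on_S2S1 (C k i j)"
  using \<phi> unfolding smooth_tensor3_def C_def by blast

private lemma linear_\<phi>:
  assumes "p \<in> S2S1"
  shows "linear (\<lambda>w. \<phi> p w i j)" "linear (\<lambda>w. \<phi> p k w j)" "linear (\<lambda>w. \<phi> p k i w)"
  using \<phi> assms unfolding smooth_tensor3_def trilinear_def by blast+

private lemma linear_C:
  assumes p: "p \<in> S2S1"
  shows "linear (\<lambda>w. C w i j p)" "linear (\<lambda>w. C k w j p)" "linear (\<lambda>w. C k i w p)"
  unfolding C_def comp3_def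
  using linear_compose[OF linear_proj linear_\<phi>(1)[OF p]] linear_compose[OF linear_proj linear_\<phi>(2)[OF p]]
    linear_compose[OF linear_proj linear_\<phi>(3)[OF p]]
  by (simp_all add: o_def)

private lemma C_normal:
  assumes p: "p \<in> S2S1" and w: "proj p w = 0"
  shows "C w i j p = 0" "C k w j p = 0" "C k i w p = 0"
  unfolding C_def comp3_def w by (rule linear_0[OF linear_\<phi>(1)[OF p]] linear_0[OF linear_\<phi>(2)[OF p]] linear_0[OF linear_\<phi>(3)[OF p]])+

private definition E where "E k i j p v = dirderiv (C k i j) p v"

private lemma linear_E:
  assumes p: "p \<in> S2S1"
  shows "linear (\<lambda>w. E w i j p v)" "linear (\<lambda>w. E k w j p v)" "linear (\<lambda>w. E k i w p v)" "linear (\<lambda>w. E k i j p w)"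
  unfolding E_def
  by (rule dirderiv_linear_param[OF smooth_C linear_C(1) p] dirderiv_linear_param[OF smooth_C linear_C(2) p]
      dirderiv_linear_param[OF smooth_C linear_C(3) p] has_derivative_linear[OF smooth_on_S2S1_derivative(1)[OF smooth_C p]]; assumption)+

private definition S where "S s k = (\<lambda>p. \<Sum>i\<in>Basis. \<Sum>j\<in>Basis. factor_form s p i j * C k i j p)"

private definition gS where "gS s k = (\<lambda>p. \<Sum>i\<in>Basis. \<Sum>j\<in>Basis. factor_form s p i j *\<^sub>R smooth_grad (C k i j) p + C k i j p *\<^sub>R factor_form_grad s i j p)"

private lemma has_grad_S: "has_grad (S s k) (gS s k)"
  unfolding S_def gS_def
  by (rule has_grad_sum, rule has_grad_sum, rule has_grad_mult[OF has_grad_factor_form has_grad_smooth[OF smooth_C]])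

text \<open>The test field contracted in its last two slots with the metric of a factor. It reduces
  the weak derivative of a diagonal tensor to the weak gradient of its coefficient.\<close>

definition contract_field :: "bool \<Rightarrow> vfield" where
  "contract_field s p = (\<Sum>k\<in>Basis. S s k p *\<^sub>R proj p k)"

definition contract_deriv :: "bool \<Rightarrow> ambient \<Rightarrow> ambient \<Rightarrow> ambient" where
  "contract_deriv s p v = (\<Sum>k\<in>Basis. S s k p *\<^sub>R proj_deriv k p v + (gS s k p \<bullet> v) *\<^sub>R proj p k)"

lemma C1_field_contract: "C1_field (contract_field s) (contract_deriv s)"
  unfolding contract_field_def[abs_def] contract_deriv_def[abs_def]
  by (rule C1_field_sum, rule C1_field_scaleR[OF has_grad_S C1_field_proj])

private lemma linear_S: "p \<in> S2S1 \<Longrightarrow> linear (\<lambda>k. S s k p)"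
  by (rule linearI)
     (simp_all add: S_def linear_add[OF linear_C(1)] linear_cmul[OF linear_C(1)] distrib_left sum.distrib sum_distrib_left mult.left_commute)

text \<open>The extension of a tangent vector has vanishing covariant derivative at the base point,
  so the correction terms are zero there.\<close>

lemma cov_deriv3_tangent:
  assumes p: "p \<in> S2S1" and y: "y1 \<in> tangent p" "y2 \<in> tangent p" "y3 \<in> tangent p"
  shows "cov_deriv3 \<phi> p x y1 y2 y3 = dirderiv (\<lambda>q. comp3 \<phi> q y1 y2 y3) p x"
proof -
  have "levi_civita g0 (\<lambda>q. proj q x) (\<lambda>q. proj q y) p = 0" if "y \<in> tangent p" for y
  proof -
    have "fst y \<bullet> fst p = 0" "snd y \<bullet> snd p = 0" using that by (auto simp: tangent_def)
    then show ?thesis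
      using p by (subst levi_civita_g0[OF p proj_tangent proj_tangent has_derivative_proj_field[OF p] has_derivative_proj_field[OF p]])
         (simp_all add: proj_def zero_prod_def)
  qed
  then show ?thesis
    using y by (simp add: cov_deriv3_def linear_0[OF linear_\<phi>(1)[OF p]] linear_0[OF linear_\<phi>(2)[OF p]] linear_0[OF linear_\<phi>(3)[OF p]])
qed

text \<open>The metric of a factor is parallel, so contraction commutes with the divergence.
  Concretely, each term of the derivative of \<open>factor_form\<close> puts a normal vector into a
  slot of \<open>C\<close>, where it is projected away.\<close>

lemma field_trace_contract:
  assumes p: "p \<in> S2S1"
  shows "field_trace (contract_deriv s) p = (\<Sum>i\<in>Basis. \<Sum>j\<in>Basis. factor_form s p i j * comp2 (div3 \<phi>) p i j)"
proof -
  \<comment> \<open>The normal vector whose inner product with \<open>k\<close> is the divergence of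
    \<open>proj p k\<close>; the coefficients are minus the dimensions of the factors.\<close>
  define w0 where "w0 = (- 2 *\<^sub>R fst p, - snd p)"
  have w0: "proj p w0 = 0" using p by (simp add: w0_def proj_def zero_prod_def)
  have ft: "field_trace (proj_deriv k) p = k \<bullet> w0" for k
    by (simp add: field_trace_proj[OF p] w0_def inner_prod_def)
  have "field_trace (contract_deriv s) p = (\<Sum>k\<in>Basis. S s k p * (k \<bullet> w0) + gS s k p \<bullet> proj p k)"
    unfolding contract_deriv_def[abs_def] field_trace_sum field_trace_scaleR ft ..
  also have "\<dots> = (\<Sum>k\<in>Basis. (k \<bullet> w0) * S s k p) + (\<Sum>k\<in>Basis. gS s k p \<bullet> proj p k)"
    by (simp only: sum.distrib mult.commute)
  also have "(\<Sum>k\<in>Basis. (k \<bullet> w0) * S s k p) = 0"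
    unfolding linear_sum_inner[OF linear_S[OF p]] by (simp add: S_def C_normal[OF p w0])
  also have "(\<Sum>k\<in>Basis. gS s k p \<bullet> proj p k) = (\<Sum>k\<in>Basis. \<Sum>i\<in>Basis. \<Sum>j\<in>Basis. factor_form s p i j * E k i j p (proj p k))"
  proof (rule sum.cong[OF refl])
    fix k :: ambient
    define v where "v = proj p k"
    have ps: "proj p (factor s p) = 0" by (rule proj_factor_self[OF p])
    have z1: "(\<Sum>i\<in>Basis. (factor s i \<bullet> p) * C k i j p) = 0" for j
      unfolding factor_adjoint linear_sum_inner[OF linear_C(2)[OF p]] by (rule C_normal(2)[OF p ps])
    have z2: "(\<Sum>j\<in>Basis. (factor s j \<bullet> p) * C k i j p) = 0" for i
      unfolding factor_adjoint linear_sum_inner[OF linear_C(3)[OF p]] by (rule C_normal(3)[OF p ps])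
    have "(\<Sum>i\<in>Basis. \<Sum>j\<in>Basis. C k i j p * (factor_form_grad s i j p \<bullet> v))
      = - ((\<Sum>i\<in>Basis. \<Sum>j\<in>Basis. (proj p (factor s j) \<bullet> v) * ((factor s i \<bullet> p) * C k i j p))
         + (\<Sum>i\<in>Basis. \<Sum>j\<in>Basis. (proj p (factor s i) \<bullet> v) * ((factor s j \<bullet> p) * C k i j p)))"
      unfolding sum.distrib[symmetric] sum_negf[symmetric] factor_form_grad_def
      by (intro sum.cong refl) (simp add: inner_add_left inner_diff_left algebra_simps)
    also have "(\<Sum>i\<in>Basis. \<Sum>j\<in>Basis. (proj p (factor s j) \<bullet> v) * ((factor s i \<bullet> p) * C k i j p)) = 0"
      by (subst sum.swap) (simp only: sum_distrib_left[symmetric] z1 mult_zero_right sum.neutral_const)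
    also have "(\<Sum>i\<in>Basis. \<Sum>j\<in>Basis. (proj p (factor s i) \<bullet> v) * ((factor s j \<bullet> p) * C k i j p)) = 0"
      by (simp only: sum_distrib_left[symmetric] z2 mult_zero_right sum.neutral_const)
    finally have z: "(\<Sum>i\<in>Basis. \<Sum>j\<in>Basis. C k i j p * (factor_form_grad s i j p \<bullet> v)) = 0" by simp
    have "gS s k p \<bullet> v = (\<Sum>i\<in>Basis. \<Sum>j\<in>Basis. factor_form s p i j * E k i j p v) + (\<Sum>i\<in>Basis. \<Sum>j\<in>Basis. C k i j p * (factor_form_grad s i j p \<bullet> v))"
      unfolding gS_def inner_sum_left E_def sum.distrib[symmetric]
      by (simp add: inner_add_left smooth_grad_inner[OF smooth_C p])
    then show "gS s k p \<bullet> proj p k = (\<Sum>i\<in>Basis. \<Sum>j\<in>Basis. factor_form s p i j * E k i j p (proj p k))"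
      using z by (simp add: v_def)
  qed
  also have "\<dots> = (\<Sum>i\<in>Basis. \<Sum>k\<in>Basis. \<Sum>j\<in>Basis. factor_form s p i j * E k i j p (proj p k))"
    by (rule sum.swap)
  also have "\<dots> = (\<Sum>i\<in>Basis. \<Sum>j\<in>Basis. \<Sum>k\<in>Basis. factor_form s p i j * E k i j p (proj p k))"
    by (rule sum.cong[OF refl]) (rule sum.swap)
  also have "\<dots> = (\<Sum>i\<in>Basis. \<Sum>j\<in>Basis. factor_form s p i j * (\<Sum>k\<in>Basis. E (proj p k) i j p (proj p k)))"
  proof (intro sum.cong refl)
    fix i j :: ambient
    have "(\<Sum>k\<in>Basis. E (proj p k) i j p (proj p k)) = (\<Sum>k\<in>Basis. E k i j p (proj p (proj p k)))"
      by (rule sum_proj_cyclic[where f = "\<lambda>w v. E w i j p (proj p v)"])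
         (use linear_E(1)[OF p] linear_compose[OF linear_proj linear_E(4)[OF p]] in \<open>simp_all add: o_def\<close>)
    then show "(\<Sum>k\<in>Basis. factor_form s p i j * E k i j p (proj p k)) = factor_form s p i j * (\<Sum>k\<in>Basis. E (proj p k) i j p (proj p k))"
      by (simp only: proj_proj[OF p] sum_distrib_left)
  qed
  also have "\<dots> = (\<Sum>i\<in>Basis. \<Sum>j\<in>Basis. factor_form s p i j * (\<Sum>k\<in>Basis. E (proj p k) (proj p i) (proj p j) p (proj p k)))"
  proof (rule sum_factor_form_proj[OF p, symmetric])
    show "linear (\<lambda>v. \<Sum>k\<in>Basis. E (proj p k) v w p (proj p k))" for w
      by (rule linear_compose_sum) (use linear_E(2)[OF p] in blast)
    show "linear (\<lambda>w. \<Sum>k\<in>Basis. E (proj p k) v w p (proj p k))" for v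
      by (rule linear_compose_sum) (use linear_E(3)[OF p] in blast)
  qed
  also have "\<dots> = (\<Sum>i\<in>Basis. \<Sum>j\<in>Basis. factor_form s p i j * comp2 (div3 \<phi>) p i j)"
    unfolding comp2_def div3_def
    by (simp only: cov_deriv3_tangent[OF p proj_tangent[OF p] proj_tangent[OF p] proj_tangent[OF p]] E_def C_def)
  finally show ?thesis by simp
qed

lemma inner3_contract:
  assumes p: "p \<in> S2S1"
  shows "inner3 (\<lambda>p k i j. (W p \<bullet> k) * (snd i \<bullet> snd j)) \<phi> p = W p \<bullet> contract_field False p"
  unfolding inner3_def contract_field_def S_def C_def inner_sum_right inner_scaleR_right
  by (simp add: comp3_def factor_form_eq[OF p] sum_distrib_left sum_distrib_right mult.commute mult.left_commute)

end

text \<open>The sphere part of the tensor is parallel and its pairing vanishes by the divergence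
  theorem. The circle part is the weak gradient of \<open>\<zeta>\<close> tested against the
  contracted field.\<close>

lemma has_weak_cov_deriv_diagonal:
  assumes w: "weak_grad \<zeta> W" and T: "\<And>p i j. p \<in> S2S1 \<Longrightarrow> comp2 T p i j = factor_form True p i j + \<zeta> p * factor_form False p i j"
    and L2: "in_Lq2 1 T" and L3: "in_Lq3 1 (\<lambda>p k i j. (W p \<bullet> k) * (snd i \<bullet> snd j))"
  shows "has_weak_cov_deriv T (\<lambda>p k i j. (W p \<bullet> k) * (snd i \<bullet> snd j))"
  unfolding has_weak_cov_deriv_def
proof (intro conjI allI impI L2 L3)
  fix \<phi> assume \<phi>: "smooth_tensor3 \<phi>"
  note C1 = C1_field_contract[OF \<phi>]
  have eq: "inner2 T (div3 \<phi>) p = field_trace (contract_deriv \<phi> True) p + \<zeta> p * field_trace (contract_deriv \<phi> False) p"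
    if p: "p \<in> S2S1" for p
    unfolding inner2_def T[OF p] field_trace_contract[OF \<phi> p]
    by (simp add: distrib_right sum.distrib sum_distrib_left mult.assoc)
  have i1: "integrable \<mu>0 (field_trace (contract_deriv \<phi> True))"
    by (rule integrable_mu0_continuous[OF C1_field_continuous(2)[OF C1]])
  have i2: "integrable \<mu>0 (\<lambda>p. \<zeta> p * field_trace (contract_deriv \<phi> False) p)"
  proof -
    obtain B where B: "0 \<le> B" "\<And>p. p \<in> S2S1 \<Longrightarrow> norm (field_trace (contract_deriv \<phi> False) p) \<le> B"
      using continuous_S2S1_bound[OF C1_field_continuous(2)[OF C1]] by blast
    have m: "field_trace (contract_deriv \<phi> False) \<in> borel_measurable \<mu>0"
      by (rule borel_measurable_mu0_continuous[OF C1_field_continuous(2)[OF C1]])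
    have iz: "integrable \<mu>0 \<zeta>" using w by (simp add: weak_grad_def)
    show ?thesis
    proof (rule Bochner_Integration.integrable_bound[where f = "\<lambda>p. \<zeta> p * B"])
      show "AE p in \<mu>0. norm (\<zeta> p * field_trace (contract_deriv \<phi> False) p) \<le> norm (\<zeta> p * B)"
        using B by (intro AE_I2) (auto simp: abs_mult intro!: mult_left_mono)
    qed (use iz m in auto)
  qed
  have "(\<integral>p. inner2 T (div3 \<phi>) p \<partial>\<mu>0) = (\<integral>p. field_trace (contract_deriv \<phi> True) p + \<zeta> p * field_trace (contract_deriv \<phi> False) p \<partial>\<mu>0)"
    by (intro Bochner_Integration.integral_cong refl) (simp add: eq)
  also have "\<dots> = (\<integral>p. \<zeta> p * field_trace (contract_deriv \<phi> False) p \<partial>\<mu>0)"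
    using i1 i2 divergence_S2S1[OF C1, of True] by simp
  also have "\<dots> = - (\<integral>p. W p \<bullet> contract_field \<phi> False p \<partial>\<mu>0)"
  proof -
    have "(\<integral>p. W p \<bullet> contract_field \<phi> False p \<partial>\<mu>0) = - (\<integral>p. \<zeta> p * field_trace (contract_deriv \<phi> False) p \<partial>\<mu>0)"
      using w C1[of False] unfolding weak_grad_def by blast
    then show ?thesis by (simp only: minus_minus)
  qed
  also have "(\<integral>p. W p \<bullet> contract_field \<phi> False p \<partial>\<mu>0) = (\<integral>p. inner3 (\<lambda>p k i j. (W p \<bullet> k) * (snd i \<bullet> snd j)) \<phi> p \<partial>\<mu>0)"
    by (intro Bochner_Integration.integral_cong refl) (simp add: inner3_contract[OF \<phi>])
  finally show "(\<integral>p. inner3 (\<lambda>p k i j. (W p \<bullet> k) * (snd i \<bullet> snd j)) \<phi> p \<partial>\<mu>0) = - (\<integral>p. inner2 T (div3 \<phi>) p \<partial>\<mu>0)" by simp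
qed

lemma norm2_diagonal:
  assumes p: "p \<in> S2S1" and T: "\<And>i j. comp2 T p i j = c * factor_form True p i j + d * factor_form False p i j"
  shows "norm2 T p = sqrt (2 * c\<^sup>2 + d\<^sup>2)"
proof -
  have "inner2 T T p = (\<Sum>i\<in>Basis. \<Sum>j\<in>Basis. c\<^sup>2 * (factor_form True p i j * factor_form True p i j)
     + (2 * c * d) * (factor_form True p i j * factor_form False p i j) + d\<^sup>2 * (factor_form False p i j * factor_form False p i j))"
    unfolding inner2_def T by (intro sum.cong refl) (simp add: algebra_simps power2_eq_square)
  also have "\<dots> = 2 * c\<^sup>2 + d\<^sup>2"
    unfolding sum.distrib sum_distrib_left[symmetric] sum_factor_form_mult[OF p] by simp
  finally show ?thesis by (simp add: norm2_def)
qed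

lemma norm3_diagonal:
  assumes p: "p \<in> S2S1" and W: "W p \<in> tangent p"
  shows "norm3 (\<lambda>p k i j. (W p \<bullet> k) * (snd i \<bullet> snd j)) p = norm (W p)"
proof -
  have "inner3 (\<lambda>p k i j. (W p \<bullet> k) * (snd i \<bullet> snd j)) (\<lambda>p k i j. (W p \<bullet> k) * (snd i \<bullet> snd j)) p
    = (\<Sum>k\<in>Basis. ((W p \<bullet> proj p k) * (W p \<bullet> proj p k)) * (\<Sum>i\<in>Basis. \<Sum>j\<in>Basis. factor_form False p i j * factor_form False p i j))"
    unfolding inner3_def by (simp add: comp3_def factor_form_eq[OF p] sum_distrib_left mult.commute mult.left_commute)
  also have "\<dots> = W p \<bullet> W p"
    unfolding sum_factor_form_mult[OF p] using sum_Basis_proj[of "W p" p "W p"] by (simp add: proj_ident[OF W])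
  finally show ?thesis by (simp add: norm3_def norm_eq_sqrt_inner)
qed

section \<open>The Lee--LeFloch integrand\<close>

text \<open>The contractions in the Lee--LeFloch formula for \<open>t + e\<^sup>2 c\<close>, where \<open>t\<close> and \<open>c\<close> are the metrics
  of the two factors and \<open>a\<close> is the differential of \<open>e\<close>.\<close>

locale contraction =
  fixes I :: "'i set" and t c :: "'i \<Rightarrow> 'i \<Rightarrow> real" and a :: "'i \<Rightarrow> real" and N e :: real
  assumes e: "e \<noteq> 0"
    and c_sym: "\<And>i j. c i j = c j i"
    and cc: "\<And>i j. (\<Sum>l\<in>I. c i l * c l j) = c i j" and ac: "\<And>j. (\<Sum>l\<in>I. a l * c l j) = 0"
    and aa: "(\<Sum>l\<in>I. a l * a l) = N" and c_trace: "(\<Sum>l\<in>I. c l l) = 1"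
    and tc: "\<And>i j. (\<Sum>l\<in>I. t i l * c l j) = 0" and ta: "\<And>i. (\<Sum>l\<in>I. t i l * a l) = a i"
    and t_sym: "\<And>i j. t i j = t j i" and tt: "(\<Sum>i\<in>I. \<Sum>j\<in>I. t i j * t i j) = 2"
begin

definition gi where "gi i j = t i j + (1 / e\<^sup>2) * c i j"

definition \<Gamma> where "\<Gamma> k i j = (1/2) * (\<Sum>l\<in>I. gi k l * (2 * e * a i * c j l + 2 * e * a j * c i l - 2 * e * a l * c i j))"

lemma ca: "(\<Sum>l\<in>I. c j l * a l) = 0"
  using ac[of j] by (simp add: c_sym mult.commute)

lemma gi_c: "(\<Sum>l\<in>I. gi k l * c l j) = c k j / e\<^sup>2"
proof -
  have "(\<Sum>l\<in>I. gi k l * c l j) = (\<Sum>l\<in>I. t k l * c l j + (1 / e\<^sup>2) * (c k l * c l j))"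
    by (simp add: gi_def distrib_right mult.assoc)
  then show ?thesis unfolding sum.distrib sum_distrib_left[symmetric] tc cc by simp
qed

lemma gi_a: "(\<Sum>l\<in>I. gi k l * a l) = a k"
proof -
  have "(\<Sum>l\<in>I. gi k l * a l) = (\<Sum>l\<in>I. t k l * a l + (1 / e\<^sup>2) * (c k l * a l))"
    by (simp add: gi_def distrib_right mult.assoc)
  then show ?thesis unfolding sum.distrib sum_distrib_left[symmetric] ta ca by simp
qed

lemma gi_sym: "gi i j = gi j i"
  by (simp add: gi_def t_sym c_sym)

text \<open>Raising an index with \<open>gi\<close> fixes \<open>a\<close>, which lives on the first
  factor, and divides \<open>c\<close> by \<open>e\<^sup>2\<close>.\<close>

lemma \<Gamma>_eq: "\<Gamma> k i j = (a i / e) * c k j + (a j / e) * c k i - (e * a k) * c i j"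
proof -
  have "(\<Sum>l\<in>I. gi k l * (2 * e * a i * c j l + 2 * e * a j * c i l - 2 * e * a l * c i j))
    = (\<Sum>l\<in>I. (2 * e * a i) * (gi k l * c l j) + (2 * e * a j) * (gi k l * c l i) - (2 * e * c i j) * (gi k l * a l))"
    by (intro sum.cong refl) (simp add: c_sym algebra_simps)
  also have "\<dots> = (2 * e * a i) * (c k j / e\<^sup>2) + (2 * e * a j) * (c k i / e\<^sup>2) - (2 * e * c i j) * a k"
    unfolding sum.distrib sum_subtractf sum_distrib_left[symmetric] gi_c gi_a ..
  finally show ?thesis using e by (simp add: \<Gamma>_def power2_eq_square field_simps)
qed

lemma \<Gamma>_trace: "(\<Sum>j\<in>I. \<Gamma> j j i) = a i / e"
proof -
  have "(\<Sum>j\<in>I. \<Gamma> j j i) = (\<Sum>j\<in>I. (1 / e) * (a j * c j i) + (a i / e) * c j j - e * (a j * c j i))"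
    unfolding \<Gamma>_eq by (intro sum.cong refl) (simp add: algebra_simps)
  then show ?thesis unfolding sum.distrib sum_subtractf sum_distrib_left[symmetric] ac c_trace by simp
qed

text \<open>The first trace equals \<open>- a k / e\<close> and the one subtracted from it
  \<open>a k / e\<close>.\<close>

lemma V_eq: "(\<Sum>i\<in>I. \<Sum>j\<in>I. gi i j * \<Gamma> k i j) - (\<Sum>i\<in>I. gi i k * (\<Sum>j\<in>I. \<Gamma> j j i)) = - 2 * a k / e"
proof -
  have 1: "(\<Sum>j\<in>I. gi i j * \<Gamma> k i j) = (a i / e) * (c i k / e\<^sup>2) + (c k i / e) * a i - (e * a k) * (c i i / e\<^sup>2)" for i
  proof -
    have "(\<Sum>j\<in>I. gi i j * \<Gamma> k i j) = (\<Sum>j\<in>I. (a i / e) * (gi i j * c j k) + (c k i / e) * (gi i j * a j) - (e * a k) * (gi i j * c j i))"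
      unfolding \<Gamma>_eq by (intro sum.cong refl) (simp add: c_sym algebra_simps)
    then show ?thesis unfolding sum.distrib sum_subtractf sum_distrib_left[symmetric] gi_c gi_a .
  qed
  have "(\<Sum>i\<in>I. \<Sum>j\<in>I. gi i j * \<Gamma> k i j) = (\<Sum>i\<in>I. (1 / (e * e\<^sup>2)) * (a i * c i k) + (1 / e) * (a i * c i k) - (e * a k / e\<^sup>2) * c i i)"
    unfolding 1 by (intro sum.cong refl) (simp add: c_sym algebra_simps)
  also have "\<dots> = - a k / e"
    unfolding sum.distrib sum_subtractf sum_distrib_left[symmetric] ac c_trace using e by (simp add: power2_eq_square)
  finally have 2: "(\<Sum>i\<in>I. \<Sum>j\<in>I. gi i j * \<Gamma> k i j) = - a k / e" .
  have "(\<Sum>i\<in>I. gi i k * (a i / e)) = (1 / e) * (\<Sum>i\<in>I. gi k i * a i)"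
    unfolding sum_distrib_left by (intro sum.cong refl) (simp add: gi_sym)
  then show ?thesis unfolding 2 \<Gamma>_trace gi_a by simp
qed

text \<open>Here \<open>d * a k * c i j\<close> stands for the derivative of the inverse metric;
  with \<open>d = - 2 / e^3\<close> the sum is \<open>2 * N / e\<^sup>2\<close>.\<close>

lemma DGamma_eq: "(\<Sum>k\<in>I. \<Sum>i\<in>I. \<Sum>j\<in>I. (d * a k * c i j) * \<Gamma> k i j) = - d * e * N"
proof -
  have 1: "(\<Sum>j\<in>I. (d * a k * c i j) * \<Gamma> k i j) = (d * a k) * ((a i / e) * c i k - (e * a k) * c i i)" for k i
  proof -
    have "(\<Sum>j\<in>I. (d * a k * c i j) * \<Gamma> k i j) = (\<Sum>j\<in>I. (d * a k) * ((a i / e) * (c i j * c j k) + (c k i / e) * (c i j * a j) - (e * a k) * (c i j * c j i)))"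
      unfolding \<Gamma>_eq by (intro sum.cong refl) (simp add: c_sym algebra_simps)
    then show ?thesis unfolding sum_distrib_left[symmetric] sum.distrib sum_subtractf sum_distrib_left[symmetric] cc ca by simp
  qed
  have 2: "(\<Sum>i\<in>I. (d * a k) * ((a i / e) * c i k - (e * a k) * c i i)) = - d * e * (a k * a k)" for k
  proof -
    have "(\<Sum>i\<in>I. (d * a k) * ((a i / e) * c i k - (e * a k) * c i i)) = (\<Sum>i\<in>I. (d * a k / e) * (a i * c i k) - (d * a k * e * a k) * c i i)"
      by (intro sum.cong refl) (simp add: algebra_simps)
    then show ?thesis unfolding sum_subtractf sum_distrib_left[symmetric] ac c_trace by simp
  qed
  show ?thesis unfolding 1 unfolding 2 unfolding sum_distrib_left[symmetric] aa ..
qed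

lemma D_trace_eq: "(\<Sum>k\<in>I. \<Sum>i\<in>I. (d * a k * c i k) * (\<Sum>j\<in>I. \<Gamma> j j i)) = 0"
proof -
  have "(\<Sum>i\<in>I. (d * a k * c i k) * (a i / e)) = (d * a k / e) * (\<Sum>i\<in>I. a i * c i k)" for k
    unfolding sum_distrib_left by (intro sum.cong refl) simp
  then show ?thesis unfolding \<Gamma>_trace ac by simp
qed

lemma quadratic_eq:
  "(\<Sum>k\<in>I. \<Sum>l\<in>I. \<Gamma> k k l * \<Gamma> l i j - \<Gamma> k j l * \<Gamma> l i k) = N * c i j - a i * a j / e\<^sup>2"
proof -
  have "(\<Sum>k\<in>I. \<Sum>l\<in>I. \<Gamma> k k l * \<Gamma> l i j) = (\<Sum>l\<in>I. (\<Sum>k\<in>I. \<Gamma> k k l) * \<Gamma> l i j)"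
    unfolding sum_distrib_right by (rule sum.swap)
  also have "\<dots> = (\<Sum>l\<in>I. (a i / e\<^sup>2) * (a l * c l j) + (a j / e\<^sup>2) * (a l * c l i) - c i j * (a l * a l))"
    unfolding \<Gamma>_trace unfolding \<Gamma>_eq using e by (intro sum.cong refl) (simp add: power2_eq_square algebra_simps)
  also have "\<dots> = - N * c i j"
    unfolding sum.distrib sum_subtractf sum_distrib_left[symmetric] ac aa by simp
  finally have 1: "(\<Sum>k\<in>I. \<Sum>l\<in>I. \<Gamma> k k l * \<Gamma> l i j) = - N * c i j" .
  have 2: "(\<Sum>l\<in>I. \<Gamma> k j l * \<Gamma> l i k) = (a j * a i / e\<^sup>2) * c k k + (a j / e\<^sup>2) * (a k * c k i) - N * (c j k * c k i) - a i * (a k * c k j) - c j i * (a k * a k)" for k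
  proof -
    have "(\<Sum>l\<in>I. \<Gamma> k j l * \<Gamma> l i k) = (\<Sum>l\<in>I. (a j * a i / e\<^sup>2) * (c k l * c l k) + (a j * a k / e\<^sup>2) * (c k l * c l i) - (a j * c i k) * (c k l * a l)
        + (c k j * a i / e\<^sup>2) * (a l * c l k) + (c k j * a k / e\<^sup>2) * (a l * c l i) - (c k j * c i k) * (a l * a l)
        - (a k * a i) * (c j l * c l k) - (a k * a k) * (c j l * c l i) + (e * e * a k * c i k) * (c j l * a l))"
      unfolding \<Gamma>_eq using e by (intro sum.cong refl) (simp add: power2_eq_square field_simps)
    then show ?thesis
      unfolding sum.distrib sum_subtractf sum_distrib_left[symmetric] cc ca ac aa
      by (simp add: c_sym[of i k] c_sym[of k j])
  qed
  have "(\<Sum>k\<in>I. \<Sum>l\<in>I. \<Gamma> k j l * \<Gamma> l i k) = a j * a i / e\<^sup>2 - N * c j i - c j i * N"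
    unfolding 2 sum.distrib sum_subtractf sum_distrib_left[symmetric] cc ac aa c_trace by simp
  then show ?thesis unfolding sum_subtractf 1 by (simp add: c_sym)
qed

text \<open>The two terms of \<open>quadratic_eq\<close> have the same trace
  \<open>N / e\<^sup>2\<close> with respect to \<open>gi\<close>.\<close>

lemma quadratic_contracted:
  "(\<Sum>i\<in>I. \<Sum>j\<in>I. gi i j * (\<Sum>k\<in>I. \<Sum>l\<in>I. \<Gamma> k k l * \<Gamma> l i j - \<Gamma> k j l * \<Gamma> l i k)) = 0"
proof -
  have 1: "(\<Sum>j\<in>I. gi i j * (N * c i j - a i * a j / e\<^sup>2)) = (N / e\<^sup>2) * c i i - (1 / e\<^sup>2) * (a i * a i)" for i
  proof -
    have "(\<Sum>j\<in>I. gi i j * (N * c i j - a i * a j / e\<^sup>2)) = (\<Sum>j\<in>I. N * (gi i j * c j i) - (a i / e\<^sup>2) * (gi i j * a j))"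
      by (intro sum.cong refl) (simp add: c_sym algebra_simps)
    then show ?thesis unfolding sum_subtractf sum_distrib_left[symmetric] gi_c gi_a by simp
  qed
  show ?thesis unfolding quadratic_eq unfolding 1 unfolding sum_subtractf sum_distrib_left[symmetric] aa c_trace by simp
qed

lemma gi_t: "(\<Sum>i\<in>I. \<Sum>j\<in>I. gi i j * t i j) = 2"
proof -
  have "(\<Sum>j\<in>I. gi i j * t i j) = (\<Sum>j\<in>I. t i j * t i j) + (1 / e\<^sup>2) * (\<Sum>j\<in>I. t i j * c j i)" for i
    unfolding sum_distrib_left sum.distrib[symmetric]
    by (intro sum.cong refl) (simp add: gi_def c_sym algebra_simps)
  then show ?thesis unfolding tc by (simp add: tt)
qed

end

section \<open>The contractions on the product of sphere and circle\<close>

lemma factor_form_sym: "factor_form s p i j = factor_form s p j i"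
  by (metis factor_form_def factor_form_right inner_commute)

lemma sum_factor_form_compose:
  assumes p: "p \<in> S2S1"
  shows "(\<Sum>l\<in>Basis. factor_form s p i l * factor_form r p l j) = (if s = r then factor_form s p i j else 0)"
proof -
  have "(\<Sum>l\<in>Basis. factor_form s p i l * factor_form r p l j) = (\<Sum>l\<in>Basis. (proj p (factor s i) \<bullet> l) * (proj p (factor r j) \<bullet> l))"
    by (intro sum.cong refl) (simp add: factor_form_def[of s] factor_form_right[of r] inner_commute)
  also have "\<dots> = proj p (factor s i) \<bullet> proj p (factor r j)" by (rule euclidean_inner[symmetric])
  also have "\<dots> = proj p (factor r (factor s i)) \<bullet> j"
    by (metis proj_adjoint factor_adjoint factor_proj proj_proj[OF p])
  finally show ?thesis by (cases s; cases r) (simp_all add: factor_form_def factor_def proj_def zero_prod_def[symmetric])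
qed

lemma sum_inner_factor_form:
  assumes p: "p \<in> S2S1" and n: "n \<in> tangent p" "snd n = 0"
  shows "(\<Sum>l\<in>Basis. (n \<bullet> l) * factor_form s p l j) = (if s then n \<bullet> j else 0)"
proof -
  have "(\<Sum>l\<in>Basis. (n \<bullet> l) * factor_form s p l j) = n \<bullet> proj p (factor s j)"
    by (subst euclidean_inner[of n]) (simp add: factor_form_right inner_commute)
  also have "\<dots> = factor s n \<bullet> j"
    using proj_ident[OF n(1)] by (simp only: factor_proj[symmetric] factor_adjoint[symmetric] proj_adjoint[symmetric])
  finally show ?thesis using n(2) by (cases n) (simp add: factor_def zero_prod_def[symmetric])
qed

lemma sum_factor_form_trace:
  assumes p: "p \<in> S2S1" shows "(\<Sum>l\<in>Basis. factor_form False p l l) = 1"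
  using trace_proj_snd[OF p]
  by (simp add: factor_form_eq[OF p] sum_Basis_prod_split) (simp add: proj_def)

lemma contraction_S2S1:
  assumes p: "p \<in> S2S1" and n: "n \<in> tangent p" "snd n = 0" and e: "e \<noteq> 0"
  shows "contraction Basis (factor_form True p) (factor_form False p) (\<lambda>l. n \<bullet> l) (n \<bullet> n) e"
proof
  show "(\<Sum>l\<in>Basis. n \<bullet> l * (n \<bullet> l)) = n \<bullet> n" by (rule euclidean_inner[symmetric])
  show "(\<Sum>l\<in>Basis. factor_form True p i l * (n \<bullet> l)) = n \<bullet> i" for i
    using sum_inner_factor_form[OF p n, of True i] by (simp add: factor_form_sym[of True p i] mult.commute)
  show "(\<Sum>i\<in>Basis. \<Sum>j\<in>Basis. factor_form True p i j * factor_form True p i j) = 2"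
    using sum_factor_form_mult[OF p, of True True] by simp
qed (use e sum_factor_form_compose[OF p] sum_inner_factor_form[OF p n, of False] sum_factor_form_trace[OF p] in
    \<open>simp_all add: factor_form_sym[symmetric]\<close>)

lemma comp2_ricci_g0:
  assumes p: "p \<in> S2S1"
  shows "comp2 (ricci g0) p i j = factor_form True p i j"
proof -
  have "ricci (warped (\<lambda>_. 1)) p (proj p i) (proj p j) = fst (proj p i) \<bullet> fst (proj p j)
      - (0 \<bullet> fst (proj p j)) / 1 - 1 * (snd (proj p i) \<bullet> snd (proj p j)) * trace_fst p (\<lambda>_. 0)"
    by (rule ricci_warped[where G = "\<lambda>_. 0" and H = "\<lambda>_. 0"]) (auto simp: p proj_tangent)
  then show ?thesis by (simp add: comp2_def g0_eq_warped factor_form_eq[OF p] trace_fst_def)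
qed

lemma comp2_warped: "p \<in> S2S1 \<Longrightarrow> comp2 (warped \<eta>) p i j = factor_form True p i j + (\<eta> (fst p))\<^sup>2 * factor_form False p i j"
  by (simp add: comp2_def warped_def factor_form_eq)

lemma comp2_inverse_metric_warped:
  assumes p: "p \<in> S2S1" and e: "\<eta> (fst p) \<noteq> 0"
  shows "comp2 (inverse_metric (warped \<eta>)) p i j = factor_form True p i j + (1 / (\<eta> (fst p))\<^sup>2) * factor_form False p i j"
  using p by (simp add: comp2_def inverse_metric_warped[of p \<eta>, OF p e] factor_form_eq)

text \<open>The divergence part contributes
  \<open>2 * u p * (n \<bullet> n) / e + 2 * (n \<bullet> U)\<close>, the other part
  \<open>2 * e * u p - 2 * u p * (n \<bullet> n) / e\<close>. The terms quadratic in the gradient,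
  in general not integrable for the limit, cancel.\<close>

lemma LL_integrand_warped:
  assumes p: "p \<in> S2S1" and n: "n \<in> tangent p" "snd n = 0" and h: "\<eta> (fst p) = e" "e \<noteq> 0"
    and Dg: "\<And>k i j. Dg p k i j = ((2 * e) *\<^sub>R n \<bullet> k) * (snd i \<bullet> snd j)"
    and Dgi: "\<And>k i j. Dgi p k i j = ((- 2 / e^3) *\<^sub>R n \<bullet> k) * (snd i \<bullet> snd j)"
    and W: "W p = u p *\<^sub>R n + e *\<^sub>R U" and U: "U \<in> tangent p" and vd: "vol_density (warped \<eta>) p = e"
  shows "LL_integrand (warped \<eta>) Dg Dgi u W p = 2 * (n \<bullet> U) + 2 * e * u p"
proof -
  interpret contraction Basis "factor_form True p" "factor_form False p" "\<lambda>l. n \<bullet> l" "n \<bullet> n" e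
    by (rule contraction_S2S1[OF p n h(2)])
  have gi: "comp2 (inverse_metric (warped \<eta>)) p i j = gi i j" for i j
    using comp2_inverse_metric_warped[OF p, of \<eta> i j] h by (simp add: gi_def)
  have np: "n \<bullet> proj p k = n \<bullet> k" for k by (rule tangent_inner_proj[OF n(1)])
  have c3: "comp3 Dg p k i j = 2 * e * (n \<bullet> k) * factor_form False p i j"
    "comp3 Dgi p k i j = (- 2 / e^3) * (n \<bullet> k) * factor_form False p i j" for k i j
    unfolding comp3_def Dg Dgi by (simp_all add: np factor_form_eq[OF p])
  have G: "LL_Gamma (warped \<eta>) Dg p = \<Gamma>"
    unfolding LL_Gamma_def[abs_def] gi c3 \<Gamma>_def[abs_def] by (simp add: fun_eq_iff)
  have V: "LL_V (warped \<eta>) Dg p k = - 2 * (n \<bullet> k) / e" for k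
    unfolding LL_V_def Let_def G gi by (rule V_eq)
  have F: "LL_F (warped \<eta>) Dg Dgi p = 2 - 2 * (n \<bullet> n) / e\<^sup>2"
    unfolding LL_F_def Let_def G gi c3 comp2_ricci_g0[OF p] gi_t DGamma_eq D_trace_eq quadratic_contracted
    using h(2) by (simp add: power2_eq_square power3_eq_cube)
  have Wt: "W p \<in> tangent p" using n U unfolding W by (auto simp: tangent_def inner_add_left)
  have "(\<Sum>k\<in>Basis. - 2 * (n \<bullet> k) / e * (W p \<bullet> proj p k)) = (\<Sum>k\<in>Basis. (- 2 / e) * ((n \<bullet> k) * (W p \<bullet> k)))"
    by (simp add: tangent_inner_proj[OF Wt] mult.assoc)
  also have "\<dots> = (- 2 / e) * (n \<bullet> W p)" by (subst euclidean_inner[of n "W p"]) (simp only: sum_distrib_left)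
  finally have s: "(\<Sum>k\<in>Basis. - 2 * (n \<bullet> k) / e * (W p \<bullet> proj p k)) = (- 2 / e) * (n \<bullet> W p)" .
  have nW: "n \<bullet> W p = u p * (n \<bullet> n) + e * (n \<bullet> U)" unfolding W by (simp add: inner_add_right)
  have alg: "- (- 2 / e * (v * M + e * t)) + (2 - 2 * M / e\<^sup>2) * v * e = 2 * t + 2 * e * v" for v M t :: real
    using h(2) by (simp add: field_simps power2_eq_square)
  show ?thesis unfolding LL_integrand_def V F s vd nW by (rule alg)
qed

section \<open>Product rule for weak gradients and measurability of the curvature integrand\<close>

lemma weak_grad_AE_cong:
  assumes w: "weak_grad f W" and e: "AE p in \<mu>0. f p = h p" and m: "h \<in> borel_measurable \<mu>0"
  shows "weak_grad h W"
  unfolding weak_grad_def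
proof (intro conjI allI impI)
  have mf: "f \<in> borel_measurable \<mu>0" using w by (auto simp: weak_grad_def)
  show "integrable \<mu>0 h" using w integrable_cong_AE[OF mf m e] by (simp add: weak_grad_def)
  show "integrable \<mu>0 W" "AE p in \<mu>0. W p \<in> tangent p" using w by (auto simp: weak_grad_def)
  fix X X' assume X: "C1_field X X'"
  have [measurable]: "field_trace X' \<in> borel_measurable \<mu>0"
    by (rule borel_measurable_mu0_continuous[OF C1_field_continuous(2)[OF X]])
  have "(\<integral>p. f p * field_trace X' p \<partial>\<mu>0) = (\<integral>p. h p * field_trace X' p \<partial>\<mu>0)"
    by (rule integral_cong_AE) (use mf m e in \<open>auto elim: eventually_mono\<close>)
  then show "(\<integral>p. W p \<bullet> X p \<partial>\<mu>0) = - (\<integral>p. h p * field_trace X' p \<partial>\<mu>0)"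
    using w X by (simp add: weak_grad_def)
qed

lemma integrable_continuous_mult:
  fixes f :: "ambient \<Rightarrow> 'b::euclidean_space"
  assumes u: "continuous_on S2S1 u" and f: "integrable \<mu>0 f"
  shows "integrable \<mu>0 (\<lambda>p. u p *\<^sub>R f p)"
proof -
  obtain C where C: "0 \<le> C" "\<And>p. p \<in> S2S1 \<Longrightarrow> norm (u p) \<le> C" using continuous_S2S1_bound[OF u] by blast
  have [measurable]: "u \<in> borel_measurable \<mu>0" by (rule borel_measurable_mu0_continuous[OF u])
  have [measurable]: "f \<in> borel_measurable \<mu>0" using f by auto
  have i: "integrable \<mu>0 (\<lambda>p. C * norm (f p))" using f by simp
  show ?thesis
  proof (rule Bochner_Integration.integrable_bound[OF i])
    show "AE p in \<mu>0. norm (u p *\<^sub>R f p) \<le> norm (C * norm (f p))"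
    proof (rule AE_I2)
      fix p assume "p \<in> space \<mu>0"
      then have "norm (u p) \<le> C" using C by simp
      then have "norm (u p) * norm (f p) \<le> C * norm (f p)" by (intro mult_right_mono) auto
      then show "norm (u p *\<^sub>R f p) \<le> norm (C * norm (f p))" using C(1) by (simp add: abs_mult)
    qed
  qed measurable
qed

lemma integrable_continuous_inner:
  assumes u: "continuous_on S2S1 U" and f: "integrable \<mu>0 f"
  shows "integrable \<mu>0 (\<lambda>p. f p \<bullet> (U p :: ambient))"
proof -
  have "integrable \<mu>0 (\<lambda>p. (U p \<bullet> e) *\<^sub>R (f p \<bullet> e))" for e
    by (rule integrable_continuous_mult) (intro continuous_intros u integrable_inner_left f)+
  then have "integrable \<mu>0 (\<lambda>p. \<Sum>e\<in>Basis. (U p \<bullet> e) *\<^sub>R (f p \<bullet> e))" by (intro Bochner_Integration.integrable_sum)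
  then show ?thesis by (subst euclidean_inner) (simp add: mult.commute)
qed

text \<open>The field \<open>u p *\<^sub>R X p\<close> is again an admissible test field, and its
  divergence supplies both terms of the product rule.\<close>

lemma weak_grad_mult:
  assumes w: "weak_grad f W" and u: "has_grad u U"
  shows "weak_grad (\<lambda>p. u p * f p) (\<lambda>p. u p *\<^sub>R W p + f p *\<^sub>R U p)"
  unfolding weak_grad_def
proof (intro conjI allI impI)
  have f: "integrable \<mu>0 f" and W: "integrable \<mu>0 W" and t: "AE p in \<mu>0. W p \<in> tangent p"
    using w by (auto simp: weak_grad_def)
  note cu = has_grad_continuous_on[OF u] and cU = has_grad_continuous[OF u]
  show "integrable \<mu>0 (\<lambda>p. u p * f p)" using integrable_continuous_mult[OF cu f] by simp
  have fU: "integrable \<mu>0 (\<lambda>p. f p *\<^sub>R U p)"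
  proof (rule Bochner_Integration.integrable_bound)
    have [measurable]: "f \<in> borel_measurable \<mu>0" "U \<in> borel_measurable \<mu>0"
      using f borel_measurable_mu0_continuous[OF cU] by auto
    show "(\<lambda>p. f p *\<^sub>R U p) \<in> borel_measurable \<mu>0" by measurable
    show "integrable \<mu>0 (\<lambda>p. norm (U p) *\<^sub>R f p)" by (rule integrable_continuous_mult[OF _ f]) (intro continuous_intros cU)
  qed (simp add: abs_mult mult.commute)
  show "integrable \<mu>0 (\<lambda>p. u p *\<^sub>R W p + f p *\<^sub>R U p)"
    by (rule Bochner_Integration.integrable_add[OF integrable_continuous_mult[OF cu W] fU])
  show "AE p in \<mu>0. u p *\<^sub>R W p + f p *\<^sub>R U p \<in> tangent p"
    using t AE_space[of \<mu>0]
  proof eventually_elim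
    case (elim p)
    then show ?case using has_grad_tangent[OF u, of p] by (simp add: tangent_def inner_add_left)
  qed
  fix X X' assume X: "C1_field X X'"
  note cX = C1_field_continuous(1)[OF X] and cX' = C1_field_continuous(2)[OF X]
  have "(\<integral>p. W p \<bullet> (u p *\<^sub>R X p) \<partial>\<mu>0) = - (\<integral>p. f p * (u p * field_trace X' p + U p \<bullet> X p) \<partial>\<mu>0)"
    using w C1_field_scaleR[OF u X] unfolding weak_grad_def by (metis (no_types, lifting) Bochner_Integration.integral_cong field_trace_scaleR)
  moreover have "(\<integral>p. f p * (u p * field_trace X' p + U p \<bullet> X p) \<partial>\<mu>0)
      = (\<integral>p. u p * f p * field_trace X' p \<partial>\<mu>0) + (\<integral>p. f p *\<^sub>R U p \<bullet> X p \<partial>\<mu>0)"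
  proof -
    have "integrable \<mu>0 (\<lambda>p. (u p * field_trace X' p) *\<^sub>R f p)"
      by (rule integrable_continuous_mult[OF _ f]) (intro continuous_intros cu cX')
    then have "integrable \<mu>0 (\<lambda>p. u p * f p * field_trace X' p)" by (simp add: mult.commute mult.left_commute)
    from Bochner_Integration.integral_add[OF this integrable_continuous_inner[OF cX fU]]
    show ?thesis by (simp add: distrib_left mult.commute mult.left_commute)
  qed
  moreover have "(\<integral>p. (u p *\<^sub>R W p + f p *\<^sub>R U p) \<bullet> X p \<partial>\<mu>0) = (\<integral>p. W p \<bullet> (u p *\<^sub>R X p) \<partial>\<mu>0) + (\<integral>p. f p *\<^sub>R U p \<bullet> X p \<partial>\<mu>0)"
  proof -
    have "integrable \<mu>0 (\<lambda>p. W p \<bullet> (u p *\<^sub>R X p))"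
      by (rule integrable_continuous_inner[OF _ W]) (intro continuous_intros cu cX)
    from Bochner_Integration.integral_add[OF this integrable_continuous_inner[OF cX fU]]
    show ?thesis by (simp add: inner_add_left)
  qed
  ultimately show "(\<integral>p. (u p *\<^sub>R W p + f p *\<^sub>R U p) \<bullet> X p \<partial>\<mu>0) = - (\<integral>p. u p * f p * field_trace X' p \<partial>\<mu>0)"
    by simp
qed

context
  fixes g :: tensor2 and Dg Dgi :: tensor3 and u :: "ambient \<Rightarrow> real" and W :: vfield
  assumes gi [measurable]: "\<And>i j. (\<lambda>p. comp2 (inverse_metric g) p i j) \<in> borel_measurable \<mu>0"
    and Dg [measurable]: "\<And>k i j. (\<lambda>p. comp3 Dg p k i j) \<in> borel_measurable \<mu>0"
    and Dgi [measurable]: "\<And>k i j. (\<lambda>p. comp3 Dgi p k i j) \<in> borel_measurable \<mu>0"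
    and u [measurable]: "u \<in> borel_measurable \<mu>0" and W [measurable]: "W \<in> borel_measurable \<mu>0"
begin

lemma borel_measurable_LL_Gamma [measurable]: "(\<lambda>p. LL_Gamma g Dg p k i j) \<in> borel_measurable \<mu>0"
  unfolding LL_Gamma_def by measurable

lemma borel_measurable_LL_V [measurable]: "(\<lambda>p. LL_V g Dg p k) \<in> borel_measurable \<mu>0"
  unfolding LL_V_def Let_def by measurable

lemma borel_measurable_ricci_g0 [measurable]: "(\<lambda>p. comp2 (ricci g0) p i j) \<in> borel_measurable \<mu>0"
proof -
  have "(\<lambda>p. factor_form True p i j) \<in> borel_measurable \<mu>0"
    by (rule borel_measurable_mu0_continuous[OF has_grad_continuous_on[OF has_grad_factor_form]])
  then show ?thesis by (subst measurable_cong[where g = "\<lambda>p. factor_form True p i j"]) (simp_all add: comp2_ricci_g0)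
qed

lemma borel_measurable_LL_F [measurable]: "LL_F g Dg Dgi \<in> borel_measurable \<mu>0"
  unfolding LL_F_def[abs_def] Let_def by measurable

lemma borel_measurable_LL_integrand: "LL_integrand g Dg Dgi u W \<in> borel_measurable \<mu>0"
proof -
  have [measurable]: "(\<lambda>p. proj p k) \<in> borel_measurable \<mu>0" for k
    unfolding proj_def by (intro borel_measurable_mu0_continuous continuous_intros)
  show ?thesis unfolding LL_integrand_def[abs_def] vol_density_def by measurable
qed

end

text \<open>Radon-Nikodym derivatives are unique up to null sets, so the equation can hold only
  almost everywhere.\<close>

lemma vol_density_warped:
  assumes m: "(\<lambda>p. \<eta> (fst p)) \<in> borel_measurable \<mu>0"
  shows "AE p in \<mu>0. vol_density (warped \<eta>) p = \<bar>\<eta> (fst p)\<bar>"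
proof -
  have [measurable]: "(\<lambda>p. \<eta> (fst p)) \<in> borel_measurable \<mu>0" by (rule m)
  have "(\<lambda>p. \<eta> (fst p)) \<in> borel_measurable (restrict_space borel S2S1)"
    using m measurable_cong_sets[OF sets_vol[of g0] refl] by blast
  from vol_warped[OF this] have d: "density \<mu>0 (\<lambda>p. ennreal \<bar>\<eta> (fst p)\<bar>) = vol (warped \<eta>)" by simp
  have "AE p in \<mu>0. ennreal \<bar>\<eta> (fst p)\<bar> = RN_deriv \<mu>0 (vol (warped \<eta>)) p"
    by (rule mu0.RN_deriv_unique[OF _ d]) measurable
  then show ?thesis
  proof eventually_elim
    case (elim p)
    show ?case unfolding vol_density_def elim[symmetric] by simp
  qed
qed

lemma borel_measurable_vol_density: "vol_density g \<in> borel_measurable \<mu>0"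
  unfolding vol_density_def[abs_def] by measurable

lemma bilinear_warped: "bilinear (warped \<eta> p)"
  unfolding bilinear_def warped_def by (auto intro!: linearI simp: inner_simps algebra_simps)

lemma bilinear_inverse_metric_warped:
  assumes "p \<in> S2S1" "\<eta> (fst p) \<noteq> 0" shows "bilinear (inverse_metric (warped \<eta>) p)"
  unfolding bilinear_def
  by (intro conjI allI linearI)
     (simp_all add: inverse_metric_warped[of p \<eta>, OF assms] linear_add[OF linear_proj] linear_cmul[OF linear_proj] inner_simps algebra_simps)

lemma borel_measurable_norm2:
  assumes [measurable]: "\<And>i j. (\<lambda>p. comp2 T p i j) \<in> borel_measurable \<mu>0"
  shows "norm2 T \<in> borel_measurable \<mu>0"
  unfolding norm2_def[abs_def] inner2_def by measurable

lemma borel_measurable_norm3: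
  assumes [measurable]: "\<And>k i j. (\<lambda>p. comp3 T p k i j) \<in> borel_measurable \<mu>0"
  shows "norm3 T \<in> borel_measurable \<mu>0"
  unfolding norm3_def[abs_def] inner3_def by measurable

lemma borel_measurable_comp2_diagonal:
  assumes [measurable]: "\<zeta> \<in> borel_measurable \<mu>0"
    and T: "\<And>p i j. p \<in> S2S1 \<Longrightarrow> comp2 T p i j = factor_form True p i j + \<zeta> p * factor_form False p i j"
  shows "(\<lambda>p. comp2 T p i j) \<in> borel_measurable \<mu>0"
proof -
  have [measurable]: "(\<lambda>p. factor_form s p i j) \<in> borel_measurable \<mu>0" for s
    by (rule borel_measurable_mu0_continuous[OF has_grad_continuous_on[OF has_grad_factor_form]])
  have "(\<lambda>p. factor_form True p i j + \<zeta> p * factor_form False p i j) \<in> borel_measurable \<mu>0" by measurable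
  then show ?thesis
    by (subst measurable_cong[where g = "\<lambda>p. factor_form True p i j + \<zeta> p * factor_form False p i j"]) (simp_all add: T)
qed

lemma borel_measurable_comp3_diagonal:
  assumes [measurable]: "W \<in> borel_measurable \<mu>0"
  shows "(\<lambda>p. comp3 (\<lambda>p k i j. (W p \<bullet> k) * (snd i \<bullet> snd j)) p k i j) \<in> borel_measurable \<mu>0"
proof -
  have [measurable]: "(\<lambda>p. proj p k) \<in> borel_measurable \<mu>0" "(\<lambda>p. snd (proj p k)) \<in> borel_measurable \<mu>0" for k
    unfolding proj_def by (intro borel_measurable_mu0_continuous continuous_intros)+
  show ?thesis unfolding comp3_def by measurable
qed

lemma trilinear_diagonal: "trilinear (\<lambda>k i j. (w \<bullet> k) * (snd i \<bullet> snd j) :: real)" for w :: ambient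
  unfolding trilinear_def by (intro conjI allI linearI) (simp_all add: inner_add_right inner_add_left algebra_simps)

section \<open>Norms and weak derivatives of functions of the limit warping function\<close>

context limit_warping
begin

lemma integrable_eta_lim_bounded:
  assumes q: "1 \<le> q" and m: "f \<in> borel_measurable \<mu>0" and C: "0 \<le> C"
    and f: "\<And>p. p \<in> S2S1 \<Longrightarrow> 0 \<le> f p \<and> f p \<le> C * (eta_lim (fst p))\<^sup>2"
  shows "integrable \<mu>0 (\<lambda>p. f p powr q)"
proof (rule Bochner_Integration.integrable_bound)
  show "integrable \<mu>0 (\<lambda>p. C powr q * eta_lim (fst p) powr (2 * q))"
    using q integrable_eta_lim_powr[of "2 * q"] by simp
  have [measurable]: "f \<in> borel_measurable \<mu>0" by (rule m)
  show "(\<lambda>p. f p powr q) \<in> borel_measurable \<mu>0" by measurable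
  show "AE p in \<mu>0. norm (f p powr q) \<le> norm (C powr q * eta_lim (fst p) powr (2 * q))"
  proof (rule AE_I2)
    fix p assume "p \<in> space \<mu>0"
    then have "f p powr q \<le> (C * (eta_lim (fst p))\<^sup>2) powr q" using f[of p] q by (intro powr_mono2) auto
    also have "\<dots> = C powr q * ((eta_lim (fst p))\<^sup>2) powr q" using C by (simp add: powr_mult)
    also have "((eta_lim (fst p))\<^sup>2) powr q = eta_lim (fst p) powr (2 * q)"
      using eta_lim_pos[of "fst p"] by (simp add: powr_powr[symmetric])
    finally show "norm (f p powr q) \<le> norm (C powr q * eta_lim (fst p) powr (2 * q))" by simp
  qed
qed

lemma in_Lq2_diagonal:
  assumes q: "1 \<le> q" and bil: "\<And>p. p \<in> S2S1 \<Longrightarrow> bilinear (T p)" and m: "\<zeta> \<in> borel_measurable \<mu>0"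
    and T: "\<And>p i j. p \<in> S2S1 \<Longrightarrow> comp2 T p i j = factor_form True p i j + \<zeta> p * factor_form False p i j"
    and C: "\<And>p. p \<in> S2S1 \<Longrightarrow> \<bar>\<zeta> p\<bar> \<le> C * (eta_lim (fst p))\<^sup>2" "0 \<le> C"
  shows "in_Lq2 q T"
  unfolding in_Lq2_def
proof (intro conjI allI)
  show "AE p in \<mu>0. bilinear (T p)" by (rule AE_I2) (simp add: bil)
  show mT: "(\<lambda>p. comp2 T p v w) \<in> borel_measurable \<mu>0" for v w
    by (rule borel_measurable_comp2_diagonal[OF m T])
  show "integrable \<mu>0 (\<lambda>p. norm2 T p powr q)"
  proof (rule integrable_eta_lim_bounded[OF q borel_measurable_norm2[OF mT], where C = "C + 2 / (2 * A 0)\<^sup>2"])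
    show "0 \<le> C + 2 / (2 * A 0)\<^sup>2" using C(2) by simp
    fix p assume p: "p \<in> S2S1"
    have n: "norm2 T p = sqrt (2 * 1\<^sup>2 + (\<zeta> p)\<^sup>2)" using norm2_diagonal[OF p, of T 1 "\<zeta> p"] T[OF p] by simp
    have "2 * 1\<^sup>2 + (\<zeta> p)\<^sup>2 \<le> (2 + \<bar>\<zeta> p\<bar>)\<^sup>2" by (simp add: power2_sum)
    then have "norm2 T p \<le> 2 + \<bar>\<zeta> p\<bar>" unfolding n by (intro real_le_lsqrt) auto
    \<comment> \<open>The contribution of the sphere part is a constant; it is absorbed into the
      square of \<open>eta_lim\<close>, which is bounded below by \<open>2 * A 0\<close>.\<close>
    moreover have "(2 * A 0)\<^sup>2 \<le> (eta_lim (fst p))\<^sup>2" using eta_lim_ge[of "fst p"] A0_pos by (intro power_mono) auto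
    then have "2 / (2 * A 0)\<^sup>2 * (2 * A 0)\<^sup>2 \<le> 2 / (2 * A 0)\<^sup>2 * (eta_lim (fst p))\<^sup>2" by (intro mult_left_mono) auto
    then have "2 \<le> 2 / (2 * A 0)\<^sup>2 * (eta_lim (fst p))\<^sup>2" using A0_pos by simp
    ultimately have "norm2 T p \<le> (C + 2 / (2 * A 0)\<^sup>2) * (eta_lim (fst p))\<^sup>2"
      using C(1)[OF p] unfolding distrib_right by linarith
    then show "0 \<le> norm2 T p \<and> norm2 T p \<le> (C + 2 / (2 * A 0)\<^sup>2) * (eta_lim (fst p))\<^sup>2"
      unfolding n by simp
  qed
qed

context
  fixes \<phi> \<phi>' :: "real \<Rightarrow> real" and C :: real
  assumes d: "\<And>t. 2 * A 0 \<le> t \<Longrightarrow> (\<phi> has_real_derivative \<phi>' t) (at t)"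
    and c: "continuous_on {2 * A 0..} \<phi>'"
    and b: "\<And>t. 2 * A 0 \<le> t \<Longrightarrow> \<bar>\<phi> t\<bar> \<le> C * t\<^sup>2" "\<And>t. 2 * A 0 \<le> t \<Longrightarrow> \<bar>\<phi>' t\<bar> \<le> C * t"
begin

lemma bound_nonneg: "0 \<le> C"
proof -
  have "0 \<le> C * (2 * A 0)\<^sup>2" using b(1)[of "2 * A 0"] abs_ge_zero order_trans by blast
  then show ?thesis using A0_pos by (simp add: zero_le_mult_iff)
qed

lemma borel_measurable_compose_eta_lim:
  "(\<lambda>p. \<phi> (eta_lim (fst p))) \<in> borel_measurable \<mu>0" "(\<lambda>p. \<phi>' (eta_lim (fst p))) \<in> borel_measurable \<mu>0"
proof -
  have *: "(\<lambda>p. \<psi> (eta_lim (fst p))) \<in> borel_measurable \<mu>0" if "continuous_on {2 * A 0..} \<psi>" for \<psi> :: "real \<Rightarrow> real"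
  proof -
    have "continuous_on UNIV (\<lambda>t. \<psi> (max (2 * A 0) t))"
      by (rule continuous_on_compose2[OF that]) (auto intro!: continuous_intros)
    then have [measurable]: "(\<lambda>t. \<psi> (max (2 * A 0) t)) \<in> borel_measurable borel" by (rule borel_measurable_continuous_onI)
    have "(\<lambda>p. \<psi> (max (2 * A 0) (eta_lim (fst p)))) \<in> borel_measurable \<mu>0" by measurable
    then show ?thesis using eta_lim_ge by (simp add: max_absorb2)
  qed
  have "continuous_on {2 * A 0..} \<phi>"
    by (intro continuous_at_imp_continuous_on ballI DERIV_isCont[OF d]) simp
  then show "(\<lambda>p. \<phi> (eta_lim (fst p))) \<in> borel_measurable \<mu>0" by (rule *)
  show "(\<lambda>p. \<phi>' (eta_lim (fst p))) \<in> borel_measurable \<mu>0" by (rule *[OF c])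
qed

text \<open>The chain rule holds classically for \<open>eta_approx\<close> and passes to the limit.
  The growth conditions on \<open>\<phi>\<close> and \<open>\<phi>'\<close> are those for which the
  square of \<open>eta_lim\<close> and \<open>eta_lim\<close> times \<open>grad_bound\<close> are
  majorants. They cover the identity, the square (metric) and the inverse square (inverse
  metric).\<close>

lemma weak_grad_compose_eta_lim: "weak_grad (\<lambda>p. \<phi> (eta_lim (fst p))) (\<lambda>p. \<phi>' (eta_lim (fst p)) *\<^sub>R grad_lim p)"
proof (rule weak_grad_limit[where f = "\<lambda>n p. \<phi> (eta_approx n (fst p))" and W = "\<lambda>n p. \<phi>' (eta_approx n (fst p)) *\<^sub>R grad_approx n p"
      and F = "\<lambda>p. C * (eta_lim (fst p))\<^sup>2" and G = "\<lambda>p. C * (eta_lim (fst p) * grad_bound p)"])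
  show "has_grad (\<lambda>p. \<phi> (eta_approx n (fst p))) (\<lambda>p. \<phi>' (eta_approx n (fst p)) *\<^sub>R grad_approx n p)" for n
    by (rule has_grad_compose[OF has_grad_approx])
       (auto intro!: d eta_approx_ge continuous_on_subset[OF c])
  note [measurable] = borel_measurable_compose_eta_lim
  show "(\<lambda>p. \<phi> (eta_lim (fst p))) \<in> borel_measurable \<mu>0" "(\<lambda>p. \<phi>' (eta_lim (fst p)) *\<^sub>R grad_lim p) \<in> borel_measurable \<mu>0"
    by measurable
  show "integrable \<mu>0 (\<lambda>p. C * (eta_lim (fst p))\<^sup>2)" using integrable_eta_lim_sq by simp
  show "integrable \<mu>0 (\<lambda>p. C * (eta_lim (fst p) * grad_bound p))" using integrable_eta_grad by simp
  show "AE p in \<mu>0. (\<lambda>n. \<phi> (eta_approx n (fst p))) \<longlonglongrightarrow> \<phi> (eta_lim (fst p))"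
    by (rule eventually_mono[OF AE_good]) (intro isCont_tendsto_compose[OF DERIV_isCont[OF d]] eta_lim_ge eta_approx_tendsto)
  show "AE p in \<mu>0. (\<lambda>n. \<phi>' (eta_approx n (fst p)) *\<^sub>R grad_approx n p) \<longlonglongrightarrow> \<phi>' (eta_lim (fst p)) *\<^sub>R grad_lim p"
  proof (rule eventually_mono[OF AE_good])
    fix p assume p: "good p"
    have "(\<lambda>n. \<phi>' (eta_approx n (fst p))) \<longlonglongrightarrow> \<phi>' (eta_lim (fst p))"
      by (rule continuous_on_tendsto_compose[OF c eta_approx_tendsto[OF p]])
         (simp_all add: eta_lim_ge eta_approx_ge[OF good_S2S1[OF p]])
    then show "(\<lambda>n. \<phi>' (eta_approx n (fst p)) *\<^sub>R grad_approx n p) \<longlonglongrightarrow> \<phi>' (eta_lim (fst p)) *\<^sub>R grad_lim p"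
      by (intro tendsto_scaleR grad_approx_tendsto[OF p])
  qed
  show "AE p in \<mu>0. \<forall>n. \<bar>\<phi> (eta_approx n (fst p))\<bar> \<le> C * (eta_lim (fst p))\<^sup>2"
  proof (rule eventually_mono[OF AE_good], rule allI)
    fix p n assume p: "good p"
    have ge: "2 * A 0 \<le> eta_approx n (fst p)" by (rule eta_approx_ge[OF good_S2S1[OF p]])
    have "\<bar>\<phi> (eta_approx n (fst p))\<bar> \<le> C * (eta_approx n (fst p))\<^sup>2" by (rule b(1)[OF ge])
    also have "\<dots> \<le> C * (eta_lim (fst p))\<^sup>2"
      using eta_approx_le[OF p, of n] ge A0_pos by (intro mult_left_mono power_mono bound_nonneg) auto
    finally show "\<bar>\<phi> (eta_approx n (fst p))\<bar> \<le> C * (eta_lim (fst p))\<^sup>2" .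
  qed
  show "AE p in \<mu>0. \<forall>n. norm (\<phi>' (eta_approx n (fst p)) *\<^sub>R grad_approx n p) \<le> C * (eta_lim (fst p) * grad_bound p)"
  proof (rule eventually_mono[OF AE_good], rule allI)
    fix p n assume p: "good p"
    have ge: "2 * A 0 \<le> eta_approx n (fst p)" by (rule eta_approx_ge[OF good_S2S1[OF p]])
    have "\<bar>\<phi>' (eta_approx n (fst p))\<bar> \<le> C * eta_approx n (fst p)" by (rule b(2)[OF ge])
    also have "\<dots> \<le> C * eta_lim (fst p)" using eta_approx_le[OF p, of n] by (intro mult_left_mono bound_nonneg)
    finally have "\<bar>\<phi>' (eta_approx n (fst p))\<bar> * norm (grad_approx n p) \<le> (C * eta_lim (fst p)) * grad_bound p"
      using bound_nonneg eta_lim_pos[of "fst p"] by (intro mult_mono norm_grad_approx_le[OF p]) auto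
    then show "norm (\<phi>' (eta_approx n (fst p)) *\<^sub>R grad_approx n p) \<le> C * (eta_lim (fst p) * grad_bound p)"
      by (simp add: mult.assoc)
  qed
qed

lemma in_Lq3_compose_eta_lim:
  assumes r: "1 \<le> r" "r < 2"
  shows "in_Lq3 r (\<lambda>p k i j. ((\<phi>' (eta_lim (fst p)) *\<^sub>R grad_lim p) \<bullet> k) * (snd i \<bullet> snd j))" (is "in_Lq3 r ?D")
proof -
  note [measurable] = borel_measurable_compose_eta_lim
  have mD: "(\<lambda>p. comp3 ?D p k i j) \<in> borel_measurable \<mu>0" for k i j
    by (rule borel_measurable_comp3_diagonal) measurable
  have [measurable]: "norm3 ?D \<in> borel_measurable \<mu>0" by (rule borel_measurable_norm3[OF mD])
  have "integrable \<mu>0 (\<lambda>p. norm3 ?D p powr r)"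
  proof (rule Bochner_Integration.integrable_bound)
    show "integrable \<mu>0 (\<lambda>p. C powr r * (eta_lim (fst p) * grad_bound p) powr r)"
      using integrable_eta_grad_powr[OF r] by simp
    show "(\<lambda>p. norm3 ?D p powr r) \<in> borel_measurable \<mu>0" by measurable
    show "AE p in \<mu>0. norm (norm3 ?D p powr r) \<le> norm (C powr r * (eta_lim (fst p) * grad_bound p) powr r)"
    proof (rule eventually_mono[OF AE_good])
      fix p assume p: "good p"
      have gb: "0 \<le> grad_bound p" using norm_grad_lim_le[OF p] norm_ge_zero order_trans by blast
      have t: "\<phi>' (eta_lim (fst p)) *\<^sub>R grad_lim p \<in> tangent p"
        using grad_lim_tangent[OF p] by (simp add: tangent_def)
      have n: "norm3 ?D p = \<bar>\<phi>' (eta_lim (fst p))\<bar> * norm (grad_lim p)"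
        using norm3_diagonal[where W = "\<lambda>p. \<phi>' (eta_lim (fst p)) *\<^sub>R grad_lim p", OF good_S2S1[OF p] t] by simp
      have le: "norm3 ?D p \<le> (C * eta_lim (fst p)) * grad_bound p"
        unfolding n using bound_nonneg eta_lim_pos[of "fst p"] by (intro mult_mono b(2) eta_lim_ge norm_grad_lim_le[OF p]) auto
      have n0: "0 \<le> norm3 ?D p" unfolding n by simp
      have "norm3 ?D p powr r \<le> (C * (eta_lim (fst p) * grad_bound p)) powr r"
        using le r n0 by (intro powr_mono2) (simp_all only: mult.assoc)
      also have "\<dots> = C powr r * (eta_lim (fst p) * grad_bound p) powr r"
        using bound_nonneg eta_lim_pos[of "fst p"] gb by (subst powr_mult) auto
      finally show "norm (norm3 ?D p powr r) \<le> norm (C powr r * (eta_lim (fst p) * grad_bound p) powr r)" by simp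
    qed
  qed
  then show ?thesis unfolding in_Lq3_def using mD by (intro conjI allI AE_I2 trilinear_diagonal)
qed

lemma weak_cov_deriv_compose_eta_lim:
  assumes bil: "\<And>p. p \<in> S2S1 \<Longrightarrow> bilinear (T p)"
    and T: "\<And>p i j. p \<in> S2S1 \<Longrightarrow> comp2 T p i j = factor_form True p i j + \<phi> (eta_lim (fst p)) * factor_form False p i j"
  shows "1 \<le> q \<Longrightarrow> in_Lq2 q T"
    and "has_weak_cov_deriv T (\<lambda>p k i j. ((\<phi>' (eta_lim (fst p)) *\<^sub>R grad_lim p) \<bullet> k) * (snd i \<bullet> snd j))"
proof -
  show L: "in_Lq2 q T" if "1 \<le> q" for q
    by (rule in_Lq2_diagonal[OF that bil borel_measurable_compose_eta_lim(1) T b(1)[OF eta_lim_ge] bound_nonneg])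
  show "has_weak_cov_deriv T (\<lambda>p k i j. ((\<phi>' (eta_lim (fst p)) *\<^sub>R grad_lim p) \<bullet> k) * (snd i \<bullet> snd j))"
    by (rule has_weak_cov_deriv_diagonal[OF weak_grad_compose_eta_lim T L in_Lq3_compose_eta_lim]) auto
qed

end

end

section \<open>The limit metric\<close>

context limit_warping
begin

text \<open>Each summand is split as \<open>?G i + ?R i\<close> by adding and subtracting
  \<open>u\<close> times the Laplacian of the potential. The first integrates to zero by Green's
  identity; the second is non-negative because potential plus \<open>b i\<close> is at least 2 and
  the Laplacian at most 2.\<close>

lemma grad_approx_pairing_nonneg:
  assumes u: "has_grad u U" and nn: "\<And>p. p \<in> S2S1 \<Longrightarrow> 0 \<le> u p"
  shows "0 \<le> (\<integral>p. grad_approx n p \<bullet> U p + eta_approx n (fst p) * u p \<partial>\<mu>0)"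
proof -
  note cu = has_grad_continuous_on[OF u] and cU = has_grad_continuous[OF u]
  let ?t = "\<lambda>i p. x i \<bullet> fst p"
  let ?G = "\<lambda>i p. potential' (reg n) (?t i p) * (U p \<bullet> proj p (x i, 0))
      + u p * ((1 - (?t i p)\<^sup>2) * potential'' (reg n) (?t i p) - 2 * ?t i p * potential' (reg n) (?t i p))"
  let ?R = "\<lambda>i p. u p * (potential (reg n) (?t i p) + b i
      - ((1 - (?t i p)\<^sup>2) * potential'' (reg n) (?t i p) - 2 * ?t i p * potential' (reg n) (?t i p)))"
  have img: "?t i ` S2S1 \<subseteq> {-1..1}" for i using abs_inner_S2_le[OF _ x_S2] by (auto simp: abs_le_iff minus_le_iff)
  have ct: "continuous_on S2S1 (?t i)" for i by (intro continuous_intros)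
  have c1: "continuous_on S2S1 (\<lambda>p. potential' (reg n) (?t i p))" and c2: "continuous_on S2S1 (\<lambda>p. potential'' (reg n) (?t i p))" for i
    by (rule continuous_on_compose2[OF continuous_potential'[OF reg_pos] ct img],
        rule continuous_on_compose2[OF continuous_potential''[OF reg_pos] ct img])
  have cp: "continuous_on S2S1 (\<lambda>p. proj p w)" for w unfolding proj_def by (intro continuous_intros)
  have intG: "integrable \<mu>0 (?G i)" for i
    by (intro integrable_mu0_continuous continuous_intros c1 c2 ct cu cU cp)
  have c0: "continuous_on {-1..1} (potential (reg n))"
    by (intro continuous_at_imp_continuous_on ballI DERIV_isCont[OF DERIV_potential[OF reg_pos]]) (auto simp: abs_le_iff)
  have cpot: "continuous_on S2S1 (\<lambda>p. potential (reg n) (?t i p))" for i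
    by (rule continuous_on_compose2[OF c0 ct img])
  have intR: "integrable \<mu>0 (?R i)" for i
    by (intro integrable_mu0_continuous continuous_intros c1 c2 ct cu cpot)
  have G0: "(\<integral>p. ?G i p \<partial>\<mu>0) = 0" for i
    by (rule green_weighted[OF u x_S2 DERIV_potential'[OF reg_pos] continuous_potential''[OF reg_pos]])
  have R0: "0 \<le> (\<integral>p. ?R i p \<partial>\<mu>0)" for i
  proof (rule integral_nonneg_AE, rule AE_I2)
    fix p assume "p \<in> space \<mu>0"
    then have p: "p \<in> S2S1" by simp
    have t: "\<bar>?t i p\<bar> \<le> 1" by (rule abs_inner_S2_le[OF p x_S2])
    show "0 \<le> ?R i p"
      using potential_laplacian_le[OF reg_pos t, of n] potential_nonneg[OF reg_pos t, of n] b_ge[of i]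
      by (intro mult_nonneg_nonneg nn[OF p]) linarith
  qed
  have gU: "grad_approx n p \<bullet> U p = (\<Sum>i\<le>n. A i * (potential' (reg n) (?t i p) * (U p \<bullet> proj p (x i, 0))))" for p
    by (simp add: grad_approx_def inner_sum_left inner_commute[of "U p"] mult.assoc)
  have "(\<integral>p. grad_approx n p \<bullet> U p + eta_approx n (fst p) * u p \<partial>\<mu>0) = (\<integral>p. (\<Sum>i\<le>n. A i * (?G i p + ?R i p)) \<partial>\<mu>0)"
    unfolding gU eta_approx_def sum_distrib_right sum.distrib[symmetric]
    by (intro Bochner_Integration.integral_cong sum.cong refl) (simp add: algebra_simps)
  also have "\<dots> = (\<Sum>i\<le>n. \<integral>p. A i * (?G i p + ?R i p) \<partial>\<mu>0)"
    by (rule Bochner_Integration.integral_sum) (intro integrable_mult_right Bochner_Integration.integrable_add intG intR)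
  also have "\<dots> = (\<Sum>i\<le>n. A i * (\<integral>p. ?R i p \<partial>\<mu>0))"
  proof (rule sum.cong[OF refl])
    fix i
    have "(\<integral>p. ?G i p + ?R i p \<partial>\<mu>0) = (\<integral>p. ?R i p \<partial>\<mu>0)"
      using Bochner_Integration.integral_add[OF intG intR, of i i] unfolding G0 by simp
    then show "(\<integral>p. A i * (?G i p + ?R i p) \<partial>\<mu>0) = A i * (\<integral>p. ?R i p \<partial>\<mu>0)" by simp
  qed
  also have "0 \<le> \<dots>" by (intro sum_nonneg mult_nonneg_nonneg A_nonneg R0)
  finally show ?thesis .
qed

lemma grad_lim_pairing:
  assumes u: "has_grad u U"
  shows "integrable \<mu>0 (\<lambda>p. grad_lim p \<bullet> U p + eta_lim (fst p) * u p)"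
    and "(\<And>p. p \<in> S2S1 \<Longrightarrow> 0 \<le> u p) \<Longrightarrow> 0 \<le> (\<integral>p. grad_lim p \<bullet> U p + eta_lim (fst p) * u p \<partial>\<mu>0)"
proof -
  note cu = has_grad_continuous_on[OF u] and cU = has_grad_continuous[OF u]
  have [measurable]: "u \<in> borel_measurable \<mu>0" "U \<in> borel_measurable \<mu>0"
    by (intro borel_measurable_mu0_continuous cu cU)+
  obtain C where C: "0 \<le> C" "\<And>p. p \<in> S2S1 \<Longrightarrow> norm (u p) \<le> C" using continuous_S2S1_bound[OF cu] by blast
  obtain D where D: "0 \<le> D" "\<And>p. p \<in> S2S1 \<Longrightarrow> norm (U p) \<le> D" using continuous_S2S1_bound[OF cU] by blast
  have ma: "(\<lambda>p. grad_approx n p \<bullet> U p + eta_approx n (fst p) * u p) \<in> borel_measurable \<mu>0" for n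
    by (intro borel_measurable_mu0_continuous continuous_intros cu cU has_grad_continuous[OF has_grad_approx] has_grad_continuous_on[OF has_grad_approx])
  have bd: "norm (w \<bullet> U p + e * u p) \<le> grad_bound p * D + eta_lim (fst p) * C"
    if p: "p \<in> S2S1" and w: "norm w \<le> grad_bound p" and e: "0 \<le> e" "e \<le> eta_lim (fst p)" for w p e
  proof -
    have "norm (w \<bullet> U p + e * u p) \<le> \<bar>w \<bullet> U p\<bar> + \<bar>e * u p\<bar>" by simp
    also have "\<bar>w \<bullet> U p\<bar> \<le> norm w * norm (U p)" by (rule Cauchy_Schwarz_ineq2)
    also have "\<dots> \<le> grad_bound p * D" using w D(2)[OF p] by (intro mult_mono) (auto intro: order_trans[OF norm_ge_zero])
    also have "\<bar>e * u p\<bar> \<le> eta_lim (fst p) * C" using e C(2)[OF p] unfolding abs_mult by (intro mult_mono) auto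
    finally show ?thesis by simp
  qed
  have ge0: "0 \<le> eta_approx n (fst p)" if "p \<in> S2S1" for n p using eta_approx_ge[OF that, of n] A0_pos by simp
  have dom: "integrable \<mu>0 (\<lambda>p. grad_bound p * D + eta_lim (fst p) * C)"
    using integrable_grad_bound integrable_eta_lim by simp
  have m: "(\<lambda>p. grad_lim p \<bullet> U p + eta_lim (fst p) * u p) \<in> borel_measurable \<mu>0" by measurable
  have lim: "AE p in \<mu>0. (\<lambda>n. grad_approx n p \<bullet> U p + eta_approx n (fst p) * u p) \<longlonglongrightarrow> grad_lim p \<bullet> U p + eta_lim (fst p) * u p"
    by (rule eventually_mono[OF AE_good]) (intro tendsto_intros grad_approx_tendsto eta_approx_tendsto)
  have le: "AE p in \<mu>0. norm (grad_approx n p \<bullet> U p + eta_approx n (fst p) * u p) \<le> grad_bound p * D + eta_lim (fst p) * C" for n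
    by (rule eventually_mono[OF AE_good]) (intro bd ge0 norm_grad_approx_le eta_approx_le good_S2S1)
  show "integrable \<mu>0 (\<lambda>p. grad_lim p \<bullet> U p + eta_lim (fst p) * u p)"
    by (rule integrable_dominated_convergence[OF m ma dom lim le])
  have "(\<lambda>n. \<integral>p. grad_approx n p \<bullet> U p + eta_approx n (fst p) * u p \<partial>\<mu>0) \<longlonglongrightarrow> (\<integral>p. grad_lim p \<bullet> U p + eta_lim (fst p) * u p \<partial>\<mu>0)"
    by (rule integral_dominated_convergence[OF m ma dom lim le])
  then show "0 \<le> (\<integral>p. grad_lim p \<bullet> U p + eta_lim (fst p) * u p \<partial>\<mu>0)" if "\<And>p. p \<in> S2S1 \<Longrightarrow> 0 \<le> u p"
    by (rule tendsto_lowerbound) (auto intro!: always_eventually grad_approx_pairing_nonneg[OF u] that)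
qed

text \<open>Away from zero a constant is dominated by any power. This brings bounded and decaying
  functions under the growth conditions of \<open>weak_grad_compose_eta_lim\<close>.\<close>

lemma power_le_power_mult:
  assumes t: "2 * A 0 \<le> t" and c: "0 \<le> c" shows "c \<le> c / (2 * A 0) ^ k * t ^ k"
proof -
  have "(2 * A 0) ^ k \<le> t ^ k" using t A0_pos by (intro power_mono) auto
  then have "c / (2 * A 0) ^ k * (2 * A 0) ^ k \<le> c / (2 * A 0) ^ k * t ^ k" using c A0_pos by (intro mult_left_mono) auto
  then show ?thesis using A0_pos by simp
qed

lemma derivative_bounds_square:
  "2 * A 0 \<le> t \<Longrightarrow> ((\<lambda>t. t\<^sup>2) has_real_derivative 2 * t) (at t)"
  "continuous_on {2 * A 0..} (\<lambda>t::real. 2 * t)"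
  "2 * A 0 \<le> t \<Longrightarrow> \<bar>t\<^sup>2\<bar> \<le> 2 * t\<^sup>2" "2 * A 0 \<le> t \<Longrightarrow> \<bar>2 * t\<bar> \<le> 2 * t"
  using A0_pos by (auto intro!: derivative_eq_intros continuous_intros)

text \<open>One constant serves both estimates, since each follows from
  \<open>2 \<le> C * t ^ 4\<close>.\<close>

lemma derivative_bounds_inverse_square:
  fixes t :: real
  defines "C \<equiv> 2 / (2 * A 0) ^ 4"
  assumes "2 * A 0 \<le> t"
  shows "((\<lambda>t. 1 / t\<^sup>2) has_real_derivative - 2 / t ^ 3) (at t)" "\<bar>1 / t\<^sup>2\<bar> \<le> C * t\<^sup>2" "\<bar>- 2 / t ^ 3\<bar> \<le> C * t"
proof -
  have t: "0 < t" using assms(2) A0_pos by simp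
  show "((\<lambda>t. 1 / t\<^sup>2) has_real_derivative - 2 / t ^ 3) (at t)"
    using t by (auto intro!: derivative_eq_intros simp: field_simps power2_eq_square power3_eq_cube)
  have 2: "2 \<le> C * t ^ 4" unfolding C_def by (rule power_le_power_mult[OF assms(2)]) simp
  have "1 \<le> C * t\<^sup>2 * t\<^sup>2" using 2 by (simp add: power2_eq_square power4_eq_xxxx mult.assoc)
  then show "\<bar>1 / t\<^sup>2\<bar> \<le> C * t\<^sup>2" using t by (simp add: divide_le_eq)
  have "2 \<le> C * t * t ^ 3" using 2 by (simp add: power3_eq_cube power4_eq_xxxx mult.assoc)
  then show "\<bar>- 2 / t ^ 3\<bar> \<le> C * t" using t by (simp add: divide_le_eq)
qed

lemma continuous_inverse_cube: "continuous_on {2 * A 0..} (\<lambda>t::real. - 2 / t ^ 3)"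
  using A0_pos by (auto intro!: continuous_intros)

lemma derivative_bounds_id:
  fixes t :: real
  defines "C \<equiv> 1 / (2 * A 0) ^ 1"
  assumes "2 * A 0 \<le> t"
  shows "\<bar>t\<bar> \<le> C * t\<^sup>2" "\<bar>1\<bar> \<le> C * t"
proof -
  have t: "0 < t" using assms(2) A0_pos by simp
  have 1: "1 \<le> C * t ^ 1" unfolding C_def by (rule power_le_power_mult[OF assms(2)]) simp
  then show "\<bar>1\<bar> \<le> C * t" by simp
  show "\<bar>t\<bar> \<le> C * t\<^sup>2" using mult_right_mono[OF 1, of t] t by (simp add: power2_eq_square mult.assoc)
qed

lemma weak_grad_eta_lim: "weak_grad (\<lambda>p. eta_lim (fst p)) grad_lim"
  using weak_grad_compose_eta_lim[of "\<lambda>t. t" "\<lambda>_. 1", OF _ _ derivative_bounds_id] by simp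

lemma in_Lq2_limit_metric: "1 \<le> q \<Longrightarrow> in_Lq2 q (warped eta_lim)"
  and weak_cov_deriv_limit_metric:
    "has_weak_cov_deriv (warped eta_lim) (\<lambda>p k i j. ((2 * eta_lim (fst p)) *\<^sub>R grad_lim p \<bullet> k) * (snd i \<bullet> snd j))"
  using weak_cov_deriv_compose_eta_lim[where T = "warped eta_lim", OF derivative_bounds_square bilinear_warped comp2_warped]
  by auto

lemma weak_cov_deriv_inverse_limit_metric:
  "has_weak_cov_deriv (inverse_metric (warped eta_lim)) (\<lambda>p k i j. ((- 2 / eta_lim (fst p) ^ 3) *\<^sub>R grad_lim p \<bullet> k) * (snd i \<bullet> snd j))"
proof (rule weak_cov_deriv_compose_eta_lim(2)[OF derivative_bounds_inverse_square(1) continuous_inverse_cube derivative_bounds_inverse_square(2,3)])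
  fix p i j assume p: "p \<in> S2S1"
  have nz: "eta_lim (fst p) \<noteq> 0" using eta_lim_pos[of "fst p"] by simp
  show "bilinear (inverse_metric (warped eta_lim) p)" by (rule bilinear_inverse_metric_warped[where \<eta> = eta_lim, OF p nz])
  show "comp2 (inverse_metric (warped eta_lim)) p i j = factor_form True p i j + 1 / (eta_lim (fst p))\<^sup>2 * factor_form False p i j"
    by (rule comp2_inverse_metric_warped[where \<eta> = eta_lim, OF p nz])
qed

lemma in_W1p_limit_metric: "1 \<le> r \<Longrightarrow> r < 2 \<Longrightarrow> in_W1p r (warped eta_lim)"
  unfolding in_W1p_def
  using in_Lq2_limit_metric weak_cov_deriv_limit_metric in_Lq3_compose_eta_lim[OF derivative_bounds_square] by blast

theorem nonneg_distributional_scal_limit_metric: "nonneg_distributional_scal (warped eta_lim)"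
  unfolding nonneg_distributional_scal_def
proof (intro allI impI)
  fix u :: "ambient \<Rightarrow> real" assume "smooth_on_S2S1 u"
  note gu = has_grad_smooth[OF this]
  define U where "U = smooth_grad u"
  have u: "has_grad u U" unfolding U_def by (rule gu)
  note cu = has_grad_continuous_on[OF u] and cU = has_grad_continuous[OF u]
  have [measurable]: "u \<in> borel_measurable \<mu>0" "U \<in> borel_measurable \<mu>0"
    by (intro borel_measurable_mu0_continuous cu cU)+
  define Dg :: tensor3 where "Dg = (\<lambda>p k i j. ((2 * eta_lim (fst p)) *\<^sub>R grad_lim p \<bullet> k) * (snd i \<bullet> snd j))"
  define Dgi :: tensor3 where "Dgi = (\<lambda>p k i j. ((- 2 / eta_lim (fst p) ^ 3) *\<^sub>R grad_lim p \<bullet> k) * (snd i \<bullet> snd j))"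
  define W where "W p = u p *\<^sub>R grad_lim p + eta_lim (fst p) *\<^sub>R U p" for p
  define L where "L = LL_integrand (warped eta_lim) Dg Dgi u W"
  let ?P = "\<lambda>p. grad_lim p \<bullet> U p + eta_lim (fst p) * u p"
  have vd: "AE p in \<mu>0. vol_density (warped eta_lim) p = eta_lim (fst p)"
    using vol_density_warped[OF borel_measurable_lim(1)] by eventually_elim (simp add: eta_lim_pos less_imp_le)
  have Dg: "has_weak_cov_deriv (warped eta_lim) Dg"
    unfolding Dg_def by (rule weak_cov_deriv_limit_metric)
  have Dgi: "has_weak_cov_deriv (inverse_metric (warped eta_lim)) Dgi"
    unfolding Dgi_def by (rule weak_cov_deriv_inverse_limit_metric)
  have [measurable]: "vol_density (warped eta_lim) \<in> borel_measurable \<mu>0" by (rule borel_measurable_vol_density)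
  \<comment> \<open>The product rule gives the weak gradient of \<open>u\<close> times
    \<open>eta_lim\<close>; the volume density differs from \<open>eta_lim\<close> on a null set
    only.\<close>
  have "weak_grad (\<lambda>p. u p * vol_density (warped eta_lim) p) (\<lambda>p. u p *\<^sub>R grad_lim p + eta_lim (fst p) *\<^sub>R U p)"
  proof (rule weak_grad_AE_cong[OF weak_grad_mult[OF weak_grad_eta_lim u]])
    show "AE p in \<mu>0. u p * eta_lim (fst p) = u p * vol_density (warped eta_lim) p"
      using vd by eventually_elim simp
  qed measurable
  then have W: "has_weak_gradient (\<lambda>p. u p * vol_density (warped eta_lim) p) W"
    unfolding W_def[abs_def] by (rule weak_grad_imp_has_weak_gradient)
  have mL: "L \<in> borel_measurable \<mu>0" unfolding L_def
  proof (rule borel_measurable_LL_integrand)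
    show "(\<lambda>p. comp2 (inverse_metric (warped eta_lim)) p i j) \<in> borel_measurable \<mu>0"
      "(\<lambda>p. comp3 Dg p k i j) \<in> borel_measurable \<mu>0" "(\<lambda>p. comp3 Dgi p k i j) \<in> borel_measurable \<mu>0" for k i j
      using Dg Dgi unfolding has_weak_cov_deriv_def in_Lq2_def in_Lq3_def by blast+
    show "W \<in> borel_measurable \<mu>0" unfolding W_def[abs_def] by measurable
  qed measurable
  \<comment> \<open>After this pointwise cancellation the integrand is integrable, and measurability
    of \<open>L\<close> transfers both integrability and the value of the integral.\<close>
  have eq: "AE p in \<mu>0. L p = 2 * ?P p"
    using AE_good vd
  proof eventually_elim
    case (elim p)
    have S: "p \<in> S2S1" by (rule good_S2S1[OF elim(1)])
    have nz: "eta_lim (fst p) \<noteq> 0" using eta_lim_pos[of "fst p"] by simp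
    have "L p = 2 * (grad_lim p \<bullet> U p) + 2 * eta_lim (fst p) * u p"
      unfolding L_def
      by (rule LL_integrand_warped[OF S grad_lim_tangent[OF elim(1)] snd_grad_lim[OF elim(1)] refl nz _ _ _ has_grad_tangent[OF u S] elim(2)])
         (simp_all add: Dg_def Dgi_def W_def)
    then show ?case by simp
  qed
  have int: "integrable \<mu>0 (\<lambda>p. 2 * ?P p)" by (rule integrable_mult_right[OF grad_lim_pairing(1)[OF u]])
  have mP: "(\<lambda>p. 2 * ?P p) \<in> borel_measurable \<mu>0" using int by (rule borel_measurable_integrable)
  have "integrable \<mu>0 L" using int integrable_cong_AE[OF mL mP eq] by blast
  moreover have "(\<integral>p. L p \<partial>\<mu>0) = 2 * (\<integral>p. ?P p \<partial>\<mu>0)"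
    using integral_cong_AE[OF mL mP eq] by (simp only: integral_mult_right_zero)
  ultimately have bi: "has_bochner_integral \<mu>0 L (2 * (\<integral>p. ?P p \<partial>\<mu>0))"
    by (simp add: has_bochner_integral_iff)
  show "\<exists>I. has_scal_pairing (warped eta_lim) u I \<and> ((\<forall>p\<in>S2S1. 0 \<le> u p) \<longrightarrow> 0 \<le> I)"
  proof (intro exI conjI impI)
    show "has_scal_pairing (warped eta_lim) u (2 * (\<integral>p. ?P p \<partial>\<mu>0))"
      unfolding has_scal_pairing_def using Dg Dgi W bi unfolding L_def by blast
    assume "\<forall>p\<in>S2S1. 0 \<le> u p"
    then show "0 \<le> 2 * (\<integral>p. ?P p \<partial>\<mu>0)" using grad_lim_pairing(2)[OF u] by auto
  qed
qed

end

text \<open>The metrics differ only in the circle direction, whose form has norm one, so the tensor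
  norm of the difference is that of the squared warping functions.\<close>

lemma (in limit_warping) converges_Lq2_warped:
  assumes q: "1 \<le> q" and c: "\<And>n. continuous_on S2S1 (\<lambda>p. H n (fst p))"
    and lim: "(\<lambda>n. \<integral>p. \<bar>(H n (fst p))\<^sup>2 - (eta_lim (fst p))\<^sup>2\<bar> powr q \<partial>\<mu>0) \<longlonglongrightarrow> 0"
  shows "converges_Lq2 q (\<lambda>n. warped (H n)) (warped eta_lim)"
  unfolding converges_Lq2_def
proof (intro conjI allI)
  show "in_Lq2 q (warped eta_lim)" by (rule in_Lq2_limit_metric[OF q])
  show "in_Lq2 q (warped (H n))" for n
  proof -
    have c2: "continuous_on S2S1 (\<lambda>p. (H n (fst p))\<^sup>2)" by (intro continuous_intros c)
    obtain C where C: "0 \<le> C" "\<And>p. p \<in> S2S1 \<Longrightarrow> norm ((H n (fst p))\<^sup>2) \<le> C"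
      using continuous_S2S1_bound[OF c2] by blast
    show ?thesis
    proof (rule in_Lq2_diagonal[OF q bilinear_warped borel_measurable_mu0_continuous[OF c2] comp2_warped])
      fix p assume p: "p \<in> S2S1"
      show "\<bar>(H n (fst p))\<^sup>2\<bar> \<le> C / (2 * A 0) ^ 2 * (eta_lim (fst p))\<^sup>2"
        using order_trans[OF C(2)[OF p] power_le_power_mult[of _ _ 2, OF eta_lim_ge C(1)]] by simp
    qed (use C in auto)
  qed
  have "Lq_norm2 q (\<lambda>p v w. warped (H n) p v w - warped eta_lim p v w)
      = (\<integral>p. \<bar>(H n (fst p))\<^sup>2 - (eta_lim (fst p))\<^sup>2\<bar> powr q \<partial>\<mu>0) powr (1 / q)" for n
  proof -
    have "norm2 (\<lambda>p v w. warped (H n) p v w - warped eta_lim p v w) p = \<bar>(H n (fst p))\<^sup>2 - (eta_lim (fst p))\<^sup>2\<bar>"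
      if p: "p \<in> S2S1" for p
    proof -
      have "comp2 (\<lambda>p v w. warped (H n) p v w - warped eta_lim p v w) p i j
          = 0 * factor_form True p i j + ((H n (fst p))\<^sup>2 - (eta_lim (fst p))\<^sup>2) * factor_form False p i j" for i j
        using comp2_warped[OF p, of "H n" i j] comp2_warped[OF p, of eta_lim i j]
        by (simp add: comp2_def left_diff_distrib)
      from norm2_diagonal[OF p this] show ?thesis by simp
    qed
    then show ?thesis unfolding Lq_norm2_def
      by (intro arg_cong[where f = "\<lambda>t. t powr (1 / q)"] Bochner_Integration.integral_cong refl) simp
  qed
  then show "(\<lambda>n. Lq_norm2 q (\<lambda>p v w. warped (H n) p v w - warped eta_lim p v w)) \<longlonglongrightarrow> 0"
    using tendsto_zero_powrI[OF lim tendsto_const[of "1 / q"]] q by simp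
qed

theorem theorem1p3:
  fixes a b A :: "nat \<Rightarrow> real" and K Kbar :: real and x :: "nat \<Rightarrow> nat \<Rightarrow> real^3"
    and g :: "nat \<Rightarrow> tensor2"
  assumes a_pos: "\<And>j. j \<ge> 1 \<Longrightarrow> a j > 0"
    and a_decr: "\<And>j. j \<ge> 1 \<Longrightarrow> a (Suc j) \<le> a j"
    and a_lim: "a \<longlonglongrightarrow> 0"
    and Kbar: "Kbar \<ge> 2"
    and b_range: "\<And>i. i \<ge> 1 \<Longrightarrow> b i \<in> {2..Kbar}"
    and A_nonneg: "\<And>i. i \<ge> 1 \<Longrightarrow> A i \<ge> 0"
    and A1_pos: "A 1 > 0"
    and A_sums: "(\<lambda>i. A (Suc i)) sums K"
    and x_S2: "\<And>i j. i \<ge> 1 \<Longrightarrow> j \<ge> 1 \<Longrightarrow> x i j \<in> S2"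
    and g_def: "\<And>j. g j = warped (eta A a b x j)"
  shows
    "(\<forall>j\<ge>1. \<forall>p\<in>S2S1. scal (g j) p \<ge> 0) \<and>
     (\<forall>j\<ge>1.
        ennreal (16 * pi\<^sup>2 * A 1) \<le> emeasure (vol (g j)) S2S1 \<and>
        emeasure (vol (g j)) S2S1
          \<le> ennreal (2 * pi * K * (8 * pi - 4 * pi * ln 4 + 4 * pi * Kbar)) \<and>
        riem_diam S2S1 (g j)
          \<le> ennreal (4 * pi + 2 * pi * K * (8 * pi - 4 * pi * ln 4 + 4 * pi * Kbar))) \<and>
     (\<exists>(s :: nat \<Rightarrow> nat) \<eta>lim.
        strict_mono s \<and> (\<forall>n. s n \<ge> 1) \<and> weak_warping_function \<eta>lim \<and>
        (\<forall>q\<ge>1. converges_Lq2 q (\<lambda>n. g (s n)) (warped \<eta>lim)) \<and>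
        (\<forall>r. 1 \<le> r \<and> r < 2 \<longrightarrow> in_W1p r (warped \<eta>lim)) \<and>
        nonneg_distributional_scal (warped \<eta>lim))"
proof -
  let ?c = "8 * pi - 4 * pi * ln 4 + 4 * pi * Kbar"
  have eta: "eta A a b x j y = (\<Sum>i\<in>{1..j}. A i * (potential (a j) (x i j \<bullet> y) + b i))" if "j \<ge> 1" "y \<in> S2" for j y
    unfolding eta_def using that by (intro sum.cong refl) (simp add: f_ab_dist_S2_potential[OF x_S2])
  have fw: "finite_warping {1..j} A b (\<lambda>i. x i j) (a j) (eta A a b x j)" if j: "j \<ge> 1" for j
  proof
    show "\<exists>i\<in>{1..j}. 0 < A i" using A1_pos j by (intro bexI[of _ 1]) auto
  qed (use j a_pos A_nonneg b_range x_S2 eta in auto)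
  have A_le: "(\<Sum>i\<in>{1..j}. A i) \<le> K" for j
    using sum_le_suminf[OF sums_summable[OF A_sums], of "{..<j}"] A_nonneg
    by (simp add: sums_unique[OF A_sums] sum.atLeast1_atMost_eq)
  have K: "0 < K" using A_le[of 1] A1_pos by simp
  \<comment> \<open>With \<open>ln 4 \<le> 3\<close> and \<open>Kbar \<ge> 2\<close> the constant
    \<open>?c\<close> is at least \<open>8 * pi - 12 * pi + 8 * pi\<close>, which is
    positive.\<close>
  have "pi * ln 4 \<le> pi * 3" using ln_le_minus_one[of 4] by (intro mult_left_mono) auto
  moreover have "pi * 2 \<le> pi * Kbar" using Kbar by (intro mult_left_mono) auto
  ultimately have c: "0 < ?c" using pi_gt_zero by linarith

  have fin: "(\<forall>p\<in>S2S1. scal (g j) p \<ge> 0) \<and> ennreal (16 * pi\<^sup>2 * A 1) \<le> emeasure (vol (g j)) S2S1 \<and>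
      emeasure (vol (g j)) S2S1 \<le> ennreal (2 * pi * K * ?c) \<and> riem_diam S2S1 (g j) \<le> ennreal (4 * pi + 2 * pi * K * ?c)"
    if j: "j \<ge> 1" for j
  proof -
    interpret finite_warping "{1..j}" A b "\<lambda>i. x i j" "a j" "eta A a b x j" by (rule fw[OF j])
    have "emeasure (vol (g j)) S2S1 \<le> ennreal (2 * pi * (\<Sum>i\<in>{1..j}. A i) * ?c)"
      unfolding g_def by (rule emeasure_vol_le) (use b_range in auto)
    also have "\<dots> \<le> ennreal (2 * pi * K * ?c)"
      using A_le[of j] c by (intro ennreal_leI mult_right_mono mult_left_mono) auto
    finally have vol: "emeasure (vol (g j)) S2S1 \<le> ennreal (2 * pi * K * ?c)" .
    \<comment> \<open>The volume bound read as \<open>2 * pi * M\<close> with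
      \<open>M = K * ?c\<close>.\<close>
    moreover have "riem_diam S2S1 (g j) \<le> ennreal (4 * pi + 2 * pi * (K * ?c))"
      unfolding g_def by (rule riem_diam_le) (use vol K c in \<open>simp_all add: g_def mult.assoc\<close>)
    moreover have "ennreal (16 * pi\<^sup>2 * A 1) \<le> emeasure (vol (g j)) S2S1"
      using emeasure_vol_ge[of "{1}"] j by (simp add: g_def)
    ultimately show ?thesis using scal_nonneg by (simp add: g_def mult.assoc)
  qed

  have x_norm: "norm (x (Suc i) (Suc n)) = 1" for i n using x_S2[of "Suc i" "Suc n"] by (simp add: S2_def)
  \<comment> \<open>The diagonal argument: the centres, indexed by \<open>i\<close>, are bounded
    sequences of vectors. Both indices are shifted by one because centres are given only for indices
    at least 1.\<close>
  obtain k :: "nat \<Rightarrow> nat" where k: "strict_mono k" and "\<And>i. i \<in> UNIV \<Longrightarrow> \<exists>l. (\<lambda>n. x (Suc i) (Suc (k n))) \<longlonglongrightarrow> l"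
    using function_convergent_subsequence[of "UNIV :: nat set" "\<lambda>n i. x (Suc i) (Suc n)" 1] x_norm by auto
  then obtain y where y: "\<And>i. (\<lambda>n. x (Suc i) (Suc (k n))) \<longlonglongrightarrow> y i" by (metis UNIV_I)
  \<comment> \<open>The shift also makes all indices of the subsequence at least 1.\<close>
  define s where "s n = Suc (k n)" for n
  have s: "strict_mono s" "s n \<ge> 1" for n using k by (simp_all add: s_def strict_mono_def)
  have y_S2: "y i \<in> S2" for i
    using LIMSEQ_unique[OF tendsto_norm[OF y[of i]], of 1] by (simp add: x_norm S2_def)
  interpret L: limit_warping "\<lambda>i. A (Suc i)" "\<lambda>i. b (Suc i)" y K Kbar
    by unfold_locales (use A_nonneg A1_pos A_sums b_range y_S2 in auto)
  \<comment> \<open>Monotonicity enters as the uniform bound \<open>a 1\<close> on the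
    regularisation parameters.\<close>
  have a_le: "a j \<le> a 1" if "j \<ge> 1" for j
    using that by (induction j rule: nat_induct_at_least) (auto intro: order_trans[OF a_decr])
  have H: "eta A a b x (s n) (fst p) = (\<Sum>i<s n. A (Suc i) * (potential (a (s n)) (x (Suc i) (s n) \<bullet> fst p) + b (Suc i)))"
    if "p \<in> S2S1" for n p
    by (simp add: eta[OF s(2) S2S1_imp_fst[OF that]] sum.atLeast1_atMost_eq)
  have conv: "converges_Lq2 q (\<lambda>n. g (s n)) (warped L.eta_lim)" if q: "q \<ge> 1" for q
    unfolding g_def
  proof (rule L.converges_Lq2_warped[OF q])
    show "continuous_on S2S1 (\<lambda>p. eta A a b x (s n) (fst p))" for n
      by (rule finite_warping.continuous_\<eta>[OF fw[OF s(2)]])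
    show "(\<lambda>n. \<integral>p. \<bar>(eta A a b x (s n) (fst p))\<^sup>2 - (L.eta_lim (fst p))\<^sup>2\<bar> powr q \<partial>\<mu>0) \<longlonglongrightarrow> 0"
    proof (rule L.integrable_H_sq_diff(2)[where H = "\<lambda>n. eta A a b x (s n)" and N = s and \<alpha> = "\<lambda>n. a (s n)" and \<alpha>m = "a 1"
          and \<xi> = "\<lambda>n i. x (Suc i) (s n)", OF filterlim_subseq[OF s(1)]])
      show "(\<lambda>n. a (s n)) \<longlonglongrightarrow> 0" using LIMSEQ_subseq_LIMSEQ[OF a_lim s(1)] by (simp add: o_def)
    qed (use s(2) a_pos a_le x_S2 y H q in \<open>auto simp: s_def\<close>)
  qed
  have "weak_warping_function L.eta_lim"
    by (simp add: weak_warping_function_def L.eta_lim_pos L.borel_measurable_lim)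
  then show ?thesis
    using fin s conv L.in_W1p_limit_metric L.nonneg_distributional_scal_limit_metric by blast
qed

end
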